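(* Let $\mathcal C$ be a finite tensor category and $\mathcal M$ be a $\mathcal C$-module. Then the assignments $$\int_\bullet:\ G\longmapsto \int_{m\in\mathcal M} G(m,m)\qquad\text{and}\qquad \int^\bullet:\ H\longmapsto \int^{m\in\mathcal M} H(m,m)$$ for $G\in \mathrm{Fun}_{\mathcal C|\mathcal C}({}^{\#}\mathcal M\boxtimes\mathcal M,\mathcal C)$ and $H\in \mathrm{Fun}_{\mathcal C|\mathcal C}(\mathcal M^{\#}\boxtimes\mathcal M,\mathcal C)$ provide functors $$\int_\bullet:\ \mathrm{Fun}_{\mathcal C|\mathcal C}({}^{\#}\mathcal M\boxtimes\mathcal M,\mathcal C)\to\mathcal Z(\mathcal C)\qquad\text{and}\qquad \int^\bullet:\ \mathrm{Fun}_{\mathcal C|\mathcal C}(\mathcal M^{\#}\boxtimes\mathcal M,\mathcal C)\to\mathcal Z(\mathcal C),$$ respectively.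
   Context: Let $\Bbbk$ be an algebraically closed field. A finite $\Bbbk$-linear category is one equivalent to the category of finite-dimensional modules over a finite-dimensional $\Bbbk$-algebra. A finite tensor category is a finite $\Bbbk$-linear rigid monoidal category with bilinear tensor product and simple unit $\mathbf 1$ (associators are suppressed). The right dual $c^\vee$ has evaluation $c^\vee\otimes c\to\mathbf 1$ and coevaluation $\mathbf 1\to c\otimes c^\vee$; the left dual ${}^\vee c$ has evaluation $c\otimes{}^\vee c\to\mathbf 1$ and coevaluation $\mathbf 1\to{}^\vee c\otimes c$. A $\mathcal C$-module is a finite $\Bbbk$-linear left module category over $\mathcal C$ with bilinear action $(c,m)\mapsto c.m$, exact in the first variable and right exact in both. For a $\mathcal C$-module $\mathcal M$, ${}^{\#}\mathcal M$ and $\mathcal M^{\#}$ are the right $\mathcal C$-modules with underlying category $\mathcal M^{\rm opp}$ and right actions $\overline m.c:=\overline{{}^\vee c.m}$ and $\overline m.c:=\overline{c^\vee.m}$, respectively. Then ${}^{\#}\mathcal M\boxtimes\mathcal M$ and $\mathcal M^{\#}\boxtimes\mathcal M$ (Deligne products) are $\mathcal C$-bimodule categories. $\mathrm{Fun}_{\mathcal C|\mathcal C}$ denotes the category of bimodule functors and bimodule natural transformations, where $\mathcal C$ is a bimodule over itself; write $G(m,m')=G(\overline m\boxtimes m')$. The bimodule constraints give isomorphisms $G(c.m,c.m)\cong c\otimes G(m,m)\otimes c^\vee$ and $H(c.m,c.m)\cong c\otimes H(m,m)\otimes{}^\vee c$. Objects of the Drinfeld center $\mathcal Z(\mathcal C)$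 are pairs $(a_0,\sigma)$ with $\sigma$ a half-braiding, i.e. a natural family $\sigma_a\colon a\otimes a_0\to a_0\otimes a$ satisfying $\sigma_{a\otimes a'}=(\sigma_a\otimes\mathrm{id})\circ(\mathrm{id}\otimes\sigma_{a'})$ and $\sigma_{\mathbf 1}=\mathrm{id}$; morphisms are morphisms of $\mathcal C$ commuting with the half-braidings. The end and coend are regarded as objects of $\mathcal Z(\mathcal C)$ as follows. For $g=\int_{m}G(m,m)$ with structure morphisms $j_m\colon g\to G(m,m)$, let $\hat\delta_c\colon g\to c\otimes g\otimes c^\vee$ be the morphism such that for all $m$, $(c\otimes j_m\otimes c^\vee)\circ\hat\delta_c$ equals $g\xrightarrow{j_{c.m}}G(c.m,c.m)\cong c\otimes G(m,m)\otimes c^\vee$; the inverse half-braiding $\sigma_c^{-1}\colon g\otimes c\to c\otimes g$ is $\hat\delta_c\otimes c$ followed by the evaluation of $c^\vee\otimes c$. For $h=\int^{m}H(m,m)$ with structure morphisms $i_m\colon H(m,m)\to h$, let $\hat\rho_c\colon c\otimes h\otimes{}^\vee c\to h$ be the morphism such that $\hat\rho_c\circ(c\otimes i_m\otimes{}^\vee c)$ equals $c\otimes H(m,m)\otimes{}^\vee c\cong H(c.m,c.m)\xrightarrow{i_{c.m}}h$ for all $m$; the half-braiding $\sigma_c\colon c\otimes h\to h\otimes c$ is the coevaluation $\mathbf 1\to{}^\vee c\otimes c$ followed by $\hat\rho_c\otimes c$. On bimodule natural transformations the assignments act by functoriality of the end, respectively coend.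
   Formalization: The functors are defined on the full subcategories of those bimodule functors G (resp. H) whose end (resp. coend) exists, since it need not exist for every linear bimodule functor; these are proved to contain all G left exact (resp. H right exact) in each variable. *)

theory Defs
  imports
    "HOL-Library.FuncSet"
    "HOL-Computational_Algebra.Polynomial"
    "Jordan_Normal_Form.VS_Connect"
begin

section \<open>Categories, functors, natural transformations\<close>

record ('o, 'a) cat =
  ob :: "'o set"
  arr :: "'a set"
  src :: "'a \<Rightarrow> 'o"
  trg :: "'a \<Rightarrow> 'o"
  idt :: "'o \<Rightarrow> 'a"
  comp :: "'a \<Rightarrow> 'a \<Rightarrow> 'a"  (infixr "\<cdot>\<index>" 60)

definition Hom :: "('o, 'a, 'z) cat_scheme \<Rightarrow> 'o \<Rightarrow> 'o \<Rightarrow> 'a set" where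
  "Hom C x y = {f \<in> arr C. src C f = x \<and> trg C f = y}"

locale category =
  fixes C :: "('o, 'a, 'z) cat_scheme" (structure)
  assumes src_ob: "f \<in> arr C \<Longrightarrow> src C f \<in> ob C"
    and trg_ob: "f \<in> arr C \<Longrightarrow> trg C f \<in> ob C"
    and idt_hom: "x \<in> ob C \<Longrightarrow> idt C x \<in> Hom C x x"
    and comp_hom: "f \<in> Hom C x y \<Longrightarrow> g \<in> Hom C y z \<Longrightarrow> g \<cdot> f \<in> Hom C x z"
    and comp_assoc: "f \<in> Hom C w x \<Longrightarrow> g \<in> Hom C x y \<Longrightarrow> h \<in> Hom C y z \<Longrightarrow>
      (h \<cdot> g) \<cdot> f = h \<cdot> (g \<cdot> f)"
    and comp_idt_right: "f \<in> Hom C x y \<Longrightarrow> f \<cdot> idt C x = f"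
    and comp_idt_left: "f \<in> Hom C x y \<Longrightarrow> idt C y \<cdot> f = f"

definition inverse_arrows :: "('o, 'a, 'z) cat_scheme \<Rightarrow> 'a \<Rightarrow> 'a \<Rightarrow> bool" where
  "inverse_arrows C f g \<longleftrightarrow> f \<in> arr C \<and> g \<in> Hom C (trg C f) (src C f) \<and>
     g \<cdot>\<^bsub>C\<^esub> f = idt C (src C f) \<and> f \<cdot>\<^bsub>C\<^esub> g = idt C (trg C f)"

definition is_iso :: "('o, 'a, 'z) cat_scheme \<Rightarrow> 'a \<Rightarrow> bool" where
  "is_iso C f \<longleftrightarrow> (\<exists>g. inverse_arrows C f g)"

definition inv_arr :: "('o, 'a, 'z) cat_scheme \<Rightarrow> 'a \<Rightarrow> 'a" where
  "inv_arr C f = (THE g. inverse_arrows C f g)"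

definition is_mono :: "('o, 'a, 'z) cat_scheme \<Rightarrow> 'a \<Rightarrow> bool" where
  "is_mono C f \<longleftrightarrow> f \<in> arr C \<and>
     (\<forall>w\<in>ob C. \<forall>g\<in>Hom C w (src C f). \<forall>h\<in>Hom C w (src C f). f \<cdot>\<^bsub>C\<^esub> g = f \<cdot>\<^bsub>C\<^esub> h \<longrightarrow> g = h)"

definition full_subcategory :: "('o, 'a, 'z) cat_scheme \<Rightarrow> 'o set \<Rightarrow> ('o, 'a, 'z) cat_scheme" where
  "full_subcategory C S =
     C\<lparr>ob := ob C \<inter> S, arr := {f \<in> arr C. src C f \<in> S \<and> trg C f \<in> S}\<rparr>"

record ('o, 'a, 'p, 'b) ftr =
  f_ob :: "'o \<Rightarrow> 'p"
  f_arr :: "'a \<Rightarrow> 'b"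

locale cat_functor = A: category A + B: category B
  for A :: "('o, 'a, 'y) cat_scheme" and B :: "('p, 'b, 'z) cat_scheme" +
  fixes F :: "('o, 'a, 'p, 'b, 'f) ftr_scheme"
  assumes ob: "x \<in> ob A \<Longrightarrow> f_ob F x \<in> ob B"
    and hom: "f \<in> Hom A x y \<Longrightarrow> f_arr F f \<in> Hom B (f_ob F x) (f_ob F y)"
    and idt: "x \<in> ob A \<Longrightarrow> f_arr F (idt A x) = idt B (f_ob F x)"
    and comp: "f \<in> Hom A x y \<Longrightarrow> g \<in> Hom A y z \<Longrightarrow>
      f_arr F (g \<cdot>\<^bsub>A\<^esub> f) = f_arr F g \<cdot>\<^bsub>B\<^esub> f_arr F f"

definition id_ftr :: "('o, 'a, 'o, 'a) ftr" where
  "id_ftr = \<lparr>f_ob = \<lambda>x. x, f_arr = \<lambda>f. f\<rparr>"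

definition comp_ftr ::
  "('p, 'b, 'q, 'c, 'y) ftr_scheme \<Rightarrow> ('o, 'a, 'p, 'b, 'z) ftr_scheme \<Rightarrow> ('o, 'a, 'q, 'c) ftr" where
  "comp_ftr G F = \<lparr>f_ob = \<lambda>x. f_ob G (f_ob F x), f_arr = \<lambda>f. f_arr G (f_arr F f)\<rparr>"

definition nat_trans ::
  "('o, 'a, 'x) cat_scheme \<Rightarrow> ('p, 'b, 'y) cat_scheme \<Rightarrow> ('o, 'a, 'p, 'b, 'f) ftr_scheme \<Rightarrow>
   ('o, 'a, 'p, 'b, 'g) ftr_scheme \<Rightarrow> ('o \<Rightarrow> 'b) \<Rightarrow> bool" where
  "nat_trans A B F G \<eta> \<longleftrightarrow>
     (\<forall>x\<in>ob A. \<eta> x \<in> Hom B (f_ob F x) (f_ob G x)) \<and>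
     (\<forall>f\<in>arr A. \<eta> (trg A f) \<cdot>\<^bsub>B\<^esub> f_arr F f = f_arr G f \<cdot>\<^bsub>B\<^esub> \<eta> (src A f))"

definition nat_iso ::
  "('o, 'a, 'x) cat_scheme \<Rightarrow> ('p, 'b, 'y) cat_scheme \<Rightarrow> ('o, 'a, 'p, 'b, 'f) ftr_scheme \<Rightarrow>
   ('o, 'a, 'p, 'b, 'g) ftr_scheme \<Rightarrow> ('o \<Rightarrow> 'b) \<Rightarrow> bool" where
  "nat_iso A B F G \<eta> \<longleftrightarrow> nat_trans A B F G \<eta> \<and> (\<forall>x\<in>ob A. is_iso B (\<eta> x))"

record ('o1, 'a1, 'o2, 'a2, 'p, 'b) bftr =
  bf_ob :: "'o1 \<Rightarrow> 'o2 \<Rightarrow> 'p"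
  bf_arr :: "'a1 \<Rightarrow> 'a2 \<Rightarrow> 'b"

locale bifunctor = A: category A + B: category B + X: category X
  for A :: "('o1, 'a1, 'x) cat_scheme" and B :: "('o2, 'a2, 'y) cat_scheme"
    and X :: "('p, 'b, 'z) cat_scheme" +
  fixes T :: "('o1, 'a1, 'o2, 'a2, 'p, 'b, 't) bftr_scheme"
  assumes ob: "x \<in> ob A \<Longrightarrow> y \<in> ob B \<Longrightarrow> bf_ob T x y \<in> ob X"
    and hom: "f \<in> Hom A x x' \<Longrightarrow> g \<in> Hom B y y' \<Longrightarrow>
      bf_arr T f g \<in> Hom X (bf_ob T x y) (bf_ob T x' y')"
    and idt: "x \<in> ob A \<Longrightarrow> y \<in> ob B \<Longrightarrow> bf_arr T (idt A x) (idt B y) = idt X (bf_ob T x y)"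
    and comp: "f \<in> Hom A x x' \<Longrightarrow> f' \<in> Hom A x' x'' \<Longrightarrow> g \<in> Hom B y y' \<Longrightarrow> g' \<in> Hom B y' y'' \<Longrightarrow>
      bf_arr T (f' \<cdot>\<^bsub>A\<^esub> f) (g' \<cdot>\<^bsub>B\<^esub> g) = bf_arr T f' g' \<cdot>\<^bsub>X\<^esub> bf_arr T f g"

definition fix_left :: "('o1, 'a1, 'z) cat_scheme \<Rightarrow> ('o1, 'a1, 'o2, 'a2, 'p, 'b, 't) bftr_scheme \<Rightarrow>
    'o1 \<Rightarrow> ('o2, 'a2, 'p, 'b) ftr" where
  "fix_left A T x = \<lparr>f_ob = bf_ob T x, f_arr = bf_arr T (idt A x)\<rparr>"

definition fix_right :: "('o2, 'a2, 'z) cat_scheme \<Rightarrow> ('o1, 'a1, 'o2, 'a2, 'p, 'b, 't) bftr_scheme \<Rightarrow>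
    'o2 \<Rightarrow> ('o1, 'a1, 'p, 'b) ftr" where
  "fix_right B T y = \<lparr>f_ob = \<lambda>x. bf_ob T x y, f_arr = \<lambda>f. bf_arr T f (idt B y)\<rparr>"

definition comp_bftr ::
  "('p, 'b, 'q, 'c, 'y) ftr_scheme \<Rightarrow> ('o1, 'a1, 'o2, 'a2, 'p, 'b, 'z) bftr_scheme \<Rightarrow>
   ('o1, 'a1, 'o2, 'a2, 'q, 'c) bftr" where
  "comp_bftr G T =
     \<lparr>bf_ob = \<lambda>x y. f_ob G (bf_ob T x y), bf_arr = \<lambda>f g. f_arr G (bf_arr T f g)\<rparr>"

definition nat_trans2 ::
  "('o1, 'a1, 'x) cat_scheme \<Rightarrow> ('o2, 'a2, 'y) cat_scheme \<Rightarrow> ('p, 'b, 'z) cat_scheme \<Rightarrow>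
   ('o1, 'a1, 'o2, 'a2, 'p, 'b, 's) bftr_scheme \<Rightarrow> ('o1, 'a1, 'o2, 'a2, 'p, 'b, 't) bftr_scheme \<Rightarrow>
   ('o1 \<Rightarrow> 'o2 \<Rightarrow> 'b) \<Rightarrow> bool" where
  "nat_trans2 A B X S T \<tau> \<longleftrightarrow>
     (\<forall>x\<in>ob A. \<forall>y\<in>ob B. \<tau> x y \<in> Hom X (bf_ob S x y) (bf_ob T x y)) \<and>
     (\<forall>f\<in>arr A. \<forall>g\<in>arr B.
        \<tau> (trg A f) (trg B g) \<cdot>\<^bsub>X\<^esub> bf_arr S f g = bf_arr T f g \<cdot>\<^bsub>X\<^esub> \<tau> (src A f) (src B g))"

definition nat_iso2 ::
  "('o1, 'a1, 'x) cat_scheme \<Rightarrow> ('o2, 'a2, 'y) cat_scheme \<Rightarrow> ('p, 'b, 'z) cat_scheme \<Rightarrow>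
   ('o1, 'a1, 'o2, 'a2, 'p, 'b, 's) bftr_scheme \<Rightarrow> ('o1, 'a1, 'o2, 'a2, 'p, 'b, 't) bftr_scheme \<Rightarrow>
   ('o1 \<Rightarrow> 'o2 \<Rightarrow> 'b) \<Rightarrow> bool" where
  "nat_iso2 A B X S T \<tau> \<longleftrightarrow> nat_trans2 A B X S T \<tau> \<and> (\<forall>x\<in>ob A. \<forall>y\<in>ob B. is_iso X (\<tau> x y))"

text \<open>Natural isomorphisms between functors of three variables, the functors being given by
  their object and arrow maps.\<close>

definition nat_iso3 ::
  "('o1, 'a1, 'x) cat_scheme \<Rightarrow> ('o2, 'a2, 'y) cat_scheme \<Rightarrow> ('o3, 'a3, 'w) cat_scheme \<Rightarrow>
   ('p, 'b, 'z) cat_scheme \<Rightarrow>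
   ('o1 \<Rightarrow> 'o2 \<Rightarrow> 'o3 \<Rightarrow> 'p) \<Rightarrow> ('a1 \<Rightarrow> 'a2 \<Rightarrow> 'a3 \<Rightarrow> 'b) \<Rightarrow>
   ('o1 \<Rightarrow> 'o2 \<Rightarrow> 'o3 \<Rightarrow> 'p) \<Rightarrow> ('a1 \<Rightarrow> 'a2 \<Rightarrow> 'a3 \<Rightarrow> 'b) \<Rightarrow>
   ('o1 \<Rightarrow> 'o2 \<Rightarrow> 'o3 \<Rightarrow> 'b) \<Rightarrow> bool" where
  "nat_iso3 A B E X S S' T T' \<tau> \<longleftrightarrow>
     (\<forall>x\<in>ob A. \<forall>y\<in>ob B. \<forall>z\<in>ob E.
        \<tau> x y z \<in> Hom X (S x y z) (T x y z) \<and> is_iso X (\<tau> x y z)) \<and>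
     (\<forall>f\<in>arr A. \<forall>g\<in>arr B. \<forall>h\<in>arr E.
        \<tau> (trg A f) (trg B g) (trg E h) \<cdot>\<^bsub>X\<^esub> S' f g h =
        T' f g h \<cdot>\<^bsub>X\<^esub> \<tau> (src A f) (src B g) (src E h))"


section \<open>Finite linear categories\<close>

record ('o, 'a, 'k) lcat = "('o, 'a) cat" +
  zero_arr :: "'o \<Rightarrow> 'o \<Rightarrow> 'a"
  add_arr :: "'a \<Rightarrow> 'a \<Rightarrow> 'a"
  scale_arr :: "'k \<Rightarrow> 'a \<Rightarrow> 'a"

text \<open>The multiplicative fields of the record are not used by \<^locale>\<open>vectorspace\<close>.\<close>

definition hom_space :: "('o, 'a, 'k, 'z) lcat_scheme \<Rightarrow> 'o \<Rightarrow> 'o \<Rightarrow> ('k, 'a) module" where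
  "hom_space C x y = \<lparr>carrier = Hom C x y, mult = undefined, one = undefined,
     zero = zero_arr C x y, add = add_arr C, smult = scale_arr C\<rparr>"

locale linear_category = category C
  for C :: "('o, 'a, 'k::field, 'z) lcat_scheme" (structure) +
  assumes hom_vectorspace: "x \<in> ob C \<Longrightarrow> y \<in> ob C \<Longrightarrow> vectorspace class_ring (hom_space C x y)"
    and comp_add_left: "f \<in> Hom C x y \<Longrightarrow> g \<in> Hom C y z \<Longrightarrow> g' \<in> Hom C y z \<Longrightarrow>
      add_arr C g g' \<cdot> f = add_arr C (g \<cdot> f) (g' \<cdot> f)"
    and comp_add_right: "f \<in> Hom C x y \<Longrightarrow> f' \<in> Hom C x y \<Longrightarrow> g \<in> Hom C y z \<Longrightarrow>
      g \<cdot> add_arr C f f' = add_arr C (g \<cdot> f) (g \<cdot> f')"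
    and comp_scale_left: "f \<in> Hom C x y \<Longrightarrow> g \<in> Hom C y z \<Longrightarrow>
      scale_arr C r g \<cdot> f = scale_arr C r (g \<cdot> f)"
    and comp_scale_right: "f \<in> Hom C x y \<Longrightarrow> g \<in> Hom C y z \<Longrightarrow>
      g \<cdot> scale_arr C r f = scale_arr C r (g \<cdot> f)"

definition opp :: "('o, 'a, 'k, 'z) lcat_scheme \<Rightarrow> ('o, 'a, 'k) lcat" where
  "opp C = \<lparr>ob = ob C, arr = arr C, src = trg C, trg = src C, idt = idt C,
     comp = \<lambda>g f. f \<cdot>\<^bsub>C\<^esub> g,
     zero_arr = \<lambda>x y. zero_arr C y x, add_arr = add_arr C, scale_arr = scale_arr C\<rparr>"

definition is_kernel :: "('o, 'a, 'k, 'z) lcat_scheme \<Rightarrow> 'a \<Rightarrow> 'a \<Rightarrow> bool" where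
  "is_kernel C f k \<longleftrightarrow> f \<in> arr C \<and> k \<in> arr C \<and> trg C k = src C f \<and>
     f \<cdot>\<^bsub>C\<^esub> k = zero_arr C (src C k) (trg C f) \<and>
     (\<forall>h\<in>arr C. trg C h = src C f \<and> f \<cdot>\<^bsub>C\<^esub> h = zero_arr C (src C h) (trg C f) \<longrightarrow>
        (\<exists>!u. u \<in> Hom C (src C h) (src C k) \<and> k \<cdot>\<^bsub>C\<^esub> u = h))"

definition is_cokernel :: "('o, 'a, 'k, 'z) lcat_scheme \<Rightarrow> 'a \<Rightarrow> 'a \<Rightarrow> bool" where
  "is_cokernel C f q \<longleftrightarrow> f \<in> arr C \<and> q \<in> arr C \<and> src C q = trg C f \<and>
     q \<cdot>\<^bsub>C\<^esub> f = zero_arr C (src C f) (trg C q) \<and>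
     (\<forall>h\<in>arr C. src C h = trg C f \<and> h \<cdot>\<^bsub>C\<^esub> f = zero_arr C (src C f) (trg C h) \<longrightarrow>
        (\<exists>!u. u \<in> Hom C (trg C q) (trg C h) \<and> u \<cdot>\<^bsub>C\<^esub> q = h))"

definition left_exact :: "('o, 'a, 'k, 'y) lcat_scheme \<Rightarrow> ('p, 'b, 'k, 'z) lcat_scheme \<Rightarrow>
    ('o, 'a, 'p, 'b, 'f) ftr_scheme \<Rightarrow> bool" where
  "left_exact A B F \<longleftrightarrow> (\<forall>f k. is_kernel A f k \<longrightarrow> is_kernel B (f_arr F f) (f_arr F k))"

definition right_exact :: "('o, 'a, 'k, 'y) lcat_scheme \<Rightarrow> ('p, 'b, 'k, 'z) lcat_scheme \<Rightarrow>
    ('o, 'a, 'p, 'b, 'f) ftr_scheme \<Rightarrow> bool" where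
  "right_exact A B F \<longleftrightarrow> (\<forall>f q. is_cokernel A f q \<longrightarrow> is_cokernel B (f_arr F f) (f_arr F q))"

definition zero_object :: "('o, 'a, 'k, 'z) lcat_scheme \<Rightarrow> 'o \<Rightarrow> bool" where
  "zero_object C x \<longleftrightarrow> x \<in> ob C \<and> idt C x = zero_arr C x x"

definition simple_object :: "('o, 'a, 'k, 'z) lcat_scheme \<Rightarrow> 'o \<Rightarrow> bool" where
  "simple_object C x \<longleftrightarrow> x \<in> ob C \<and> \<not> zero_object C x \<and>
     (\<forall>f. is_mono C f \<and> trg C f = x \<longrightarrow> zero_object C (src C f) \<or> is_iso C f)"

locale linear_functor = cat_functor A B F + A: linear_category A + B: linear_category B
  for A :: "('o, 'a, 'k::field, 'y) lcat_scheme" and B :: "('p, 'b, 'k, 'z) lcat_scheme"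
    and F :: "('o, 'a, 'p, 'b, 'f) ftr_scheme" +
  assumes add: "f \<in> Hom A x y \<Longrightarrow> g \<in> Hom A x y \<Longrightarrow>
      f_arr F (add_arr A f g) = add_arr B (f_arr F f) (f_arr F g)"
    and scale: "f \<in> Hom A x y \<Longrightarrow> f_arr F (scale_arr A r f) = scale_arr B r (f_arr F f)"

locale bilinear_bifunctor = bifunctor A B X T +
    A: linear_category A + B: linear_category B + X: linear_category X
  for A :: "('o1, 'a1, 'k::field, 'x) lcat_scheme" and B :: "('o2, 'a2, 'k, 'y) lcat_scheme"
    and X :: "('p, 'b, 'k, 'z) lcat_scheme"
    and T :: "('o1, 'a1, 'o2, 'a2, 'p, 'b, 't) bftr_scheme" +
  assumes add_left: "f \<in> Hom A x x' \<Longrightarrow> f' \<in> Hom A x x' \<Longrightarrow> g \<in> Hom B y y' \<Longrightarrow>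
      bf_arr T (add_arr A f f') g = add_arr X (bf_arr T f g) (bf_arr T f' g)"
    and add_right: "f \<in> Hom A x x' \<Longrightarrow> g \<in> Hom B y y' \<Longrightarrow> g' \<in> Hom B y y' \<Longrightarrow>
      bf_arr T f (add_arr B g g') = add_arr X (bf_arr T f g) (bf_arr T f g')"
    and scale_left: "f \<in> Hom A x x' \<Longrightarrow> g \<in> Hom B y y' \<Longrightarrow>
      bf_arr T (scale_arr A r f) g = scale_arr X r (bf_arr T f g)"
    and scale_right: "f \<in> Hom A x x' \<Longrightarrow> g \<in> Hom B y y' \<Longrightarrow>
      bf_arr T f (scale_arr B r g) = scale_arr X r (bf_arr T f g)"

definition left_exact_in_each ::
  "('o1, 'a1, 'k, 'x) lcat_scheme \<Rightarrow> ('o2, 'a2, 'k, 'y) lcat_scheme \<Rightarrow>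
   ('p, 'b, 'k, 'z) lcat_scheme \<Rightarrow> ('o1, 'a1, 'o2, 'a2, 'p, 'b, 't) bftr_scheme \<Rightarrow> bool" where
  "left_exact_in_each A B X T \<longleftrightarrow>
     (\<forall>x\<in>ob A. left_exact B X (fix_left A T x)) \<and> (\<forall>y\<in>ob B. left_exact A X (fix_right B T y))"

definition right_exact_in_each ::
  "('o1, 'a1, 'k, 'x) lcat_scheme \<Rightarrow> ('o2, 'a2, 'k, 'y) lcat_scheme \<Rightarrow>
   ('p, 'b, 'k, 'z) lcat_scheme \<Rightarrow> ('o1, 'a1, 'o2, 'a2, 'p, 'b, 't) bftr_scheme \<Rightarrow> bool" where
  "right_exact_in_each A B X T \<longleftrightarrow>
     (\<forall>x\<in>ob A. right_exact B X (fix_left A T x)) \<and> (\<forall>y\<in>ob B. right_exact A X (fix_right B T y))"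

definition linearly_equivalent ::
  "('o, 'a, 'k::field, 'y) lcat_scheme \<Rightarrow> ('p, 'b, 'k, 'z) lcat_scheme \<Rightarrow> bool" where
  "linearly_equivalent A B \<longleftrightarrow>
     (\<exists>(F :: ('o, 'a, 'p, 'b) ftr) (G :: ('p, 'b, 'o, 'a) ftr) \<eta> \<epsilon>.
        linear_functor A B F \<and> linear_functor B A G \<and>
        nat_iso A A (comp_ftr G F) id_ftr \<eta> \<and> nat_iso B B (comp_ftr F G) id_ftr \<epsilon>)"

text \<open>A finite-dimensional algebra is given by structure constants with respect to a basis
  \<open>e\<^sub>0, \<dots>, e\<^sub>n\<^sub>-\<^sub>1\<close>, so that \<open>e\<^sub>i e\<^sub>j = (\<Sum>l<n. mul_const i j l e\<^sub>l)\<close> and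
  \<open>1 = (\<Sum>i<n. unit_const i e\<^sub>i)\<close>. A finite-dimensional module is given in coordinates by a dimension
  and the matrices by which the basis elements act.\<close>

record 'k fd_alg =
  alg_dim :: nat
  mul_const :: "nat \<Rightarrow> nat \<Rightarrow> nat \<Rightarrow> 'k"
  unit_const :: "nat \<Rightarrow> 'k"

definition fd_algebra :: "'k::field fd_alg \<Rightarrow> bool" where
  "fd_algebra R \<longleftrightarrow>
     (\<forall>i<alg_dim R. \<forall>j<alg_dim R. \<forall>l<alg_dim R. \<forall>r<alg_dim R.
        (\<Sum>s<alg_dim R. mul_const R i j s * mul_const R s l r) =
        (\<Sum>s<alg_dim R. mul_const R j l s * mul_const R i s r)) \<and>
     (\<forall>j<alg_dim R. \<forall>l<alg_dim R.
        (\<Sum>i<alg_dim R. unit_const R i * mul_const R i j l) = (if j = l then 1 else 0) \<and>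
        (\<Sum>i<alg_dim R. unit_const R i * mul_const R j i l) = (if j = l then 1 else 0))"

type_synonym 'k rep = "nat \<times> (nat \<Rightarrow> 'k mat)"

definition fd_module :: "'k::field fd_alg \<Rightarrow> 'k rep \<Rightarrow> bool" where
  "fd_module R = (\<lambda>(d, \<rho>).
     (\<forall>i<alg_dim R. \<rho> i \<in> carrier_mat d d) \<and>
     (\<forall>i<alg_dim R. \<forall>j<alg_dim R.
        \<rho> i * \<rho> j = mat d d (\<lambda>(p, q). \<Sum>l<alg_dim R. mul_const R i j l * \<rho> l $$ (p, q))) \<and>
     mat d d (\<lambda>(p, q). \<Sum>l<alg_dim R. unit_const R l * \<rho> l $$ (p, q)) = 1\<^sub>m d)"

definition fd_modules :: "'k::field fd_alg \<Rightarrow> ('k rep, 'k rep \<times> 'k mat \<times> 'k rep, 'k) lcat" where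
  "fd_modules R =
     \<lparr>ob = {X. fd_module R X},
      arr = {(X, f, Y). fd_module R X \<and> fd_module R Y \<and> f \<in> carrier_mat (fst Y) (fst X) \<and>
               (\<forall>i<alg_dim R. f * snd X i = snd Y i * f)},
      src = \<lambda>(X, f, Y). X,
      trg = \<lambda>(X, f, Y). Y,
      idt = \<lambda>X. (X, 1\<^sub>m (fst X), X),
      comp = \<lambda>(Y, g, Z) (X, f, Y'). (X, g * f, Z),
      zero_arr = \<lambda>X Y. (X, 0\<^sub>m (fst Y) (fst X), Y),
      add_arr = \<lambda>(X, f, Y) (X', g, Y'). (X, f + g, Y),
      scale_arr = \<lambda>r (X, f, Y). (X, r \<cdot>\<^sub>m f, Y)\<rparr>"

locale finite_linear_category = linear_category C
  for C :: "('o, 'a, 'k::field, 'z) lcat_scheme" (structure) +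
  assumes finite: "\<exists>R. fd_algebra R \<and> linearly_equivalent C (fd_modules R)"

text \<open>The Deligne product is characterised by its universal property for functors that are right
  exact in each variable. As every finite linear category is equivalent to some
  \<^term>\<open>fd_modules R\<close>, these suffice as test categories.\<close>

locale deligne_product = finite_linear_category D + bilinear_bifunctor A B D bx
  for A :: "('o1, 'a1, 'k::field, 'x) lcat_scheme" and B :: "('o2, 'a2, 'k, 'y) lcat_scheme"
    and D :: "('d, 'e, 'k, 'z) lcat_scheme"
    and bx :: "('o1, 'a1, 'o2, 'a2, 'd, 'e, 't) bftr_scheme" +
  assumes box_right_exact: "right_exact_in_each A B D bx"
    and universal_ex: "fd_algebra R \<Longrightarrow> bilinear_bifunctor A B (fd_modules R) T \<Longrightarrow>
      right_exact_in_each A B (fd_modules R) T \<Longrightarrow>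
      \<exists>(F :: ('d, 'e, 'k rep, 'k rep \<times> 'k mat \<times> 'k rep) ftr) \<tau>.
        linear_functor D (fd_modules R) F \<and> right_exact D (fd_modules R) F \<and>
        nat_iso2 A B (fd_modules R) (comp_bftr F bx)
          (T :: ('o1, 'a1, 'o2, 'a2, 'k rep, 'k rep \<times> 'k mat \<times> 'k rep) bftr) \<tau>"
    and universal_ff: "fd_algebra R \<Longrightarrow>
      linear_functor D (fd_modules R) F \<Longrightarrow> right_exact D (fd_modules R) F \<Longrightarrow>
      linear_functor D (fd_modules R) F' \<Longrightarrow> right_exact D (fd_modules R) F' \<Longrightarrow>
      nat_trans2 A B (fd_modules R)
        (comp_bftr (F :: ('d, 'e, 'k rep, 'k rep \<times> 'k mat \<times> 'k rep) ftr) bx)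
        (comp_bftr (F' :: ('d, 'e, 'k rep, 'k rep \<times> 'k mat \<times> 'k rep) ftr) bx) \<tau> \<Longrightarrow>
      \<exists>!\<eta>. \<eta> \<in> extensional (ob D) \<and> nat_trans D (fd_modules R) F F' \<eta> \<and>
        (\<forall>x\<in>ob A. \<forall>y\<in>ob B. \<eta> (bf_ob bx x y) = \<tau> x y)"


section \<open>Finite tensor categories\<close>

text \<open>The right dual \<open>rdual c\<close> has evaluation \<open>rdual_ev c : rdual c \<otimes> c \<rightarrow> 1\<close> and coevaluation
  \<open>rdual_coev c : 1 \<rightarrow> c \<otimes> rdual c\<close>; the left dual has \<open>ldual_ev c : c \<otimes> ldual c \<rightarrow> 1\<close> and
  \<open>ldual_coev c : 1 \<rightarrow> ldual c \<otimes> c\<close>.\<close>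

record ('o, 'a, 'k) tcat = "('o, 'a, 'k) lcat" +
  tensor :: "('o, 'a, 'o, 'a, 'o, 'a) bftr"
  unit_ob :: 'o  ("\<one>\<^sub>o\<index>")
  assoc :: "'o \<Rightarrow> 'o \<Rightarrow> 'o \<Rightarrow> 'a"
  lunit :: "'o \<Rightarrow> 'a"
  runit :: "'o \<Rightarrow> 'a"
  rdual :: "'o \<Rightarrow> 'o"
  rdual_ev :: "'o \<Rightarrow> 'a"
  rdual_coev :: "'o \<Rightarrow> 'a"
  ldual :: "'o \<Rightarrow> 'o"
  ldual_ev :: "'o \<Rightarrow> 'a"
  ldual_coev :: "'o \<Rightarrow> 'a"

abbreviation tensor_ob :: "('o, 'a, 'k, 'z) tcat_scheme \<Rightarrow> 'o \<Rightarrow> 'o \<Rightarrow> 'o"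
    (infixr "\<otimes>\<^sub>o\<index>" 70) where
  "c \<otimes>\<^sub>o\<^bsub>C\<^esub> d \<equiv> bf_ob (tensor C) c d"

abbreviation tensor_arr :: "('o, 'a, 'k, 'z) tcat_scheme \<Rightarrow> 'a \<Rightarrow> 'a \<Rightarrow> 'a"
    (infixr "\<otimes>\<^sub>a\<index>" 70) where
  "f \<otimes>\<^sub>a\<^bsub>C\<^esub> g \<equiv> bf_arr (tensor C) f g"

text \<open>\<open>x\<close> is a right dual of \<open>y\<close> (equivalently \<open>y\<close> a left dual of \<open>x\<close>).\<close>

definition dual_pair :: "('o, 'a, 'k, 'z) tcat_scheme \<Rightarrow> 'o \<Rightarrow> 'o \<Rightarrow> 'a \<Rightarrow> 'a \<Rightarrow> bool" where
  "dual_pair C x y ev coev \<longleftrightarrow> x \<in> ob C \<and> y \<in> ob C \<and>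
     ev \<in> Hom C (x \<otimes>\<^sub>o\<^bsub>C\<^esub> y) \<one>\<^sub>o\<^bsub>C\<^esub> \<and> coev \<in> Hom C \<one>\<^sub>o\<^bsub>C\<^esub> (y \<otimes>\<^sub>o\<^bsub>C\<^esub> x) \<and>
     runit C y \<cdot>\<^bsub>C\<^esub> (idt C y \<otimes>\<^sub>a\<^bsub>C\<^esub> ev) \<cdot>\<^bsub>C\<^esub> assoc C y x y \<cdot>\<^bsub>C\<^esub> (coev \<otimes>\<^sub>a\<^bsub>C\<^esub> idt C y) = lunit C y \<and>
     lunit C x \<cdot>\<^bsub>C\<^esub> (ev \<otimes>\<^sub>a\<^bsub>C\<^esub> idt C x) \<cdot>\<^bsub>C\<^esub> inv_arr C (assoc C x y x) \<cdot>\<^bsub>C\<^esub> (idt C x \<otimes>\<^sub>a\<^bsub>C\<^esub> coev) = runit C x"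

locale finite_tensor_category = finite_linear_category C + bilinear_bifunctor C C C "tensor C"
  for C :: "('o, 'a, 'k::field, 'z) tcat_scheme" (structure) +
  assumes unit_ob: "\<one>\<^sub>o \<in> ob C"
    and assoc_nat: "nat_iso3 C C C C
      (\<lambda>b c d. (b \<otimes>\<^sub>o c) \<otimes>\<^sub>o d) (\<lambda>f g h. (f \<otimes>\<^sub>a g) \<otimes>\<^sub>a h)
      (\<lambda>b c d. b \<otimes>\<^sub>o (c \<otimes>\<^sub>o d)) (\<lambda>f g h. f \<otimes>\<^sub>a (g \<otimes>\<^sub>a h)) (assoc C)"
    and lunit_nat: "nat_iso C C (fix_left C (tensor C) \<one>\<^sub>o) id_ftr (lunit C)"
    and runit_nat: "nat_iso C C (fix_right C (tensor C) \<one>\<^sub>o) id_ftr (runit C)"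
    and pentagon: "b \<in> ob C \<Longrightarrow> c \<in> ob C \<Longrightarrow> d \<in> ob C \<Longrightarrow> e \<in> ob C \<Longrightarrow>
      (idt C b \<otimes>\<^sub>a assoc C c d e) \<cdot> assoc C b (c \<otimes>\<^sub>o d) e \<cdot> (assoc C b c d \<otimes>\<^sub>a idt C e) =
      assoc C b c (d \<otimes>\<^sub>o e) \<cdot> assoc C (b \<otimes>\<^sub>o c) d e"
    and triangle: "c \<in> ob C \<Longrightarrow> d \<in> ob C \<Longrightarrow>
      (idt C c \<otimes>\<^sub>a lunit C d) \<cdot> assoc C c \<one>\<^sub>o d = runit C c \<otimes>\<^sub>a idt C d"
    and right_dual: "c \<in> ob C \<Longrightarrow> dual_pair C (rdual C c) c (rdual_ev C c) (rdual_coev C c)"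
    and left_dual: "c \<in> ob C \<Longrightarrow> dual_pair C c (ldual C c) (ldual_ev C c) (ldual_coev C c)"
    and unit_simple: "simple_object C \<one>\<^sub>o"

subsection \<open>Canonical morphisms between duals\<close>

context
  fixes C :: "('o, 'a, 'k, 'z) tcat_scheme" (structure)
begin

text \<open>The morphism \<open>y' \<rightarrow> y\<close> of left duals induced by \<open>f : x \<rightarrow> x'\<close>, where
  \<open>coev : 1 \<rightarrow> y \<otimes> x\<close> and \<open>ev' : x' \<otimes> y' \<rightarrow> 1\<close>.\<close>

definition left_mate :: "'o \<Rightarrow> 'o \<Rightarrow> 'a \<Rightarrow> 'o \<Rightarrow> 'a \<Rightarrow> 'a \<Rightarrow> 'a" where
  "left_mate x y coev y' ev' f =
     runit C y \<cdot> (idt C y \<otimes>\<^sub>a (ev' \<cdot> (f \<otimes>\<^sub>a idt C y'))) \<cdot> assoc C y x y' \<cdot>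
     (coev \<otimes>\<^sub>a idt C y') \<cdot> inv_arr C (lunit C y')"

text \<open>The morphism \<open>x' \<rightarrow> x\<close> of right duals induced by \<open>f : y \<rightarrow> y'\<close>, where
  \<open>coev : 1 \<rightarrow> y \<otimes> x\<close> and \<open>ev' : x' \<otimes> y' \<rightarrow> 1\<close>.\<close>

definition right_mate :: "'o \<Rightarrow> 'o \<Rightarrow> 'a \<Rightarrow> 'o \<Rightarrow> 'a \<Rightarrow> 'a \<Rightarrow> 'a" where
  "right_mate x y coev x' ev' f =
     lunit C x \<cdot> ((ev' \<cdot> (idt C x' \<otimes>\<^sub>a f)) \<otimes>\<^sub>a idt C x) \<cdot> inv_arr C (assoc C x' y x) \<cdot>
     (idt C x' \<otimes>\<^sub>a coev) \<cdot> inv_arr C (runit C x')"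

text \<open>\<open>1 \<rightarrow> (y\<^sub>1 \<otimes> y\<^sub>2) \<otimes> (x\<^sub>2 \<otimes> x\<^sub>1)\<close>, built from \<open>coev\<^sub>i : 1 \<rightarrow> y\<^sub>i \<otimes> x\<^sub>i\<close>.\<close>

definition coev_tensor :: "'o \<Rightarrow> 'o \<Rightarrow> 'a \<Rightarrow> 'o \<Rightarrow> 'o \<Rightarrow> 'a \<Rightarrow> 'a" where
  "coev_tensor y\<^sub>1 x\<^sub>1 coev\<^sub>1 y\<^sub>2 x\<^sub>2 coev\<^sub>2 =
     inv_arr C (assoc C y\<^sub>1 y\<^sub>2 (x\<^sub>2 \<otimes>\<^sub>o x\<^sub>1)) \<cdot> (idt C y\<^sub>1 \<otimes>\<^sub>a assoc C y\<^sub>2 x\<^sub>2 x\<^sub>1) \<cdot>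
     (idt C y\<^sub>1 \<otimes>\<^sub>a (coev\<^sub>2 \<otimes>\<^sub>a idt C x\<^sub>1)) \<cdot> (idt C y\<^sub>1 \<otimes>\<^sub>a inv_arr C (lunit C x\<^sub>1)) \<cdot> coev\<^sub>1"

text \<open>\<open>ldual (trg f) \<rightarrow> ldual (src f)\<close>, \<open>ldual (c \<otimes> d) \<rightarrow> ldual d \<otimes> ldual c\<close>, \<open>1 \<rightarrow> ldual 1\<close>.\<close>

definition ldual_arr :: "'a \<Rightarrow> 'a" where
  "ldual_arr f = left_mate (src C f) (ldual C (src C f)) (ldual_coev C (src C f))
     (ldual C (trg C f)) (ldual_ev C (trg C f)) f"

definition ldual_tensor :: "'o \<Rightarrow> 'o \<Rightarrow> 'a" where
  "ldual_tensor c d = left_mate (c \<otimes>\<^sub>o d) (ldual C d \<otimes>\<^sub>o ldual C c)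
     (coev_tensor (ldual C d) d (ldual_coev C d) (ldual C c) c (ldual_coev C c))
     (ldual C (c \<otimes>\<^sub>o d)) (ldual_ev C (c \<otimes>\<^sub>o d)) (idt C (c \<otimes>\<^sub>o d))"

definition ldual_unit :: 'a where
  "ldual_unit = left_mate \<one>\<^sub>o (ldual C \<one>\<^sub>o) (ldual_coev C \<one>\<^sub>o) \<one>\<^sub>o (lunit C \<one>\<^sub>o) (idt C \<one>\<^sub>o)"

definition rdual_arr :: "'a \<Rightarrow> 'a" where
  "rdual_arr f = right_mate (rdual C (src C f)) (src C f) (rdual_coev C (src C f))
     (rdual C (trg C f)) (rdual_ev C (trg C f)) f"

definition rdual_tensor :: "'o \<Rightarrow> 'o \<Rightarrow> 'a" where
  "rdual_tensor c d = right_mate (rdual C d \<otimes>\<^sub>o rdual C c) (c \<otimes>\<^sub>o d)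
     (coev_tensor c (rdual C c) (rdual_coev C c) d (rdual C d) (rdual_coev C d))
     (rdual C (c \<otimes>\<^sub>o d)) (rdual_ev C (c \<otimes>\<^sub>o d)) (idt C (c \<otimes>\<^sub>o d))"

definition rdual_unit :: 'a where
  "rdual_unit = right_mate (rdual C \<one>\<^sub>o) \<one>\<^sub>o (rdual_coev C \<one>\<^sub>o) \<one>\<^sub>o (lunit C \<one>\<^sub>o) (idt C \<one>\<^sub>o)"

text \<open>\<open>ldual (rdual c) \<rightarrow> c\<close> and \<open>rdual (ldual c) \<rightarrow> c\<close>.\<close>

definition ldual_rdual :: "'o \<Rightarrow> 'a" where
  "ldual_rdual c = left_mate (rdual C c) c (rdual_coev C c)
     (ldual C (rdual C c)) (ldual_ev C (rdual C c)) (idt C (rdual C c))"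

definition rdual_ldual :: "'o \<Rightarrow> 'a" where
  "rdual_ldual c = right_mate c (ldual C c) (ldual_coev C c)
     (rdual C (ldual C c)) (rdual_ev C (ldual C c)) (idt C (ldual C c))"

end


section \<open>Module categories and bimodule categories\<close>

text \<open>\<open>lact_assoc b c x : (b \<otimes> c) \<rhd> x \<rightarrow> b \<rhd> (c \<rhd> x)\<close> and
  \<open>ract_assoc x c d : (x \<lhd> c) \<lhd> d \<rightarrow> x \<lhd> (c \<otimes> d)\<close>.\<close>

record ('o, 'a, 'm, 'n) lact =
  lact_fun :: "('o, 'a, 'm, 'n, 'm, 'n) bftr"
  lact_assoc :: "'o \<Rightarrow> 'o \<Rightarrow> 'm \<Rightarrow> 'n"
  lact_unit :: "'m \<Rightarrow> 'n"

record ('o, 'a, 'm, 'n) ract =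
  ract_fun :: "('m, 'n, 'o, 'a, 'm, 'n) bftr"
  ract_assoc :: "'m \<Rightarrow> 'o \<Rightarrow> 'o \<Rightarrow> 'n"
  ract_unit :: "'m \<Rightarrow> 'n"

abbreviation lact_ob :: "('o, 'a, 'm, 'n, 'z) lact_scheme \<Rightarrow> 'o \<Rightarrow> 'm \<Rightarrow> 'm"
    (infixr "\<rhd>\<^sub>o\<index>" 68) where
  "c \<rhd>\<^sub>o\<^bsub>L\<^esub> x \<equiv> bf_ob (lact_fun L) c x"

abbreviation lact_arr :: "('o, 'a, 'm, 'n, 'z) lact_scheme \<Rightarrow> 'a \<Rightarrow> 'n \<Rightarrow> 'n"
    (infixr "\<rhd>\<^sub>a\<index>" 68) where
  "f \<rhd>\<^sub>a\<^bsub>L\<^esub> g \<equiv> bf_arr (lact_fun L) f g"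

abbreviation ract_ob :: "('o, 'a, 'm, 'n, 'z) ract_scheme \<Rightarrow> 'm \<Rightarrow> 'o \<Rightarrow> 'm"
    (infixl "\<lhd>\<^sub>o\<index>" 68) where
  "x \<lhd>\<^sub>o\<^bsub>R\<^esub> c \<equiv> bf_ob (ract_fun R) x c"

abbreviation ract_arr :: "('o, 'a, 'm, 'n, 'z) ract_scheme \<Rightarrow> 'n \<Rightarrow> 'a \<Rightarrow> 'n"
    (infixl "\<lhd>\<^sub>a\<index>" 68) where
  "g \<lhd>\<^sub>a\<^bsub>R\<^esub> f \<equiv> bf_arr (ract_fun R) g f"

locale left_module_category =
    bilinear_bifunctor C N N "lact_fun L"
  for C :: "('o, 'a, 'k::field, 'y) tcat_scheme" and N :: "('m, 'n, 'k, 'z) lcat_scheme"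
    and L :: "('o, 'a, 'm, 'n) lact" +
  assumes assoc_nat: "nat_iso3 C C N N
      (\<lambda>b c x. (b \<otimes>\<^sub>o\<^bsub>C\<^esub> c) \<rhd>\<^sub>o\<^bsub>L\<^esub> x) (\<lambda>f g h. (f \<otimes>\<^sub>a\<^bsub>C\<^esub> g) \<rhd>\<^sub>a\<^bsub>L\<^esub> h)
      (\<lambda>b c x. b \<rhd>\<^sub>o\<^bsub>L\<^esub> (c \<rhd>\<^sub>o\<^bsub>L\<^esub> x)) (\<lambda>f g h. f \<rhd>\<^sub>a\<^bsub>L\<^esub> (g \<rhd>\<^sub>a\<^bsub>L\<^esub> h)) (lact_assoc L)"
    and unit_nat: "nat_iso N N (fix_left C (lact_fun L) \<one>\<^sub>o\<^bsub>C\<^esub>) id_ftr (lact_unit L)"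
    and pentagon: "b \<in> ob C \<Longrightarrow> c \<in> ob C \<Longrightarrow> d \<in> ob C \<Longrightarrow> x \<in> ob N \<Longrightarrow>
      (idt C b \<rhd>\<^sub>a\<^bsub>L\<^esub> lact_assoc L c d x) \<cdot>\<^bsub>N\<^esub> lact_assoc L b (c \<otimes>\<^sub>o\<^bsub>C\<^esub> d) x \<cdot>\<^bsub>N\<^esub>
        (assoc C b c d \<rhd>\<^sub>a\<^bsub>L\<^esub> idt N x) =
      lact_assoc L b c (d \<rhd>\<^sub>o\<^bsub>L\<^esub> x) \<cdot>\<^bsub>N\<^esub> lact_assoc L (b \<otimes>\<^sub>o\<^bsub>C\<^esub> c) d x"
    and triangle: "c \<in> ob C \<Longrightarrow> x \<in> ob N \<Longrightarrow>
      (idt C c \<rhd>\<^sub>a\<^bsub>L\<^esub> lact_unit L x) \<cdot>\<^bsub>N\<^esub> lact_assoc L c \<one>\<^sub>o\<^bsub>C\<^esub> x = runit C c \<rhd>\<^sub>a\<^bsub>L\<^esub> idt N x"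

locale right_module_category =
    bilinear_bifunctor N C N "ract_fun R"
  for C :: "('o, 'a, 'k::field, 'y) tcat_scheme" and N :: "('m, 'n, 'k, 'z) lcat_scheme"
    and R :: "('o, 'a, 'm, 'n) ract" +
  assumes assoc_nat: "nat_iso3 N C C N
      (\<lambda>x c d. (x \<lhd>\<^sub>o\<^bsub>R\<^esub> c) \<lhd>\<^sub>o\<^bsub>R\<^esub> d) (\<lambda>f g h. (f \<lhd>\<^sub>a\<^bsub>R\<^esub> g) \<lhd>\<^sub>a\<^bsub>R\<^esub> h)
      (\<lambda>x c d. x \<lhd>\<^sub>o\<^bsub>R\<^esub> (c \<otimes>\<^sub>o\<^bsub>C\<^esub> d)) (\<lambda>f g h. f \<lhd>\<^sub>a\<^bsub>R\<^esub> (g \<otimes>\<^sub>a\<^bsub>C\<^esub> h)) (ract_assoc R)"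
    and unit_nat: "nat_iso N N (fix_right C (ract_fun R) \<one>\<^sub>o\<^bsub>C\<^esub>) id_ftr (ract_unit R)"
    and pentagon: "x \<in> ob N \<Longrightarrow> b \<in> ob C \<Longrightarrow> c \<in> ob C \<Longrightarrow> d \<in> ob C \<Longrightarrow>
      (idt N x \<lhd>\<^sub>a\<^bsub>R\<^esub> assoc C b c d) \<cdot>\<^bsub>N\<^esub> ract_assoc R x (b \<otimes>\<^sub>o\<^bsub>C\<^esub> c) d \<cdot>\<^bsub>N\<^esub>
        (ract_assoc R x b c \<lhd>\<^sub>a\<^bsub>R\<^esub> idt C d) =
      ract_assoc R x b (c \<otimes>\<^sub>o\<^bsub>C\<^esub> d) \<cdot>\<^bsub>N\<^esub> ract_assoc R (x \<lhd>\<^sub>o\<^bsub>R\<^esub> b) c d"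
    and triangle: "x \<in> ob N \<Longrightarrow> c \<in> ob C \<Longrightarrow>
      (idt N x \<lhd>\<^sub>a\<^bsub>R\<^esub> lunit C c) \<cdot>\<^bsub>N\<^esub> ract_assoc R x \<one>\<^sub>o\<^bsub>C\<^esub> c = ract_unit R x \<lhd>\<^sub>a\<^bsub>R\<^esub> idt C c"

locale module_category = left_module_category C M L + finite_linear_category M
  for C :: "('o, 'a, 'k::field, 'y) tcat_scheme" and M :: "('m, 'n, 'k, 'z) lcat_scheme"
    and L :: "('o, 'a, 'm, 'n) lact" +
  assumes exact_first: "x \<in> ob M \<Longrightarrow> left_exact C M (fix_right M (lact_fun L) x)"
    and right_exact_each: "right_exact_in_each C M M (lact_fun L)"

text \<open>\<open>mid c x d : (c \<rhd> x) \<lhd> d \<rightarrow> c \<rhd> (x \<lhd> d)\<close>.\<close>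

record ('d, 'e, 'k, 'o, 'a) bimod = "('d, 'e, 'k) lcat" +
  lft :: "('o, 'a, 'd, 'e) lact"
  rgt :: "('o, 'a, 'd, 'e) ract"
  mid :: "'o \<Rightarrow> 'd \<Rightarrow> 'o \<Rightarrow> 'e"

locale bimodule_category =
    left: left_module_category C D "lft D" + right: right_module_category C D "rgt D"
  for C :: "('o, 'a, 'k::field, 'y) tcat_scheme" and D :: "('d, 'e, 'k, 'o, 'a, 'z) bimod_scheme" +
  assumes mid_nat: "nat_iso3 C D C D
      (\<lambda>c x d. (c \<rhd>\<^sub>o\<^bsub>lft D\<^esub> x) \<lhd>\<^sub>o\<^bsub>rgt D\<^esub> d) (\<lambda>f g h. (f \<rhd>\<^sub>a\<^bsub>lft D\<^esub> g) \<lhd>\<^sub>a\<^bsub>rgt D\<^esub> h)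
      (\<lambda>c x d. c \<rhd>\<^sub>o\<^bsub>lft D\<^esub> (x \<lhd>\<^sub>o\<^bsub>rgt D\<^esub> d)) (\<lambda>f g h. f \<rhd>\<^sub>a\<^bsub>lft D\<^esub> (g \<lhd>\<^sub>a\<^bsub>rgt D\<^esub> h)) (mid D)"
    and mid_left: "b \<in> ob C \<Longrightarrow> c \<in> ob C \<Longrightarrow> x \<in> ob D \<Longrightarrow> d \<in> ob C \<Longrightarrow>
      (idt C b \<rhd>\<^sub>a\<^bsub>lft D\<^esub> mid D c x d) \<cdot>\<^bsub>D\<^esub> mid D b (c \<rhd>\<^sub>o\<^bsub>lft D\<^esub> x) d \<cdot>\<^bsub>D\<^esub>
        (lact_assoc (lft D) b c x \<lhd>\<^sub>a\<^bsub>rgt D\<^esub> idt C d) =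
      lact_assoc (lft D) b c (x \<lhd>\<^sub>o\<^bsub>rgt D\<^esub> d) \<cdot>\<^bsub>D\<^esub> mid D (b \<otimes>\<^sub>o\<^bsub>C\<^esub> c) x d"
    and mid_right: "b \<in> ob C \<Longrightarrow> x \<in> ob D \<Longrightarrow> c \<in> ob C \<Longrightarrow> d \<in> ob C \<Longrightarrow>
      (idt C b \<rhd>\<^sub>a\<^bsub>lft D\<^esub> ract_assoc (rgt D) x c d) \<cdot>\<^bsub>D\<^esub> mid D b (x \<lhd>\<^sub>o\<^bsub>rgt D\<^esub> c) d \<cdot>\<^bsub>D\<^esub>
        (mid D b x c \<lhd>\<^sub>a\<^bsub>rgt D\<^esub> idt C d) =
      mid D b x (c \<otimes>\<^sub>o\<^bsub>C\<^esub> d) \<cdot>\<^bsub>D\<^esub> ract_assoc (rgt D) (b \<rhd>\<^sub>o\<^bsub>lft D\<^esub> x) c d"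

definition regular_bimodule :: "('o, 'a, 'k, 'z) tcat_scheme \<Rightarrow> ('o, 'a, 'k, 'o, 'a) bimod" where
  "regular_bimodule C =
     \<lparr>ob = ob C, arr = arr C, src = src C, trg = trg C, idt = idt C, comp = comp C,
      zero_arr = zero_arr C, add_arr = add_arr C, scale_arr = scale_arr C,
      lft = \<lparr>lact_fun = tensor C, lact_assoc = assoc C, lact_unit = lunit C\<rparr>,
      rgt = \<lparr>ract_fun = tensor C, ract_assoc = assoc C, ract_unit = runit C\<rparr>,
      mid = assoc C\<rparr>"

text \<open>The right actions \<open>m \<lhd> c = ldual c \<rhd> m\<close> and \<open>m \<lhd> c = rdual c \<rhd> m\<close> on \<^term>\<open>opp M\<close>. The
  constraints are arrows of \<^term>\<open>opp M\<close>, hence arrows of \<open>M\<close> in the reverse direction.\<close>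

definition left_sharp :: "('o, 'a, 'k, 'y) tcat_scheme \<Rightarrow> ('m, 'n, 'k, 'z) lcat_scheme \<Rightarrow>
    ('o, 'a, 'm, 'n) lact \<Rightarrow> ('o, 'a, 'm, 'n) ract" where
  "left_sharp C M L =
     \<lparr>ract_fun = \<lparr>bf_ob = \<lambda>m c. ldual C c \<rhd>\<^sub>o\<^bsub>L\<^esub> m, bf_arr = \<lambda>f g. ldual_arr C g \<rhd>\<^sub>a\<^bsub>L\<^esub> f\<rparr>,
      ract_assoc = \<lambda>m c d. lact_assoc L (ldual C d) (ldual C c) m \<cdot>\<^bsub>M\<^esub> (ldual_tensor C c d \<rhd>\<^sub>a\<^bsub>L\<^esub> idt M m),
      ract_unit = \<lambda>m. (ldual_unit C \<rhd>\<^sub>a\<^bsub>L\<^esub> idt M m) \<cdot>\<^bsub>M\<^esub> inv_arr M (lact_unit L m)\<rparr>"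

definition right_sharp :: "('o, 'a, 'k, 'y) tcat_scheme \<Rightarrow> ('m, 'n, 'k, 'z) lcat_scheme \<Rightarrow>
    ('o, 'a, 'm, 'n) lact \<Rightarrow> ('o, 'a, 'm, 'n) ract" where
  "right_sharp C M L =
     \<lparr>ract_fun = \<lparr>bf_ob = \<lambda>m c. rdual C c \<rhd>\<^sub>o\<^bsub>L\<^esub> m, bf_arr = \<lambda>f g. rdual_arr C g \<rhd>\<^sub>a\<^bsub>L\<^esub> f\<rparr>,
      ract_assoc = \<lambda>m c d. lact_assoc L (rdual C d) (rdual C c) m \<cdot>\<^bsub>M\<^esub> (rdual_tensor C c d \<rhd>\<^sub>a\<^bsub>L\<^esub> idt M m),
      ract_unit = \<lambda>m. (rdual_unit C \<rhd>\<^sub>a\<^bsub>L\<^esub> idt M m) \<cdot>\<^bsub>M\<^esub> inv_arr M (lact_unit L m)\<rparr>"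

subsection \<open>The bimodule category on a Deligne product\<close>

text \<open>The actions on the Deligne product of a right module category \<open>A\<close> and a left module category
  \<open>B\<close> extend those on the factors, via coherent isomorphisms
  \<open>box_l x c y : x \<boxtimes> (c \<rhd> y) \<rightarrow> c \<rhd> (x \<boxtimes> y)\<close> and \<open>box_r x c y : (x \<lhd> c) \<boxtimes> y \<rightarrow> (x \<boxtimes> y) \<lhd> c\<close>.\<close>

record ('o1, 'a1, 'o2, 'a2, 'd, 'e, 'o) box = "('o1, 'a1, 'o2, 'a2, 'd, 'e) bftr" +
  box_l :: "'o1 \<Rightarrow> 'o \<Rightarrow> 'o2 \<Rightarrow> 'e"
  box_r :: "'o1 \<Rightarrow> 'o \<Rightarrow> 'o2 \<Rightarrow> 'e"

locale deligne_bimodule = deligne_product A B D bx + bimodule_category C D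
  for C :: "('o, 'a, 'k::field, 'w) tcat_scheme"
    and A :: "('o1, 'a1, 'k, 'x) lcat_scheme" and R :: "('o, 'a, 'o1, 'a1) ract"
    and B :: "('o2, 'a2, 'k, 'y) lcat_scheme" and L :: "('o, 'a, 'o2, 'a2) lact"
    and D :: "('d, 'e, 'k, 'o, 'a, 'z) bimod_scheme"
    and bx :: "('o1, 'a1, 'o2, 'a2, 'd, 'e, 'o) box" +
  assumes box_l_nat: "nat_iso3 A C B D
      (\<lambda>x c y. bf_ob bx x (c \<rhd>\<^sub>o\<^bsub>L\<^esub> y)) (\<lambda>f g h. bf_arr bx f (g \<rhd>\<^sub>a\<^bsub>L\<^esub> h))
      (\<lambda>x c y. c \<rhd>\<^sub>o\<^bsub>lft D\<^esub> bf_ob bx x y) (\<lambda>f g h. g \<rhd>\<^sub>a\<^bsub>lft D\<^esub> bf_arr bx f h) (box_l bx)"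
    and box_r_nat: "nat_iso3 A C B D
      (\<lambda>x c y. bf_ob bx (x \<lhd>\<^sub>o\<^bsub>R\<^esub> c) y) (\<lambda>f g h. bf_arr bx (f \<lhd>\<^sub>a\<^bsub>R\<^esub> g) h)
      (\<lambda>x c y. bf_ob bx x y \<lhd>\<^sub>o\<^bsub>rgt D\<^esub> c) (\<lambda>f g h. bf_arr bx f h \<lhd>\<^sub>a\<^bsub>rgt D\<^esub> g) (box_r bx)"
    and box_l_assoc: "x \<in> ob A \<Longrightarrow> b \<in> ob C \<Longrightarrow> c \<in> ob C \<Longrightarrow> y \<in> ob B \<Longrightarrow>
      lact_assoc (lft D) b c (bf_ob bx x y) \<cdot>\<^bsub>D\<^esub> box_l bx x (b \<otimes>\<^sub>o\<^bsub>C\<^esub> c) y =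
      (idt C b \<rhd>\<^sub>a\<^bsub>lft D\<^esub> box_l bx x c y) \<cdot>\<^bsub>D\<^esub> box_l bx x b (c \<rhd>\<^sub>o\<^bsub>L\<^esub> y) \<cdot>\<^bsub>D\<^esub>
        bf_arr bx (idt A x) (lact_assoc L b c y)"
    and box_l_unit: "x \<in> ob A \<Longrightarrow> y \<in> ob B \<Longrightarrow>
      lact_unit (lft D) (bf_ob bx x y) \<cdot>\<^bsub>D\<^esub> box_l bx x \<one>\<^sub>o\<^bsub>C\<^esub> y = bf_arr bx (idt A x) (lact_unit L y)"
    and box_r_assoc: "x \<in> ob A \<Longrightarrow> c \<in> ob C \<Longrightarrow> d \<in> ob C \<Longrightarrow> y \<in> ob B \<Longrightarrow>
      ract_assoc (rgt D) (bf_ob bx x y) c d \<cdot>\<^bsub>D\<^esub> (box_r bx x c y \<lhd>\<^sub>a\<^bsub>rgt D\<^esub> idt C d) \<cdot>\<^bsub>D\<^esub>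
        box_r bx (x \<lhd>\<^sub>o\<^bsub>R\<^esub> c) d y =
      box_r bx x (c \<otimes>\<^sub>o\<^bsub>C\<^esub> d) y \<cdot>\<^bsub>D\<^esub> bf_arr bx (ract_assoc R x c d) (idt B y)"
    and box_r_unit: "x \<in> ob A \<Longrightarrow> y \<in> ob B \<Longrightarrow>
      ract_unit (rgt D) (bf_ob bx x y) \<cdot>\<^bsub>D\<^esub> box_r bx x \<one>\<^sub>o\<^bsub>C\<^esub> y = bf_arr bx (ract_unit R x) (idt B y)"
    and box_mid: "x \<in> ob A \<Longrightarrow> c \<in> ob C \<Longrightarrow> d \<in> ob C \<Longrightarrow> y \<in> ob B \<Longrightarrow>
      (idt C c \<rhd>\<^sub>a\<^bsub>lft D\<^esub> box_r bx x d y) \<cdot>\<^bsub>D\<^esub> box_l bx (x \<lhd>\<^sub>o\<^bsub>R\<^esub> d) c y =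
      mid D c (bf_ob bx x y) d \<cdot>\<^bsub>D\<^esub> (box_l bx x c y \<lhd>\<^sub>a\<^bsub>rgt D\<^esub> idt C d) \<cdot>\<^bsub>D\<^esub>
        box_r bx x d (c \<rhd>\<^sub>o\<^bsub>L\<^esub> y)"


section \<open>The category of bimodule functors\<close>

text \<open>\<open>lcon c x : G (c \<rhd> x) \<rightarrow> c \<rhd> G x\<close> and \<open>rcon x c : G (x \<lhd> c) \<rightarrow> G x \<lhd> c\<close>.\<close>

record ('d, 'e, 'p, 'b, 'o) bimod_ftr = "('d, 'e, 'p, 'b) ftr" +
  lcon :: "'o \<Rightarrow> 'd \<Rightarrow> 'b"
  rcon :: "'d \<Rightarrow> 'o \<Rightarrow> 'b"

locale bimodule_functor =
    D: bimodule_category C D + E: bimodule_category C E + linear_functor D E G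
  for C :: "('o, 'a, 'k::field, 'x) tcat_scheme" and D :: "('d, 'e, 'k, 'o, 'a, 'y) bimod_scheme"
    and E :: "('p, 'b, 'k, 'o, 'a, 'z) bimod_scheme" and G :: "('d, 'e, 'p, 'b, 'o) bimod_ftr" +
  assumes lcon_nat: "nat_iso2 C D E
      (comp_bftr G (lact_fun (lft D)))
      \<lparr>bf_ob = \<lambda>c x. c \<rhd>\<^sub>o\<^bsub>lft E\<^esub> f_ob G x, bf_arr = \<lambda>f g. f \<rhd>\<^sub>a\<^bsub>lft E\<^esub> f_arr G g\<rparr> (lcon G)"
    and rcon_nat: "nat_iso2 D C E
      (comp_bftr G (ract_fun (rgt D)))
      \<lparr>bf_ob = \<lambda>x c. f_ob G x \<lhd>\<^sub>o\<^bsub>rgt E\<^esub> c, bf_arr = \<lambda>g f. f_arr G g \<lhd>\<^sub>a\<^bsub>rgt E\<^esub> f\<rparr> (rcon G)"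
    and lcon_assoc: "b \<in> ob C \<Longrightarrow> c \<in> ob C \<Longrightarrow> x \<in> ob D \<Longrightarrow>
      lact_assoc (lft E) b c (f_ob G x) \<cdot>\<^bsub>E\<^esub> lcon G (b \<otimes>\<^sub>o\<^bsub>C\<^esub> c) x =
      (idt C b \<rhd>\<^sub>a\<^bsub>lft E\<^esub> lcon G c x) \<cdot>\<^bsub>E\<^esub> lcon G b (c \<rhd>\<^sub>o\<^bsub>lft D\<^esub> x) \<cdot>\<^bsub>E\<^esub> f_arr G (lact_assoc (lft D) b c x)"
    and lcon_unit: "x \<in> ob D \<Longrightarrow>
      lact_unit (lft E) (f_ob G x) \<cdot>\<^bsub>E\<^esub> lcon G \<one>\<^sub>o\<^bsub>C\<^esub> x = f_arr G (lact_unit (lft D) x)"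
    and rcon_assoc: "x \<in> ob D \<Longrightarrow> c \<in> ob C \<Longrightarrow> d \<in> ob C \<Longrightarrow>
      ract_assoc (rgt E) (f_ob G x) c d \<cdot>\<^bsub>E\<^esub> (rcon G x c \<lhd>\<^sub>a\<^bsub>rgt E\<^esub> idt C d) \<cdot>\<^bsub>E\<^esub>
        rcon G (x \<lhd>\<^sub>o\<^bsub>rgt D\<^esub> c) d =
      rcon G x (c \<otimes>\<^sub>o\<^bsub>C\<^esub> d) \<cdot>\<^bsub>E\<^esub> f_arr G (ract_assoc (rgt D) x c d)"
    and rcon_unit: "x \<in> ob D \<Longrightarrow>
      ract_unit (rgt E) (f_ob G x) \<cdot>\<^bsub>E\<^esub> rcon G x \<one>\<^sub>o\<^bsub>C\<^esub> = f_arr G (ract_unit (rgt D) x)"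
    and con_mid: "c \<in> ob C \<Longrightarrow> x \<in> ob D \<Longrightarrow> d \<in> ob C \<Longrightarrow>
      (idt C c \<rhd>\<^sub>a\<^bsub>lft E\<^esub> rcon G x d) \<cdot>\<^bsub>E\<^esub> lcon G c (x \<lhd>\<^sub>o\<^bsub>rgt D\<^esub> d) \<cdot>\<^bsub>E\<^esub> f_arr G (mid D c x d) =
      mid E c (f_ob G x) d \<cdot>\<^bsub>E\<^esub> (lcon G c x \<lhd>\<^sub>a\<^bsub>rgt E\<^esub> idt C d) \<cdot>\<^bsub>E\<^esub> rcon G (c \<rhd>\<^sub>o\<^bsub>lft D\<^esub> x) d"

definition bimodule_nat_trans ::
  "('o, 'a, 'k, 'x) tcat_scheme \<Rightarrow> ('d, 'e, 'k, 'o, 'a, 'y) bimod_scheme \<Rightarrow>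
   ('p, 'b, 'k, 'o, 'a, 'z) bimod_scheme \<Rightarrow> ('d, 'e, 'p, 'b, 'o) bimod_ftr \<Rightarrow>
   ('d, 'e, 'p, 'b, 'o) bimod_ftr \<Rightarrow> ('d \<Rightarrow> 'b) \<Rightarrow> bool" where
  "bimodule_nat_trans C D E G G' \<eta> \<longleftrightarrow> nat_trans D E G G' \<eta> \<and>
     (\<forall>c\<in>ob C. \<forall>x\<in>ob D.
        lcon G' c x \<cdot>\<^bsub>E\<^esub> \<eta> (c \<rhd>\<^sub>o\<^bsub>lft D\<^esub> x) = (idt C c \<rhd>\<^sub>a\<^bsub>lft E\<^esub> \<eta> x) \<cdot>\<^bsub>E\<^esub> lcon G c x \<and>
        rcon G' x c \<cdot>\<^bsub>E\<^esub> \<eta> (x \<lhd>\<^sub>o\<^bsub>rgt D\<^esub> c) = (\<eta> x \<lhd>\<^sub>a\<^bsub>rgt E\<^esub> idt C c) \<cdot>\<^bsub>E\<^esub> rcon G x c)"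

type_synonym ('d, 'e, 'p, 'b, 'o) bimod_trans =
  "('d, 'e, 'p, 'b, 'o) bimod_ftr \<times> ('d \<Rightarrow> 'b) \<times> ('d, 'e, 'p, 'b, 'o) bimod_ftr"

definition bimodule_functors ::
  "('o, 'a, 'k::field, 'x) tcat_scheme \<Rightarrow> ('d, 'e, 'k, 'o, 'a, 'y) bimod_scheme \<Rightarrow>
   ('p, 'b, 'k, 'o, 'a, 'z) bimod_scheme \<Rightarrow>
   (('d, 'e, 'p, 'b, 'o) bimod_ftr, ('d, 'e, 'p, 'b, 'o) bimod_trans) cat" where
  "bimodule_functors C D E =
     \<lparr>ob = {G. bimodule_functor C D E G},
      arr = {(G, \<eta>, G'). bimodule_functor C D E G \<and> bimodule_functor C D E G' \<and>
               \<eta> \<in> extensional (ob D) \<and> bimodule_nat_trans C D E G G' \<eta>},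
      src = \<lambda>(G, \<eta>, G'). G,
      trg = \<lambda>(G, \<eta>, G'). G',
      idt = \<lambda>G. (G, \<lambda>x\<in>ob D. idt E (f_ob G x), G),
      comp = \<lambda>(G', \<theta>, G'') (G, \<eta>, H). (G, \<lambda>x\<in>ob D. \<theta> x \<cdot>\<^bsub>E\<^esub> \<eta> x, G'')\<rparr>"


section \<open>The Drinfeld center\<close>

definition half_braiding :: "('o, 'a, 'k, 'z) tcat_scheme \<Rightarrow> 'o \<Rightarrow> ('o \<Rightarrow> 'a) \<Rightarrow> bool" where
  "half_braiding C z \<sigma> \<longleftrightarrow>
     (\<forall>a\<in>ob C. \<sigma> a \<in> Hom C (a \<otimes>\<^sub>o\<^bsub>C\<^esub> z) (z \<otimes>\<^sub>o\<^bsub>C\<^esub> a) \<and> is_iso C (\<sigma> a)) \<and>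
     (\<forall>f\<in>arr C. \<sigma> (trg C f) \<cdot>\<^bsub>C\<^esub> (f \<otimes>\<^sub>a\<^bsub>C\<^esub> idt C z) = (idt C z \<otimes>\<^sub>a\<^bsub>C\<^esub> f) \<cdot>\<^bsub>C\<^esub> \<sigma> (src C f)) \<and>
     (\<forall>a\<in>ob C. \<forall>b\<in>ob C. \<sigma> (a \<otimes>\<^sub>o\<^bsub>C\<^esub> b) =
        assoc C z a b \<cdot>\<^bsub>C\<^esub> (\<sigma> a \<otimes>\<^sub>a\<^bsub>C\<^esub> idt C b) \<cdot>\<^bsub>C\<^esub> inv_arr C (assoc C a z b) \<cdot>\<^bsub>C\<^esub>
        (idt C a \<otimes>\<^sub>a\<^bsub>C\<^esub> \<sigma> b) \<cdot>\<^bsub>C\<^esub> assoc C a b z) \<and>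
     \<sigma> \<one>\<^sub>o\<^bsub>C\<^esub> = inv_arr C (runit C z) \<cdot>\<^bsub>C\<^esub> lunit C z"

definition center_objects :: "('o, 'a, 'k, 'z) tcat_scheme \<Rightarrow> ('o \<times> ('o \<Rightarrow> 'a)) set" where
  "center_objects C = {(z, \<sigma>). z \<in> ob C \<and> \<sigma> \<in> extensional (ob C) \<and> half_braiding C z \<sigma>}"

definition drinfeld_center :: "('o, 'a, 'k, 'z) tcat_scheme \<Rightarrow>
    ('o \<times> ('o \<Rightarrow> 'a), ('o \<times> ('o \<Rightarrow> 'a)) \<times> 'a \<times> ('o \<times> ('o \<Rightarrow> 'a))) cat" where
  "drinfeld_center C =
     \<lparr>ob = center_objects C,
      arr = {(X, f, Y). X \<in> center_objects C \<and> Y \<in> center_objects C \<and> f \<in> Hom C (fst X) (fst Y) \<and>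
               (\<forall>a\<in>ob C. (f \<otimes>\<^sub>a\<^bsub>C\<^esub> idt C a) \<cdot>\<^bsub>C\<^esub> snd X a = snd Y a \<cdot>\<^bsub>C\<^esub> (idt C a \<otimes>\<^sub>a\<^bsub>C\<^esub> f))},
      src = \<lambda>(X, f, Y). X,
      trg = \<lambda>(X, f, Y). Y,
      idt = \<lambda>X. (X, idt C (fst X), X),
      comp = \<lambda>(Y, g, Z) (X, f, Y'). (X, g \<cdot>\<^bsub>C\<^esub> f, Z)\<rparr>"


section \<open>Ends and coends\<close>

text \<open>Here \<open>T\<close> is a functor from \<^term>\<open>opp M\<close> and \<open>M\<close> to \<open>X\<close>.\<close>

definition wedge :: "('m, 'n, 'y) cat_scheme \<Rightarrow> ('o, 'a, 'z) cat_scheme \<Rightarrow>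
    ('m, 'n, 'm, 'n, 'o, 'a, 't) bftr_scheme \<Rightarrow> 'o \<Rightarrow> ('m \<Rightarrow> 'a) \<Rightarrow> bool" where
  "wedge M X T g j \<longleftrightarrow> g \<in> ob X \<and> (\<forall>m\<in>ob M. j m \<in> Hom X g (bf_ob T m m)) \<and>
     (\<forall>f\<in>arr M. bf_arr T (idt M (src M f)) f \<cdot>\<^bsub>X\<^esub> j (src M f) =
                bf_arr T f (idt M (trg M f)) \<cdot>\<^bsub>X\<^esub> j (trg M f))"

definition is_end :: "('m, 'n, 'y) cat_scheme \<Rightarrow> ('o, 'a, 'z) cat_scheme \<Rightarrow>
    ('m, 'n, 'm, 'n, 'o, 'a, 't) bftr_scheme \<Rightarrow> 'o \<Rightarrow> ('m \<Rightarrow> 'a) \<Rightarrow> bool" where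
  "is_end M X T g j \<longleftrightarrow> wedge M X T g j \<and>
     (\<forall>w k. wedge M X T w k \<longrightarrow> (\<exists>!u. u \<in> Hom X w g \<and> (\<forall>m\<in>ob M. j m \<cdot>\<^bsub>X\<^esub> u = k m)))"

definition cowedge :: "('m, 'n, 'y) cat_scheme \<Rightarrow> ('o, 'a, 'z) cat_scheme \<Rightarrow>
    ('m, 'n, 'm, 'n, 'o, 'a, 't) bftr_scheme \<Rightarrow> 'o \<Rightarrow> ('m \<Rightarrow> 'a) \<Rightarrow> bool" where
  "cowedge M X T h i \<longleftrightarrow> h \<in> ob X \<and> (\<forall>m\<in>ob M. i m \<in> Hom X (bf_ob T m m) h) \<and>
     (\<forall>f\<in>arr M. i (src M f) \<cdot>\<^bsub>X\<^esub> bf_arr T f (idt M (src M f)) =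
                i (trg M f) \<cdot>\<^bsub>X\<^esub> bf_arr T (idt M (trg M f)) f)"

definition is_coend :: "('m, 'n, 'y) cat_scheme \<Rightarrow> ('o, 'a, 'z) cat_scheme \<Rightarrow>
    ('m, 'n, 'm, 'n, 'o, 'a, 't) bftr_scheme \<Rightarrow> 'o \<Rightarrow> ('m \<Rightarrow> 'a) \<Rightarrow> bool" where
  "is_coend M X T h i \<longleftrightarrow> cowedge M X T h i \<and>
     (\<forall>w k. cowedge M X T w k \<longrightarrow> (\<exists>!u. u \<in> Hom X h w \<and> (\<forall>m\<in>ob M. u \<cdot>\<^bsub>X\<^esub> i m = k m)))"


section \<open>The end and the coend as objects of the Drinfeld center\<close>

context
  fixes C :: "('o, 'a, 'k, 'x) tcat_scheme" (structure)
    and M :: "('m, 'n, 'k, 'y) lcat_scheme" and L :: "('o, 'a, 'm, 'n) lact"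
    and D :: "('d, 'e, 'k, 'o, 'a, 'z) bimod_scheme"
    and bx :: "('m, 'n, 'm, 'n, 'd, 'e, 'o) box"
begin

text \<open>The isomorphism \<open>G (c \<rhd> m, c \<rhd> m) \<rightarrow> c \<otimes> (G (m, m) \<otimes> e)\<close>, where \<open>\<theta> : e' \<rightarrow> c\<close> identifies \<open>c\<close>
  with the dual \<open>e'\<close> of \<open>e\<close> used in the right action \<open>m \<lhd> e = e' \<rhd> m\<close> on \<^term>\<open>opp M\<close>. It is the composite
  \<open>G (c \<rhd> m, c \<rhd> m) \<rightarrow> G (m \<lhd> e, c \<rhd> m) \<rightarrow> G ((m \<boxtimes> (c \<rhd> m)) \<lhd> e) \<rightarrow> G ((c \<rhd> (m \<boxtimes> m)) \<lhd> e) \<rightarrow>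
  G (c \<rhd> (m \<boxtimes> m)) \<otimes> e \<rightarrow> (c \<otimes> G (m, m)) \<otimes> e \<rightarrow> c \<otimes> (G (m, m) \<otimes> e)\<close>.\<close>

definition conj_iso :: "('d, 'e, 'o, 'a, 'o) bimod_ftr \<Rightarrow> 'o \<Rightarrow> 'a \<Rightarrow> 'o \<Rightarrow> 'm \<Rightarrow> 'a" where
  "conj_iso G e \<theta> c m =
     assoc C c (f_ob G (bf_ob bx m m)) e \<cdot>
     (lcon G c (bf_ob bx m m) \<otimes>\<^sub>a idt C e) \<cdot>
     rcon G (c \<rhd>\<^sub>o\<^bsub>lft D\<^esub> bf_ob bx m m) e \<cdot>
     f_arr G ((box_l bx m c m \<lhd>\<^sub>a\<^bsub>rgt D\<^esub> idt C e) \<cdot>\<^bsub>D\<^esub>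
              box_r bx m e (c \<rhd>\<^sub>o\<^bsub>L\<^esub> m) \<cdot>\<^bsub>D\<^esub>
              bf_arr bx (\<theta> \<rhd>\<^sub>a\<^bsub>L\<^esub> idt M m) (idt M (c \<rhd>\<^sub>o\<^bsub>L\<^esub> m)))"

text \<open>\<open>G (c \<rhd> m, c \<rhd> m) \<rightarrow> c \<otimes> (G (m, m) \<otimes> rdual c)\<close> and
  \<open>H (c \<rhd> m, c \<rhd> m) \<rightarrow> c \<otimes> (H (m, m) \<otimes> ldual c)\<close>.\<close>

definition end_conj :: "('d, 'e, 'o, 'a, 'o) bimod_ftr \<Rightarrow> 'o \<Rightarrow> 'm \<Rightarrow> 'a" where
  "end_conj G c m = conj_iso G (rdual C c) (ldual_rdual C c) c m"

definition coend_conj :: "('d, 'e, 'o, 'a, 'o) bimod_ftr \<Rightarrow> 'o \<Rightarrow> 'm \<Rightarrow> 'a" where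
  "coend_conj H c m = conj_iso H (ldual C c) (rdual_ldual C c) c m"

definition is_end_delta ::
  "('d, 'e, 'o, 'a, 'o) bimod_ftr \<Rightarrow> 'o \<Rightarrow> ('m \<Rightarrow> 'a) \<Rightarrow> 'o \<Rightarrow> 'a \<Rightarrow> bool" where
  "is_end_delta G g j c \<delta> \<longleftrightarrow> \<delta> \<in> Hom C g (c \<otimes>\<^sub>o (g \<otimes>\<^sub>o rdual C c)) \<and>
     (\<forall>m\<in>ob M. (idt C c \<otimes>\<^sub>a (j m \<otimes>\<^sub>a idt C (rdual C c))) \<cdot> \<delta> = end_conj G c m \<cdot> j (c \<rhd>\<^sub>o\<^bsub>L\<^esub> m))"

definition end_delta :: "('d, 'e, 'o, 'a, 'o) bimod_ftr \<Rightarrow> 'o \<Rightarrow> ('m \<Rightarrow> 'a) \<Rightarrow> 'o \<Rightarrow> 'a" where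
  "end_delta G g j c = (THE \<delta>. is_end_delta G g j c \<delta>)"

definition end_half_braiding_inv ::
  "('d, 'e, 'o, 'a, 'o) bimod_ftr \<Rightarrow> 'o \<Rightarrow> ('m \<Rightarrow> 'a) \<Rightarrow> 'o \<Rightarrow> 'a" where
  "end_half_braiding_inv G g j c =
     (idt C c \<otimes>\<^sub>a (runit C g \<cdot> (idt C g \<otimes>\<^sub>a rdual_ev C c) \<cdot> assoc C g (rdual C c) c)) \<cdot>
     assoc C c (g \<otimes>\<^sub>o rdual C c) c \<cdot> (end_delta G g j c \<otimes>\<^sub>a idt C c)"

definition end_object ::
  "('d, 'e, 'o, 'a, 'o) bimod_ftr \<Rightarrow> 'o \<times> ('m \<Rightarrow> 'a) \<Rightarrow> 'o \<times> ('o \<Rightarrow> 'a)" where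
  "end_object G = (\<lambda>(g, j). (g, \<lambda>c\<in>ob C. inv_arr C (end_half_braiding_inv G g j c)))"

definition is_coend_rho ::
  "('d, 'e, 'o, 'a, 'o) bimod_ftr \<Rightarrow> 'o \<Rightarrow> ('m \<Rightarrow> 'a) \<Rightarrow> 'o \<Rightarrow> 'a \<Rightarrow> bool" where
  "is_coend_rho H h i c \<rho> \<longleftrightarrow> \<rho> \<in> Hom C (c \<otimes>\<^sub>o (h \<otimes>\<^sub>o ldual C c)) h \<and>
     (\<forall>m\<in>ob M. \<rho> \<cdot> (idt C c \<otimes>\<^sub>a (i m \<otimes>\<^sub>a idt C (ldual C c))) =
        i (c \<rhd>\<^sub>o\<^bsub>L\<^esub> m) \<cdot> inv_arr C (coend_conj H c m))"

definition coend_rho :: "('d, 'e, 'o, 'a, 'o) bimod_ftr \<Rightarrow> 'o \<Rightarrow> ('m \<Rightarrow> 'a) \<Rightarrow> 'o \<Rightarrow> 'a" where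
  "coend_rho H h i c = (THE \<rho>. is_coend_rho H h i c \<rho>)"

definition coend_half_braiding ::
  "('d, 'e, 'o, 'a, 'o) bimod_ftr \<Rightarrow> 'o \<Rightarrow> ('m \<Rightarrow> 'a) \<Rightarrow> 'o \<Rightarrow> 'a" where
  "coend_half_braiding H h i c =
     (coend_rho H h i c \<otimes>\<^sub>a idt C c) \<cdot> (assoc C c h (ldual C c) \<otimes>\<^sub>a idt C c) \<cdot>
     inv_arr C (assoc C (c \<otimes>\<^sub>o h) (ldual C c) c) \<cdot> (idt C (c \<otimes>\<^sub>o h) \<otimes>\<^sub>a ldual_coev C c) \<cdot>
     inv_arr C (runit C (c \<otimes>\<^sub>o h))"

definition coend_object ::
  "('d, 'e, 'o, 'a, 'o) bimod_ftr \<Rightarrow> 'o \<times> ('m \<Rightarrow> 'a) \<Rightarrow> 'o \<times> ('o \<Rightarrow> 'a)" where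
  "coend_object H = (\<lambda>(h, i). (h, \<lambda>c\<in>ob C. coend_half_braiding H h i c))"

definition is_end_map :: "'o \<times> ('m \<Rightarrow> 'a) \<Rightarrow> ('d \<Rightarrow> 'a) \<Rightarrow> 'o \<times> ('m \<Rightarrow> 'a) \<Rightarrow> 'a \<Rightarrow> bool" where
  "is_end_map = (\<lambda>(g, j) \<eta> (g', j') u. u \<in> Hom C g g' \<and>
     (\<forall>m\<in>ob M. j' m \<cdot> u = \<eta> (bf_ob bx m m) \<cdot> j m))"

definition is_coend_map :: "'o \<times> ('m \<Rightarrow> 'a) \<Rightarrow> ('d \<Rightarrow> 'a) \<Rightarrow> 'o \<times> ('m \<Rightarrow> 'a) \<Rightarrow> 'a \<Rightarrow> bool" where
  "is_coend_map = (\<lambda>(h, i) \<eta> (h', i') u. u \<in> Hom C h h' \<and>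
     (\<forall>m\<in>ob M. u \<cdot> i m = i' m \<cdot> \<eta> (bf_ob bx m m)))"

text \<open>The functors depend on a choice \<open>\<E>\<close> of an end \<open>(g, j)\<close>, respectively coend \<open>(h, i)\<close>, for each
  bimodule functor.\<close>

definition end_functor :: "(('d, 'e, 'o, 'a, 'o) bimod_ftr \<Rightarrow> 'o \<times> ('m \<Rightarrow> 'a)) \<Rightarrow>
    (('d, 'e, 'o, 'a, 'o) bimod_ftr, ('d, 'e, 'o, 'a, 'o) bimod_trans,
     'o \<times> ('o \<Rightarrow> 'a), ('o \<times> ('o \<Rightarrow> 'a)) \<times> 'a \<times> ('o \<times> ('o \<Rightarrow> 'a))) ftr" where
  "end_functor \<E> =
     \<lparr>f_ob = \<lambda>G. end_object G (\<E> G),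
      f_arr = \<lambda>(G, \<eta>, G').
        (end_object G (\<E> G), THE u. is_end_map (\<E> G) \<eta> (\<E> G') u, end_object G' (\<E> G'))\<rparr>"

definition coend_functor :: "(('d, 'e, 'o, 'a, 'o) bimod_ftr \<Rightarrow> 'o \<times> ('m \<Rightarrow> 'a)) \<Rightarrow>
    (('d, 'e, 'o, 'a, 'o) bimod_ftr, ('d, 'e, 'o, 'a, 'o) bimod_trans,
     'o \<times> ('o \<Rightarrow> 'a), ('o \<times> ('o \<Rightarrow> 'a)) \<times> 'a \<times> ('o \<times> ('o \<Rightarrow> 'a))) ftr" where
  "coend_functor \<E> =
     \<lparr>f_ob = \<lambda>H. coend_object H (\<E> H),
      f_arr = \<lambda>(H, \<eta>, H').
        (coend_object H (\<E> H), THE u. is_coend_map (\<E> H) \<eta> (\<E> H') u, coend_object H' (\<E> H'))\<rparr>"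

text \<open>A bimodule functor that is not left (right) exact need not have an end (a coend). For example,
  let \<open>C\<close> be the category of finite-dimensional vector spaces and \<open>M\<close> the category of modules over an
  algebra of infinite representation type, and let \<open>G (m, n)\<close> be the direct sum, over all
  indecomposable objects \<open>X\<close>, of \<open>Hom (m, X) / rad (m, X) \<otimes> Hom (X, n) / rad (X, n)\<close>: the wedges with vertex
  the ground field form an infinite-dimensional space.\<close>

definition has_end :: "('d, 'e, 'o, 'a, 'o) bimod_ftr set" where
  "has_end = {G. \<exists>g j. is_end M C (comp_bftr G bx) g j}"

definition has_coend :: "('d, 'e, 'o, 'a, 'o) bimod_ftr set" where
  "has_coend = {H. \<exists>h i. is_coend M C (comp_bftr H bx) h i}"

end

end

theory Submission imports Defs begin

text \<open>Both functors come from one construction. Let \<open>T\<close> be a functor of two variables in \<open>M\<close>, contravariant in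
  the first, with coherent isomorphisms \<open>T m (c \<bullet> n) \<rightarrow> c \<otimes> T m n\<close> and \<open>T (c\<^sup>* \<bullet> m) n \<rightarrow> T m n \<otimes> c\<close>, where \<open>c\<^sup>*\<close> is
  a left dual of \<open>c\<close>. As \<open>c\<close> has both duals, tensoring with \<open>c\<close> preserves the end \<open>g\<close> of \<open>T\<close>, so that the arrows
  \<open>c \<otimes> g \<rightarrow> c \<otimes> T (c\<^sup>* \<bullet> m) (c\<^sup>* \<bullet> m) \<rightarrow> T (c\<^sup>* \<bullet> m) (c \<bullet> (c\<^sup>* \<bullet> m)) \<rightarrow> T (c\<^sup>* \<bullet> m) m \<rightarrow> T m m \<otimes> c\<close>
  induce an arrow \<open>c \<otimes> g \<rightarrow> g \<otimes> c\<close>. The laws of a half-braiding hold because they hold after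
  composition with the universal wedge, and the arrow built from \<open>\<delta>\<close> and an evaluation is inverse to this one.
  The coend is the case of the opposite categories, in which the left and the right duals are interchanged.

  The existence of ends is reduced to linear algebra: a finite linear category has a projective
  generator \<open>P\<close>, and the end of a left exact functor \<open>T\<close> is the joint equaliser of the arrows \<open>T P i\<close> and \<open>T i P\<close>,
  where \<open>i\<close> ranges over the endomorphisms of \<open>P\<close>.\<close>

section \<open>Monoidal categories and module categories in terms of whiskerings\<close>

text \<open>The formula for the half-braiding on the end gives an arrow \<open>g c -> c g\<close>
  through the right dual of c, and nothing in it exhibits an inverse. The arrow in the opposite
  direction is therefore constructed independently, through the left dual: it comes from the counit
  of the adjunction between acting with c and acting with its left dual, and the two triangle
  identities show that any arrow with the components \<open>\<beta>_comp\<close> inverts it. What is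
  left is a comparison of the two duals: the coevaluation of the left dual is recovered from the
  evaluation of the right one (\<open>cv_eq\<close>). For a coend the given formula produces the
  half-braiding itself and not its inverse. Read in the opposite category it is an inverse of the
  arrow constructed there, so the laws have to be transferred to inverses. In the part on existence
  the endomorphisms of P form an infinite family in general. Finite dimension enters through a joint
  kernel of largest possible dimension, which replaces any choice of finitely many of them. That
  free modules are sums of copies of P is expressed by writing their identity as a sum of arrows
  factoring through P.\<close>

definition iso_pair :: "('o, 'a, 'z) cat_scheme \<Rightarrow> 'a \<Rightarrow> 'a \<Rightarrow> 'o \<Rightarrow> 'o \<Rightarrow> bool" where
  "iso_pair C f f' x y \<longleftrightarrow> x \<in> ob C \<and> y \<in> ob C \<and> f \<in> Hom C x y \<and> f' \<in> Hom C y x \<and>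
     f' \<cdot>\<^bsub>C\<^esub> f = idt C x \<and> f \<cdot>\<^bsub>C\<^esub> f' = idt C y"

lemma Hom_iff: "f \<in> Hom C x y \<longleftrightarrow> f \<in> arr C \<and> src C f = x \<and> trg C f = y"
  by (simp add: Hom_def)

context category
begin

lemma arr_comp [simp]: "f \<in> arr C \<Longrightarrow> g \<in> arr C \<Longrightarrow> src C g = trg C f \<Longrightarrow> g \<cdot> f \<in> arr C"
  and src_comp [simp]: "f \<in> arr C \<Longrightarrow> g \<in> arr C \<Longrightarrow> src C g = trg C f \<Longrightarrow> src C (g \<cdot> f) = src C f"
  and trg_comp [simp]: "f \<in> arr C \<Longrightarrow> g \<in> arr C \<Longrightarrow> src C g = trg C f \<Longrightarrow> trg C (g \<cdot> f) = trg C g"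
  using comp_hom[of f "src C f" "trg C f" g "trg C g"] by (simp_all add: Hom_iff)

lemma arr_idt [simp]: "x \<in> ob C \<Longrightarrow> idt C x \<in> arr C"
  and src_idt [simp]: "x \<in> ob C \<Longrightarrow> src C (idt C x) = x"
  and trg_idt [simp]: "x \<in> ob C \<Longrightarrow> trg C (idt C x) = x"
  using idt_hom[of x] by (simp_all add: Hom_iff)

lemma idt_right [simp]: "f \<in> arr C \<Longrightarrow> src C f = x \<Longrightarrow> f \<cdot> idt C x = f"
  and idt_left [simp]: "f \<in> arr C \<Longrightarrow> trg C f = x \<Longrightarrow> idt C x \<cdot> f = f"
  using comp_idt_right[of f "src C f"] comp_idt_left[of f _ "trg C f"] by (auto simp: Hom_iff)

lemma comp_assoc' [simp]: "f \<in> arr C \<Longrightarrow> g \<in> arr C \<Longrightarrow> h \<in> arr C \<Longrightarrow> src C g = trg C f \<Longrightarrow>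
    src C h = trg C g \<Longrightarrow> (h \<cdot> g) \<cdot> f = h \<cdot> (g \<cdot> f)"
  using comp_assoc[of f "src C f" "trg C f" g "trg C g" h "trg C h"] by (simp add: Hom_iff)

text \<open>Composites are normalised to right-nested form, where an equation between two factors
  matches only at the end. The instances \<open>comp_tail[OF eq]\<close> extend it to a rewrite rule
  that also applies in the middle of a composite, and \<open>comp_tail3\<close> does the same for
  three factors.\<close>

lemma comp_tail: "g \<cdot> f = k \<Longrightarrow> f \<in> arr C \<Longrightarrow> g \<in> arr C \<Longrightarrow> z \<in> arr C \<Longrightarrow> src C g = trg C f \<Longrightarrow>
    src C f = trg C z \<Longrightarrow> g \<cdot> (f \<cdot> z) = k \<cdot> z"
  using comp_assoc'[of z f g] by simp

lemma comp_tail3: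
  assumes "h \<cdot> (g \<cdot> f) = k" "f \<in> arr C" "g \<in> arr C" "h \<in> arr C" "z \<in> arr C"
    "src C h = trg C g" "src C g = trg C f" "src C f = trg C z"
  shows "h \<cdot> (g \<cdot> (f \<cdot> z)) = k \<cdot> z"
  unfolding assms(1)[symmetric] using assms(2-) by simp

lemma src_ob' [simp]: "f \<in> arr C \<Longrightarrow> src C f \<in> ob C"
  and trg_ob' [simp]: "f \<in> arr C \<Longrightarrow> trg C f \<in> ob C"
  using src_ob trg_ob by simp_all

lemma iso_pairD:
  assumes "iso_pair C f f' x y"
  shows "f \<in> arr C" "src C f = x" "trg C f = y" "f' \<in> arr C" "src C f' = y" "trg C f' = x"
    "f' \<cdot> f = idt C x" "f \<cdot> f' = idt C y"
  using assms by (auto simp: iso_pair_def Hom_iff)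

lemma iso_pairD_tail:
  assumes "iso_pair C f f' x y" "z \<in> arr C"
  shows "trg C z = x \<Longrightarrow> f' \<cdot> (f \<cdot> z) = z" "trg C z = y \<Longrightarrow> f \<cdot> (f' \<cdot> z) = z"
  using assms(2) iso_pairD[OF assms(1)] comp_tail[OF iso_pairD(7)[OF assms(1)]]
    comp_tail[OF iso_pairD(8)[OF assms(1)]] by simp_all

lemma iso_pair_sym: "iso_pair C f f' x y \<Longrightarrow> iso_pair C f' f y x"
  by (auto simp: iso_pair_def)

lemma iso_pair_comp:
  assumes "iso_pair C f f' x y" "iso_pair C g g' y z"
  shows "iso_pair C (g \<cdot> f) (f' \<cdot> g') x z"
proof -
  have "x \<in> ob C" "z \<in> ob C" using assms by (auto simp: iso_pair_def)
  then show ?thesis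
    by (simp add: iso_pair_def Hom_iff iso_pairD[OF assms(1)] iso_pairD[OF assms(2)]
      iso_pairD_tail[OF assms(1)] iso_pairD_tail[OF assms(2)])
qed

text \<open>Solves a commuting square with two invertible sides for their inverses. The naturality
  of the inverse constraints is obtained from that of the constraints in this way.\<close>

lemma iso_pair_square:
  assumes "iso_pair C f f' x y" "iso_pair C h h' u w"
    and "p \<in> arr C" "src C p = u" "trg C p = x" "q \<in> arr C" "src C q = w" "trg C q = y"
    and "f \<cdot> p = q \<cdot> h"
  shows "f' \<cdot> q = p \<cdot> h'"
proof -
  note [simp] = iso_pairD[OF assms(1)] iso_pairD[OF assms(2)] iso_pairD_tail[OF assms(1)]
    iso_pairD_tail[OF assms(2)]
  have "f' \<cdot> q = f' \<cdot> ((q \<cdot> h) \<cdot> h')" using assms(3-8) by simp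
  also have "\<dots> = p \<cdot> h'" unfolding assms(9)[symmetric] using assms(3-8) by simp
  finally show ?thesis .
qed

lemma iso_epi:
  assumes "iso_pair C h h' x y" "f \<cdot> h = g \<cdot> h"
    and "f \<in> arr C" "g \<in> arr C" "src C f = y" "src C g = y"
  shows "f = g"
proof -
  have "f = (f \<cdot> h) \<cdot> h'" "g = (g \<cdot> h) \<cdot> h'" using assms(3-) by (simp_all add: iso_pairD[OF assms(1)])
  then show ?thesis unfolding assms(2) by simp
qed

lemma iso_mono:
  assumes "iso_pair C h h' x y" "h \<cdot> f = h \<cdot> g"
    and "f \<in> arr C" "g \<in> arr C" "trg C f = x" "trg C g = x"
  shows "f = g"
proof -
  have "f = h' \<cdot> (h \<cdot> f)" "g = h' \<cdot> (h \<cdot> g)" using assms(3-) by (simp_all add: iso_pairD_tail[OF assms(1)])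
  then show ?thesis unfolding assms(2) by simp
qed

lemma iso_pair_inverse_arrows:
  "iso_pair C f f' x y \<longleftrightarrow> f \<in> Hom C x y \<and> inverse_arrows C f f'"
  by (auto simp: iso_pair_def inverse_arrows_def Hom_iff)

lemma inverse_arrows_unique:
  assumes "inverse_arrows C f g" "inverse_arrows C f h"
  shows "g = h"
proof -
  have *: "f \<in> arr C" "g \<in> arr C" "src C g = trg C f" "trg C g = src C f" "g \<cdot> f = idt C (src C f)"
    "h \<in> arr C" "src C h = trg C f" "trg C h = src C f" "f \<cdot> h = idt C (trg C f)"
    using assms by (auto simp: inverse_arrows_def Hom_iff)
  show ?thesis
    using comp_assoc'[of h f g] * by simp
qed

text \<open>Inverses are carried along as the second argument of \<open>iso_pair\<close>, so that
  the inverse of a long composite is built together with it. This lemma leads back to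
  \<open>inv_arr\<close>; applied to two inverse pairs with the same first arrow it also proves
  equations between their inverses.\<close>

lemma inv_arr_eq: "iso_pair C f f' x y \<Longrightarrow> inv_arr C f = f'"
  unfolding inv_arr_def iso_pair_inverse_arrows by (blast intro: inverse_arrows_unique)

lemma iso_pair_inv_arr:
  assumes "is_iso C f" "f \<in> Hom C x y"
  shows "iso_pair C f (inv_arr C f) x y"
proof -
  obtain g where "inverse_arrows C f g" using assms(1) by (auto simp: is_iso_def)
  then have "iso_pair C f g x y" using assms(2) by (simp add: iso_pair_inverse_arrows)
  then show ?thesis using inv_arr_eq by simp
qed

lemma iso_pair_is_iso: "iso_pair C f f' x y \<Longrightarrow> is_iso C f"
  by (auto simp: iso_pair_inverse_arrows is_iso_def)

end

lemma category_arrI: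
  assumes "\<And>f. f \<in> arr C \<Longrightarrow> src C f \<in> ob C" "\<And>f. f \<in> arr C \<Longrightarrow> trg C f \<in> ob C"
    and "\<And>x. x \<in> ob C \<Longrightarrow> idt C x \<in> arr C \<and> src C (idt C x) = x \<and> trg C (idt C x) = x"
    and "\<And>f g. f \<in> arr C \<Longrightarrow> g \<in> arr C \<Longrightarrow> src C g = trg C f \<Longrightarrow>
      comp C g f \<in> arr C \<and> src C (comp C g f) = src C f \<and> trg C (comp C g f) = trg C g"
    and "\<And>f g h. f \<in> arr C \<Longrightarrow> g \<in> arr C \<Longrightarrow> h \<in> arr C \<Longrightarrow> src C g = trg C f \<Longrightarrow> src C h = trg C g \<Longrightarrow>
      comp C (comp C h g) f = comp C h (comp C g f)"
    and "\<And>f. f \<in> arr C \<Longrightarrow> comp C f (idt C (src C f)) = f \<and> comp C (idt C (trg C f)) f = f"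
  shows "category C"
  by unfold_locales (use assms in \<open>auto simp: Hom_iff\<close>)

text \<open>The inverses of the constraints are fields of the record, and whiskerings replace the tensor
  product of two arrows, so that passing to opposite categories is a mere exchange of fields.\<close>

record ('o, 'a) mcat = "('o, 'a) cat" +
  tob :: "'o \<Rightarrow> 'o \<Rightarrow> 'o"
  lwh :: "'o \<Rightarrow> 'a \<Rightarrow> 'a"
  rwh :: "'a \<Rightarrow> 'o \<Rightarrow> 'a"
  uob :: 'o
  asc :: "'o \<Rightarrow> 'o \<Rightarrow> 'o \<Rightarrow> 'a"
  asc' :: "'o \<Rightarrow> 'o \<Rightarrow> 'o \<Rightarrow> 'a"
  lun :: "'o \<Rightarrow> 'a"
  lun' :: "'o \<Rightarrow> 'a"
  run :: "'o \<Rightarrow> 'a"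
  run' :: "'o \<Rightarrow> 'a"

text \<open>Bifunctoriality of the tensor product is split into functoriality of the two whiskerings
  and \<open>interchange\<close>; likewise the naturality of the associator is split into one law
  for each variable.\<close>

locale monoidal = category C for C :: "('o, 'a) mcat" (structure) +
  assumes tob_ob [simp]: "x \<in> ob C \<Longrightarrow> y \<in> ob C \<Longrightarrow> tob C x y \<in> ob C"
    and uob_ob [simp]: "uob C \<in> ob C"
    and lwh_arr [simp]: "x \<in> ob C \<Longrightarrow> f \<in> arr C \<Longrightarrow> lwh C x f \<in> arr C"
    and lwh_src [simp]: "x \<in> ob C \<Longrightarrow> f \<in> arr C \<Longrightarrow> src C (lwh C x f) = tob C x (src C f)"
    and lwh_trg [simp]: "x \<in> ob C \<Longrightarrow> f \<in> arr C \<Longrightarrow> trg C (lwh C x f) = tob C x (trg C f)"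
    and lwh_idt [simp]: "x \<in> ob C \<Longrightarrow> y \<in> ob C \<Longrightarrow> lwh C x (idt C y) = idt C (tob C x y)"
    and lwh_comp [simp]: "x \<in> ob C \<Longrightarrow> f \<in> arr C \<Longrightarrow> g \<in> arr C \<Longrightarrow> src C g = trg C f \<Longrightarrow>
      lwh C x (g \<cdot> f) = lwh C x g \<cdot> lwh C x f"
    and rwh_arr [simp]: "x \<in> ob C \<Longrightarrow> f \<in> arr C \<Longrightarrow> rwh C f x \<in> arr C"
    and rwh_src [simp]: "x \<in> ob C \<Longrightarrow> f \<in> arr C \<Longrightarrow> src C (rwh C f x) = tob C (src C f) x"
    and rwh_trg [simp]: "x \<in> ob C \<Longrightarrow> f \<in> arr C \<Longrightarrow> trg C (rwh C f x) = tob C (trg C f) x"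
    and rwh_idt [simp]: "x \<in> ob C \<Longrightarrow> y \<in> ob C \<Longrightarrow> rwh C (idt C y) x = idt C (tob C y x)"
    and rwh_comp [simp]: "x \<in> ob C \<Longrightarrow> f \<in> arr C \<Longrightarrow> g \<in> arr C \<Longrightarrow> src C g = trg C f \<Longrightarrow>
      rwh C (g \<cdot> f) x = rwh C g x \<cdot> rwh C f x"
    and interchange: "f \<in> arr C \<Longrightarrow> g \<in> arr C \<Longrightarrow>
      rwh C f (trg C g) \<cdot> lwh C (src C f) g = lwh C (trg C f) g \<cdot> rwh C f (src C g)"
    and asc_iso: "x \<in> ob C \<Longrightarrow> y \<in> ob C \<Longrightarrow> z \<in> ob C \<Longrightarrow>
      iso_pair C (asc C x y z) (asc' C x y z) (tob C (tob C x y) z) (tob C x (tob C y z))"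
    and lun_iso: "x \<in> ob C \<Longrightarrow> iso_pair C (lun C x) (lun' C x) (tob C (uob C) x) x"
    and run_iso: "x \<in> ob C \<Longrightarrow> iso_pair C (run C x) (run' C x) (tob C x (uob C)) x"
    and asc_nat1: "f \<in> arr C \<Longrightarrow> y \<in> ob C \<Longrightarrow> z \<in> ob C \<Longrightarrow>
      asc C (trg C f) y z \<cdot> rwh C (rwh C f y) z = rwh C f (tob C y z) \<cdot> asc C (src C f) y z"
    and asc_nat2: "f \<in> arr C \<Longrightarrow> x \<in> ob C \<Longrightarrow> z \<in> ob C \<Longrightarrow>
      asc C x (trg C f) z \<cdot> rwh C (lwh C x f) z = lwh C x (rwh C f z) \<cdot> asc C x (src C f) z"
    and asc_nat3: "f \<in> arr C \<Longrightarrow> x \<in> ob C \<Longrightarrow> y \<in> ob C \<Longrightarrow>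
      asc C x y (trg C f) \<cdot> lwh C (tob C x y) f = lwh C x (lwh C y f) \<cdot> asc C x y (src C f)"
    and lun_nat: "f \<in> arr C \<Longrightarrow> lun C (trg C f) \<cdot> lwh C (uob C) f = f \<cdot> lun C (src C f)"
    and run_nat: "f \<in> arr C \<Longrightarrow> run C (trg C f) \<cdot> rwh C f (uob C) = f \<cdot> run C (src C f)"
    and pentagon: "w \<in> ob C \<Longrightarrow> x \<in> ob C \<Longrightarrow> y \<in> ob C \<Longrightarrow> z \<in> ob C \<Longrightarrow>
      lwh C w (asc C x y z) \<cdot> asc C w (tob C x y) z \<cdot> rwh C (asc C w x y) z =
      asc C w x (tob C y z) \<cdot> asc C (tob C w x) y z"
    and triangle: "x \<in> ob C \<Longrightarrow> y \<in> ob C \<Longrightarrow>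
      lwh C x (lun C y) \<cdot> asc C x (uob C) y = rwh C (run C x) y"

text \<open>Arrows are reversed and the order of the tensor factors is kept; right and left duals
  are interchanged by this, and evaluations become coevaluations.\<close>

definition mdual :: "('o, 'a) mcat \<Rightarrow> ('o, 'a) mcat" where
  "mdual C = C\<lparr>src := trg C, trg := src C, comp := \<lambda>g f. f \<cdot>\<^bsub>C\<^esub> g, asc := asc' C, asc' := asc C,
     lun := lun' C, lun' := lun C, run := run' C, run' := run C\<rparr>"

lemma mdual_simps [simp]:
  "ob (mdual C) = ob C" "arr (mdual C) = arr C" "src (mdual C) = trg C" "trg (mdual C) = src C"
  "idt (mdual C) = idt C" "g \<cdot>\<^bsub>mdual C\<^esub> f = f \<cdot>\<^bsub>C\<^esub> g" "tob (mdual C) = tob C" "lwh (mdual C) = lwh C"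
  "rwh (mdual C) = rwh C" "uob (mdual C) = uob C" "asc (mdual C) = asc' C" "asc' (mdual C) = asc C"
  "lun (mdual C) = lun' C" "lun' (mdual C) = lun C" "run (mdual C) = run' C" "run' (mdual C) = run C"
  by (simp_all add: mdual_def)

lemma iso_pair_mdual [simp]: "iso_pair (mdual C) f g x y \<longleftrightarrow> iso_pair C g f x y"
  by (auto simp: iso_pair_def Hom_iff)

text \<open>The order of the tensor factors is reversed and arrows keep their direction; right and
  left duals are interchanged, but evaluations remain evaluations.\<close>

definition mrev :: "('o, 'a) mcat \<Rightarrow> ('o, 'a) mcat" where
  "mrev C = C\<lparr>tob := \<lambda>x y. tob C y x, lwh := \<lambda>x f. rwh C f x, rwh := \<lambda>f x. lwh C x f,
     asc := \<lambda>x y z. asc' C z y x, asc' := \<lambda>x y z. asc C z y x,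
     lun := run C, lun' := run' C, run := lun C, run' := lun' C\<rparr>"

lemma mrev_simps [simp]:
  "ob (mrev C) = ob C" "arr (mrev C) = arr C" "src (mrev C) = src C" "trg (mrev C) = trg C"
  "idt (mrev C) = idt C" "comp (mrev C) = comp C" "tob (mrev C) x y = tob C y x"
  "lwh (mrev C) x f = rwh C f x" "rwh (mrev C) f x = lwh C x f" "uob (mrev C) = uob C"
  "asc (mrev C) x y z = asc' C z y x" "asc' (mrev C) x y z = asc C z y x"
  "lun (mrev C) = run C" "lun' (mrev C) = run' C" "run (mrev C) = lun C" "run' (mrev C) = lun' C"
  by (simp_all add: mrev_def)

lemma iso_pair_mrev [simp]: "iso_pair (mrev C) f g x y \<longleftrightarrow> iso_pair C f g x y"
  by (auto simp: iso_pair_def Hom_iff)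

context monoidal
begin

abbreviation tob_syntax (infixr "\<sqdot>" 70) where "x \<sqdot> y \<equiv> tob C x y"
abbreviation lwh_syntax (infixr "\<triangleright>" 70) where "x \<triangleright> f \<equiv> lwh C x f"
abbreviation rwh_syntax (infixl "\<triangleleft>" 70) where "f \<triangleleft> x \<equiv> rwh C f x"
abbreviation \<I> where "\<I> \<equiv> uob C"
abbreviation \<a> where "\<a> \<equiv> asc C"
abbreviation \<b> where "\<b> \<equiv> asc' C"
abbreviation \<l> where "\<l> \<equiv> lun C"
abbreviation \<l>' where "\<l>' \<equiv> lun' C"
abbreviation \<r> where "\<r> \<equiv> run C"
abbreviation \<r>' where "\<r>' \<equiv> run' C"

lemmas asc_simps [simp] = iso_pairD[OF asc_iso] iso_pairD_tail[OF asc_iso]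
lemmas lun_simps [simp] = iso_pairD[OF lun_iso] iso_pairD_tail[OF lun_iso]
lemmas run_simps [simp] = iso_pairD[OF run_iso] iso_pairD_tail[OF run_iso]

lemma lwh_iso: "iso_pair C f f' y z \<Longrightarrow> x \<in> ob C \<Longrightarrow> iso_pair C (x \<triangleright> f) (x \<triangleright> f') (x \<sqdot> y) (x \<sqdot> z)"
  by (auto simp: iso_pair_def Hom_iff simp flip: lwh_comp)

lemma rwh_iso: "iso_pair C f f' y z \<Longrightarrow> x \<in> ob C \<Longrightarrow> iso_pair C (f \<triangleleft> x) (f' \<triangleleft> x) (y \<sqdot> x) (z \<sqdot> x)"
  by (auto simp: iso_pair_def Hom_iff simp flip: rwh_comp)

lemmas lwh_asc_simps [simp] = iso_pairD(7,8)[OF lwh_iso[OF asc_iso]] iso_pairD_tail[OF lwh_iso[OF asc_iso]]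
lemmas rwh_asc_simps [simp] = iso_pairD(7,8)[OF rwh_iso[OF asc_iso]] iso_pairD_tail[OF rwh_iso[OF asc_iso]]
lemmas lwh_lun_simps [simp] = iso_pairD(7,8)[OF lwh_iso[OF lun_iso]] iso_pairD_tail[OF lwh_iso[OF lun_iso]]
lemmas rwh_lun_simps [simp] = iso_pairD(7,8)[OF rwh_iso[OF lun_iso]] iso_pairD_tail[OF rwh_iso[OF lun_iso]]
lemmas lwh_run_simps [simp] = iso_pairD(7,8)[OF lwh_iso[OF run_iso]] iso_pairD_tail[OF lwh_iso[OF run_iso]]
lemmas rwh_run_simps [simp] = iso_pairD(7,8)[OF rwh_iso[OF run_iso]] iso_pairD_tail[OF rwh_iso[OF run_iso]]

lemma asc'_nat1: "f \<in> arr C \<Longrightarrow> y \<in> ob C \<Longrightarrow> z \<in> ob C \<Longrightarrow>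
    \<b> (trg C f) y z \<cdot> f \<triangleleft> (y \<sqdot> z) = f \<triangleleft> y \<triangleleft> z \<cdot> \<b> (src C f) y z"
  by (rule iso_pair_square[OF asc_iso asc_iso]) (simp_all add: asc_nat1)

lemma asc'_nat2: "f \<in> arr C \<Longrightarrow> x \<in> ob C \<Longrightarrow> z \<in> ob C \<Longrightarrow>
    \<b> x (trg C f) z \<cdot> x \<triangleright> (f \<triangleleft> z) = (x \<triangleright> f) \<triangleleft> z \<cdot> \<b> x (src C f) z"
  by (rule iso_pair_square[OF asc_iso asc_iso]) (simp_all add: asc_nat2)

lemma asc'_nat3: "f \<in> arr C \<Longrightarrow> x \<in> ob C \<Longrightarrow> y \<in> ob C \<Longrightarrow>
    \<b> x y (trg C f) \<cdot> x \<triangleright> (y \<triangleright> f) = (x \<sqdot> y) \<triangleright> f \<cdot> \<b> x y (src C f)"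
  by (rule iso_pair_square[OF asc_iso asc_iso]) (simp_all add: asc_nat3)

lemma lun'_nat: "f \<in> arr C \<Longrightarrow> \<l>' (trg C f) \<cdot> f = \<I> \<triangleright> f \<cdot> \<l>' (src C f)"
  by (rule iso_pair_square[OF lun_iso lun_iso]) (simp_all add: lun_nat)

lemma run'_nat: "f \<in> arr C \<Longrightarrow> \<r>' (trg C f) \<cdot> f = f \<triangleleft> \<I> \<cdot> \<r>' (src C f)"
  by (rule iso_pair_square[OF run_iso run_iso]) (simp_all add: run_nat)

text \<open>Each side is the inverse of one side of the pentagon, and inverses are unique. The same
  argument gives \<open>triangle'\<close> and the corresponding laws for modules.\<close>

lemma pentagon': "w \<in> ob C \<Longrightarrow> x \<in> ob C \<Longrightarrow> y \<in> ob C \<Longrightarrow> z \<in> ob C \<Longrightarrow>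
    \<b> w x y \<triangleleft> z \<cdot> \<b> w (x \<sqdot> y) z \<cdot> w \<triangleright> \<b> x y z = \<b> (w \<sqdot> x) y z \<cdot> \<b> w x (y \<sqdot> z)"
proof -
  assume o [simp]: "w \<in> ob C" "x \<in> ob C" "y \<in> ob C" "z \<in> ob C"
  let ?p = "w \<triangleright> \<a> x y z \<cdot> \<a> w (x \<sqdot> y) z \<cdot> \<a> w x y \<triangleleft> z"
  have 1: "iso_pair C ?p ((\<b> w x y \<triangleleft> z \<cdot> \<b> w (x \<sqdot> y) z) \<cdot> w \<triangleright> \<b> x y z)
      (((w \<sqdot> x) \<sqdot> y) \<sqdot> z) (w \<sqdot> (x \<sqdot> (y \<sqdot> z)))"
    by (rule iso_pair_comp[OF iso_pair_comp[OF rwh_iso[OF asc_iso] asc_iso] lwh_iso[OF asc_iso]]) simp_all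
  have 2: "iso_pair C ?p (\<b> (w \<sqdot> x) y z \<cdot> \<b> w x (y \<sqdot> z)) (((w \<sqdot> x) \<sqdot> y) \<sqdot> z) (w \<sqdot> (x \<sqdot> (y \<sqdot> z)))"
    unfolding pentagon[OF o] by (rule iso_pair_comp[OF asc_iso asc_iso]) simp_all
  show ?thesis using inv_arr_eq[OF 1] inv_arr_eq[OF 2] by simp
qed

lemma triangle': "x \<in> ob C \<Longrightarrow> y \<in> ob C \<Longrightarrow> \<b> x \<I> y \<cdot> x \<triangleright> \<l>' y = \<r>' x \<triangleleft> y"
proof -
  assume o [simp]: "x \<in> ob C" "y \<in> ob C"
  have 1: "iso_pair C (\<r> x \<triangleleft> y) (\<b> x \<I> y \<cdot> x \<triangleright> \<l>' y) ((x \<sqdot> \<I>) \<sqdot> y) (x \<sqdot> y)"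
    unfolding triangle[OF o, symmetric] by (rule iso_pair_comp[OF asc_iso lwh_iso[OF lun_iso]]) simp_all
  show ?thesis using inv_arr_eq[OF 1] inv_arr_eq[OF rwh_iso[OF run_iso]] by simp
qed

lemma monoidal_mdual: "monoidal (mdual C)"
proof -
  interpret d: category "mdual C" by (rule category_arrI) auto
  show ?thesis
    by unfold_locales
      (simp_all add: asc_iso iso_pair_sym lun_iso run_iso interchange asc'_nat1 asc'_nat2 asc'_nat3
        lun'_nat run'_nat pentagon' triangle')
qed

lemma monoidal_mrev: "monoidal (mrev C)"
proof -
  interpret d: category "mrev C" by (rule category_arrI) auto
  \<comment> \<open>The reversed product exchanges \<l> and \<r> and inverts the associator, so its
    triangle law is the given one with the associator moved to the other side.\<close>
  have t: "\<r> x \<triangleleft> y \<cdot> \<b> x \<I> y = x \<triangleright> \<l> y" if "x \<in> ob C" "y \<in> ob C" for x y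
    using that by (simp flip: triangle)
  show ?thesis
    by unfold_locales
      (simp_all add: asc_iso iso_pair_sym lun_iso run_iso interchange asc'_nat1 asc'_nat2 asc'_nat3
        lun_nat run_nat pentagon' t)
qed

end

section \<open>Module categories in terms of one-variable actions\<close>

record ('m, 'n, 'o, 'a) mdcat = "('m, 'n) cat" +
  aob :: "'o \<Rightarrow> 'm \<Rightarrow> 'm"
  lac :: "'o \<Rightarrow> 'n \<Rightarrow> 'n"
  rac :: "'a \<Rightarrow> 'm \<Rightarrow> 'n"
  mas :: "'o \<Rightarrow> 'o \<Rightarrow> 'm \<Rightarrow> 'n"
  mas' :: "'o \<Rightarrow> 'o \<Rightarrow> 'm \<Rightarrow> 'n"
  mun :: "'m \<Rightarrow> 'n"
  mun' :: "'m \<Rightarrow> 'n"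

locale left_module = monoidal C + N: category N
  for C :: "('o, 'a) mcat" (structure) and N :: "('m, 'n, 'o, 'a) mdcat" +
  assumes aob_ob [simp]: "c \<in> ob C \<Longrightarrow> m \<in> ob N \<Longrightarrow> aob N c m \<in> ob N"
    and lac_arr [simp]: "c \<in> ob C \<Longrightarrow> g \<in> arr N \<Longrightarrow> lac N c g \<in> arr N"
    and lac_src [simp]: "c \<in> ob C \<Longrightarrow> g \<in> arr N \<Longrightarrow> src N (lac N c g) = aob N c (src N g)"
    and lac_trg [simp]: "c \<in> ob C \<Longrightarrow> g \<in> arr N \<Longrightarrow> trg N (lac N c g) = aob N c (trg N g)"
    and lac_idt [simp]: "c \<in> ob C \<Longrightarrow> m \<in> ob N \<Longrightarrow> lac N c (idt N m) = idt N (aob N c m)"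
    and lac_comp [simp]: "c \<in> ob C \<Longrightarrow> g \<in> arr N \<Longrightarrow> h \<in> arr N \<Longrightarrow> src N h = trg N g \<Longrightarrow>
      lac N c (h \<cdot>\<^bsub>N\<^esub> g) = lac N c h \<cdot>\<^bsub>N\<^esub> lac N c g"
    and rac_arr [simp]: "f \<in> arr C \<Longrightarrow> m \<in> ob N \<Longrightarrow> rac N f m \<in> arr N"
    and rac_src [simp]: "f \<in> arr C \<Longrightarrow> m \<in> ob N \<Longrightarrow> src N (rac N f m) = aob N (src C f) m"
    and rac_trg [simp]: "f \<in> arr C \<Longrightarrow> m \<in> ob N \<Longrightarrow> trg N (rac N f m) = aob N (trg C f) m"
    and rac_idt [simp]: "c \<in> ob C \<Longrightarrow> m \<in> ob N \<Longrightarrow> rac N (idt C c) m = idt N (aob N c m)"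
    and rac_comp [simp]: "f \<in> arr C \<Longrightarrow> k \<in> arr C \<Longrightarrow> src C k = trg C f \<Longrightarrow> m \<in> ob N \<Longrightarrow>
      rac N (k \<cdot> f) m = rac N k m \<cdot>\<^bsub>N\<^esub> rac N f m"
    and minterchange: "f \<in> arr C \<Longrightarrow> g \<in> arr N \<Longrightarrow>
      rac N f (trg N g) \<cdot>\<^bsub>N\<^esub> lac N (src C f) g = lac N (trg C f) g \<cdot>\<^bsub>N\<^esub> rac N f (src N g)"
    and mas_iso: "c \<in> ob C \<Longrightarrow> d \<in> ob C \<Longrightarrow> m \<in> ob N \<Longrightarrow>
      iso_pair N (mas N c d m) (mas' N c d m) (aob N (tob C c d) m) (aob N c (aob N d m))"
    and mun_iso: "m \<in> ob N \<Longrightarrow> iso_pair N (mun N m) (mun' N m) (aob N (uob C) m) m"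
    and mas_nat1: "f \<in> arr C \<Longrightarrow> d \<in> ob C \<Longrightarrow> m \<in> ob N \<Longrightarrow>
      mas N (trg C f) d m \<cdot>\<^bsub>N\<^esub> rac N (rwh C f d) m = rac N f (aob N d m) \<cdot>\<^bsub>N\<^esub> mas N (src C f) d m"
    and mas_nat2: "f \<in> arr C \<Longrightarrow> c \<in> ob C \<Longrightarrow> m \<in> ob N \<Longrightarrow>
      mas N c (trg C f) m \<cdot>\<^bsub>N\<^esub> rac N (lwh C c f) m = lac N c (rac N f m) \<cdot>\<^bsub>N\<^esub> mas N c (src C f) m"
    and mas_nat3: "g \<in> arr N \<Longrightarrow> c \<in> ob C \<Longrightarrow> d \<in> ob C \<Longrightarrow>
      mas N c d (trg N g) \<cdot>\<^bsub>N\<^esub> lac N (tob C c d) g = lac N c (lac N d g) \<cdot>\<^bsub>N\<^esub> mas N c d (src N g)"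
    and mun_nat: "g \<in> arr N \<Longrightarrow> mun N (trg N g) \<cdot>\<^bsub>N\<^esub> lac N (uob C) g = g \<cdot>\<^bsub>N\<^esub> mun N (src N g)"
    and mpentagon: "b \<in> ob C \<Longrightarrow> c \<in> ob C \<Longrightarrow> d \<in> ob C \<Longrightarrow> m \<in> ob N \<Longrightarrow>
      lac N b (mas N c d m) \<cdot>\<^bsub>N\<^esub> mas N b (tob C c d) m \<cdot>\<^bsub>N\<^esub> rac N (asc C b c d) m =
      mas N b c (aob N d m) \<cdot>\<^bsub>N\<^esub> mas N (tob C b c) d m"
    and mtriangle: "c \<in> ob C \<Longrightarrow> m \<in> ob N \<Longrightarrow>
      lac N c (mun N m) \<cdot>\<^bsub>N\<^esub> mas N c (uob C) m = rac N (run C c) m"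

definition mddual :: "('m, 'n, 'o, 'a) mdcat \<Rightarrow> ('m, 'n, 'o, 'a) mdcat" where
  "mddual N = N\<lparr>src := trg N, trg := src N, comp := \<lambda>g f. f \<cdot>\<^bsub>N\<^esub> g, mas := mas' N, mas' := mas N,
     mun := mun' N, mun' := mun N\<rparr>"

lemma mddual_simps [simp]:
  "ob (mddual N) = ob N" "arr (mddual N) = arr N" "src (mddual N) = trg N" "trg (mddual N) = src N"
  "idt (mddual N) = idt N" "g \<cdot>\<^bsub>mddual N\<^esub> f = f \<cdot>\<^bsub>N\<^esub> g" "aob (mddual N) = aob N" "lac (mddual N) = lac N"
  "rac (mddual N) = rac N" "mas (mddual N) = mas' N" "mas' (mddual N) = mas N"
  "mun (mddual N) = mun' N" "mun' (mddual N) = mun N"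
  by (simp_all add: mddual_def)

lemma iso_pair_mddual [simp]: "iso_pair (mddual N) f g x y \<longleftrightarrow> iso_pair N g f x y"
  by (auto simp: iso_pair_def Hom_iff)

text \<open>As a module over itself, the monoidal category inherits every statement about modules as
  a statement about tensoring on the left. The coherence of units and the calculus of mates below
  are obtained from the action of a dual pair in this way.\<close>

definition mreg :: "('o, 'a) mcat \<Rightarrow> ('o, 'a, 'o, 'a) mdcat" where
  "mreg C = \<lparr>ob = ob C, arr = arr C, src = src C, trg = trg C, idt = idt C, comp = comp C,
     aob = tob C, lac = lwh C, rac = rwh C, mas = asc C, mas' = asc' C, mun = lun C, mun' = lun' C\<rparr>"

lemma mreg_simps [simp]:
  "ob (mreg C) = ob C" "arr (mreg C) = arr C" "src (mreg C) = src C" "trg (mreg C) = trg C"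
  "idt (mreg C) = idt C" "comp (mreg C) = comp C" "aob (mreg C) = tob C" "lac (mreg C) = lwh C"
  "rac (mreg C) = rwh C" "mas (mreg C) = asc C" "mas' (mreg C) = asc' C"
  "mun (mreg C) = lun C" "mun' (mreg C) = lun' C"
  by (simp_all add: mreg_def)

lemma iso_pair_mreg [simp]: "iso_pair (mreg C) f g x y \<longleftrightarrow> iso_pair C f g x y"
  by (auto simp: iso_pair_def Hom_iff)

lemma (in monoidal) left_module_mreg: "left_module C (mreg C)"
proof -
  interpret r: category "mreg C" by (rule category_arrI) auto
  show ?thesis
    by unfold_locales
      (simp_all add: asc_iso lun_iso interchange asc_nat1 asc_nat2 asc_nat3 lun_nat pentagon triangle)
qed

text \<open>\<open>x\<close> is a right dual of \<open>y\<close>.\<close>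

definition duality :: "('o, 'a) mcat \<Rightarrow> 'o \<Rightarrow> 'o \<Rightarrow> 'a \<Rightarrow> 'a \<Rightarrow> bool" where
  "duality C x y ev cv \<longleftrightarrow> x \<in> ob C \<and> y \<in> ob C \<and>
     ev \<in> arr C \<and> src C ev = tob C x y \<and> trg C ev = uob C \<and>
     cv \<in> arr C \<and> src C cv = uob C \<and> trg C cv = tob C y x \<and>
     run C y \<cdot>\<^bsub>C\<^esub> lwh C y ev \<cdot>\<^bsub>C\<^esub> asc C y x y \<cdot>\<^bsub>C\<^esub> rwh C cv y = lun C y \<and>
     lun C x \<cdot>\<^bsub>C\<^esub> rwh C ev x \<cdot>\<^bsub>C\<^esub> asc' C x y x \<cdot>\<^bsub>C\<^esub> lwh C x cv = run C x"

lemma dualityD: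
  assumes "duality C x y ev cv"
  shows "x \<in> ob C" "y \<in> ob C" "ev \<in> arr C" "src C ev = tob C x y" "trg C ev = uob C"
    "cv \<in> arr C" "src C cv = uob C" "trg C cv = tob C y x"
  using assms by (auto simp: duality_def)

lemma
  assumes "duality C x y ev cv"
  shows duality_zigzag1:
      "run C y \<cdot>\<^bsub>C\<^esub> lwh C y ev \<cdot>\<^bsub>C\<^esub> asc C y x y \<cdot>\<^bsub>C\<^esub> rwh C cv y = lun C y"
    and duality_zigzag2:
      "lun C x \<cdot>\<^bsub>C\<^esub> rwh C ev x \<cdot>\<^bsub>C\<^esub> asc' C x y x \<cdot>\<^bsub>C\<^esub> lwh C x cv = run C x"
  using assms by (auto simp: duality_def)

lemma duality_mrev [simp]: "duality (mrev C) y x ev cv \<longleftrightarrow> duality C x y ev cv"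
  by (auto simp: duality_def)

text \<open>The two zigzag identities are exchanged. Since the unit constraints of
  \<open>mdual C\<close> are the inverse ones, each identity first has to be solved for an inverse
  unit constraint.\<close>

lemma (in monoidal) duality_mdual:
  assumes d: "duality C x y ev cv"
  shows "duality (mdual C) y x cv ev"
proof -
  note [simp] = dualityD[OF d]
  have "\<l> x \<cdot> (ev \<triangleleft> x \<cdot> \<b> x y x \<cdot> x \<triangleright> cv \<cdot> \<r>' x) = \<l> x \<cdot> \<l>' x"
    using comp_tail[OF duality_zigzag2[OF d], of "\<r>' x"] by simp
  then have "\<l>' x \<cdot> (\<l> x \<cdot> (ev \<triangleleft> x \<cdot> \<b> x y x \<cdot> x \<triangleright> cv \<cdot> \<r>' x)) = \<l>' x \<cdot> (\<l> x \<cdot> \<l>' x)" by simp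
  then have 1: "ev \<triangleleft> x \<cdot> \<b> x y x \<cdot> x \<triangleright> cv \<cdot> \<r>' x = \<l>' x" by simp
  have "\<r> y \<cdot> (y \<triangleright> ev \<cdot> \<a> y x y \<cdot> cv \<triangleleft> y \<cdot> \<l>' y) = \<r> y \<cdot> \<r>' y"
    using comp_tail[OF duality_zigzag1[OF d], of "\<l>' y"] by simp
  then have "\<r>' y \<cdot> (\<r> y \<cdot> (y \<triangleright> ev \<cdot> \<a> y x y \<cdot> cv \<triangleleft> y \<cdot> \<l>' y)) = \<r>' y \<cdot> (\<r> y \<cdot> \<r>' y)" by simp
  then have 2: "y \<triangleright> ev \<cdot> \<a> y x y \<cdot> cv \<triangleleft> y \<cdot> \<l>' y = \<r>' y" by simp
  show ?thesis using 1 2 by (simp add: duality_def)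
qed

context left_module
begin

abbreviation ncomp (infixr "\<circ>\<^sub>N" 60) where "g \<circ>\<^sub>N f \<equiv> g \<cdot>\<^bsub>N\<^esub> f"
abbreviation aob_syntax (infixr "\<bullet>" 68) where "c \<bullet> m \<equiv> aob N c m"
abbreviation lac_syntax (infixr "\<star>" 68) where "c \<star> g \<equiv> lac N c g"
abbreviation rac_syntax (infixr "\<diamondop>" 68) where "f \<diamondop> m \<equiv> rac N f m"
abbreviation \<p> where "\<p> \<equiv> mas N"
abbreviation \<q> where "\<q> \<equiv> mas' N"
abbreviation \<u> where "\<u> \<equiv> mun N"
abbreviation \<u>' where "\<u>' \<equiv> mun' N"

lemmas mas_simps [simp] = N.iso_pairD[OF mas_iso] N.iso_pairD_tail[OF mas_iso]
lemmas mun_simps [simp] = N.iso_pairD[OF mun_iso] N.iso_pairD_tail[OF mun_iso]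

lemma lac_iso: "iso_pair N g g' m n \<Longrightarrow> c \<in> ob C \<Longrightarrow> iso_pair N (c \<star> g) (c \<star> g') (c \<bullet> m) (c \<bullet> n)"
  by (auto simp: iso_pair_def Hom_iff simp flip: lac_comp)

lemma rac_iso: "iso_pair C f f' c d \<Longrightarrow> m \<in> ob N \<Longrightarrow> iso_pair N (f \<diamondop> m) (f' \<diamondop> m) (c \<bullet> m) (d \<bullet> m)"
  by (auto simp: iso_pair_def Hom_iff simp flip: rac_comp)

lemmas lac_mas_simps [simp] = N.iso_pairD(7,8)[OF lac_iso[OF mas_iso]] N.iso_pairD_tail[OF lac_iso[OF mas_iso]]
lemmas lac_mun_simps [simp] = N.iso_pairD(7,8)[OF lac_iso[OF mun_iso]] N.iso_pairD_tail[OF lac_iso[OF mun_iso]]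
lemmas rac_asc_simps [simp] = N.iso_pairD(7,8)[OF rac_iso[OF asc_iso]] N.iso_pairD_tail[OF rac_iso[OF asc_iso]]
lemmas rac_lun_simps [simp] = N.iso_pairD(7,8)[OF rac_iso[OF lun_iso]] N.iso_pairD_tail[OF rac_iso[OF lun_iso]]
lemmas rac_run_simps [simp] = N.iso_pairD(7,8)[OF rac_iso[OF run_iso]] N.iso_pairD_tail[OF rac_iso[OF run_iso]]

lemma mas'_nat1: "f \<in> arr C \<Longrightarrow> d \<in> ob C \<Longrightarrow> m \<in> ob N \<Longrightarrow>
    \<q> (trg C f) d m \<circ>\<^sub>N f \<diamondop> (d \<bullet> m) = (f \<triangleleft> d) \<diamondop> m \<circ>\<^sub>N \<q> (src C f) d m"
  by (rule N.iso_pair_square[OF mas_iso mas_iso]) (simp_all add: mas_nat1)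

lemma mas'_nat2: "f \<in> arr C \<Longrightarrow> c \<in> ob C \<Longrightarrow> m \<in> ob N \<Longrightarrow>
    \<q> c (trg C f) m \<circ>\<^sub>N c \<star> (f \<diamondop> m) = (c \<triangleright> f) \<diamondop> m \<circ>\<^sub>N \<q> c (src C f) m"
  by (rule N.iso_pair_square[OF mas_iso mas_iso]) (simp_all add: mas_nat2)

lemma mas'_nat3: "g \<in> arr N \<Longrightarrow> c \<in> ob C \<Longrightarrow> d \<in> ob C \<Longrightarrow>
    \<q> c d (trg N g) \<circ>\<^sub>N c \<star> (d \<star> g) = (c \<sqdot> d) \<star> g \<circ>\<^sub>N \<q> c d (src N g)"
  by (rule N.iso_pair_square[OF mas_iso mas_iso]) (simp_all add: mas_nat3)

lemma mun'_nat: "g \<in> arr N \<Longrightarrow> \<u>' (trg N g) \<circ>\<^sub>N g = \<I> \<star> g \<circ>\<^sub>N \<u>' (src N g)"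
  by (rule N.iso_pair_square[OF mun_iso mun_iso]) (simp_all add: mun_nat)

lemma mpentagon': "b \<in> ob C \<Longrightarrow> c \<in> ob C \<Longrightarrow> d \<in> ob C \<Longrightarrow> m \<in> ob N \<Longrightarrow>
    \<b> b c d \<diamondop> m \<circ>\<^sub>N \<q> b (c \<sqdot> d) m \<circ>\<^sub>N b \<star> \<q> c d m = \<q> (b \<sqdot> c) d m \<circ>\<^sub>N \<q> b c (d \<bullet> m)"
proof -
  assume o [simp]: "b \<in> ob C" "c \<in> ob C" "d \<in> ob C" "m \<in> ob N"
  let ?p = "b \<star> \<p> c d m \<circ>\<^sub>N \<p> b (c \<sqdot> d) m \<circ>\<^sub>N \<a> b c d \<diamondop> m"
  have 1: "iso_pair N ?p ((\<b> b c d \<diamondop> m \<circ>\<^sub>N \<q> b (c \<sqdot> d) m) \<circ>\<^sub>N b \<star> \<q> c d m)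
      (((b \<sqdot> c) \<sqdot> d) \<bullet> m) (b \<bullet> (c \<bullet> (d \<bullet> m)))"
    by (rule N.iso_pair_comp[OF N.iso_pair_comp[OF rac_iso[OF asc_iso] mas_iso] lac_iso[OF mas_iso]]) simp_all
  have 2: "iso_pair N ?p (\<q> (b \<sqdot> c) d m \<circ>\<^sub>N \<q> b c (d \<bullet> m)) (((b \<sqdot> c) \<sqdot> d) \<bullet> m) (b \<bullet> (c \<bullet> (d \<bullet> m)))"
    unfolding mpentagon[OF o] by (rule N.iso_pair_comp[OF mas_iso mas_iso]) simp_all
  show ?thesis using N.inv_arr_eq[OF 1] N.inv_arr_eq[OF 2] by simp
qed

text \<open>The pentagon with two constraints moved across; it lets an inverse associativity
  constraint pass a direct one, which is the situation when a counit meets a unit.\<close>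

lemma mpentagon_shift: "b \<in> ob C \<Longrightarrow> c \<in> ob C \<Longrightarrow> d \<in> ob C \<Longrightarrow> m \<in> ob N \<Longrightarrow>
    \<q> b c (d \<bullet> m) \<circ>\<^sub>N b \<star> \<p> c d m = \<p> (b \<sqdot> c) d m \<circ>\<^sub>N \<b> b c d \<diamondop> m \<circ>\<^sub>N \<q> b (c \<sqdot> d) m"
  by (rule N.iso_pair_square[OF mas_iso N.iso_pair_comp[OF rac_iso[OF asc_iso] mas_iso]])
    (simp_all add: mpentagon)

lemma mtriangle': "c \<in> ob C \<Longrightarrow> m \<in> ob N \<Longrightarrow> \<q> c \<I> m \<circ>\<^sub>N c \<star> \<u>' m = \<r>' c \<diamondop> m"
proof -
  assume o [simp]: "c \<in> ob C" "m \<in> ob N"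
  have 1: "iso_pair N (\<r> c \<diamondop> m) (\<q> c \<I> m \<circ>\<^sub>N c \<star> \<u>' m) ((c \<sqdot> \<I>) \<bullet> m) (c \<bullet> m)"
    unfolding mtriangle[OF o, symmetric] by (rule N.iso_pair_comp[OF mas_iso lac_iso[OF mun_iso]]) simp_all
  show ?thesis using N.inv_arr_eq[OF 1] N.inv_arr_eq[OF rac_iso[OF run_iso]] by simp
qed

lemma left_module_dual: "left_module (mdual C) (mddual N)"
proof -
  interpret d: monoidal "mdual C" by (rule monoidal_mdual)
  interpret n: category "mddual N" by (rule category_arrI) auto
  show ?thesis
    by unfold_locales
      (simp_all add: mas_iso N.iso_pair_sym mun_iso minterchange mas'_nat1 mas'_nat2 mas'_nat3
        mun'_nat mpentagon' mtriangle')
qed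

text \<open>The unit constraint is a natural isomorphism from the action of \<I> to the identity
  functor, and a functor isomorphic to the identity is faithful.\<close>

lemma unit_faithful:
  assumes "g \<in> arr N" "h \<in> arr N" "src N g = src N h" "trg N g = trg N h" "\<I> \<star> g = \<I> \<star> h"
  shows "g = h"
proof -
  have "g = (g \<circ>\<^sub>N \<u> (src N g)) \<circ>\<^sub>N \<u>' (src N g)" using assms by simp
  also have "\<dots> = (h \<circ>\<^sub>N \<u> (src N h)) \<circ>\<^sub>N \<u>' (src N h)"
    using mun_nat[of g] mun_nat[of h] assms by simp
  also have "\<dots> = h" using assms by simp
  finally show ?thesis .
qed

text \<open>Kelly's redundancy of the second unit law.\<close>

lemma mtriangle_left:
  assumes [simp]: "c \<in> ob C" "m \<in> ob N"
  shows "\<u> (c \<bullet> m) \<circ>\<^sub>N \<p> \<I> c m = \<l> c \<diamondop> m"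
proof -
  have 1: "\<I> \<star> \<u> (c \<bullet> m) \<circ>\<^sub>N \<p> \<I> \<I> (c \<bullet> m) = \<r> \<I> \<diamondop> (c \<bullet> m)"
    by (rule mtriangle) simp_all
  have 2: "\<r> \<I> \<diamondop> (c \<bullet> m) \<circ>\<^sub>N \<p> (\<I> \<sqdot> \<I>) c m = \<p> \<I> c m \<circ>\<^sub>N (\<r> \<I> \<triangleleft> c) \<diamondop> m"
    using mas_nat1[of "\<r> \<I>" c m] by simp
  have 3: "\<p> \<I> c m \<circ>\<^sub>N (\<I> \<triangleright> \<l> c) \<diamondop> m = \<I> \<star> (\<l> c \<diamondop> m) \<circ>\<^sub>N \<p> \<I> (\<I> \<sqdot> c) m"
    using mas_nat2[of "\<l> c" \<I> m] by simp
  have 4: "(\<I> \<triangleright> \<l> c) \<diamondop> m \<circ>\<^sub>N \<a> \<I> \<I> c \<diamondop> m = (\<r> \<I> \<triangleleft> c) \<diamondop> m"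
    using rac_comp[of "\<a> \<I> \<I> c" "\<I> \<triangleright> \<l> c" m] by (simp add: triangle del: rac_comp)
  \<comment> \<open>After acting with \<I> and precomposing with an isomorphism both sides become
    the same arrow: one by the pentagon for \<I>, \<I>, \<open>c\<close> and the triangle at the
    object \<open>c \<bullet> m\<close>, the other by the triangle in \<open>C\<close>.\<close>
  have "\<I> \<star> (\<u> (c \<bullet> m) \<circ>\<^sub>N \<p> \<I> c m) \<circ>\<^sub>N \<p> \<I> (\<I> \<sqdot> c) m \<circ>\<^sub>N \<a> \<I> \<I> c \<diamondop> m =
      \<p> \<I> c m \<circ>\<^sub>N (\<r> \<I> \<triangleleft> c) \<diamondop> m"
    by (simp add: mpentagon N.comp_tail[OF 1] 2)
  also have "\<dots> = \<I> \<star> (\<l> c \<diamondop> m) \<circ>\<^sub>N \<p> \<I> (\<I> \<sqdot> c) m \<circ>\<^sub>N \<a> \<I> \<I> c \<diamondop> m"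
    unfolding 4[symmetric] by (simp add: N.comp_tail[OF 3])
  finally have *: "\<I> \<star> (\<u> (c \<bullet> m) \<circ>\<^sub>N \<p> \<I> c m) \<circ>\<^sub>N \<p> \<I> (\<I> \<sqdot> c) m \<circ>\<^sub>N \<a> \<I> \<I> c \<diamondop> m =
      \<I> \<star> (\<l> c \<diamondop> m) \<circ>\<^sub>N \<p> \<I> (\<I> \<sqdot> c) m \<circ>\<^sub>N \<a> \<I> \<I> c \<diamondop> m" .
  have "\<I> \<star> (\<u> (c \<bullet> m) \<circ>\<^sub>N \<p> \<I> c m) = \<I> \<star> (\<l> c \<diamondop> m)"
    by (rule N.iso_epi[OF N.iso_pair_comp[OF rac_iso[OF asc_iso] mas_iso] *]) simp_all
  then show ?thesis by (rule unit_faithful[rotated 4]) simp_all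
qed

text \<open>For a dual pair, acting with \<open>x\<close> is left adjoint to acting with
  \<open>y\<close>. This is the counit of the adjunction, and the next definition is its
  unit.\<close>

definition counit :: "'o \<Rightarrow> 'o \<Rightarrow> 'a \<Rightarrow> 'm \<Rightarrow> 'n" where
  "counit x y ev m = \<u> m \<circ>\<^sub>N ev \<diamondop> m \<circ>\<^sub>N \<q> x y m"

definition unit :: "'o \<Rightarrow> 'o \<Rightarrow> 'a \<Rightarrow> 'm \<Rightarrow> 'n" where
  "unit x y cv m = \<p> y x m \<circ>\<^sub>N cv \<diamondop> m \<circ>\<^sub>N \<u>' m"

lemma counit_hom [simp]:
  assumes "duality C x y ev cv" "m \<in> ob N"
  shows "counit x y ev m \<in> arr N" "src N (counit x y ev m) = x \<bullet> (y \<bullet> m)" "trg N (counit x y ev m) = m"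
  using assms dualityD[OF assms(1)] by (simp_all add: counit_def)

lemma unit_hom [simp]:
  assumes "duality C x y ev cv" "m \<in> ob N"
  shows "unit x y cv m \<in> arr N" "src N (unit x y cv m) = m" "trg N (unit x y cv m) = y \<bullet> (x \<bullet> m)"
  using assms dualityD[OF assms(1)] by (simp_all add: unit_def)

lemma counit_nat:
  assumes d: "duality C x y ev cv" and [simp]: "g \<in> arr N"
  shows "counit x y ev (trg N g) \<circ>\<^sub>N x \<star> (y \<star> g) = g \<circ>\<^sub>N counit x y ev (src N g)"
proof -
  note [simp] = dualityD[OF d]
  have 1: "\<q> x y (trg N g) \<circ>\<^sub>N x \<star> (y \<star> g) = (x \<sqdot> y) \<star> g \<circ>\<^sub>N \<q> x y (src N g)"
    by (simp add: mas'_nat3)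
  have 2: "ev \<diamondop> trg N g \<circ>\<^sub>N (x \<sqdot> y) \<star> g = \<I> \<star> g \<circ>\<^sub>N ev \<diamondop> src N g"
    using minterchange[of ev g] by simp
  show ?thesis by (simp add: counit_def 1 N.comp_tail[OF 2] N.comp_tail[OF mun_nat])
qed

text \<open>A triangle identity of the adjunction. The module constraints are pushed outwards until
  only a zigzag identity acting on \<open>m\<close> remains; the two laws for units,
  \<open>mtriangle_left\<close> and \<open>mtriangle'\<close>, absorb the unit constraints.\<close>

lemma counit_unit:
  assumes d: "duality C x y ev cv" and [simp]: "m \<in> ob N"
  shows "counit x y ev (x \<bullet> m) \<circ>\<^sub>N x \<star> unit x y cv m = idt N (x \<bullet> m)"
proof -
  note [simp] = dualityD[OF d]
  have 1: "\<q> x y (x \<bullet> m) \<circ>\<^sub>N x \<star> \<p> y x m = \<p> (x \<sqdot> y) x m \<circ>\<^sub>N \<b> x y x \<diamondop> m \<circ>\<^sub>N \<q> x (y \<sqdot> x) m"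
    by (simp add: mpentagon_shift)
  have 2: "\<q> x (y \<sqdot> x) m \<circ>\<^sub>N x \<star> (cv \<diamondop> m) = (x \<triangleright> cv) \<diamondop> m \<circ>\<^sub>N \<q> x \<I> m"
    using mas'_nat2[of cv x m] by simp
  have 3: "ev \<diamondop> (x \<bullet> m) \<circ>\<^sub>N \<p> (x \<sqdot> y) x m = \<p> \<I> x m \<circ>\<^sub>N (ev \<triangleleft> x) \<diamondop> m"
    using mas_nat1[of ev x m] by simp
  have 4: "\<u> (x \<bullet> m) \<circ>\<^sub>N \<p> \<I> x m = \<l> x \<diamondop> m" by (simp add: mtriangle_left)
  have 5: "\<q> x \<I> m \<circ>\<^sub>N x \<star> \<u>' m = \<r>' x \<diamondop> m" by (simp add: mtriangle')
  have 6: "\<l> x \<diamondop> m \<circ>\<^sub>N (ev \<triangleleft> x) \<diamondop> m \<circ>\<^sub>N \<b> x y x \<diamondop> m \<circ>\<^sub>N (x \<triangleright> cv) \<diamondop> m \<circ>\<^sub>N \<r>' x \<diamondop> m =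
      idt N (x \<bullet> m)"
    using arg_cong[OF duality_zigzag2[OF d], of "\<lambda>f. f \<diamondop> m \<circ>\<^sub>N \<r>' x \<diamondop> m"] by simp
  show ?thesis
    by (simp add: counit_def unit_def N.comp_tail[OF 1] N.comp_tail[OF 2] N.comp_tail[OF 3] N.comp_tail[OF 4] 5 6)
qed

end

context left_module
begin

text \<open>In the dual category the unit is the counit of the exchanged pair, so this is
  \<open>counit_nat\<close> there; \<open>unit_counit\<close> is obtained from
  \<open>counit_unit\<close> by the same passage.\<close>

lemma unit_nat:
  assumes d: "duality C x y ev cv" and [simp]: "g \<in> arr N"
  shows "y \<star> (x \<star> g) \<circ>\<^sub>N unit x y cv (src N g) = unit x y cv (trg N g) \<circ>\<^sub>N g"
proof -
  interpret d: left_module "mdual C" "mddual N" by (rule left_module_dual)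
  note [simp] = dualityD[OF d]
  show ?thesis
    using d.counit_nat[OF duality_mdual[OF d], of g] by (simp add: d.counit_def unit_def)
qed

lemma unit_counit:
  assumes d: "duality C x y ev cv" and [simp]: "m \<in> ob N"
  shows "y \<star> counit x y ev m \<circ>\<^sub>N unit x y cv (y \<bullet> m) = idt N (y \<bullet> m)"
proof -
  interpret d: left_module "mdual C" "mddual N" by (rule left_module_dual)
  note [simp] = dualityD[OF d]
  show ?thesis
    using d.counit_unit[OF duality_mdual[OF d], of m]
    by (simp add: d.counit_def d.unit_def unit_def counit_def)
qed

lemma counit_precomp:
  assumes [simp]: "x \<in> ob C" "y \<in> ob C" "ev \<in> arr C" "src C ev = x \<sqdot> y" "trg C ev = \<I>"
    "f \<in> arr C" "trg C f = y" "m \<in> ob N"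
  shows "counit x (src C f) (ev \<cdot> x \<triangleright> f) m = counit x y ev m \<circ>\<^sub>N x \<star> (f \<diamondop> m)"
proof -
  have 1: "\<q> x y m \<circ>\<^sub>N x \<star> (f \<diamondop> m) = (x \<triangleright> f) \<diamondop> m \<circ>\<^sub>N \<q> x (src C f) m"
    using mas'_nat2[of f x m] by simp
  show ?thesis by (simp add: counit_def 1)
qed

text \<open>The hypothesis \<open>e\<close> says that \<open>h\<close> and \<open>f\<close> are
  mates, and the counits inherit this relation. It is how an arrow of \<open>C\<close> is exchanged
  for its dual in the naturality of the half-braiding.\<close>

lemma counit_dinat:
  assumes [simp]: "x \<in> ob C" "y \<in> ob C" "ev \<in> arr C" "src C ev = x \<sqdot> y" "trg C ev = \<I>"
    "x' \<in> ob C" "y' \<in> ob C" "ev' \<in> arr C" "src C ev' = x' \<sqdot> y'" "trg C ev' = \<I>"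
    "h \<in> arr C" "src C h = y'" "trg C h = y" "f \<in> arr C" "src C f = x" "trg C f = x'" "m \<in> ob N"
    and e: "ev \<cdot> x \<triangleright> h = ev' \<cdot> f \<triangleleft> y'"
  shows "counit x y ev m \<circ>\<^sub>N x \<star> (h \<diamondop> m) = counit x' y' ev' m \<circ>\<^sub>N f \<diamondop> (y' \<bullet> m)"
proof -
  have 1: "\<q> x' y' m \<circ>\<^sub>N f \<diamondop> (y' \<bullet> m) = (f \<triangleleft> y') \<diamondop> m \<circ>\<^sub>N \<q> x y' m"
    using mas'_nat1[of f y' m] by simp
  have "counit x y ev m \<circ>\<^sub>N x \<star> (h \<diamondop> m) = counit x y' (ev' \<cdot> f \<triangleleft> y') m"
    using counit_precomp[of x y ev h m] by (simp add: e)
  also have "\<dots> = counit x' y' ev' m \<circ>\<^sub>N f \<diamondop> (y' \<bullet> m)"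
    by (simp add: counit_def 1)
  finally show ?thesis .
qed

end

section \<open>Coherence of the units and mates under a duality\<close>

context monoidal
begin

text \<open>This is \<open>mtriangle_left\<close> for the reversed tensor product, seen as a module
  over itself.\<close>

lemma run_tensor: "x \<in> ob C \<Longrightarrow> y \<in> ob C \<Longrightarrow> \<r> (x \<sqdot> y) \<cdot> \<b> x y \<I> = x \<triangleright> \<r> y"
proof -
  interpret v: monoidal "mrev C" by (rule monoidal_mrev)
  interpret vr: left_module "mrev C" "mreg (mrev C)" by (rule v.left_module_mreg)
  show "x \<in> ob C \<Longrightarrow> y \<in> ob C \<Longrightarrow> \<r> (x \<sqdot> y) \<cdot> \<b> x y \<I> = x \<triangleright> \<r> y"
    using vr.mtriangle_left[of y x] by simp
qed

lemma run_tensor': "x \<in> ob C \<Longrightarrow> y \<in> ob C \<Longrightarrow> x \<triangleright> \<r> y \<cdot> \<a> x y \<I> = \<r> (x \<sqdot> y)"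
  by (simp flip: run_tensor)

lemma lun_run_unit: "\<l> \<I> = \<r> \<I>"
proof -
  interpret r: left_module C "mreg C" by (rule left_module_mreg)
  \<comment> \<open>Naturality of \<l> at \<open>\<l> \<I>\<close> shows that the two agree after
    composition with the isomorphism \<open>\<l> \<I>\<close>. The two triangle laws at \<I> then
    describe the same arrow, and naturality of \<r> cancels the whiskering by \<I>.\<close>
  have 1: "\<l> (\<I> \<sqdot> \<I>) = \<I> \<triangleright> \<l> \<I>"
    by (rule iso_mono[OF lun_iso[of \<I>]]) (simp_all add: lun_nat[of "\<l> \<I>", simplified])
  have "\<l> \<I> \<triangleleft> \<I> = \<r> \<I> \<triangleleft> \<I>"
    using r.mtriangle_left[of \<I> \<I>] triangle[of \<I> \<I>] by (simp add: 1)
  then have *: "\<l> \<I> \<cdot> \<r> (\<I> \<sqdot> \<I>) = \<r> \<I> \<cdot> \<r> (\<I> \<sqdot> \<I>)"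
    using run_nat[of "\<l> \<I>"] run_nat[of "\<r> \<I>"] by simp
  show ?thesis by (rule iso_epi[OF run_iso[of "\<I> \<sqdot> \<I>"] *]) simp_all
qed

text \<open>The arrow \<open>z \<rightarrow> y\<close> corresponding to \<open>s : x \<otimes> z \<rightarrow> \<I>\<close> for a dual pair with coevaluation
  \<open>cv : \<I> \<rightarrow> y \<otimes> x\<close>.\<close>

definition mate :: "'o \<Rightarrow> 'o \<Rightarrow> 'a \<Rightarrow> 'o \<Rightarrow> 'a \<Rightarrow> 'a" where
  "mate x y cv z s = \<r> y \<cdot> y \<triangleright> s \<cdot> \<a> y x z \<cdot> cv \<triangleleft> z \<cdot> \<l>' z"

lemma mate_hom [simp]:
  assumes "x \<in> ob C" "y \<in> ob C" "cv \<in> arr C" "src C cv = \<I>" "trg C cv = y \<sqdot> x"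
    "s \<in> arr C" "src C s = x \<sqdot> z" "trg C s = \<I>" "z \<in> ob C"
  shows "mate x y cv z s \<in> arr C" "src C (mate x y cv z s) = z" "trg C (mate x y cv z s) = y"
  using assms by (simp_all add: mate_def)

text \<open>Transposition under the adjunction: the constraints are moved past \<open>s\<close>,
  which leaves a triangle identity at \<open>z\<close>. With \<open>mate_ev\<close> this is a
  bijection between arrows from \<open>z\<close> to \<open>y\<close> and arrows from
  \<open>x \<sqdot> z\<close> to \<I>, and hence evaluations distinguish arrows into
  \<open>y\<close>.\<close>

lemma ev_mate:
  assumes d: "duality C x y ev cv"
    and [simp]: "s \<in> arr C" "src C s = x \<sqdot> z" "trg C s = \<I>" "z \<in> ob C"
  shows "ev \<cdot> x \<triangleright> mate x y cv z s = s"
proof -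
  interpret r: left_module C "mreg C" by (rule left_module_mreg)
  note [simp] = dualityD[OF d]
  have 1: "x \<triangleright> \<r> y = \<r> (x \<sqdot> y) \<cdot> \<b> x y \<I>" by (simp add: run_tensor)
  have 2: "\<b> x y \<I> \<cdot> x \<triangleright> (y \<triangleright> s) = (x \<sqdot> y) \<triangleright> s \<cdot> \<b> x y (x \<sqdot> z)"
    using asc'_nat3[of s x y] by simp
  have 3: "ev \<cdot> \<r> (x \<sqdot> y) = \<r> \<I> \<cdot> ev \<triangleleft> \<I>" using run_nat[of ev] by simp
  have 4: "ev \<triangleleft> \<I> \<cdot> (x \<sqdot> y) \<triangleright> s = \<I> \<triangleright> s \<cdot> ev \<triangleleft> (x \<sqdot> z)" using interchange[of ev s] by simp
  have 5: "\<r> \<I> \<cdot> \<I> \<triangleright> s = s \<cdot> \<l> (x \<sqdot> z)" using lun_nat[of s] by (simp add: lun_run_unit)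
  have 6: "\<l> (x \<sqdot> z) \<cdot> ev \<triangleleft> (x \<sqdot> z) \<cdot> \<b> x y (x \<sqdot> z) \<cdot> x \<triangleright> \<a> y x z \<cdot> x \<triangleright> (cv \<triangleleft> z) \<cdot> x \<triangleright> \<l>' z =
      idt C (x \<sqdot> z)"
    using r.counit_unit[OF d, of z] by (simp add: r.counit_def r.unit_def)
  show ?thesis
    by (simp add: mate_def 1 comp_tail[OF 2] comp_tail[OF 3] comp_tail[OF 4] comp_tail[OF 5] 6)
qed

lemma mate_ev:
  assumes d: "duality C x y ev cv" and [simp]: "p \<in> arr C" "trg C p = y"
  shows "mate x y cv (src C p) (ev \<cdot> x \<triangleright> p) = p"
proof -
  note [simp] = dualityD[OF d]
  have 1: "y \<triangleright> (x \<triangleright> p) \<cdot> \<a> y x (src C p) = \<a> y x y \<cdot> (y \<sqdot> x) \<triangleright> p"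
    using asc_nat3[of p y x] by simp
  have 2: "(y \<sqdot> x) \<triangleright> p \<cdot> cv \<triangleleft> src C p = cv \<triangleleft> y \<cdot> \<I> \<triangleright> p" using interchange[of cv p] by simp
  have 3: "\<I> \<triangleright> p \<cdot> \<l>' (src C p) = \<l>' y \<cdot> p" using lun'_nat[of p] by simp
  have 4: "\<r> y \<cdot> y \<triangleright> ev \<cdot> \<a> y x y \<cdot> cv \<triangleleft> y \<cdot> \<l>' y \<cdot> p = \<l> y \<cdot> \<l>' y \<cdot> p"
    using arg_cong[OF duality_zigzag1[OF d], of "\<lambda>f. f \<cdot> (\<l>' y \<cdot> p)"] by simp
  show ?thesis
    by (simp add: mate_def comp_tail[OF 1] comp_tail[OF 2] 3 4)
qed

lemma ev_inject:
  assumes "duality C x y ev cv" "p \<in> arr C" "trg C p = y" "q \<in> arr C" "trg C q = y" "src C p = src C q"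
    "ev \<cdot> x \<triangleright> p = ev \<cdot> x \<triangleright> q"
  shows "p = q"
  using mate_ev[OF assms(1-3)] mate_ev[OF assms(1,4,5)] unfolding assms(6,7) by (rule trans[OF sym])

text \<open>Transposition with an arbitrary object \<open>w\<close> in place of \<I>. The equation
  \<open>*\<close> recovers an arrow from its transpose by the other triangle identity.\<close>

lemma counit_inject:
  assumes d: "duality C x y ev cv" and [simp]: "p \<in> arr C" "trg C p = y \<sqdot> w" "q \<in> arr C" "trg C q = y \<sqdot> w"
    "src C p = src C q" "w \<in> ob C"
    and e: "\<l> w \<cdot> ev \<triangleleft> w \<cdot> \<b> x y w \<cdot> x \<triangleright> p = \<l> w \<cdot> ev \<triangleleft> w \<cdot> \<b> x y w \<cdot> x \<triangleright> q"
  shows "p = q"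
proof -
  interpret r: left_module C "mreg C" by (rule left_module_mreg)
  note [simp] = dualityD[OF d]
  have *: "f = y \<triangleright> (\<l> w \<cdot> ev \<triangleleft> w \<cdot> \<b> x y w \<cdot> x \<triangleright> f) \<cdot> r.unit x y cv (src C f)"
    if [simp]: "f \<in> arr C" "trg C f = y \<sqdot> w" for f
  proof -
    have [simp]: "r.unit x y cv (src C f) \<in> arr C" "src C (r.unit x y cv (src C f)) = src C f"
      "trg C (r.unit x y cv (src C f)) = y \<sqdot> (x \<sqdot> src C f)"
      "r.unit x y cv (y \<sqdot> w) \<in> arr C" "src C (r.unit x y cv (y \<sqdot> w)) = y \<sqdot> w"
      "trg C (r.unit x y cv (y \<sqdot> w)) = y \<sqdot> (x \<sqdot> (y \<sqdot> w))"
      using r.unit_hom[OF d, of "src C f"] r.unit_hom[OF d, of "y \<sqdot> w"] by simp_all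
    have 1: "y \<triangleright> (x \<triangleright> f) \<cdot> r.unit x y cv (src C f) = r.unit x y cv (y \<sqdot> w) \<cdot> f"
      using r.unit_nat[OF d, of f] by simp
    have 2: "y \<triangleright> \<l> w \<cdot> y \<triangleright> (ev \<triangleleft> w) \<cdot> y \<triangleright> \<b> x y w \<cdot> r.unit x y cv (y \<sqdot> w) \<cdot> f = f"
      using arg_cong[OF r.unit_counit[OF d, of w], of "\<lambda>h. h \<cdot> f"] by (simp add: r.counit_def)
    show ?thesis by (simp add: 1 2)
  qed
  show ?thesis
    using *[of p] *[of q] unfolding e by simp
qed

text \<open>Mates may be characterised by evaluations or by coevaluations. The two sides are
  compared through their transposes, both of which reduce to \<open>f \<cdot> \<r> x\<close>, one by
  the zigzag identity of the second pair and the other by that of the first.\<close>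

lemma mate_coev:
  assumes d: "duality C x y ev cv" and d': "duality C x' y' ev' cv'"
    and [simp]: "h \<in> arr C" "src C h = y'" "trg C h = y" "f \<in> arr C" "src C f = x" "trg C f = x'"
    and e: "ev \<cdot> x \<triangleright> h = ev' \<cdot> f \<triangleleft> y'"
  shows "h \<triangleleft> x' \<cdot> cv' = y \<triangleright> f \<cdot> cv"
proof (rule counit_inject[OF d, where w = x'])
  note [simp] = dualityD[OF d] dualityD[OF d']
  show "h \<triangleleft> x' \<cdot> cv' \<in> arr C" "trg C (h \<triangleleft> x' \<cdot> cv') = y \<sqdot> x'" "y \<triangleright> f \<cdot> cv \<in> arr C"
    "trg C (y \<triangleright> f \<cdot> cv) = y \<sqdot> x'" "src C (h \<triangleleft> x' \<cdot> cv') = src C (y \<triangleright> f \<cdot> cv)" "x' \<in> ob C"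
    by simp_all
  have 1: "\<b> x y x' \<cdot> x \<triangleright> (h \<triangleleft> x') = (x \<triangleright> h) \<triangleleft> x' \<cdot> \<b> x y' x'" using asc'_nat2[of h x x'] by simp
  have 2: "ev \<triangleleft> x' \<cdot> (x \<triangleright> h) \<triangleleft> x' = ev' \<triangleleft> x' \<cdot> f \<triangleleft> y' \<triangleleft> x'"
    using arg_cong[OF e, of "\<lambda>g. g \<triangleleft> x'"] by simp
  have 3: "f \<triangleleft> y' \<triangleleft> x' \<cdot> \<b> x y' x' = \<b> x' y' x' \<cdot> f \<triangleleft> (y' \<sqdot> x')" using asc'_nat1[of f y' x'] by simp
  have 4: "f \<triangleleft> (y' \<sqdot> x') \<cdot> x \<triangleright> cv' = x' \<triangleright> cv' \<cdot> f \<triangleleft> \<I>" using interchange[of f cv'] by simp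
  have 5: "\<l> x' \<cdot> ev' \<triangleleft> x' \<cdot> \<b> x' y' x' \<cdot> x' \<triangleright> cv' \<cdot> f \<triangleleft> \<I> = \<r> x' \<cdot> f \<triangleleft> \<I>"
    using arg_cong[OF duality_zigzag2[OF d'], of "\<lambda>g. g \<cdot> f \<triangleleft> \<I>"] by simp
  have 6: "\<b> x y x' \<cdot> x \<triangleright> (y \<triangleright> f) = (x \<sqdot> y) \<triangleright> f \<cdot> \<b> x y x" using asc'_nat3[of f x y] by simp
  have 7: "ev \<triangleleft> x' \<cdot> (x \<sqdot> y) \<triangleright> f = \<I> \<triangleright> f \<cdot> ev \<triangleleft> x" using interchange[of ev f] by simp
  have 8: "\<l> x' \<cdot> \<I> \<triangleright> f = f \<cdot> \<l> x" using lun_nat[of f] by simp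
  have 9: "\<r> x' \<cdot> f \<triangleleft> \<I> = f \<cdot> \<r> x" using run_nat[of f] by simp
  show "\<l> x' \<cdot> ev \<triangleleft> x' \<cdot> \<b> x y x' \<cdot> x \<triangleright> (h \<triangleleft> x' \<cdot> cv') = \<l> x' \<cdot> ev \<triangleleft> x' \<cdot> \<b> x y x' \<cdot> x \<triangleright> (y \<triangleright> f \<cdot> cv)"
    by (simp add: comp_tail[OF 1] comp_tail[OF 2] comp_tail[OF 3] 4 5 comp_tail[OF 6] comp_tail[OF 7]
        comp_tail[OF 8] duality_zigzag2[OF d] 9)
qed

text \<open>Uniqueness of left duals: both composites preserve an evaluation, and an endomorphism of
  a dual that preserves the evaluation is the identity.\<close>

lemma mates_iso:
  assumes d: "duality C x y ev cv" and d': "duality C x y' ev' cv'"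
    and [simp]: "h \<in> arr C" "src C h = y'" "trg C h = y" "h' \<in> arr C" "src C h' = y" "trg C h' = y'"
    and e: "ev \<cdot> x \<triangleright> h = ev'" "ev' \<cdot> x \<triangleright> h' = ev"
  shows "iso_pair C h h' y' y"
proof -
  note [simp] = dualityD[OF d] dualityD[OF d']
  have "h \<cdot> h' = idt C y"
    by (rule ev_inject[OF d]) (simp_all add: comp_tail[OF e(1)] e)
  moreover have "h' \<cdot> h = idt C y'"
    by (rule ev_inject[OF d']) (simp_all add: comp_tail[OF e(2)] e)
  ultimately show ?thesis by (simp add: iso_pair_def Hom_iff)
qed

text \<open>The nested evaluation: the inner factors \<open>x\<^sub>2\<close> and
  \<open>y\<^sub>2\<close> are adjacent and cancel first, which forces the order
  \<open>y\<^sub>2 \<sqdot> y\<^sub>1\<close> of the duals. In \<open>tensor_cv\<close> the outer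
  pair is created first and the inner one is inserted between its factors.\<close>

definition tensor_ev :: "'o \<Rightarrow> 'o \<Rightarrow> 'a \<Rightarrow> 'o \<Rightarrow> 'o \<Rightarrow> 'a \<Rightarrow> 'a" where
  "tensor_ev x\<^sub>1 y\<^sub>1 ev\<^sub>1 x\<^sub>2 y\<^sub>2 ev\<^sub>2 = ev\<^sub>1 \<cdot> x\<^sub>1 \<triangleright> \<l> y\<^sub>1 \<cdot> x\<^sub>1 \<triangleright> (ev\<^sub>2 \<triangleleft> y\<^sub>1) \<cdot> x\<^sub>1 \<triangleright> \<b> x\<^sub>2 y\<^sub>2 y\<^sub>1 \<cdot> \<a> x\<^sub>1 x\<^sub>2 (y\<^sub>2 \<sqdot> y\<^sub>1)"

definition tensor_cv :: "'o \<Rightarrow> 'o \<Rightarrow> 'a \<Rightarrow> 'o \<Rightarrow> 'o \<Rightarrow> 'a \<Rightarrow> 'a" where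
  "tensor_cv x\<^sub>1 y\<^sub>1 cv\<^sub>1 x\<^sub>2 y\<^sub>2 cv\<^sub>2 = \<b> y\<^sub>2 y\<^sub>1 (x\<^sub>1 \<sqdot> x\<^sub>2) \<cdot> y\<^sub>2 \<triangleright> \<a> y\<^sub>1 x\<^sub>1 x\<^sub>2 \<cdot> y\<^sub>2 \<triangleright> (cv\<^sub>1 \<triangleleft> x\<^sub>2) \<cdot> y\<^sub>2 \<triangleright> \<l>' x\<^sub>2 \<cdot> cv\<^sub>2"

lemma tensor_ev_hom [simp]:
  assumes "duality C x\<^sub>1 y\<^sub>1 ev\<^sub>1 cv\<^sub>1" "duality C x\<^sub>2 y\<^sub>2 ev\<^sub>2 cv\<^sub>2"
  shows "tensor_ev x\<^sub>1 y\<^sub>1 ev\<^sub>1 x\<^sub>2 y\<^sub>2 ev\<^sub>2 \<in> arr C"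
    "src C (tensor_ev x\<^sub>1 y\<^sub>1 ev\<^sub>1 x\<^sub>2 y\<^sub>2 ev\<^sub>2) = (x\<^sub>1 \<sqdot> x\<^sub>2) \<sqdot> (y\<^sub>2 \<sqdot> y\<^sub>1)" "trg C (tensor_ev x\<^sub>1 y\<^sub>1 ev\<^sub>1 x\<^sub>2 y\<^sub>2 ev\<^sub>2) = \<I>"
  using dualityD[OF assms(1)] dualityD[OF assms(2)] by (simp_all add: tensor_ev_def)

lemma tensor_cv_hom [simp]:
  assumes "duality C x\<^sub>1 y\<^sub>1 ev\<^sub>1 cv\<^sub>1" "duality C x\<^sub>2 y\<^sub>2 ev\<^sub>2 cv\<^sub>2"
  shows "tensor_cv x\<^sub>1 y\<^sub>1 cv\<^sub>1 x\<^sub>2 y\<^sub>2 cv\<^sub>2 \<in> arr C" "src C (tensor_cv x\<^sub>1 y\<^sub>1 cv\<^sub>1 x\<^sub>2 y\<^sub>2 cv\<^sub>2) = \<I>"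
    "trg C (tensor_cv x\<^sub>1 y\<^sub>1 cv\<^sub>1 x\<^sub>2 y\<^sub>2 cv\<^sub>2) = (y\<^sub>2 \<sqdot> y\<^sub>1) \<sqdot> (x\<^sub>1 \<sqdot> x\<^sub>2)"
  using dualityD[OF assms(1)] dualityD[OF assms(2)] by (simp_all add: tensor_cv_def)

end

section \<open>Composite adjunctions and duals of tensor products\<close>

context left_module
begin

text \<open>Up to associativity constraints the action of a tensor product is the composite of the
  actions, and the counit of the composite of two adjunctions is the nested composite of their
  counits.\<close>

lemma counit_tensor:
  assumes d1: "duality C x\<^sub>1 y\<^sub>1 ev\<^sub>1 cv\<^sub>1" and d2: "duality C x\<^sub>2 y\<^sub>2 ev\<^sub>2 cv\<^sub>2" and [simp]: "m \<in> ob N"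
  shows "counit (x\<^sub>1 \<sqdot> x\<^sub>2) (y\<^sub>2 \<sqdot> y\<^sub>1) (tensor_ev x\<^sub>1 y\<^sub>1 ev\<^sub>1 x\<^sub>2 y\<^sub>2 ev\<^sub>2) m =
    counit x\<^sub>1 y\<^sub>1 ev\<^sub>1 m \<circ>\<^sub>N x\<^sub>1 \<star> counit x\<^sub>2 y\<^sub>2 ev\<^sub>2 (y\<^sub>1 \<bullet> m) \<circ>\<^sub>N x\<^sub>1 \<star> (x\<^sub>2 \<star> \<p> y\<^sub>2 y\<^sub>1 m) \<circ>\<^sub>N
      \<p> x\<^sub>1 x\<^sub>2 ((y\<^sub>2 \<sqdot> y\<^sub>1) \<bullet> m)"
proof -
  note [simp] = dualityD[OF d1] dualityD[OF d2] tensor_ev_hom[OF d1 d2] counit_hom[OF d1] counit_hom[OF d2]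
  have 1: "\<q> x\<^sub>2 y\<^sub>2 (y\<^sub>1 \<bullet> m) \<circ>\<^sub>N x\<^sub>2 \<star> \<p> y\<^sub>2 y\<^sub>1 m =
      \<p> (x\<^sub>2 \<sqdot> y\<^sub>2) y\<^sub>1 m \<circ>\<^sub>N \<b> x\<^sub>2 y\<^sub>2 y\<^sub>1 \<diamondop> m \<circ>\<^sub>N \<q> x\<^sub>2 (y\<^sub>2 \<sqdot> y\<^sub>1) m"
    by (simp add: mpentagon_shift)
  have 2: "ev\<^sub>2 \<diamondop> (y\<^sub>1 \<bullet> m) \<circ>\<^sub>N \<p> (x\<^sub>2 \<sqdot> y\<^sub>2) y\<^sub>1 m = \<p> \<I> y\<^sub>1 m \<circ>\<^sub>N (ev\<^sub>2 \<triangleleft> y\<^sub>1) \<diamondop> m"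
    using mas_nat1[of ev\<^sub>2 y\<^sub>1 m] by simp
  have 3: "\<u> (y\<^sub>1 \<bullet> m) \<circ>\<^sub>N \<p> \<I> y\<^sub>1 m = \<l> y\<^sub>1 \<diamondop> m" by (simp add: mtriangle_left)
  let ?X = "\<l> y\<^sub>1 \<cdot> ev\<^sub>2 \<triangleleft> y\<^sub>1 \<cdot> \<b> x\<^sub>2 y\<^sub>2 y\<^sub>1"
  have 4: "counit x\<^sub>2 y\<^sub>2 ev\<^sub>2 (y\<^sub>1 \<bullet> m) \<circ>\<^sub>N x\<^sub>2 \<star> \<p> y\<^sub>2 y\<^sub>1 m = ?X \<diamondop> m \<circ>\<^sub>N \<q> x\<^sub>2 (y\<^sub>2 \<sqdot> y\<^sub>1) m"
    by (simp add: counit_def 1 N.comp_tail[OF 2] N.comp_tail[OF 3])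
  have 5: "\<q> x\<^sub>1 y\<^sub>1 m \<circ>\<^sub>N x\<^sub>1 \<star> (?X \<diamondop> m) = (x\<^sub>1 \<triangleright> ?X) \<diamondop> m \<circ>\<^sub>N \<q> x\<^sub>1 (x\<^sub>2 \<sqdot> (y\<^sub>2 \<sqdot> y\<^sub>1)) m"
    using mas'_nat2[of ?X x\<^sub>1 m] by simp
  have 6: "\<q> x\<^sub>1 (x\<^sub>2 \<sqdot> (y\<^sub>2 \<sqdot> y\<^sub>1)) m \<circ>\<^sub>N x\<^sub>1 \<star> \<q> x\<^sub>2 (y\<^sub>2 \<sqdot> y\<^sub>1) m \<circ>\<^sub>N \<p> x\<^sub>1 x\<^sub>2 ((y\<^sub>2 \<sqdot> y\<^sub>1) \<bullet> m) =
      \<a> x\<^sub>1 x\<^sub>2 (y\<^sub>2 \<sqdot> y\<^sub>1) \<diamondop> m \<circ>\<^sub>N \<q> (x\<^sub>1 \<sqdot> x\<^sub>2) (y\<^sub>2 \<sqdot> y\<^sub>1) m"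
  proof -
    have "\<a> x\<^sub>1 x\<^sub>2 (y\<^sub>2 \<sqdot> y\<^sub>1) \<diamondop> m \<circ>\<^sub>N (\<b> x\<^sub>1 x\<^sub>2 (y\<^sub>2 \<sqdot> y\<^sub>1) \<diamondop> m \<circ>\<^sub>N \<q> x\<^sub>1 (x\<^sub>2 \<sqdot> (y\<^sub>2 \<sqdot> y\<^sub>1)) m \<circ>\<^sub>N x\<^sub>1 \<star> \<q> x\<^sub>2 (y\<^sub>2 \<sqdot> y\<^sub>1) m) \<circ>\<^sub>N
        \<p> x\<^sub>1 x\<^sub>2 ((y\<^sub>2 \<sqdot> y\<^sub>1) \<bullet> m) = \<a> x\<^sub>1 x\<^sub>2 (y\<^sub>2 \<sqdot> y\<^sub>1) \<diamondop> m \<circ>\<^sub>N \<q> (x\<^sub>1 \<sqdot> x\<^sub>2) (y\<^sub>2 \<sqdot> y\<^sub>1) m"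
      by (subst mpentagon') simp_all
    then show ?thesis by simp
  qed
  have "counit x\<^sub>1 y\<^sub>1 ev\<^sub>1 m \<circ>\<^sub>N x\<^sub>1 \<star> (counit x\<^sub>2 y\<^sub>2 ev\<^sub>2 (y\<^sub>1 \<bullet> m) \<circ>\<^sub>N x\<^sub>2 \<star> \<p> y\<^sub>2 y\<^sub>1 m) \<circ>\<^sub>N
      \<p> x\<^sub>1 x\<^sub>2 ((y\<^sub>2 \<sqdot> y\<^sub>1) \<bullet> m) =
    \<u> m \<circ>\<^sub>N ev\<^sub>1 \<diamondop> m \<circ>\<^sub>N (\<q> x\<^sub>1 y\<^sub>1 m \<circ>\<^sub>N x\<^sub>1 \<star> (?X \<diamondop> m)) \<circ>\<^sub>N x\<^sub>1 \<star> \<q> x\<^sub>2 (y\<^sub>2 \<sqdot> y\<^sub>1) m \<circ>\<^sub>N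
      \<p> x\<^sub>1 x\<^sub>2 ((y\<^sub>2 \<sqdot> y\<^sub>1) \<bullet> m)"
    unfolding 4 by (simp add: counit_def[of x\<^sub>1])
  also have "\<dots> = counit (x\<^sub>1 \<sqdot> x\<^sub>2) (y\<^sub>2 \<sqdot> y\<^sub>1) (tensor_ev x\<^sub>1 y\<^sub>1 ev\<^sub>1 x\<^sub>2 y\<^sub>2 ev\<^sub>2) m"
    unfolding 5 by (simp add: counit_def[of "x\<^sub>1 \<sqdot> x\<^sub>2"] tensor_ev_def 6)
  finally show ?thesis by simp
qed

text \<open>This is \<open>counit_tensor\<close> in the dual category, where
  \<open>tensor_cv\<close> is the nested evaluation of the two pairs taken in the opposite
  order.\<close>

lemma unit_tensor:
  assumes d1: "duality C x\<^sub>1 y\<^sub>1 ev\<^sub>1 cv\<^sub>1" and d2: "duality C x\<^sub>2 y\<^sub>2 ev\<^sub>2 cv\<^sub>2" and [simp]: "m \<in> ob N"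
  shows "unit (x\<^sub>1 \<sqdot> x\<^sub>2) (y\<^sub>2 \<sqdot> y\<^sub>1) (tensor_cv x\<^sub>1 y\<^sub>1 cv\<^sub>1 x\<^sub>2 y\<^sub>2 cv\<^sub>2) m =
    \<q> y\<^sub>2 y\<^sub>1 ((x\<^sub>1 \<sqdot> x\<^sub>2) \<bullet> m) \<circ>\<^sub>N y\<^sub>2 \<star> (y\<^sub>1 \<star> \<q> x\<^sub>1 x\<^sub>2 m) \<circ>\<^sub>N y\<^sub>2 \<star> unit x\<^sub>1 y\<^sub>1 cv\<^sub>1 (x\<^sub>2 \<bullet> m) \<circ>\<^sub>N
      unit x\<^sub>2 y\<^sub>2 cv\<^sub>2 m"
proof -
  interpret d: left_module "mdual C" "mddual N" by (rule left_module_dual)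
  note [simp] = dualityD[OF d1] dualityD[OF d2] 
  have 1: "d.tensor_ev y\<^sub>2 x\<^sub>2 cv\<^sub>2 y\<^sub>1 x\<^sub>1 cv\<^sub>1 = tensor_cv x\<^sub>1 y\<^sub>1 cv\<^sub>1 x\<^sub>2 y\<^sub>2 cv\<^sub>2"
    by (simp add: d.tensor_ev_def tensor_cv_def)
  have 2: "d.counit y x cv m = unit x y cv m"
    if "x \<in> ob C" "y \<in> ob C" "cv \<in> arr C" "src C cv = \<I>" "trg C cv = y \<sqdot> x" "m \<in> ob N" for x y cv m
    using that by (simp add: d.counit_def unit_def)
  note h = tensor_cv_hom[OF d1 d2]
  show ?thesis
    using d.counit_tensor[OF duality_mdual[OF d2] duality_mdual[OF d1], of m]
    by (simp add: 1 2 h unit_hom[OF d1] unit_hom[OF d2])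
qed

text \<open>The triangle identity of a composite adjunction, derived from those of the factors by
  naturality. It does not presuppose a zigzag identity for the tensor product; on the contrary,
  \<open>zigzag_tensor\<close> is read off from it, which avoids a direct pasting of
  associators.\<close>

lemma counit_unit_tensor:
  assumes d1: "duality C x\<^sub>1 y\<^sub>1 ev\<^sub>1 cv\<^sub>1" and d2: "duality C x\<^sub>2 y\<^sub>2 ev\<^sub>2 cv\<^sub>2" and [simp]: "m \<in> ob N"
  shows "counit (x\<^sub>1 \<sqdot> x\<^sub>2) (y\<^sub>2 \<sqdot> y\<^sub>1) (tensor_ev x\<^sub>1 y\<^sub>1 ev\<^sub>1 x\<^sub>2 y\<^sub>2 ev\<^sub>2) ((x\<^sub>1 \<sqdot> x\<^sub>2) \<bullet> m) \<circ>\<^sub>N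
    (x\<^sub>1 \<sqdot> x\<^sub>2) \<star> unit (x\<^sub>1 \<sqdot> x\<^sub>2) (y\<^sub>2 \<sqdot> y\<^sub>1) (tensor_cv x\<^sub>1 y\<^sub>1 cv\<^sub>1 x\<^sub>2 y\<^sub>2 cv\<^sub>2) m = idt N ((x\<^sub>1 \<sqdot> x\<^sub>2) \<bullet> m)"
proof -
  note [simp] = dualityD[OF d1] dualityD[OF d2] counit_hom[OF d1] counit_hom[OF d2] unit_hom[OF d1] unit_hom[OF d2]
  define h where "h = unit (x\<^sub>1 \<sqdot> x\<^sub>2) (y\<^sub>2 \<sqdot> y\<^sub>1) (tensor_cv x\<^sub>1 y\<^sub>1 cv\<^sub>1 x\<^sub>2 y\<^sub>2 cv\<^sub>2) m"
  define W where "W = y\<^sub>1 \<star> \<q> x\<^sub>1 x\<^sub>2 m \<circ>\<^sub>N unit x\<^sub>1 y\<^sub>1 cv\<^sub>1 (x\<^sub>2 \<bullet> m)"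
  have [simp]: "W \<in> arr N" "src N W = x\<^sub>2 \<bullet> m" "trg N W = y\<^sub>1 \<bullet> ((x\<^sub>1 \<sqdot> x\<^sub>2) \<bullet> m)" by (simp_all add: W_def)
  have h: "h = \<q> y\<^sub>2 y\<^sub>1 ((x\<^sub>1 \<sqdot> x\<^sub>2) \<bullet> m) \<circ>\<^sub>N y\<^sub>2 \<star> W \<circ>\<^sub>N unit x\<^sub>2 y\<^sub>2 cv\<^sub>2 m"
    unfolding h_def unit_tensor[OF assms] by (simp add: W_def)
  have [simp]: "h \<in> arr N" "src N h = m" "trg N h = (y\<^sub>2 \<sqdot> y\<^sub>1) \<bullet> ((x\<^sub>1 \<sqdot> x\<^sub>2) \<bullet> m)" by (simp_all add: h)
  have 1: "\<p> x\<^sub>1 x\<^sub>2 ((y\<^sub>2 \<sqdot> y\<^sub>1) \<bullet> ((x\<^sub>1 \<sqdot> x\<^sub>2) \<bullet> m)) \<circ>\<^sub>N (x\<^sub>1 \<sqdot> x\<^sub>2) \<star> h = x\<^sub>1 \<star> (x\<^sub>2 \<star> h) \<circ>\<^sub>N \<p> x\<^sub>1 x\<^sub>2 m"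
    using mas_nat3[of h x\<^sub>1 x\<^sub>2] by simp
  have 2: "\<p> y\<^sub>2 y\<^sub>1 ((x\<^sub>1 \<sqdot> x\<^sub>2) \<bullet> m) \<circ>\<^sub>N h = y\<^sub>2 \<star> W \<circ>\<^sub>N unit x\<^sub>2 y\<^sub>2 cv\<^sub>2 m" by (simp add: h)
  have 3: "counit x\<^sub>2 y\<^sub>2 ev\<^sub>2 (y\<^sub>1 \<bullet> ((x\<^sub>1 \<sqdot> x\<^sub>2) \<bullet> m)) \<circ>\<^sub>N x\<^sub>2 \<star> (y\<^sub>2 \<star> W) = W \<circ>\<^sub>N counit x\<^sub>2 y\<^sub>2 ev\<^sub>2 (x\<^sub>2 \<bullet> m)"
    using counit_nat[OF d2, of W] by simp
  have 4: "counit x\<^sub>2 y\<^sub>2 ev\<^sub>2 (y\<^sub>1 \<bullet> ((x\<^sub>1 \<sqdot> x\<^sub>2) \<bullet> m)) \<circ>\<^sub>N x\<^sub>2 \<star> (\<p> y\<^sub>2 y\<^sub>1 ((x\<^sub>1 \<sqdot> x\<^sub>2) \<bullet> m) \<circ>\<^sub>N h) = W"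
    unfolding 2 by (simp add: N.comp_tail[OF 3] counit_unit[OF d2])
  have 5: "counit x\<^sub>1 y\<^sub>1 ev\<^sub>1 ((x\<^sub>1 \<sqdot> x\<^sub>2) \<bullet> m) \<circ>\<^sub>N x\<^sub>1 \<star> (y\<^sub>1 \<star> \<q> x\<^sub>1 x\<^sub>2 m) =
      \<q> x\<^sub>1 x\<^sub>2 m \<circ>\<^sub>N counit x\<^sub>1 y\<^sub>1 ev\<^sub>1 (x\<^sub>1 \<bullet> (x\<^sub>2 \<bullet> m))"
    using counit_nat[OF d1, of "\<q> x\<^sub>1 x\<^sub>2 m"] by simp
  have 6: "counit x\<^sub>1 y\<^sub>1 ev\<^sub>1 ((x\<^sub>1 \<sqdot> x\<^sub>2) \<bullet> m) \<circ>\<^sub>N x\<^sub>1 \<star> W = \<q> x\<^sub>1 x\<^sub>2 m"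
    by (simp add: W_def N.comp_tail[OF 5] counit_unit[OF d1])
  have "counit (x\<^sub>1 \<sqdot> x\<^sub>2) (y\<^sub>2 \<sqdot> y\<^sub>1) (tensor_ev x\<^sub>1 y\<^sub>1 ev\<^sub>1 x\<^sub>2 y\<^sub>2 ev\<^sub>2) ((x\<^sub>1 \<sqdot> x\<^sub>2) \<bullet> m) \<circ>\<^sub>N (x\<^sub>1 \<sqdot> x\<^sub>2) \<star> h =
    counit x\<^sub>1 y\<^sub>1 ev\<^sub>1 ((x\<^sub>1 \<sqdot> x\<^sub>2) \<bullet> m) \<circ>\<^sub>N
      x\<^sub>1 \<star> (counit x\<^sub>2 y\<^sub>2 ev\<^sub>2 (y\<^sub>1 \<bullet> ((x\<^sub>1 \<sqdot> x\<^sub>2) \<bullet> m)) \<circ>\<^sub>N x\<^sub>2 \<star> (\<p> y\<^sub>2 y\<^sub>1 ((x\<^sub>1 \<sqdot> x\<^sub>2) \<bullet> m) \<circ>\<^sub>N h)) \<circ>\<^sub>N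
      \<p> x\<^sub>1 x\<^sub>2 m"
    by (simp add: counit_tensor[OF d1 d2] 1 del: 2 h)
  also have "\<dots> = idt N ((x\<^sub>1 \<sqdot> x\<^sub>2) \<bullet> m)" unfolding 4 by (simp add: N.comp_tail[OF 6])
  finally show ?thesis by (simp add: h_def)
qed

end

context monoidal
begin

lemma zigzag_tensor:
  assumes d1: "duality C x\<^sub>1 y\<^sub>1 ev\<^sub>1 cv\<^sub>1" and d2: "duality C x\<^sub>2 y\<^sub>2 ev\<^sub>2 cv\<^sub>2"
  defines "x \<equiv> x\<^sub>1 \<sqdot> x\<^sub>2" and "y \<equiv> y\<^sub>2 \<sqdot> y\<^sub>1" and "ev \<equiv> tensor_ev x\<^sub>1 y\<^sub>1 ev\<^sub>1 x\<^sub>2 y\<^sub>2 ev\<^sub>2"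
    and "cv \<equiv> tensor_cv x\<^sub>1 y\<^sub>1 cv\<^sub>1 x\<^sub>2 y\<^sub>2 cv\<^sub>2"
  shows "\<l> x \<cdot> ev \<triangleleft> x \<cdot> \<b> x y x \<cdot> x \<triangleright> cv = \<r> x"
proof -
  interpret r: left_module C "mreg C" by (rule left_module_mreg)
  have [simp]: "x \<in> ob C" "y \<in> ob C" "ev \<in> arr C" "src C ev = x \<sqdot> y" "trg C ev = \<I>"
    "cv \<in> arr C" "src C cv = \<I>" "trg C cv = y \<sqdot> x"
    using tensor_ev_hom[OF d1 d2] tensor_cv_hom[OF d1 d2] dualityD[OF d1] dualityD[OF d2]
    by (simp_all add: x_def y_def ev_def cv_def)
  have 1: "\<r> x \<cdot> \<l> (x \<sqdot> \<I>) = \<l> x \<cdot> \<I> \<triangleright> \<r> x" using lun_nat[of "\<r> x"] by simp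
  have 2: "\<I> \<triangleright> \<r> x \<cdot> ev \<triangleleft> (x \<sqdot> \<I>) = ev \<triangleleft> x \<cdot> (x \<sqdot> y) \<triangleright> \<r> x" using interchange[of ev "\<r> x"] by simp
  have 3: "(x \<sqdot> y) \<triangleright> \<r> x \<cdot> \<b> x y (x \<sqdot> \<I>) = \<b> x y x \<cdot> x \<triangleright> (y \<triangleright> \<r> x)"
    using asc'_nat3[of "\<r> x" x y] by simp
  have 4: "x \<triangleright> (y \<triangleright> \<r> x) \<cdot> x \<triangleright> \<a> y x \<I> = x \<triangleright> \<r> (y \<sqdot> x)"
    using run_tensor'[of y x] by (simp flip: lwh_comp)
  have 5: "x \<triangleright> \<r> (y \<sqdot> x) \<cdot> x \<triangleright> (cv \<triangleleft> \<I>) = x \<triangleright> cv \<cdot> x \<triangleright> \<l> \<I>"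
    using run_nat[of cv] by (simp add: lun_run_unit flip: lwh_comp)
  have "\<r> x = \<r> x \<cdot> \<l> (x \<sqdot> \<I>) \<cdot> ev \<triangleleft> (x \<sqdot> \<I>) \<cdot> \<b> x y (x \<sqdot> \<I>) \<cdot> x \<triangleright> \<a> y x \<I> \<cdot> x \<triangleright> (cv \<triangleleft> \<I>) \<cdot> x \<triangleright> \<l>' \<I>"
    using arg_cong[OF r.counit_unit_tensor[OF d1 d2, of \<I>], of "\<lambda>f. \<r> x \<cdot> f"]
    by (simp add: r.counit_def r.unit_def flip: x_def y_def ev_def cv_def)
  also have "\<dots> = \<l> x \<cdot> ev \<triangleleft> x \<cdot> \<b> x y x \<cdot> x \<triangleright> cv"
    by (simp add: comp_tail[OF 1] comp_tail[OF 2] comp_tail[OF 3] comp_tail[OF 4] comp_tail[OF 5])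
  finally show ?thesis by simp
qed

lemma tensor_ev_mdual:
  assumes d1: "duality C x\<^sub>1 y\<^sub>1 ev\<^sub>1 cv\<^sub>1" and d2: "duality C x\<^sub>2 y\<^sub>2 ev\<^sub>2 cv\<^sub>2"
  shows "monoidal.tensor_ev (mdual C) y\<^sub>2 x\<^sub>2 cv\<^sub>2 y\<^sub>1 x\<^sub>1 cv\<^sub>1 = tensor_cv x\<^sub>1 y\<^sub>1 cv\<^sub>1 x\<^sub>2 y\<^sub>2 cv\<^sub>2"
proof -
  interpret d: monoidal "mdual C" by (rule monoidal_mdual)
  note [simp] = dualityD[OF d1] dualityD[OF d2]
  show ?thesis by (simp add: d.tensor_ev_def tensor_cv_def)
qed

text \<open>The second zigzag identity is the first one in the dual category, where the nested
  evaluation and coevaluation are exchanged.\<close>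

lemma duality_tensor:
  assumes d1: "duality C x\<^sub>1 y\<^sub>1 ev\<^sub>1 cv\<^sub>1" and d2: "duality C x\<^sub>2 y\<^sub>2 ev\<^sub>2 cv\<^sub>2"
  shows "duality C (x\<^sub>1 \<sqdot> x\<^sub>2) (y\<^sub>2 \<sqdot> y\<^sub>1) (tensor_ev x\<^sub>1 y\<^sub>1 ev\<^sub>1 x\<^sub>2 y\<^sub>2 ev\<^sub>2) (tensor_cv x\<^sub>1 y\<^sub>1 cv\<^sub>1 x\<^sub>2 y\<^sub>2 cv\<^sub>2)"
    (is "duality C ?x ?y ?ev ?cv")
proof -
  interpret d: monoidal "mdual C" by (rule monoidal_mdual)
  note [simp] = dualityD[OF d1] dualityD[OF d2] tensor_ev_hom[OF d1 d2] tensor_cv_hom[OF d1 d2]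
  have 1: "d.tensor_ev y\<^sub>2 x\<^sub>2 cv\<^sub>2 y\<^sub>1 x\<^sub>1 cv\<^sub>1 = ?cv" "d.tensor_cv y\<^sub>2 x\<^sub>2 ev\<^sub>2 y\<^sub>1 x\<^sub>1 ev\<^sub>1 = ?ev"
    by (rule tensor_ev_mdual[OF d1 d2]) (simp add: d.tensor_cv_def tensor_ev_def)
  have 2: "?y \<triangleright> ?ev \<cdot> \<a> ?y ?x ?y \<cdot> ?cv \<triangleleft> ?y \<cdot> \<l>' ?y = \<r>' ?y"
    using d.zigzag_tensor[OF duality_mdual[OF d2] duality_mdual[OF d1]] by (simp add: 1)
  have "\<r> ?y \<cdot> ?y \<triangleright> ?ev \<cdot> \<a> ?y ?x ?y \<cdot> ?cv \<triangleleft> ?y = \<r> ?y \<cdot> (?y \<triangleright> ?ev \<cdot> \<a> ?y ?x ?y \<cdot> ?cv \<triangleleft> ?y \<cdot> \<l>' ?y) \<cdot> \<l> ?y"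
    by simp
  also have "\<dots> = \<l> ?y" unfolding 2 by simp
  finally show ?thesis using zigzag_tensor[OF d1 d2] by (simp add: duality_def)
qed

end

section \<open>Limits of families of parallel pairs\<close>

text \<open>An end of \<open>T\<close> is the case \<open>D m = T m m\<close>, \<open>A f = T (src f) f\<close> and \<open>B f = T f (trg f)\<close>. This
  shape, in contrast to that of an end, is stable under whiskering.\<close>

definition fan :: "('o, 'a, 'y) cat_scheme \<Rightarrow> ('m, 'n, 'z) cat_scheme \<Rightarrow> ('m \<Rightarrow> 'o) \<Rightarrow> ('n \<Rightarrow> 'a) \<Rightarrow>
    ('n \<Rightarrow> 'a) \<Rightarrow> 'o \<Rightarrow> ('m \<Rightarrow> 'a) \<Rightarrow> bool" where
  "fan C N D A B w k \<longleftrightarrow> w \<in> ob C \<and> (\<forall>m\<in>ob N. k m \<in> Hom C w (D m)) \<and>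
     (\<forall>f\<in>arr N. A f \<cdot>\<^bsub>C\<^esub> k (src N f) = B f \<cdot>\<^bsub>C\<^esub> k (trg N f))"

definition limit_fan :: "('o, 'a, 'y) cat_scheme \<Rightarrow> ('m, 'n, 'z) cat_scheme \<Rightarrow> ('m \<Rightarrow> 'o) \<Rightarrow> ('n \<Rightarrow> 'a) \<Rightarrow>
    ('n \<Rightarrow> 'a) \<Rightarrow> 'o \<Rightarrow> ('m \<Rightarrow> 'a) \<Rightarrow> bool" where
  "limit_fan C N D A B g j \<longleftrightarrow> fan C N D A B g j \<and>
     (\<forall>w k. fan C N D A B w k \<longrightarrow> (\<exists>!u. u \<in> Hom C w g \<and> (\<forall>m\<in>ob N. j m \<cdot>\<^bsub>C\<^esub> u = k m)))"

lemma limit_fan_inject: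
  assumes l: "limit_fan C N D A B g j" and C: "category C"
    and D: "\<And>f. f \<in> arr N \<Longrightarrow> src N f \<in> ob N \<and> trg N f \<in> ob N \<and> A f \<in> arr C \<and> src C (A f) = D (src N f) \<and>
      B f \<in> arr C \<and> src C (B f) = D (trg N f)"
    and u: "u \<in> arr C" "trg C u = g" and v: "v \<in> arr C" "trg C v = g" "src C u = src C v"
    and e: "\<And>m. m \<in> ob N \<Longrightarrow> j m \<cdot>\<^bsub>C\<^esub> u = j m \<cdot>\<^bsub>C\<^esub> v"
  shows "u = v"
proof -
  interpret C: category C by (rule C)
  have j: "j m \<in> arr C" "src C (j m) = g" "trg C (j m) = D m" if "m \<in> ob N" for m
    using l that by (auto simp: limit_fan_def fan_def Hom_iff)
  have s: "A f \<cdot>\<^bsub>C\<^esub> j (src N f) = B f \<cdot>\<^bsub>C\<^esub> j (trg N f)" if "f \<in> arr N" for f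
    using l that by (simp add: limit_fan_def fan_def)
  have "A f \<cdot>\<^bsub>C\<^esub> j (src N f) \<cdot>\<^bsub>C\<^esub> u = B f \<cdot>\<^bsub>C\<^esub> j (trg N f) \<cdot>\<^bsub>C\<^esub> u" if f: "f \<in> arr N" for f
    using D[OF f] C.comp_tail[OF s[OF f], of u] u by (simp add: j)
  then have "fan C N D A B (src C u) (\<lambda>m. j m \<cdot>\<^bsub>C\<^esub> u)"
    using u D by (simp add: fan_def Hom_iff j)
  then have "\<exists>!x. x \<in> Hom C (src C u) g \<and> (\<forall>m\<in>ob N. j m \<cdot>\<^bsub>C\<^esub> x = j m \<cdot>\<^bsub>C\<^esub> u)"
    using l by (simp add: limit_fan_def)
  moreover have "u \<in> Hom C (src C u) g" "v \<in> Hom C (src C u) g" using u v by (simp_all add: Hom_iff)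
  ultimately show ?thesis using e by (metis (no_types, lifting))
qed

section \<open>Tensoring with a dualisable object preserves limits\<close>

context monoidal
begin

text \<open>\<open>cou\<close> and \<open>uni\<close> are the counit and the unit of the adjunction
  of a dual pair for the regular module, written as arrows of \<open>C\<close>.\<close>

definition cou :: "'o \<Rightarrow> 'o \<Rightarrow> 'a \<Rightarrow> 'o \<Rightarrow> 'a" where
  "cou x y ev w = \<l> w \<cdot> ev \<triangleleft> w \<cdot> \<b> x y w"

definition uni :: "'o \<Rightarrow> 'o \<Rightarrow> 'a \<Rightarrow> 'o \<Rightarrow> 'a" where
  "uni x y cv w = \<a> y x w \<cdot> cv \<triangleleft> w \<cdot> \<l>' w"

lemma cou_hom:
  assumes "duality C x y ev cv" "w \<in> ob C"
  shows "cou x y ev w \<in> arr C" "src C (cou x y ev w) = x \<sqdot> (y \<sqdot> w)" "trg C (cou x y ev w) = w"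
    "uni x y cv w \<in> arr C" "src C (uni x y cv w) = w" "trg C (uni x y cv w) = y \<sqdot> (x \<sqdot> w)"
  using assms(2) dualityD[OF assms(1)] by (simp_all add: cou_def uni_def)

lemma cou_nat:
  assumes d: "duality C x y ev cv" and f: "f \<in> arr C"
  shows "cou x y ev (trg C f) \<cdot> x \<triangleright> (y \<triangleright> f) = f \<cdot> cou x y ev (src C f)"
proof -
  interpret r: left_module C "mreg C" by (rule left_module_mreg)
  show ?thesis using r.counit_nat[OF d, of f] f by (simp add: cou_def r.counit_def)
qed

lemma transpose_transpose:
  assumes d: "duality C x y ev cv" and [simp]: "f \<in> arr C" "trg C f = y \<sqdot> w" "w \<in> ob C"
  shows "y \<triangleright> (cou x y ev w \<cdot> x \<triangleright> f) \<cdot> uni x y cv (src C f) = f"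
proof -
  interpret r: left_module C "mreg C" by (rule left_module_mreg)
  have u: "uni x y cv w = r.unit x y cv w" for w by (simp add: uni_def r.unit_def)
  have c: "cou x y ev w = r.counit x y ev w" for w by (simp add: cou_def r.counit_def)
  note [simp] = dualityD[OF d] cou_hom[OF d]
  have 1: "y \<triangleright> (x \<triangleright> f) \<cdot> uni x y cv (src C f) = uni x y cv (y \<sqdot> w) \<cdot> f"
    using r.unit_nat[OF d, of f] by (simp add: u)
  have 2: "y \<triangleright> cou x y ev w \<cdot> uni x y cv (y \<sqdot> w) = idt C (y \<sqdot> w)"
    using r.unit_counit[OF d, of w] by (simp add: u c)
  show ?thesis by (simp add: 1 comp_tail[OF 2])
qed

text \<open>Tensoring with \<open>c\<close> on the left is right adjoint to tensoring with its right
  dual \<open>x\<close>, and right adjoints preserve limits. This needs a shape of diagram whose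
  arrows may be whiskered, which is the reason for using fans.\<close>

lemma lwh_limit_fan:
  assumes d: "duality C x c ev cv" and l: "limit_fan C N D A B g j"
    and D: "\<And>m. m \<in> ob N \<Longrightarrow> D m \<in> ob C"
    and E: "\<And>f. f \<in> arr N \<Longrightarrow> src N f \<in> ob N \<and> trg N f \<in> ob N \<and> A f \<in> arr C \<and> src C (A f) = D (src N f) \<and>
      B f \<in> arr C \<and> src C (B f) = D (trg N f) \<and> trg C (A f) = trg C (B f)"
  shows "limit_fan C N (\<lambda>m. c \<sqdot> D m) (\<lambda>f. c \<triangleright> A f) (\<lambda>f. c \<triangleright> B f) (c \<sqdot> g) (\<lambda>m. c \<triangleright> j m)"
  unfolding limit_fan_def
proof (intro conjI allI impI)
  note [simp] = dualityD[OF d] cou_hom[OF d]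
  have g [simp]: "g \<in> ob C" using l by (simp add: limit_fan_def fan_def)
  have j [simp]: "j m \<in> arr C" "src C (j m) = g" "trg C (j m) = D m" if "m \<in> ob N" for m
    using l that by (auto simp: limit_fan_def fan_def Hom_iff)
  have s: "A f \<cdot> j (src N f) = B f \<cdot> j (trg N f)" if "f \<in> arr N" for f
    using l that by (simp add: limit_fan_def fan_def)
  show "fan C N (\<lambda>m. c \<sqdot> D m) (\<lambda>f. c \<triangleright> A f) (\<lambda>f. c \<triangleright> B f) (c \<sqdot> g) (\<lambda>m. c \<triangleright> j m)"
    using E by (simp add: fan_def Hom_iff s flip: lwh_comp)
  fix w k assume k: "fan C N (\<lambda>m. c \<sqdot> D m) (\<lambda>f. c \<triangleright> A f) (\<lambda>f. c \<triangleright> B f) w k"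
  have w [simp]: "w \<in> ob C" using k by (simp add: fan_def)
  have kh [simp]: "k m \<in> arr C" "src C (k m) = w" "trg C (k m) = c \<sqdot> D m" if "m \<in> ob N" for m
    using k that by (auto simp: fan_def Hom_iff)
  \<comment> \<open>The transposed fan, with vertex \<open>x \<sqdot> w\<close> and components in
    the original diagram; the arrow \<open>u\<close> that it induces is transposed back by means of
    \<open>uni\<close>.\<close>
  define k' where "k' m = cou x c ev (D m) \<cdot> x \<triangleright> k m" for m
  have k'h [simp]: "k' m \<in> arr C" "src C (k' m) = x \<sqdot> w" "trg C (k' m) = D m" if "m \<in> ob N" for m
    using that D by (simp_all add: k'_def)
  have "A f \<cdot> k' (src N f) = B f \<cdot> k' (trg N f)" if f: "f \<in> arr N" for f
  proof -
    have 1: "A f \<cdot> cou x c ev (D (src N f)) = cou x c ev (trg C (B f)) \<cdot> x \<triangleright> (c \<triangleright> A f)"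
      "B f \<cdot> cou x c ev (D (trg N f)) = cou x c ev (trg C (B f)) \<cdot> x \<triangleright> (c \<triangleright> B f)"
      using cou_nat[OF d, of "A f"] cou_nat[OF d, of "B f"] E[OF f] by simp_all
    have 2: "x \<triangleright> (c \<triangleright> A f) \<cdot> x \<triangleright> k (src N f) = x \<triangleright> (c \<triangleright> B f) \<cdot> x \<triangleright> k (trg N f)"
    proof -
      have "x \<triangleright> (c \<triangleright> A f \<cdot> k (src N f)) = x \<triangleright> (c \<triangleright> B f \<cdot> k (trg N f))" using k f by (simp add: fan_def)
      then show ?thesis using E[OF f] D by simp
    qed
    show ?thesis using E[OF f] D by (simp add: k'_def comp_tail[OF 1(1)] comp_tail[OF 1(2)] 2)
  qed
  then have "fan C N D A B (x \<sqdot> w) k'" by (simp add: fan_def Hom_iff)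
  then have ex: "\<exists>!u. u \<in> Hom C (x \<sqdot> w) g \<and> (\<forall>m\<in>ob N. j m \<cdot> u = k' m)"
    using l by (simp add: limit_fan_def)
  then obtain u where u: "u \<in> arr C" "src C u = x \<sqdot> w" "trg C u = g" "\<And>m. m \<in> ob N \<Longrightarrow> j m \<cdot> u = k' m"
    by (auto simp: Hom_iff)
  show "\<exists>!u. u \<in> Hom C w (c \<sqdot> g) \<and> (\<forall>m\<in>ob N. c \<triangleright> j m \<cdot> u = k m)"
  proof (rule ex1I[of _ "c \<triangleright> u \<cdot> uni x c cv w"], intro conjI ballI)
    show "c \<triangleright> u \<cdot> uni x c cv w \<in> Hom C w (c \<sqdot> g)" by (simp add: Hom_iff u)
    fix m assume m: "m \<in> ob N"
    have "c \<triangleright> j m \<cdot> c \<triangleright> u \<cdot> uni x c cv w = c \<triangleright> (j m \<cdot> u) \<cdot> uni x c cv w" using m by (simp add: u(1-3))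
    also have "\<dots> = k m"
      unfolding u(4)[OF m] k'_def using transpose_transpose[OF d, of "k m" "D m"] m D by simp
    finally show "c \<triangleright> j m \<cdot> c \<triangleright> u \<cdot> uni x c cv w = k m" .
  next
    fix v assume v: "v \<in> Hom C w (c \<sqdot> g) \<and> (\<forall>m\<in>ob N. c \<triangleright> j m \<cdot> v = k m)"
    then have vh [simp]: "v \<in> arr C" "src C v = w" "trg C v = c \<sqdot> g" by (simp_all add: Hom_iff)
    \<comment> \<open>The transpose of any solution \<open>v\<close> solves the transposed problem
      and therefore equals \<open>u\<close>.\<close>
    have "j m \<cdot> cou x c ev g \<cdot> x \<triangleright> v = k' m" if m: "m \<in> ob N" for m
    proof -
      have 1: "j m \<cdot> cou x c ev g = cou x c ev (D m) \<cdot> x \<triangleright> (c \<triangleright> j m)"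
        using cou_nat[OF d, of "j m"] m by simp
      have "x \<triangleright> (c \<triangleright> j m \<cdot> v) = x \<triangleright> k m" using v m by simp
      then have 2: "x \<triangleright> (c \<triangleright> j m) \<cdot> x \<triangleright> v = x \<triangleright> k m" using m D by simp
      show ?thesis using m D by (simp add: comp_tail[OF 1] 2 k'_def)
    qed
    moreover have "cou x c ev g \<cdot> x \<triangleright> v \<in> Hom C (x \<sqdot> w) g" by (simp add: Hom_iff)
    moreover have "u \<in> Hom C (x \<sqdot> w) g" by (simp add: Hom_iff u)
    ultimately have e: "cou x c ev g \<cdot> x \<triangleright> v = u" using ex u(4) by (metis (no_types, lifting))
    show "v = c \<triangleright> u \<cdot> uni x c cv w"
      using transpose_transpose[OF d, of v g] unfolding e by simp
  qed
qed

text \<open>The mirror image, from the reversed tensor product; now the adjoint is given by a left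
  dual of \<open>c\<close>.\<close>

lemma rwh_limit_fan:
  assumes d: "duality C c x ev cv" and l: "limit_fan C N D A B g j"
    and "\<And>m. m \<in> ob N \<Longrightarrow> D m \<in> ob C"
    and "\<And>f. f \<in> arr N \<Longrightarrow> src N f \<in> ob N \<and> trg N f \<in> ob N \<and> A f \<in> arr C \<and> src C (A f) = D (src N f) \<and>
      B f \<in> arr C \<and> src C (B f) = D (trg N f) \<and> trg C (A f) = trg C (B f)"
  shows "limit_fan C N (\<lambda>m. D m \<sqdot> c) (\<lambda>f. A f \<triangleleft> c) (\<lambda>f. B f \<triangleleft> c) (g \<sqdot> c) (\<lambda>m. j m \<triangleleft> c)"
proof -
  interpret v: monoidal "mrev C" by (rule monoidal_mrev)
  have e: "limit_fan (mrev C) N D A B g j \<longleftrightarrow> limit_fan C N D A B g j" for D A B g j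
    by (simp add: limit_fan_def fan_def Hom_def)
  show ?thesis
    using v.lwh_limit_fan[of x c ev cv N D A B g j] assms by (simp add: e)
qed

end

section \<open>Equivariant functors of two variables\<close>

text \<open>A choice of duals as it enters a right action on the opposite module category:
  \<open>st\<close> and \<open>sa\<close> are the dual of objects and arrows, \<open>nu c d\<close>
  goes from the dual of \<open>c \<sqdot> d\<close> to the product of the duals in reversed order,
  and \<open>uu\<close> goes from \<I> to its dual. Primes denote inverses.\<close>

record ('o, 'a) sdat =
  st :: "'o \<Rightarrow> 'o"
  sa :: "'a \<Rightarrow> 'a"
  nu :: "'o \<Rightarrow> 'o \<Rightarrow> 'a"
  nu' :: "'o \<Rightarrow> 'o \<Rightarrow> 'a"
  uu :: 'a
  uu' :: 'a

record ('m, 'n, 'o, 'a) tdat =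
  t0 :: "'m \<Rightarrow> 'm \<Rightarrow> 'o"
  t1 :: "'n \<Rightarrow> 'm \<Rightarrow> 'a"
  t2 :: "'m \<Rightarrow> 'n \<Rightarrow> 'a"
  lam :: "'o \<Rightarrow> 'm \<Rightarrow> 'm \<Rightarrow> 'a"
  lam' :: "'o \<Rightarrow> 'm \<Rightarrow> 'm \<Rightarrow> 'a"
  rho :: "'o \<Rightarrow> 'm \<Rightarrow> 'm \<Rightarrow> 'a"
  rho' :: "'o \<Rightarrow> 'm \<Rightarrow> 'm \<Rightarrow> 'a"

text \<open>\<open>T\<close> is contravariant in the first and covariant in the second variable;
  \<open>lam c m n : T m (c \<bullet> n) \<rightarrow> c \<otimes> T m n\<close> and \<open>rho e m n : T (e\<^sup>* \<bullet> m) n \<rightarrow> T m n \<otimes> e\<close>, where \<open>e\<^sup>* = st S e\<close>.\<close>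

locale equivariant = left_module C N
  for C :: "('o, 'a) mcat" (structure) and N :: "('m, 'n, 'o, 'a) mdcat" +
  fixes S :: "('o, 'a) sdat" and T :: "('m, 'n, 'o, 'a) tdat"
  assumes st_ob [simp]: "c \<in> ob C \<Longrightarrow> st S c \<in> ob C"
    and sa_arr [simp]: "f \<in> arr C \<Longrightarrow> sa S f \<in> arr C"
    and sa_src [simp]: "f \<in> arr C \<Longrightarrow> src C (sa S f) = st S (trg C f)"
    and sa_trg [simp]: "f \<in> arr C \<Longrightarrow> trg C (sa S f) = st S (src C f)"
    and nu_iso: "c \<in> ob C \<Longrightarrow> d \<in> ob C \<Longrightarrow>
      iso_pair C (nu S c d) (nu' S c d) (st S (tob C c d)) (tob C (st S d) (st S c))"
    and uu_iso: "iso_pair C (uu S) (uu' S) (uob C) (st S (uob C))"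
    and t0_ob [simp]: "m \<in> ob N \<Longrightarrow> n \<in> ob N \<Longrightarrow> t0 T m n \<in> ob C"
    and t1_arr [simp]: "g \<in> arr N \<Longrightarrow> n \<in> ob N \<Longrightarrow> t1 T g n \<in> arr C"
    and t1_src [simp]: "g \<in> arr N \<Longrightarrow> n \<in> ob N \<Longrightarrow> src C (t1 T g n) = t0 T (trg N g) n"
    and t1_trg [simp]: "g \<in> arr N \<Longrightarrow> n \<in> ob N \<Longrightarrow> trg C (t1 T g n) = t0 T (src N g) n"
    and t1_idt [simp]: "m \<in> ob N \<Longrightarrow> n \<in> ob N \<Longrightarrow> t1 T (idt N m) n = idt C (t0 T m n)"
    and t1_comp [simp]: "g \<in> arr N \<Longrightarrow> h \<in> arr N \<Longrightarrow> src N h = trg N g \<Longrightarrow> n \<in> ob N \<Longrightarrow>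
      t1 T (h \<cdot>\<^bsub>N\<^esub> g) n = t1 T g n \<cdot> t1 T h n"
    and t2_arr [simp]: "g \<in> arr N \<Longrightarrow> m \<in> ob N \<Longrightarrow> t2 T m g \<in> arr C"
    and t2_src [simp]: "g \<in> arr N \<Longrightarrow> m \<in> ob N \<Longrightarrow> src C (t2 T m g) = t0 T m (src N g)"
    and t2_trg [simp]: "g \<in> arr N \<Longrightarrow> m \<in> ob N \<Longrightarrow> trg C (t2 T m g) = t0 T m (trg N g)"
    and t2_idt [simp]: "m \<in> ob N \<Longrightarrow> n \<in> ob N \<Longrightarrow> t2 T m (idt N n) = idt C (t0 T m n)"
    and t2_comp [simp]: "g \<in> arr N \<Longrightarrow> h \<in> arr N \<Longrightarrow> src N h = trg N g \<Longrightarrow> m \<in> ob N \<Longrightarrow>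
      t2 T m (h \<cdot>\<^bsub>N\<^esub> g) = t2 T m h \<cdot> t2 T m g"
    and t_inter: "g \<in> arr N \<Longrightarrow> h \<in> arr N \<Longrightarrow>
      t1 T g (trg N h) \<cdot> t2 T (trg N g) h = t2 T (src N g) h \<cdot> t1 T g (src N h)"
    and lam_iso: "c \<in> ob C \<Longrightarrow> m \<in> ob N \<Longrightarrow> n \<in> ob N \<Longrightarrow>
      iso_pair C (lam T c m n) (lam' T c m n) (t0 T m (aob N c n)) (tob C c (t0 T m n))"
    and lam_nat: "f \<in> arr C \<Longrightarrow> m \<in> ob N \<Longrightarrow> n \<in> ob N \<Longrightarrow>
      rwh C f (t0 T m n) \<cdot> lam T (src C f) m n = lam T (trg C f) m n \<cdot> t2 T m (rac N f n)"
    and lam_nat1: "c \<in> ob C \<Longrightarrow> g \<in> arr N \<Longrightarrow> n \<in> ob N \<Longrightarrow>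
      lwh C c (t1 T g n) \<cdot> lam T c (trg N g) n = lam T c (src N g) n \<cdot> t1 T g (aob N c n)"
    and lam_nat2: "c \<in> ob C \<Longrightarrow> g \<in> arr N \<Longrightarrow> m \<in> ob N \<Longrightarrow>
      lwh C c (t2 T m g) \<cdot> lam T c m (src N g) = lam T c m (trg N g) \<cdot> t2 T m (lac N c g)"
    and lam_assoc: "c \<in> ob C \<Longrightarrow> d \<in> ob C \<Longrightarrow> m \<in> ob N \<Longrightarrow> n \<in> ob N \<Longrightarrow>
      asc C c d (t0 T m n) \<cdot> lam T (tob C c d) m n =
      lwh C c (lam T d m n) \<cdot> lam T c m (aob N d n) \<cdot> t2 T m (mas N c d n)"
    and lam_unit: "m \<in> ob N \<Longrightarrow> n \<in> ob N \<Longrightarrow> lun C (t0 T m n) \<cdot> lam T (uob C) m n = t2 T m (mun N n)"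
    and rho_iso: "c \<in> ob C \<Longrightarrow> m \<in> ob N \<Longrightarrow> n \<in> ob N \<Longrightarrow>
      iso_pair C (rho T c m n) (rho' T c m n) (t0 T (aob N (st S c) m) n) (tob C (t0 T m n) c)"
    and rho_nat: "f \<in> arr C \<Longrightarrow> m \<in> ob N \<Longrightarrow> n \<in> ob N \<Longrightarrow>
      lwh C (t0 T m n) f \<cdot> rho T (src C f) m n = rho T (trg C f) m n \<cdot> t1 T (rac N (sa S f) m) n"
    and rho_nat1: "c \<in> ob C \<Longrightarrow> g \<in> arr N \<Longrightarrow> n \<in> ob N \<Longrightarrow>
      rwh C (t1 T g n) c \<cdot> rho T c (trg N g) n = rho T c (src N g) n \<cdot> t1 T (lac N (st S c) g) n"
    and rho_nat2: "c \<in> ob C \<Longrightarrow> g \<in> arr N \<Longrightarrow> m \<in> ob N \<Longrightarrow>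
      rwh C (t2 T m g) c \<cdot> rho T c m (src N g) = rho T c m (trg N g) \<cdot> t2 T (aob N (st S c) m) g"
    and rho_assoc: "c \<in> ob C \<Longrightarrow> d \<in> ob C \<Longrightarrow> m \<in> ob N \<Longrightarrow> n \<in> ob N \<Longrightarrow>
      asc C (t0 T m n) c d \<cdot> rwh C (rho T c m n) d \<cdot> rho T d (aob N (st S c) m) n =
      rho T (tob C c d) m n \<cdot> t1 T (mas N (st S d) (st S c) m \<cdot>\<^bsub>N\<^esub> rac N (nu S c d) m) n"
    and rho_unit: "m \<in> ob N \<Longrightarrow> n \<in> ob N \<Longrightarrow>
      run C (t0 T m n) \<cdot> rho T (uob C) m n = t1 T (rac N (uu S) m \<cdot>\<^bsub>N\<^esub> mun' N m) n"
    and lam_rho: "c \<in> ob C \<Longrightarrow> d \<in> ob C \<Longrightarrow> m \<in> ob N \<Longrightarrow> n \<in> ob N \<Longrightarrow>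
      lwh C c (rho T d m n) \<cdot> lam T c (aob N (st S d) m) n =
      asc C c (t0 T m n) d \<cdot> rwh C (lam T c m n) d \<cdot> rho T d m (aob N c n)"

definition sdual :: "('o, 'a) sdat \<Rightarrow> ('o, 'a) sdat" where
  "sdual S = S\<lparr>nu := nu' S, nu' := nu S, uu := uu' S, uu' := uu S\<rparr>"

definition tdual :: "('m, 'n, 'o, 'a) tdat \<Rightarrow> ('m, 'n, 'o, 'a) tdat" where
  "tdual T = T\<lparr>lam := lam' T, lam' := lam T, rho := rho' T, rho' := rho T\<rparr>"

lemma sdual_simps [simp]:
  "st (sdual S) = st S" "sa (sdual S) = sa S" "nu (sdual S) = nu' S" "nu' (sdual S) = nu S"
  "uu (sdual S) = uu' S" "uu' (sdual S) = uu S"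
  by (simp_all add: sdual_def)

lemma tdual_simps [simp]:
  "t0 (tdual T) = t0 T" "t1 (tdual T) = t1 T" "t2 (tdual T) = t2 T" "lam (tdual T) = lam' T"
  "lam' (tdual T) = lam T" "rho (tdual T) = rho' T" "rho' (tdual T) = rho T"
  by (simp_all add: tdual_def)

context equivariant
begin

lemmas nu_simps [simp] = iso_pairD[OF nu_iso] iso_pairD_tail[OF nu_iso]
lemmas uu_simps [simp] = iso_pairD[OF uu_iso] iso_pairD_tail[OF uu_iso]
lemmas lam_simps [simp] = iso_pairD[OF lam_iso] iso_pairD_tail[OF lam_iso]
lemmas rho_simps [simp] = iso_pairD[OF rho_iso] iso_pairD_tail[OF rho_iso]

lemma t1_iso: "iso_pair N g g' m n \<Longrightarrow> p \<in> ob N \<Longrightarrow> iso_pair C (t1 T g p) (t1 T g' p) (t0 T n p) (t0 T m p)"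
  by (auto simp: iso_pair_def Hom_iff simp flip: t1_comp)

lemma t2_iso: "iso_pair N g g' m n \<Longrightarrow> p \<in> ob N \<Longrightarrow> iso_pair C (t2 T p g) (t2 T p g') (t0 T p m) (t0 T p n)"
  by (auto simp: iso_pair_def Hom_iff simp flip: t2_comp)

lemma lam'_nat: "f \<in> arr C \<Longrightarrow> m \<in> ob N \<Longrightarrow> n \<in> ob N \<Longrightarrow>
    lam' T (trg C f) m n \<cdot> f \<triangleleft> t0 T m n = t2 T m (f \<diamondop> n) \<cdot> lam' T (src C f) m n"
  by (rule iso_pair_square[OF lam_iso lam_iso]) (simp_all add: lam_nat)

lemma lam'_nat1: "c \<in> ob C \<Longrightarrow> g \<in> arr N \<Longrightarrow> n \<in> ob N \<Longrightarrow>
    lam' T c (src N g) n \<cdot> c \<triangleright> t1 T g n = t1 T g (c \<bullet> n) \<cdot> lam' T c (trg N g) n"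
  by (rule iso_pair_square[OF lam_iso lam_iso]) (simp_all add: lam_nat1)

lemma lam'_nat2: "c \<in> ob C \<Longrightarrow> g \<in> arr N \<Longrightarrow> m \<in> ob N \<Longrightarrow>
    lam' T c m (trg N g) \<cdot> c \<triangleright> t2 T m g = t2 T m (c \<star> g) \<cdot> lam' T c m (src N g)"
  by (rule iso_pair_square[OF lam_iso lam_iso]) (simp_all add: lam_nat2)

lemma rho'_nat: "f \<in> arr C \<Longrightarrow> m \<in> ob N \<Longrightarrow> n \<in> ob N \<Longrightarrow>
    rho' T (trg C f) m n \<cdot> t0 T m n \<triangleright> f = t1 T (sa S f \<diamondop> m) n \<cdot> rho' T (src C f) m n"
  by (rule iso_pair_square[OF rho_iso rho_iso]) (simp_all add: rho_nat)

lemma rho'_nat1: "c \<in> ob C \<Longrightarrow> g \<in> arr N \<Longrightarrow> n \<in> ob N \<Longrightarrow>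
    rho' T c (src N g) n \<cdot> t1 T g n \<triangleleft> c = t1 T (st S c \<star> g) n \<cdot> rho' T c (trg N g) n"
  by (rule iso_pair_square[OF rho_iso rho_iso]) (simp_all add: rho_nat1)

lemma rho'_nat2: "c \<in> ob C \<Longrightarrow> g \<in> arr N \<Longrightarrow> m \<in> ob N \<Longrightarrow>
    rho' T c m (trg N g) \<cdot> t2 T m g \<triangleleft> c = t2 T (st S c \<bullet> m) g \<cdot> rho' T c m (src N g)"
  by (rule iso_pair_square[OF rho_iso rho_iso]) (simp_all add: rho_nat2)

lemma lam'_assoc:
  assumes [simp]: "c \<in> ob C" "d \<in> ob C" "m \<in> ob N" "n \<in> ob N"
  shows "lam' T c m (d \<bullet> n) \<cdot> c \<triangleright> lam' T d m n \<cdot> \<a> c d (t0 T m n) = t2 T m (\<p> c d n) \<cdot> lam' T (c \<sqdot> d) m n"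
proof -
  have "(lam' T c m (d \<bullet> n) \<cdot> c \<triangleright> lam' T d m n) \<cdot> \<a> c d (t0 T m n) = t2 T m (\<p> c d n) \<cdot> lam' T (c \<sqdot> d) m n"
    by (rule iso_pair_square[OF iso_pair_comp[OF lam_iso lwh_iso[OF lam_iso]] lam_iso])
      (simp_all add: lam_assoc)
  then show ?thesis by simp
qed

lemma lam'_unit: "m \<in> ob N \<Longrightarrow> n \<in> ob N \<Longrightarrow> t2 T m (\<u> n) \<cdot> lam' T \<I> m n = \<l> (t0 T m n)"
  by (simp flip: lam_unit)

lemma lam'_assoc':
  assumes [simp]: "c \<in> ob C" "d \<in> ob C" "m \<in> ob N" "n \<in> ob N"
  shows "lam' T (c \<sqdot> d) m n \<cdot> \<b> c d (t0 T m n) = t2 T m (\<q> c d n) \<cdot> lam' T c m (d \<bullet> n) \<cdot> c \<triangleright> lam' T d m n"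
proof -
  let ?p = "\<a> c d (t0 T m n) \<cdot> lam T (c \<sqdot> d) m n"
  have 1: "iso_pair C ?p (lam' T (c \<sqdot> d) m n \<cdot> \<b> c d (t0 T m n)) (t0 T m ((c \<sqdot> d) \<bullet> n)) (c \<sqdot> (d \<sqdot> t0 T m n))"
    by (rule iso_pair_comp[OF lam_iso asc_iso]) simp_all
  have "iso_pair C (c \<triangleright> lam T d m n \<cdot> (lam T c m (d \<bullet> n) \<cdot> t2 T m (\<p> c d n)))
      ((t2 T m (\<q> c d n) \<cdot> lam' T c m (d \<bullet> n)) \<cdot> c \<triangleright> lam' T d m n)
      (t0 T m ((c \<sqdot> d) \<bullet> n)) (c \<sqdot> (d \<sqdot> t0 T m n))"
    by (rule iso_pair_comp[OF iso_pair_comp[OF t2_iso[OF mas_iso] lam_iso] lwh_iso[OF lam_iso]]) simp_all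
  then have 2: "iso_pair C ?p ((t2 T m (\<q> c d n) \<cdot> lam' T c m (d \<bullet> n)) \<cdot> c \<triangleright> lam' T d m n)
      (t0 T m ((c \<sqdot> d) \<bullet> n)) (c \<sqdot> (d \<sqdot> t0 T m n))"
    by (simp add: lam_assoc)
  show ?thesis using inv_arr_eq[OF 1] inv_arr_eq[OF 2] by simp
qed

lemma lam'_unit':
  assumes [simp]: "m \<in> ob N" "n \<in> ob N"
  shows "lam' T \<I> m n \<cdot> \<l>' (t0 T m n) = t2 T m (\<u>' n)"
proof -
  have 1: "iso_pair C (\<l> (t0 T m n) \<cdot> lam T \<I> m n) (lam' T \<I> m n \<cdot> \<l>' (t0 T m n)) (t0 T m (\<I> \<bullet> n)) (t0 T m n)"
    by (rule iso_pair_comp[OF lam_iso lun_iso]) simp_all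
  have 2: "iso_pair C (\<l> (t0 T m n) \<cdot> lam T \<I> m n) (t2 T m (\<u>' n)) (t0 T m (\<I> \<bullet> n)) (t0 T m n)"
    unfolding lam_unit[OF assms] by (rule t2_iso[OF mun_iso]) simp_all
  show ?thesis using inv_arr_eq[OF 1] inv_arr_eq[OF 2] by simp
qed

lemma rho'_assoc:
  assumes [simp]: "c \<in> ob C" "d \<in> ob C" "m \<in> ob N" "n \<in> ob N"
  shows "rho' T d (st S c \<bullet> m) n \<cdot> rho' T c m n \<triangleleft> d \<cdot> \<b> (t0 T m n) c d =
    t1 T (nu' S c d \<diamondop> m \<circ>\<^sub>N \<q> (st S d) (st S c) m) n \<cdot> rho' T (c \<sqdot> d) m n"
proof -
  let ?p = "\<a> (t0 T m n) c d \<cdot> rho T c m n \<triangleleft> d \<cdot> rho T d (st S c \<bullet> m) n"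
  have 1: "iso_pair C ?p ((rho' T d (st S c \<bullet> m) n \<cdot> rho' T c m n \<triangleleft> d) \<cdot> \<b> (t0 T m n) c d)
      (t0 T (st S d \<bullet> (st S c \<bullet> m)) n) (t0 T m n \<sqdot> (c \<sqdot> d))"
    by (rule iso_pair_comp[OF iso_pair_comp[OF rho_iso rwh_iso[OF rho_iso]] asc_iso]) simp_all
  have 2: "iso_pair C ?p (t1 T (nu' S c d \<diamondop> m \<circ>\<^sub>N \<q> (st S d) (st S c) m) n \<cdot> rho' T (c \<sqdot> d) m n)
      (t0 T (st S d \<bullet> (st S c \<bullet> m)) n) (t0 T m n \<sqdot> (c \<sqdot> d))"
    unfolding rho_assoc[OF assms]
    by (rule iso_pair_comp[OF t1_iso[OF N.iso_pair_comp[OF rac_iso[OF nu_iso] mas_iso]] rho_iso]) simp_all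
  show ?thesis using inv_arr_eq[OF 1] inv_arr_eq[OF 2] by simp
qed

lemma rho'_unit:
  assumes [simp]: "m \<in> ob N" "n \<in> ob N"
  shows "rho' T \<I> m n \<cdot> \<r>' (t0 T m n) = t1 T (\<u> m \<circ>\<^sub>N uu' S \<diamondop> m) n"
proof -
  have 1: "iso_pair C (\<r> (t0 T m n) \<cdot> rho T \<I> m n) (rho' T \<I> m n \<cdot> \<r>' (t0 T m n))
      (t0 T (st S \<I> \<bullet> m) n) (t0 T m n)"
    by (rule iso_pair_comp[OF rho_iso run_iso]) simp_all
  have 2: "iso_pair C (\<r> (t0 T m n) \<cdot> rho T \<I> m n) (t1 T (\<u> m \<circ>\<^sub>N uu' S \<diamondop> m) n)
      (t0 T (st S \<I> \<bullet> m) n) (t0 T m n)"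
    unfolding rho_unit[OF assms]
    by (rule t1_iso[OF N.iso_pair_comp[OF N.iso_pair_sym[OF mun_iso] rac_iso[OF uu_iso]]]) simp_all
  show ?thesis using inv_arr_eq[OF 1] inv_arr_eq[OF 2] by simp
qed

lemma lam_rho':
  assumes [simp]: "c \<in> ob C" "d \<in> ob C" "m \<in> ob N" "n \<in> ob N"
  shows "lam' T c m n \<triangleleft> d \<cdot> \<b> c (t0 T m n) d \<cdot> c \<triangleright> rho T d m n = rho T d m (c \<bullet> n) \<cdot> lam' T c (st S d \<bullet> m) n"
proof -
  have "(lam' T c m n \<triangleleft> d \<cdot> \<b> c (t0 T m n) d) \<cdot> c \<triangleright> rho T d m n = rho T d m (c \<bullet> n) \<cdot> lam' T c (st S d \<bullet> m) n"
    by (rule iso_pair_square[OF iso_pair_comp[OF rwh_iso[OF lam_iso] asc_iso] lam_iso])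
      (simp_all add: lam_rho)
  then show ?thesis by simp
qed

lemma lam'_rho':
  assumes [simp]: "c \<in> ob C" "d \<in> ob C" "m \<in> ob N" "n \<in> ob N"
  shows "lam' T c (st S d \<bullet> m) n \<cdot> c \<triangleright> rho' T d m n = rho' T d m (c \<bullet> n) \<cdot> lam' T c m n \<triangleleft> d \<cdot> \<b> c (t0 T m n) d"
proof (rule sym, rule iso_pair_square[OF rho_iso lwh_iso[OF rho_iso]])
  show "rho T d m (c \<bullet> n) \<cdot> lam' T c (st S d \<bullet> m) n = (lam' T c m n \<triangleleft> d \<cdot> \<b> c (t0 T m n) d) \<cdot> c \<triangleright> rho T d m n"
    by (simp add: lam_rho')
qed simp_all

text \<open>The axioms are symmetric under reversal of all arrows once each constraint is replaced
  by its inverse. This reduces coends to ends.\<close>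

lemma equivariant_dual: "equivariant (mdual C) (mddual N) (sdual S) (tdual T)"
proof -
  interpret d: left_module "mdual C" "mddual N" by (rule left_module_dual)
  show ?thesis
    by unfold_locales
      (simp_all add: nu_iso uu_iso lam_iso rho_iso iso_pair_sym t_inter lam'_nat lam'_nat1 lam'_nat2
        rho'_nat rho'_nat1 rho'_nat2 lam'_assoc' lam'_unit' rho'_assoc rho'_unit lam'_rho')
qed

end

section \<open>The half-braiding on an end\<close>

text \<open>The object \<open>st S c\<close> is a left dual of \<open>c\<close> and
  \<open>rd c\<close> is a right dual. The equations for \<open>sa\<close>, \<open>nu\<close> and
  \<open>uu\<close> identify these as the canonical arrows by their effect on evaluations, a form
  that can be met by the left duals of a category and by the right duals read in its opposite. The
  arrow \<open>\<theta> c\<close> identifies the left dual of the right dual of \<open>c\<close>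
  with \<open>c\<close>.\<close>

locale end_setting = equivariant C N S T
  for C :: "('o, 'a) mcat" (structure) and N :: "('m, 'n, 'o, 'a) mdcat"
    and S :: "('o, 'a) sdat" and T :: "('m, 'n, 'o, 'a) tdat" +
  fixes ev cv :: "'o \<Rightarrow> 'a" and rd :: "'o \<Rightarrow> 'o" and evr cvr \<theta> \<theta>' :: "'o \<Rightarrow> 'a"
    and g :: 'o and j :: "'m \<Rightarrow> 'a"
  assumes dual_st: "c \<in> ob C \<Longrightarrow> duality C c (st S c) (ev c) (cv c)"
    and ev_sa: "f \<in> arr C \<Longrightarrow> ev (src C f) \<cdot> lwh C (src C f) (sa S f) = ev (trg C f) \<cdot> rwh C f (st S (trg C f))"
    and ev_nu: "c \<in> ob C \<Longrightarrow> d \<in> ob C \<Longrightarrow>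
      ev (tob C c d) = tensor_ev c (st S c) (ev c) d (st S d) (ev d) \<cdot> lwh C (tob C c d) (nu S c d)"
    and ev_uu: "ev (uob C) \<cdot> lwh C (uob C) (uu S) = lun C (uob C)"
    and dual_rd: "c \<in> ob C \<Longrightarrow> duality C (rd c) c (evr c) (cvr c)"
    and \<theta>_iso: "c \<in> ob C \<Longrightarrow> iso_pair C (\<theta> c) (\<theta>' c) (st S (rd c)) c"
    and evr_\<theta>: "c \<in> ob C \<Longrightarrow> evr c \<cdot> lwh C (rd c) (\<theta> c) = ev (rd c)"
    and end_limit: "limit_fan C N (\<lambda>m. t0 T m m) (\<lambda>f. t2 T (src N f) f) (\<lambda>f. t1 T f (trg N f)) g j"
begin

lemmas st_simps [simp] = dualityD(2-8)[OF dual_st]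
lemmas rd_simps [simp] = dualityD(1,3-8)[OF dual_rd]
lemmas \<theta>_simps [simp] = iso_pairD[OF \<theta>_iso] iso_pairD_tail[OF \<theta>_iso]

abbreviation \<epsilon> where "\<epsilon> c \<equiv> counit c (st S c) (ev c)"
abbreviation \<eta> where "\<eta> c \<equiv> unit c (st S c) (cv c)"

lemmas \<epsilon>_simps [simp] = counit_hom[OF dual_st]
lemmas \<eta>_simps [simp] = unit_hom[OF dual_st]

lemma end_ob [simp]: "g \<in> ob C"
  using end_limit unfolding limit_fan_def fan_def by blast

lemma j_hom [simp]: "m \<in> ob N \<Longrightarrow> j m \<in> arr C" "m \<in> ob N \<Longrightarrow> src C (j m) = g"
    "m \<in> ob N \<Longrightarrow> trg C (j m) = t0 T m m"
  using end_limit unfolding limit_fan_def fan_def Hom_iff by blast+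

lemma j_dinat: "f \<in> arr N \<Longrightarrow> t2 T (src N f) f \<cdot> j (src N f) = t1 T f (trg N f) \<cdot> j (trg N f)"
  using end_limit unfolding limit_fan_def fan_def by blast

text \<open>Tensoring on the left preserves the end because of the right dual, and tensoring on the
  right because of the left dual; arrows into all three kinds of products below may thus be compared
  after composition with \<open>j\<close>.\<close>

lemma lwh_end: "c \<in> ob C \<Longrightarrow> limit_fan C N (\<lambda>m. c \<sqdot> t0 T m m) (\<lambda>f. c \<triangleright> t2 T (src N f) f)
    (\<lambda>f. c \<triangleright> t1 T f (trg N f)) (c \<sqdot> g) (\<lambda>m. c \<triangleright> j m)"
  by (rule lwh_limit_fan[OF dual_rd end_limit]) simp_all

lemma rwh_end: "c \<in> ob C \<Longrightarrow> limit_fan C N (\<lambda>m. t0 T m m \<sqdot> c) (\<lambda>f. t2 T (src N f) f \<triangleleft> c)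
    (\<lambda>f. t1 T f (trg N f) \<triangleleft> c) (g \<sqdot> c) (\<lambda>m. j m \<triangleleft> c)"
  by (rule rwh_limit_fan[OF dual_st end_limit]) simp_all

lemma lwh_rwh_end: "c \<in> ob C \<Longrightarrow> d \<in> ob C \<Longrightarrow> limit_fan C N (\<lambda>m. c \<sqdot> (t0 T m m \<sqdot> d))
    (\<lambda>f. c \<triangleright> (t2 T (src N f) f \<triangleleft> d)) (\<lambda>f. c \<triangleright> (t1 T f (trg N f) \<triangleleft> d)) (c \<sqdot> (g \<sqdot> d))
    (\<lambda>m. c \<triangleright> (j m \<triangleleft> d))"
  by (rule lwh_limit_fan[OF dual_rd rwh_end]) simp_all

lemma lwh_end_inject:
  assumes "c \<in> ob C" "u \<in> arr C" "trg C u = c \<sqdot> g" "v \<in> arr C" "trg C v = c \<sqdot> g" "src C u = src C v"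
    and "\<And>m. m \<in> ob N \<Longrightarrow> c \<triangleright> j m \<cdot> u = c \<triangleright> j m \<cdot> v"
  shows "u = v"
  by (rule limit_fan_inject[OF lwh_end[OF assms(1)] category_axioms _ assms(2-7)]) (use assms(1) in simp_all)

lemma rwh_end_inject:
  assumes "c \<in> ob C" "u \<in> arr C" "trg C u = g \<sqdot> c" "v \<in> arr C" "trg C v = g \<sqdot> c" "src C u = src C v"
    and "\<And>m. m \<in> ob N \<Longrightarrow> j m \<triangleleft> c \<cdot> u = j m \<triangleleft> c \<cdot> v"
  shows "u = v"
  by (rule limit_fan_inject[OF rwh_end[OF assms(1)] category_axioms _ assms(2-7)]) (use assms(1) in simp_all)

definition \<gamma>_comp :: "'o \<Rightarrow> 'm \<Rightarrow> 'a" where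
  "\<gamma>_comp c m = rho T c m m \<cdot> t2 T (st S c \<bullet> m) (\<epsilon> c m) \<cdot> lam' T c (st S c \<bullet> m) (st S c \<bullet> m) \<cdot>
     c \<triangleright> j (st S c \<bullet> m)"

lemma \<gamma>_comp_hom [simp]:
  assumes "c \<in> ob C" "m \<in> ob N"
  shows "\<gamma>_comp c m \<in> arr C" "src C (\<gamma>_comp c m) = c \<sqdot> g" "trg C (\<gamma>_comp c m) = t0 T m m \<sqdot> c"
  using assms by (simp_all add: \<gamma>_comp_def)

text \<open>The arrow \<open>f\<close> travels inwards to the universal wedge, where dinaturality at
  \<open>st S c \<star> f\<close> moves it from the covariant to the contravariant variable, and
  then travels outwards again.\<close>

lemma \<gamma>_comp_dinat:
  assumes [simp]: "c \<in> ob C" "f \<in> arr N"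
  shows "t2 T (src N f) f \<triangleleft> c \<cdot> \<gamma>_comp c (src N f) = t1 T f (trg N f) \<triangleleft> c \<cdot> \<gamma>_comp c (trg N f)"
proof -
  let ?m = "src N f" and ?n = "trg N f"
  let ?m' = "st S c \<bullet> ?m" and ?n' = "st S c \<bullet> ?n"
  have 1: "t2 T ?m f \<triangleleft> c \<cdot> rho T c ?m ?m = rho T c ?m ?n \<cdot> t2 T ?m' f" by (simp add: rho_nat2)
  have 2: "t2 T ?m' f \<cdot> t2 T ?m' (\<epsilon> c ?m) = t2 T ?m' (\<epsilon> c ?n) \<cdot> t2 T ?m' (c \<star> (st S c \<star> f))"
    using counit_nat[OF dual_st, of c f] by (simp flip: t2_comp)
  have 3: "t2 T ?m' (c \<star> (st S c \<star> f)) \<cdot> lam' T c ?m' ?m' = lam' T c ?m' ?n' \<cdot> c \<triangleright> t2 T ?m' (st S c \<star> f)"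
    using lam'_nat2[of c "st S c \<star> f" ?m'] by simp
  have 4: "c \<triangleright> t2 T ?m' (st S c \<star> f) \<cdot> c \<triangleright> j ?m' = c \<triangleright> t1 T (st S c \<star> f) ?n' \<cdot> c \<triangleright> j ?n'"
    using j_dinat[of "st S c \<star> f"] by (simp flip: lwh_comp)
  have 5: "lam' T c ?m' ?n' \<cdot> c \<triangleright> t1 T (st S c \<star> f) ?n' = t1 T (st S c \<star> f) (c \<bullet> ?n') \<cdot> lam' T c ?n' ?n'"
    using lam'_nat1[of c "st S c \<star> f" ?n'] by simp
  have 6: "t2 T ?m' (\<epsilon> c ?n) \<cdot> t1 T (st S c \<star> f) (c \<bullet> ?n') = t1 T (st S c \<star> f) ?n \<cdot> t2 T ?n' (\<epsilon> c ?n)"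
    using t_inter[of "st S c \<star> f" "\<epsilon> c ?n"] by simp
  have 7: "rho T c ?m ?n \<cdot> t1 T (st S c \<star> f) ?n = t1 T f ?n \<triangleleft> c \<cdot> rho T c ?n ?n" by (simp add: rho_nat1)
  show ?thesis
    by (simp add: \<gamma>_comp_def comp_tail[OF 1] comp_tail[OF 2] comp_tail[OF 3] 4 comp_tail[OF 5]
        comp_tail[OF 6] comp_tail[OF 7])
qed

lemma \<gamma>_ex:
  assumes [simp]: "c \<in> ob C"
  shows "\<exists>!u. u \<in> Hom C (c \<sqdot> g) (g \<sqdot> c) \<and> (\<forall>m\<in>ob N. j m \<triangleleft> c \<cdot> u = \<gamma>_comp c m)"
proof -
  have "fan C N (\<lambda>m. t0 T m m \<sqdot> c) (\<lambda>f. t2 T (src N f) f \<triangleleft> c) (\<lambda>f. t1 T f (trg N f) \<triangleleft> c) (c \<sqdot> g) (\<gamma>_comp c)"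
    by (simp add: fan_def Hom_iff \<gamma>_comp_dinat)
  then show ?thesis using rwh_end[of c] by (simp add: limit_fan_def)
qed

definition \<gamma> :: "'o \<Rightarrow> 'a" where
  "\<gamma> c = (THE u. u \<in> Hom C (c \<sqdot> g) (g \<sqdot> c) \<and> (\<forall>m\<in>ob N. j m \<triangleleft> c \<cdot> u = \<gamma>_comp c m))"

lemma
  assumes "c \<in> ob C"
  shows \<gamma>_hom [simp]: "\<gamma> c \<in> arr C" "src C (\<gamma> c) = c \<sqdot> g" "trg C (\<gamma> c) = g \<sqdot> c"
    and j_\<gamma>: "m \<in> ob N \<Longrightarrow> j m \<triangleleft> c \<cdot> \<gamma> c = \<gamma>_comp c m"
  using theI'[OF \<gamma>_ex[OF assms]] by (simp_all add: \<gamma>_def Hom_iff)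

text \<open>The naturality of \<open>rho\<close> replaces \<open>f\<close> by its dual
  \<open>sa S f\<close> acting on \<open>m\<close>; dinaturality of the wedge moves this to the
  covariant variable, where the counit turns it back into \<open>f\<close>.\<close>

lemma \<gamma>_nat:
  assumes [simp]: "f \<in> arr C"
  shows "\<gamma> (trg C f) \<cdot> f \<triangleleft> g = g \<triangleright> f \<cdot> \<gamma> (src C f)"
proof (rule rwh_end_inject[of "trg C f"])
  fix m assume [simp]: "m \<in> ob N"
  let ?c = "src C f" and ?d = "trg C f"
  let ?m = "st S ?c \<bullet> m" and ?n = "st S ?d \<bullet> m" and ?h = "sa S f \<diamondop> m"
  have 1: "j m \<triangleleft> ?d \<cdot> g \<triangleright> f = t0 T m m \<triangleright> f \<cdot> j m \<triangleleft> ?c" using interchange[of "j m" f] by simp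
  have 2: "t0 T m m \<triangleright> f \<cdot> rho T ?c m m = rho T ?d m m \<cdot> t1 T ?h m" by (simp add: rho_nat)
  have 3: "t1 T ?h m \<cdot> t2 T ?m (\<epsilon> ?c m) = t2 T ?n (\<epsilon> ?c m) \<cdot> t1 T ?h (?c \<bullet> ?m)"
    using t_inter[of ?h "\<epsilon> ?c m"] by simp
  have 4: "t1 T ?h (?c \<bullet> ?m) \<cdot> lam' T ?c ?m ?m = lam' T ?c ?n ?m \<cdot> ?c \<triangleright> t1 T ?h ?m"
    using lam'_nat1[of ?c ?h ?m] by simp
  have 5: "?c \<triangleright> t1 T ?h ?m \<cdot> ?c \<triangleright> j ?m = ?c \<triangleright> t2 T ?n ?h \<cdot> ?c \<triangleright> j ?n"
    using j_dinat[of ?h] by (simp flip: lwh_comp)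
  have 6: "lam' T ?c ?n ?m \<cdot> ?c \<triangleright> t2 T ?n ?h = t2 T ?n (?c \<star> ?h) \<cdot> lam' T ?c ?n ?n"
    using lam'_nat2[of ?c ?h ?n] by simp
  \<comment> \<open>The dual of \<open>f\<close> under the counit at the source equals
    \<open>f\<close> itself under the counit at the target, because the two are mates.\<close>
  have 7: "t2 T ?n (\<epsilon> ?c m) \<cdot> t2 T ?n (?c \<star> ?h) = t2 T ?n (\<epsilon> ?d m) \<cdot> t2 T ?n (f \<diamondop> ?n)"
  proof -
    have "\<epsilon> ?c m \<circ>\<^sub>N ?c \<star> (sa S f \<diamondop> m) = \<epsilon> ?d m \<circ>\<^sub>N f \<diamondop> (st S ?d \<bullet> m)"
      by (rule counit_dinat) (simp_all add: ev_sa)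
    then show ?thesis by (simp flip: t2_comp)
  qed
  have 8: "t2 T ?n (f \<diamondop> ?n) \<cdot> lam' T ?c ?n ?n = lam' T ?d ?n ?n \<cdot> f \<triangleleft> t0 T ?n ?n" by (simp add: lam'_nat)
  have 9: "f \<triangleleft> t0 T ?n ?n \<cdot> ?c \<triangleright> j ?n = ?d \<triangleright> j ?n \<cdot> f \<triangleleft> g" using interchange[of f "j ?n"] by simp
  have "j m \<triangleleft> ?d \<cdot> g \<triangleright> f \<cdot> \<gamma> ?c = t0 T m m \<triangleright> f \<cdot> \<gamma>_comp ?c m" by (simp add: comp_tail[OF 1] j_\<gamma>)
  also have "\<dots> = \<gamma>_comp ?d m \<cdot> f \<triangleleft> g"
    by (simp add: \<gamma>_comp_def comp_tail[OF 2] comp_tail[OF 3] comp_tail[OF 4] 5 comp_tail[OF 6]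
        comp_tail[OF 7] comp_tail[OF 8] 9)
  finally show "j m \<triangleleft> ?d \<cdot> \<gamma> ?d \<cdot> f \<triangleleft> g = j m \<triangleleft> ?d \<cdot> g \<triangleright> f \<cdot> \<gamma> ?c"
    by (simp add: comp_tail[OF j_\<gamma>])
qed simp_all

text \<open>Dinaturality along \<open>?h\<close>, from \<open>m\<close> to the dual of \<I> acting
  on \<open>m\<close>, replaces the wedge component at the latter object by the one at
  \<open>m\<close>. The remaining constraints are those of \<I>.\<close>

lemma \<gamma>_unit: "\<gamma> \<I> = \<r>' g \<cdot> \<l> g"
proof (rule rwh_end_inject[of \<I>])
  fix m assume [simp]: "m \<in> ob N"
  let ?m = "st S \<I> \<bullet> m" and ?h = "uu S \<diamondop> m \<circ>\<^sub>N \<u>' m"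
  have 1: "rho T \<I> m m = \<r>' (t0 T m m) \<cdot> t1 T ?h m" by (simp flip: rho_unit del: t1_comp)
  have 2: "t1 T ?h m \<cdot> t2 T ?m (\<epsilon> \<I> m) = t2 T m (\<epsilon> \<I> m) \<cdot> t1 T ?h (\<I> \<bullet> ?m)"
    using t_inter[of ?h "\<epsilon> \<I> m"] by (simp del: t1_comp)
  have 3: "t1 T ?h (\<I> \<bullet> ?m) \<cdot> lam' T \<I> ?m ?m = lam' T \<I> m ?m \<cdot> \<I> \<triangleright> t1 T ?h ?m"
    using lam'_nat1[of \<I> ?h ?m] by (simp del: t1_comp)
  have 4: "\<I> \<triangleright> t1 T ?h ?m \<cdot> \<I> \<triangleright> j ?m = \<I> \<triangleright> t2 T m ?h \<cdot> \<I> \<triangleright> j m"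
    using j_dinat[of ?h] by (simp flip: lwh_comp del: t1_comp t2_comp)
  have 5: "lam' T \<I> m ?m \<cdot> \<I> \<triangleright> t2 T m ?h = t2 T m (\<I> \<star> ?h) \<cdot> lam' T \<I> m m"
    using lam'_nat2[of \<I> ?h m] by (simp del: t2_comp lac_comp)
  \<comment> \<open>The counit for \<I> becomes the unit constraint when the dual of \<I> is
    identified with \<I> through \<open>uu\<close>.\<close>
  have 6: "\<epsilon> \<I> m \<circ>\<^sub>N \<I> \<star> ?h = \<u> m"
  proof -
    have "\<epsilon> \<I> m \<circ>\<^sub>N \<I> \<star> (uu S \<diamondop> m) = \<u> m \<circ>\<^sub>N \<l> \<I> \<diamondop> m \<circ>\<^sub>N \<q> \<I> \<I> m"
      using counit_precomp[of \<I> "st S \<I>" "ev \<I>" "uu S" m] by (simp add: ev_uu counit_def[of _ "\<I>"])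
    from N.comp_tail[OF this, of "\<I> \<star> \<u>' m"] show ?thesis by (simp add: mtriangle' lun_run_unit)
  qed
  have 7: "t2 T m (\<epsilon> \<I> m) \<cdot> t2 T m (\<I> \<star> ?h) = t2 T m (\<u> m)"
    unfolding 6[symmetric] by (rule t2_comp[symmetric]) simp_all
  have 8: "\<l> (t0 T m m) \<cdot> \<I> \<triangleright> j m = j m \<cdot> \<l> g" using lun_nat[of "j m"] by simp
  have 9: "j m \<triangleleft> \<I> \<cdot> \<r>' g = \<r>' (t0 T m m) \<cdot> j m" using run'_nat[of "j m"] by simp
  have "\<gamma>_comp \<I> m = \<r>' (t0 T m m) \<cdot> \<l> (t0 T m m) \<cdot> \<I> \<triangleright> j m"
    by (simp add: \<gamma>_comp_def 1 comp_tail[OF 2] comp_tail[OF 3] 4 comp_tail[OF 5] comp_tail[OF 7]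
        comp_tail[OF lam'_unit] del: t1_comp t2_comp lac_comp)
  then show "j m \<triangleleft> \<I> \<cdot> \<gamma> \<I> = j m \<triangleleft> \<I> \<cdot> \<r>' g \<cdot> \<l> g"
    by (simp add: j_\<gamma> 8 comp_tail[OF 9])
qed simp_all

text \<open>The counit for the chosen dual of \<open>c \<sqdot> d\<close> is transported along
  \<open>nu S c d\<close> to the product of the chosen duals, where it is the nested composite of
  two counits.\<close>

lemma \<epsilon>_tensor:
  assumes [simp]: "c \<in> ob C" "d \<in> ob C" "m \<in> ob N"
  shows "\<epsilon> c m \<circ>\<^sub>N c \<star> \<epsilon> d (st S c \<bullet> m) \<circ>\<^sub>N \<p> c d (st S d \<bullet> (st S c \<bullet> m)) \<circ>\<^sub>N
    (c \<sqdot> d) \<star> (\<p> (st S d) (st S c) m \<circ>\<^sub>N nu S c d \<diamondop> m) = \<epsilon> (c \<sqdot> d) m"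
proof -
  have 1: "\<p> c d (st S d \<bullet> (st S c \<bullet> m)) \<circ>\<^sub>N (c \<sqdot> d) \<star> \<p> (st S d) (st S c) m =
      c \<star> (d \<star> \<p> (st S d) (st S c) m) \<circ>\<^sub>N \<p> c d ((st S d \<sqdot> st S c) \<bullet> m)"
    using mas_nat3[of "\<p> (st S d) (st S c) m" c d] by simp
  note h [simp] = tensor_ev_hom[OF dual_st[of c] dual_st[of d]]
  have ch [simp]: "counit (c \<sqdot> d) (st S d \<sqdot> st S c) (tensor_ev c (st S c) (ev c) d (st S d) (ev d)) m \<in> arr N"
    "src N (counit (c \<sqdot> d) (st S d \<sqdot> st S c) (tensor_ev c (st S c) (ev c) d (st S d) (ev d)) m) = (c \<sqdot> d) \<bullet> ((st S d \<sqdot> st S c) \<bullet> m)"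
    by (simp_all add: counit_def)
  have "\<epsilon> (c \<sqdot> d) m = counit (c \<sqdot> d) (st S d \<sqdot> st S c) (tensor_ev c (st S c) (ev c) d (st S d) (ev d)) m \<circ>\<^sub>N
      (c \<sqdot> d) \<star> (nu S c d \<diamondop> m)"
    using counit_precomp[of "c \<sqdot> d" "st S d \<sqdot> st S c" "tensor_ev c (st S c) (ev c) d (st S d) (ev d)" "nu S c d" m]
    by (simp add: ev_nu)
  also have "\<dots> = \<epsilon> c m \<circ>\<^sub>N c \<star> \<epsilon> d (st S c \<bullet> m) \<circ>\<^sub>N (c \<star> (d \<star> \<p> (st S d) (st S c) m) \<circ>\<^sub>N
      \<p> c d ((st S d \<sqdot> st S c) \<bullet> m)) \<circ>\<^sub>N (c \<sqdot> d) \<star> (nu S c d \<diamondop> m)"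
    by (simp add: counit_tensor[OF dual_st[of c] dual_st[of d]])
  also have "\<dots> = \<epsilon> c m \<circ>\<^sub>N c \<star> \<epsilon> d (st S c \<bullet> m) \<circ>\<^sub>N \<p> c d (st S d \<bullet> (st S c \<bullet> m)) \<circ>\<^sub>N
      (c \<sqdot> d) \<star> (\<p> (st S d) (st S c) m \<circ>\<^sub>N nu S c d \<diamondop> m)"
    unfolding 1[symmetric] by simp
  finally show ?thesis by simp
qed

lemma \<gamma>_tensor:
  assumes [simp]: "c \<in> ob C" "d \<in> ob C"
  shows "\<gamma> (c \<sqdot> d) = \<a> g c d \<cdot> \<gamma> c \<triangleleft> d \<cdot> \<b> c g d \<cdot> c \<triangleright> \<gamma> d \<cdot> \<a> c d g"
proof (rule rwh_end_inject[of "c \<sqdot> d"])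
  fix m assume [simp]: "m \<in> ob N"
  \<comment> \<open>The right-hand side evaluates the wedge at \<open>m2\<close>, where the duals of
    \<open>c\<close> and \<open>d\<close> act one after the other, the left-hand side at
    \<open>M\<close>, where the dual of \<open>c \<sqdot> d\<close> acts. The arrow
    \<open>\<tau>\<close> compares the two objects, and \<open>X\<close> is the nested counit at
    \<open>m2\<close>.\<close>
  define m1 where "m1 = st S c \<bullet> m"
  define m2 where "m2 = st S d \<bullet> m1"
  define M where "M = st S (c \<sqdot> d) \<bullet> m"
  define \<tau> where "\<tau> = \<p> (st S d) (st S c) m \<circ>\<^sub>N nu S c d \<diamondop> m"
  define X where "X = \<epsilon> c m \<circ>\<^sub>N c \<star> \<epsilon> d m1 \<circ>\<^sub>N \<p> c d m2"
  have o [simp]: "m1 \<in> ob N" "m2 \<in> ob N" "M \<in> ob N" by (simp_all add: m1_def m2_def M_def)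
  note [simp] = m1_def[symmetric] m2_def[symmetric] M_def[symmetric]
  have \<tau> [simp]: "\<tau> \<in> arr N" "src N \<tau> = M" "trg N \<tau> = m2" by (simp_all add: \<tau>_def)
  have X [simp]: "X \<in> arr N" "src N X = (c \<sqdot> d) \<bullet> m2" "trg N X = m" by (simp_all add: X_def)
  have g1: "\<gamma>_comp c m = rho T c m m \<cdot> t2 T m1 (\<epsilon> c m) \<cdot> lam' T c m1 m1 \<cdot> c \<triangleright> j m1"
    by (simp add: \<gamma>_comp_def)
  have g2: "\<gamma>_comp d m1 = rho T d m1 m1 \<cdot> t2 T m2 (\<epsilon> d m1) \<cdot> lam' T d m2 m2 \<cdot> d \<triangleright> j m2"
    by (simp add: \<gamma>_comp_def)
  have 1: "j m \<triangleleft> (c \<sqdot> d) \<cdot> \<a> g c d = \<a> (t0 T m m) c d \<cdot> j m \<triangleleft> c \<triangleleft> d" using asc_nat1[of "j m" c d] by simp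
  have 2: "j m \<triangleleft> c \<triangleleft> d \<cdot> \<gamma> c \<triangleleft> d = rho T c m m \<triangleleft> d \<cdot> t2 T m1 (\<epsilon> c m) \<triangleleft> d \<cdot> lam' T c m1 m1 \<triangleleft> d \<cdot> (c \<triangleright> j m1) \<triangleleft> d"
    using arg_cong[OF j_\<gamma>[of c m], of "\<lambda>f. f \<triangleleft> d"] by (simp add: g1)
  have 3: "(c \<triangleright> j m1) \<triangleleft> d \<cdot> \<b> c g d = \<b> c (t0 T m1 m1) d \<cdot> c \<triangleright> (j m1 \<triangleleft> d)" using asc'_nat2[of "j m1" c d] by simp
  have 4: "c \<triangleright> (j m1 \<triangleleft> d) \<cdot> c \<triangleright> \<gamma> d = c \<triangleright> rho T d m1 m1 \<cdot> c \<triangleright> t2 T m2 (\<epsilon> d m1) \<cdot> c \<triangleright> lam' T d m2 m2 \<cdot> c \<triangleright> (d \<triangleright> j m2)"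
    using arg_cong[OF j_\<gamma>[of d m1], of "\<lambda>f. c \<triangleright> f"] by (simp add: g2)
  have 5: "lam' T c m1 m1 \<triangleleft> d \<cdot> \<b> c (t0 T m1 m1) d \<cdot> c \<triangleright> rho T d m1 m1 = rho T d m1 (c \<bullet> m1) \<cdot> lam' T c m2 m1"
    using lam_rho'[of c d m1 m1] by simp
  have 6: "t2 T m1 (\<epsilon> c m) \<triangleleft> d \<cdot> rho T d m1 (c \<bullet> m1) = rho T d m1 m \<cdot> t2 T m2 (\<epsilon> c m)"
    using rho_nat2[of d "\<epsilon> c m" m1] by simp
  have 7: "lam' T c m2 m1 \<cdot> c \<triangleright> t2 T m2 (\<epsilon> d m1) = t2 T m2 (c \<star> \<epsilon> d m1) \<cdot> lam' T c m2 (d \<bullet> m2)"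
    using lam'_nat2[of c "\<epsilon> d m1" m2] by simp
  have 8: "c \<triangleright> (d \<triangleright> j m2) \<cdot> \<a> c d g = \<a> c d (t0 T m2 m2) \<cdot> (c \<sqdot> d) \<triangleright> j m2" using asc_nat3[of "j m2" c d] by simp
  have 9: "lam' T c m2 (d \<bullet> m2) \<cdot> c \<triangleright> lam' T d m2 m2 \<cdot> \<a> c d (t0 T m2 m2) = t2 T m2 (\<p> c d m2) \<cdot> lam' T (c \<sqdot> d) m2 m2"
    by (simp add: lam'_assoc)
  have 10: "t2 T m2 (\<epsilon> c m) \<cdot> t2 T m2 (c \<star> \<epsilon> d m1) \<cdot> t2 T m2 (\<p> c d m2) = t2 T m2 X"
    by (simp add: X_def)
  have 11: "\<a> (t0 T m m) c d \<cdot> rho T c m m \<triangleleft> d \<cdot> rho T d m1 m = rho T (c \<sqdot> d) m m \<cdot> t1 T \<tau> m"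
    using rho_assoc[of c d m m] by (simp add: \<tau>_def)
  have 12: "t1 T \<tau> m \<cdot> t2 T m2 X = t2 T M X \<cdot> t1 T \<tau> ((c \<sqdot> d) \<bullet> m2)" using t_inter[of \<tau> X] by simp
  have 13: "t1 T \<tau> ((c \<sqdot> d) \<bullet> m2) \<cdot> lam' T (c \<sqdot> d) m2 m2 = lam' T (c \<sqdot> d) M m2 \<cdot> (c \<sqdot> d) \<triangleright> t1 T \<tau> m2"
    using lam'_nat1[of "c \<sqdot> d" \<tau> m2] by simp
  \<comment> \<open>Here the wedge is moved from \<open>m2\<close> to \<open>M\<close>. The steps
    before it bring the arrow \<tau>, produced by \<open>rho_assoc\<close>, next to the wedge; those
    after it combine \<tau> with \<open>X\<close> to the counit for
    \<open>c \<sqdot> d\<close>.\<close>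
  have 14: "(c \<sqdot> d) \<triangleright> t1 T \<tau> m2 \<cdot> (c \<sqdot> d) \<triangleright> j m2 = (c \<sqdot> d) \<triangleright> t2 T M \<tau> \<cdot> (c \<sqdot> d) \<triangleright> j M"
    using j_dinat[of \<tau>] by (simp flip: lwh_comp)
  have 15: "lam' T (c \<sqdot> d) M m2 \<cdot> (c \<sqdot> d) \<triangleright> t2 T M \<tau> = t2 T M ((c \<sqdot> d) \<star> \<tau>) \<cdot> lam' T (c \<sqdot> d) M M"
    using lam'_nat2[of "c \<sqdot> d" \<tau> M] by simp
  have 16: "t2 T M X \<cdot> t2 T M ((c \<sqdot> d) \<star> \<tau>) = t2 T M (\<epsilon> (c \<sqdot> d) m)"
  proof -
    have "X \<circ>\<^sub>N (c \<sqdot> d) \<star> \<tau> = \<epsilon> (c \<sqdot> d) m"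
      using \<epsilon>_tensor[of c d m] by (simp add: X_def \<tau>_def)
    then show ?thesis by (simp flip: t2_comp)
  qed
  have "j m \<triangleleft> (c \<sqdot> d) \<cdot> \<a> g c d \<cdot> \<gamma> c \<triangleleft> d \<cdot> \<b> c g d \<cdot> c \<triangleright> \<gamma> d \<cdot> \<a> c d g =
      \<a> (t0 T m m) c d \<cdot> rho T c m m \<triangleleft> d \<cdot> rho T d m1 m \<cdot>
      (t2 T m2 (\<epsilon> c m) \<cdot> t2 T m2 (c \<star> \<epsilon> d m1) \<cdot> t2 T m2 (\<p> c d m2)) \<cdot> lam' T (c \<sqdot> d) m2 m2 \<cdot> (c \<sqdot> d) \<triangleright> j m2"
    by (simp add: comp_tail[OF 1] comp_tail[OF 2] comp_tail[OF 3] comp_tail[OF 4] comp_tail3[OF 5]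
        comp_tail[OF 6] comp_tail[OF 7] 8 comp_tail3[OF 9])
  also have "\<dots> = \<gamma>_comp (c \<sqdot> d) m"
    unfolding 10
    by (simp add: comp_tail3[OF 11] comp_tail[OF 12] comp_tail[OF 13] 14 comp_tail[OF 15] comp_tail[OF 16]
        \<gamma>_comp_def)
  finally show "j m \<triangleleft> (c \<sqdot> d) \<cdot> \<gamma> (c \<sqdot> d) =
      j m \<triangleleft> (c \<sqdot> d) \<cdot> \<a> g c d \<cdot> \<gamma> c \<triangleleft> d \<cdot> \<b> c g d \<cdot> c \<triangleright> \<gamma> d \<cdot> \<a> c d g"
    by (simp add: j_\<gamma>)
qed simp_all

section \<open>The inverse half-braiding\<close>

text \<open>The component of the inverse arrow from \<open>g \<sqdot> c\<close> to
  \<open>c \<sqdot> g\<close>: the wedge is taken at \<open>c \<bullet> m\<close>, the constraint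
  \<open>rho\<close> is used backwards, and the unit of the adjunction replaces the counit.\<close>

definition \<beta>_comp :: "'o \<Rightarrow> 'm \<Rightarrow> 'a" where
  "\<beta>_comp c m = lam T c m m \<cdot> t1 T (\<eta> c m) (c \<bullet> m) \<cdot> rho' T c (c \<bullet> m) (c \<bullet> m) \<cdot> j (c \<bullet> m) \<triangleleft> c"

text \<open>In each composite the wedge is moved by dinaturality along a counit or a unit until a
  counit and a unit stand next to each other, and the triangle identities cancel them. The formula
  by which \<open>b\<close> is obtained does not enter, only its components.\<close>

lemma inverse_of_\<gamma>:
  assumes [simp]: "c \<in> ob C" "b \<in> arr C" "src C b = g \<sqdot> c" "trg C b = c \<sqdot> g"
    and b: "\<And>m. m \<in> ob N \<Longrightarrow> c \<triangleright> j m \<cdot> b = \<beta>_comp c m"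
  shows "iso_pair C (\<gamma> c) b (c \<sqdot> g) (g \<sqdot> c)"
proof -
  have "\<gamma> c \<cdot> b = idt C (g \<sqdot> c)"
  proof (rule rwh_end_inject[of c])
    fix m assume [simp]: "m \<in> ob N"
    let ?m = "st S c \<bullet> m"
    have 1: "t2 T ?m (\<epsilon> c m) \<cdot> t1 T (\<eta> c ?m) (c \<bullet> ?m) = t1 T (\<eta> c ?m) m \<cdot> t2 T (st S c \<bullet> (c \<bullet> ?m)) (\<epsilon> c m)"
      using t_inter[of "\<eta> c ?m" "\<epsilon> c m"] by simp
    have 2: "t2 T (st S c \<bullet> (c \<bullet> ?m)) (\<epsilon> c m) \<cdot> rho' T c (c \<bullet> ?m) (c \<bullet> ?m) =
        rho' T c (c \<bullet> ?m) m \<cdot> t2 T (c \<bullet> ?m) (\<epsilon> c m) \<triangleleft> c"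
      using rho'_nat2[of c "\<epsilon> c m" "c \<bullet> ?m"] by simp
    have 3: "t2 T (c \<bullet> ?m) (\<epsilon> c m) \<triangleleft> c \<cdot> j (c \<bullet> ?m) \<triangleleft> c = t1 T (\<epsilon> c m) m \<triangleleft> c \<cdot> j m \<triangleleft> c"
      using j_dinat[of "\<epsilon> c m"] by (simp flip: rwh_comp)
    have 4: "rho' T c (c \<bullet> ?m) m \<cdot> t1 T (\<epsilon> c m) m \<triangleleft> c = t1 T (st S c \<star> \<epsilon> c m) m \<cdot> rho' T c m m"
      using rho'_nat1[of c "\<epsilon> c m" m] by simp
    have 5: "t1 T (\<eta> c ?m) m \<cdot> t1 T (st S c \<star> \<epsilon> c m) m = idt C (t0 T ?m m)"
      using unit_counit[OF dual_st, of c m] by (simp flip: t1_comp)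
    have "j m \<triangleleft> c \<cdot> \<gamma> c \<cdot> b = \<gamma>_comp c m \<cdot> b" by (simp add: comp_tail[OF j_\<gamma>])
    also have "\<dots> = j m \<triangleleft> c"
      by (simp add: \<gamma>_comp_def b \<beta>_comp_def comp_tail[OF 1] comp_tail[OF 2] 3 comp_tail[OF 4] comp_tail[OF 5])
    finally show "j m \<triangleleft> c \<cdot> \<gamma> c \<cdot> b = j m \<triangleleft> c \<cdot> idt C (g \<sqdot> c)" by simp
  qed simp_all
  moreover have "b \<cdot> \<gamma> c = idt C (c \<sqdot> g)"
  proof (rule lwh_end_inject[of c])
    fix m assume [simp]: "m \<in> ob N"
    let ?m = "st S c \<bullet> (c \<bullet> m)"
    have 1: "t1 T (\<eta> c m) (c \<bullet> m) \<cdot> t2 T ?m (\<epsilon> c (c \<bullet> m)) = t2 T m (\<epsilon> c (c \<bullet> m)) \<cdot> t1 T (\<eta> c m) (c \<bullet> ?m)"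
      using t_inter[of "\<eta> c m" "\<epsilon> c (c \<bullet> m)"] by simp
    have 2: "t1 T (\<eta> c m) (c \<bullet> ?m) \<cdot> lam' T c ?m ?m = lam' T c m ?m \<cdot> c \<triangleright> t1 T (\<eta> c m) ?m"
      using lam'_nat1[of c "\<eta> c m" ?m] by simp
    have 3: "c \<triangleright> t1 T (\<eta> c m) ?m \<cdot> c \<triangleright> j ?m = c \<triangleright> t2 T m (\<eta> c m) \<cdot> c \<triangleright> j m"
      using j_dinat[of "\<eta> c m"] by (simp flip: lwh_comp)
    have 4: "lam' T c m ?m \<cdot> c \<triangleright> t2 T m (\<eta> c m) = t2 T m (c \<star> \<eta> c m) \<cdot> lam' T c m m"
      using lam'_nat2[of c "\<eta> c m" m] by simp
    have 5: "t2 T m (\<epsilon> c (c \<bullet> m)) \<cdot> t2 T m (c \<star> \<eta> c m) = idt C (t0 T m (c \<bullet> m))"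
      using counit_unit[OF dual_st, of c m] by (simp flip: t2_comp)
    have 6: "j (c \<bullet> m) \<triangleleft> c \<cdot> \<gamma> c = \<gamma>_comp c (c \<bullet> m)" by (simp add: j_\<gamma>)
    have "c \<triangleright> j m \<cdot> b \<cdot> \<gamma> c = \<beta>_comp c m \<cdot> \<gamma> c" by (simp add: comp_tail[OF b])
    also have "\<dots> = c \<triangleright> j m"
      by (simp add: \<beta>_comp_def 6 \<gamma>_comp_def comp_tail[OF 1] comp_tail[OF 2] 3 comp_tail[OF 4] comp_tail[OF 5])
    finally show "c \<triangleright> j m \<cdot> b \<cdot> \<gamma> c = c \<triangleright> j m \<cdot> idt C (c \<sqdot> g)" by simp
  qed simp_all
  ultimately show ?thesis by (simp add: iso_pair_def Hom_iff)
qed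

text \<open>The wedge component at \<open>c \<bullet> m\<close> followed by the identification of
  \<open>T (c \<bullet> m) (c \<bullet> m)\<close> with
  \<open>c \<sqdot> (T m m \<sqdot> rd c)\<close>. Since \<open>rho\<close> is formulated with left
  duals, the object \<open>c\<close> in the contravariant variable has to be seen as the left dual
  of \<open>rd c\<close>, through \<theta>.\<close>

definition \<delta>_comp :: "'o \<Rightarrow> 'm \<Rightarrow> 'a" where
  "\<delta>_comp c m = \<a> c (t0 T m m) (rd c) \<cdot> lam T c m m \<triangleleft> rd c \<cdot> rho T (rd c) m (c \<bullet> m) \<cdot>
     t1 T (\<theta> c \<diamondop> m) (c \<bullet> m) \<cdot> j (c \<bullet> m)"

lemma \<delta>_ex:
  assumes [simp]: "c \<in> ob C"
  shows "\<exists>!u. u \<in> Hom C g (c \<sqdot> (g \<sqdot> rd c)) \<and> (\<forall>m\<in>ob N. c \<triangleright> (j m \<triangleleft> rd c) \<cdot> u = \<delta>_comp c m)"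
proof -
  have "c \<triangleright> (t2 T (src N f) f \<triangleleft> rd c) \<cdot> \<delta>_comp c (src N f) = c \<triangleright> (t1 T f (trg N f) \<triangleleft> rd c) \<cdot> \<delta>_comp c (trg N f)"
    if [simp]: "f \<in> arr N" for f
  proof -
    let ?m = "src N f" and ?n = "trg N f" and ?e = "rd c"
    let ?s = "st S ?e"
    have 1: "c \<triangleright> (t2 T ?m f \<triangleleft> ?e) \<cdot> \<a> c (t0 T ?m ?m) ?e = \<a> c (t0 T ?m ?n) ?e \<cdot> (c \<triangleright> t2 T ?m f) \<triangleleft> ?e"
      using asc_nat2[of "t2 T ?m f" c ?e] by simp
    have 2: "(c \<triangleright> t2 T ?m f) \<triangleleft> ?e \<cdot> lam T c ?m ?m \<triangleleft> ?e = lam T c ?m ?n \<triangleleft> ?e \<cdot> t2 T ?m (c \<star> f) \<triangleleft> ?e"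
      using lam_nat2[of c f ?m] by (simp flip: rwh_comp)
    have 3: "t2 T ?m (c \<star> f) \<triangleleft> ?e \<cdot> rho T ?e ?m (c \<bullet> ?m) = rho T ?e ?m (c \<bullet> ?n) \<cdot> t2 T (?s \<bullet> ?m) (c \<star> f)"
      using rho_nat2[of ?e "c \<star> f" ?m] by simp
    have 4: "t2 T (?s \<bullet> ?m) (c \<star> f) \<cdot> t1 T (\<theta> c \<diamondop> ?m) (c \<bullet> ?m) = t1 T (\<theta> c \<diamondop> ?m) (c \<bullet> ?n) \<cdot> t2 T (c \<bullet> ?m) (c \<star> f)"
      using t_inter[of "\<theta> c \<diamondop> ?m" "c \<star> f"] by simp
    have 5: "t2 T (c \<bullet> ?m) (c \<star> f) \<cdot> j (c \<bullet> ?m) = t1 T (c \<star> f) (c \<bullet> ?n) \<cdot> j (c \<bullet> ?n)"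
      using j_dinat[of "c \<star> f"] by simp
    have 6: "t1 T (\<theta> c \<diamondop> ?m) (c \<bullet> ?n) \<cdot> t1 T (c \<star> f) (c \<bullet> ?n) = t1 T (?s \<star> f) (c \<bullet> ?n) \<cdot> t1 T (\<theta> c \<diamondop> ?n) (c \<bullet> ?n)"
      using minterchange[of "\<theta> c" f] by (simp flip: t1_comp)
    have 7: "rho T ?e ?m (c \<bullet> ?n) \<cdot> t1 T (?s \<star> f) (c \<bullet> ?n) = t1 T f (c \<bullet> ?n) \<triangleleft> ?e \<cdot> rho T ?e ?n (c \<bullet> ?n)"
      by (simp add: rho_nat1)
    have 8: "lam T c ?m ?n \<triangleleft> ?e \<cdot> t1 T f (c \<bullet> ?n) \<triangleleft> ?e = (c \<triangleright> t1 T f ?n) \<triangleleft> ?e \<cdot> lam T c ?n ?n \<triangleleft> ?e"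
      using lam_nat1[of c f ?n] by (simp flip: rwh_comp)
    have 9: "\<a> c (t0 T ?m ?n) ?e \<cdot> (c \<triangleright> t1 T f ?n) \<triangleleft> ?e = c \<triangleright> (t1 T f ?n \<triangleleft> ?e) \<cdot> \<a> c (t0 T ?n ?n) ?e"
      using asc_nat2[of "t1 T f ?n" c ?e] by simp
    show ?thesis
      by (simp add: \<delta>_comp_def comp_tail[OF 1] comp_tail[OF 2] comp_tail[OF 3] comp_tail[OF 4] 5
          comp_tail[OF 6] comp_tail[OF 7] comp_tail[OF 8] comp_tail[OF 9])
  qed
  then have "fan C N (\<lambda>m. c \<sqdot> (t0 T m m \<sqdot> rd c)) (\<lambda>f. c \<triangleright> (t2 T (src N f) f \<triangleleft> rd c))
      (\<lambda>f. c \<triangleright> (t1 T f (trg N f) \<triangleleft> rd c)) g (\<delta>_comp c)"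
    by (simp add: fan_def Hom_iff \<delta>_comp_def)
  then show ?thesis using lwh_rwh_end[of c "rd c"] by (simp add: limit_fan_def)
qed

text \<open>The left-hand side is what remains of \<open>sa S (evr c)\<close> after the constraints of \<open>st\<close> have been
  absorbed.\<close>

lemma cv_eq:
  assumes [simp]: "c \<in> ob C"
  shows "st S c \<triangleright> \<theta> c \<cdot> nu S (rd c) c \<cdot> sa S (evr c) \<cdot> uu S = cv c"
proof -
  let ?r = "rd c" and ?s = "st S c" and ?w = "st S (rd c)"
  let ?f = "nu S ?r c \<cdot> sa S (evr c) \<cdot> uu S"
  let ?F = "?s \<triangleright> \<theta> c \<cdot> ?f"
  \<comment> \<open>\<open>?q\<close> is the transpose of \<open>?F\<close> for the pair of
    \<open>c\<close> and its left dual. The transpose of \<open>cv c\<close> is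
    \<open>\<r> c\<close> by a zigzag identity, so the goal becomes \<open>?q = \<r> c\<close>,
    which is tested by \<open>evr c\<close>.\<close>
  let ?q = "\<l> c \<cdot> ev c \<triangleleft> c \<cdot> \<b> c ?s c \<cdot> c \<triangleright> ?F"
  note [simp] = tensor_ev_hom[OF dual_st[of ?r] dual_st[of c]]
  have 1: "ev (?r \<sqdot> c) \<cdot> (?r \<sqdot> c) \<triangleright> sa S (evr c) = ev \<I> \<cdot> evr c \<triangleleft> st S \<I>"
    using ev_sa[of "evr c"] by simp
  have 2: "evr c \<triangleleft> st S \<I> \<cdot> (?r \<sqdot> c) \<triangleright> uu S = \<I> \<triangleright> uu S \<cdot> evr c \<triangleleft> \<I>"
    using interchange[of "evr c" "uu S"] by simp
  \<comment> \<open>The compatibility of evaluations with \<open>nu\<close>, \<open>sa\<close> and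
    \<open>uu\<close> removes these arrows one after the other and leaves \<open>evr c\<close> up to
    unit constraints.\<close>
  have 3: "tensor_ev ?r ?w (ev ?r) c ?s (ev c) \<cdot> (?r \<sqdot> c) \<triangleright> ?f = \<r> \<I> \<cdot> evr c \<triangleleft> \<I>"
  proof -
    have "tensor_ev ?r ?w (ev ?r) c ?s (ev c) \<cdot> (?r \<sqdot> c) \<triangleright> ?f =
        ev (?r \<sqdot> c) \<cdot> (?r \<sqdot> c) \<triangleright> sa S (evr c) \<cdot> (?r \<sqdot> c) \<triangleright> uu S"
      by (simp add: ev_nu)
    also have "\<dots> = \<r> \<I> \<cdot> evr c \<triangleleft> \<I>"
      by (simp add: comp_tail[OF 1] 2 comp_tail[OF ev_uu] lun_run_unit)
    finally show ?thesis .
  qed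
  have 4: "\<a> ?r c (?s \<sqdot> ?w) \<cdot> (?r \<sqdot> c) \<triangleright> ?f = ?r \<triangleright> (c \<triangleright> ?f) \<cdot> \<a> ?r c \<I>"
    using asc_nat3[of ?f ?r c] by simp
  have 5: "\<theta> c \<cdot> \<l> ?w = \<l> c \<cdot> \<I> \<triangleright> \<theta> c" using lun_nat[of "\<theta> c"] by simp
  have 6: "\<I> \<triangleright> \<theta> c \<cdot> ev c \<triangleleft> ?w = ev c \<triangleleft> c \<cdot> (c \<sqdot> ?s) \<triangleright> \<theta> c" using interchange[of "ev c" "\<theta> c"] by simp
  have 7: "(c \<sqdot> ?s) \<triangleright> \<theta> c \<cdot> \<b> c ?s ?w = \<b> c ?s c \<cdot> c \<triangleright> (?s \<triangleright> \<theta> c)" using asc'_nat3[of "\<theta> c" c ?s] by simp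
  have 8: "\<theta> c \<cdot> \<l> ?w \<cdot> ev c \<triangleleft> ?w \<cdot> \<b> c ?s ?w \<cdot> c \<triangleright> ?f = ?q"
    by (simp add: comp_tail[OF 5] comp_tail[OF 6] comp_tail[OF 7])
  \<comment> \<open>The outer part of the nested evaluation is that of \<open>rd c\<close>, which is
    \<open>evr c\<close> after \<theta>. Moving \<theta> inwards turns the remaining arrow into
    \<open>?q\<close>.\<close>
  have "tensor_ev ?r ?w (ev ?r) c ?s (ev c) \<cdot> (?r \<sqdot> c) \<triangleright> ?f =
      evr c \<cdot> ?r \<triangleright> (\<theta> c \<cdot> \<l> ?w \<cdot> ev c \<triangleleft> ?w \<cdot> \<b> c ?s ?w \<cdot> c \<triangleright> ?f) \<cdot> \<a> ?r c \<I>"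
    using 4 by (simp add: tensor_ev_def comp_tail[OF evr_\<theta>])
  then have 9: "(evr c \<cdot> ?r \<triangleright> ?q) \<cdot> \<a> ?r c \<I> = \<r> \<I> \<cdot> evr c \<triangleleft> \<I>"
    unfolding 3 8 by simp
  have 10: "(evr c \<cdot> ?r \<triangleright> \<r> c) \<cdot> \<a> ?r c \<I> = \<r> \<I> \<cdot> evr c \<triangleleft> \<I>"
    using run_nat[of "evr c"] by (simp add: run_tensor')
  have 11: "evr c \<cdot> ?r \<triangleright> ?q = evr c \<cdot> ?r \<triangleright> \<r> c"
    by (rule iso_epi[OF asc_iso trans[OF 9 10[symmetric]]]) simp_all
  have "?q = \<r> c"
    by (rule ev_inject[OF dual_rd _ _ _ _ _ 11]) simp_all
  then have "\<l> c \<cdot> ev c \<triangleleft> c \<cdot> \<b> c ?s c \<cdot> c \<triangleright> ?F = \<l> c \<cdot> ev c \<triangleleft> c \<cdot> \<b> c ?s c \<cdot> c \<triangleright> cv c"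
    unfolding duality_zigzag2[OF dual_st, OF assms] .
  then show ?thesis by (rule counit_inject[OF dual_st, rotated -1]) simp_all
qed

text \<open>Evaluating \<open>rd c\<close> against \<open>c\<close> turns the constraint for
  \<open>rd c\<close> into the inverse of the constraint for \<open>c\<close>. After composition
  with \<open>rho T c\<close> there are two constraints, which \<open>rho_assoc\<close> merges into
  one for \<open>rd c \<sqdot> c\<close>; naturality carries \<open>evr c\<close> through it, and
  \<open>cv_eq\<close> identifies the arrow that remains as a unit of the adjunction.\<close>

lemma rho_rho:
  assumes [simp]: "c \<in> ob C" "m \<in> ob N" "n \<in> ob N"
  shows "\<r> (t0 T m n) \<cdot> t0 T m n \<triangleright> evr c \<cdot> \<a> (t0 T m n) (rd c) c \<cdot> rho T (rd c) m n \<triangleleft> c \<cdot>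
    t1 T (\<theta> c \<diamondop> m) n \<triangleleft> c = t1 T (\<eta> c m) n \<cdot> rho' T c (c \<bullet> m) n"
proof -
  let ?t = "t0 T m n" and ?r = "rd c" and ?s = "st S c" and ?w = "st S (rd c)"
  have 1: "t1 T (\<theta> c \<diamondop> m) n \<triangleleft> c \<cdot> rho T c (c \<bullet> m) n = rho T c (?w \<bullet> m) n \<cdot> t1 T (?s \<star> (\<theta> c \<diamondop> m)) n"
    using rho_nat1[of c "\<theta> c \<diamondop> m" n] by simp
  have 2: "\<a> ?t ?r c \<cdot> rho T ?r m n \<triangleleft> c \<cdot> rho T c (?w \<bullet> m) n =
      rho T (?r \<sqdot> c) m n \<cdot> t1 T (nu S ?r c \<diamondop> m) n \<cdot> t1 T (\<p> ?s ?w m) n"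
    using rho_assoc[of ?r c m n] by simp
  have 3: "?t \<triangleright> evr c \<cdot> rho T (?r \<sqdot> c) m n = rho T \<I> m n \<cdot> t1 T (sa S (evr c) \<diamondop> m) n"
    using rho_nat[of "evr c" m n] by simp
  have 4: "\<r> ?t \<cdot> rho T \<I> m n = t1 T (\<u>' m) n \<cdot> t1 T (uu S \<diamondop> m) n" by (simp add: rho_unit)
  have 5: "?s \<star> (\<theta> c \<diamondop> m) \<circ>\<^sub>N \<p> ?s ?w m = \<p> ?s c m \<circ>\<^sub>N (?s \<triangleright> \<theta> c) \<diamondop> m"
    using mas_nat2[of "\<theta> c" ?s m] by simp
  have 6: "?s \<star> (\<theta> c \<diamondop> m) \<circ>\<^sub>N \<p> ?s ?w m \<circ>\<^sub>N nu S ?r c \<diamondop> m \<circ>\<^sub>N sa S (evr c) \<diamondop> m \<circ>\<^sub>N uu S \<diamondop> m \<circ>\<^sub>N \<u>' m = \<eta> c m"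
    using arg_cong[OF cv_eq[OF assms(1)], of "\<lambda>f. \<p> ?s c m \<circ>\<^sub>N f \<diamondop> m \<circ>\<^sub>N \<u>' m"]
    by (simp add: N.comp_tail[OF 5] unit_def)
  have "(\<r> ?t \<cdot> ?t \<triangleright> evr c \<cdot> \<a> ?t ?r c \<cdot> rho T ?r m n \<triangleleft> c \<cdot> t1 T (\<theta> c \<diamondop> m) n \<triangleleft> c) \<cdot> rho T c (c \<bullet> m) n =
      t1 T (?s \<star> (\<theta> c \<diamondop> m) \<circ>\<^sub>N \<p> ?s ?w m \<circ>\<^sub>N nu S ?r c \<diamondop> m \<circ>\<^sub>N sa S (evr c) \<diamondop> m \<circ>\<^sub>N uu S \<diamondop> m \<circ>\<^sub>N \<u>' m) n"
    by (simp add: 1 comp_tail3[OF 2] comp_tail[OF 3] comp_tail[OF 4])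
  then have e: "(\<r> ?t \<cdot> ?t \<triangleright> evr c \<cdot> \<a> ?t ?r c \<cdot> rho T ?r m n \<triangleleft> c \<cdot> t1 T (\<theta> c \<diamondop> m) n \<triangleleft> c) \<cdot> rho T c (c \<bullet> m) n =
      (t1 T (\<eta> c m) n \<cdot> rho' T c (c \<bullet> m) n) \<cdot> rho T c (c \<bullet> m) n"
    unfolding 6 by simp
  show ?thesis by (rule iso_epi[OF rho_iso e]) simp_all
qed

definition \<beta> :: "'o \<Rightarrow> 'a \<Rightarrow> 'a" where
  "\<beta> c \<delta> = c \<triangleright> \<r> g \<cdot> c \<triangleright> (g \<triangleright> evr c) \<cdot> c \<triangleright> \<a> g (rd c) c \<cdot> \<a> c (g \<sqdot> rd c) c \<cdot> \<delta> \<triangleleft> c"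

lemma \<beta>_hom [simp]:
  assumes "c \<in> ob C" "\<delta> \<in> arr C" "src C \<delta> = g" "trg C \<delta> = c \<sqdot> (g \<sqdot> rd c)"
  shows "\<beta> c \<delta> \<in> arr C" "src C (\<beta> c \<delta>) = g \<sqdot> c" "trg C (\<beta> c \<delta>) = c \<sqdot> g"
  using assms by (simp_all add: \<beta>_def)

text \<open>The wedge is moved inwards until it meets \<delta> and yields
  \<open>\<delta>_comp\<close>. The pentagon then separates \<open>lam\<close> from the factors
  \<open>rd c\<close> and \<open>c\<close>, so that the evaluation acts on the constraint
  \<open>rho\<close> alone and \<open>rho_rho\<close> applies.\<close>

lemma j_\<beta>:
  assumes [simp]: "c \<in> ob C" "\<delta> \<in> arr C" "src C \<delta> = g" "trg C \<delta> = c \<sqdot> (g \<sqdot> rd c)" "m \<in> ob N"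
    and \<delta>: "c \<triangleright> (j m \<triangleleft> rd c) \<cdot> \<delta> = \<delta>_comp c m"
  shows "c \<triangleright> j m \<cdot> \<beta> c \<delta> = \<beta>_comp c m"
proof -
  let ?t = "t0 T m m" and ?r = "rd c" and ?t' = "t0 T m (c \<bullet> m)"
  have 1: "c \<triangleright> j m \<cdot> c \<triangleright> \<r> g = c \<triangleright> \<r> ?t \<cdot> c \<triangleright> (j m \<triangleleft> \<I>)" using run_nat[of "j m"] by (simp flip: lwh_comp)
  have 2: "c \<triangleright> (j m \<triangleleft> \<I>) \<cdot> c \<triangleright> (g \<triangleright> evr c) = c \<triangleright> (?t \<triangleright> evr c) \<cdot> c \<triangleright> (j m \<triangleleft> (?r \<sqdot> c))"
    using interchange[of "j m" "evr c"] by (simp flip: lwh_comp)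
  have 3: "c \<triangleright> (j m \<triangleleft> (?r \<sqdot> c)) \<cdot> c \<triangleright> \<a> g ?r c = c \<triangleright> \<a> ?t ?r c \<cdot> c \<triangleright> (j m \<triangleleft> ?r \<triangleleft> c)"
    using asc_nat1[of "j m" ?r c] by (simp flip: lwh_comp)
  have 4: "c \<triangleright> (j m \<triangleleft> ?r \<triangleleft> c) \<cdot> \<a> c (g \<sqdot> ?r) c = \<a> c (?t \<sqdot> ?r) c \<cdot> (c \<triangleright> (j m \<triangleleft> ?r)) \<triangleleft> c"
    using asc_nat2[of "j m \<triangleleft> ?r" c c] by simp
  have 5: "(c \<triangleright> (j m \<triangleleft> ?r)) \<triangleleft> c \<cdot> \<delta> \<triangleleft> c = \<a> c ?t ?r \<triangleleft> c \<cdot> lam T c m m \<triangleleft> ?r \<triangleleft> c \<cdot> rho T ?r m (c \<bullet> m) \<triangleleft> c \<cdot>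
      t1 T (\<theta> c \<diamondop> m) (c \<bullet> m) \<triangleleft> c \<cdot> j (c \<bullet> m) \<triangleleft> c"
    using arg_cong[OF \<delta>, of "\<lambda>f. f \<triangleleft> c"] by (simp add: \<delta>_comp_def)
  have 6: "c \<triangleright> \<a> ?t ?r c \<cdot> \<a> c (?t \<sqdot> ?r) c \<cdot> \<a> c ?t ?r \<triangleleft> c = \<a> c ?t (?r \<sqdot> c) \<cdot> \<a> (c \<sqdot> ?t) ?r c"
    by (simp add: pentagon)
  have 7: "c \<triangleright> (?t \<triangleright> evr c) \<cdot> \<a> c ?t (?r \<sqdot> c) = \<a> c ?t \<I> \<cdot> (c \<sqdot> ?t) \<triangleright> evr c"
    using asc_nat3[of "evr c" c ?t] by simp
  have 8: "c \<triangleright> \<r> ?t \<cdot> \<a> c ?t \<I> = \<r> (c \<sqdot> ?t)" by (simp add: run_tensor')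
  have 9: "\<a> (c \<sqdot> ?t) ?r c \<cdot> lam T c m m \<triangleleft> ?r \<triangleleft> c = lam T c m m \<triangleleft> (?r \<sqdot> c) \<cdot> \<a> ?t' ?r c"
    using asc_nat1[of "lam T c m m" ?r c] by simp
  have 10: "(c \<sqdot> ?t) \<triangleright> evr c \<cdot> lam T c m m \<triangleleft> (?r \<sqdot> c) = lam T c m m \<triangleleft> \<I> \<cdot> ?t' \<triangleright> evr c"
    using interchange[of "lam T c m m" "evr c"] by simp
  have 11: "\<r> (c \<sqdot> ?t) \<cdot> lam T c m m \<triangleleft> \<I> = lam T c m m \<cdot> \<r> ?t'" using run_nat[of "lam T c m m"] by simp
  have 12: "\<r> ?t' \<cdot> ?t' \<triangleright> evr c \<cdot> \<a> ?t' ?r c \<cdot> rho T ?r m (c \<bullet> m) \<triangleleft> c \<cdot> t1 T (\<theta> c \<diamondop> m) (c \<bullet> m) \<triangleleft> c \<cdot> j (c \<bullet> m) \<triangleleft> c =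
      t1 T (\<eta> c m) (c \<bullet> m) \<cdot> rho' T c (c \<bullet> m) (c \<bullet> m) \<cdot> j (c \<bullet> m) \<triangleleft> c"
    using arg_cong[OF rho_rho[of c m "c \<bullet> m"], of "\<lambda>f. f \<cdot> j (c \<bullet> m) \<triangleleft> c"] by simp
  show ?thesis
    by (simp add: \<beta>_def comp_tail[OF 1] comp_tail[OF 2] comp_tail[OF 3] comp_tail[OF 4] 5 comp_tail3[OF 6]
        comp_tail[OF 7] comp_tail[OF 8] comp_tail[OF 9] comp_tail[OF 10] comp_tail[OF 11] 12 \<beta>_comp_def)
qed

lemma \<beta>_iso:
  assumes "c \<in> ob C" "\<delta> \<in> Hom C g (c \<sqdot> (g \<sqdot> rd c))" "\<forall>m\<in>ob N. c \<triangleright> (j m \<triangleleft> rd c) \<cdot> \<delta> = \<delta>_comp c m"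
  shows "iso_pair C (\<gamma> c) (\<beta> c \<delta>) (c \<sqdot> g) (g \<sqdot> c)"
  using assms by (intro inverse_of_\<gamma>) (simp_all add: Hom_iff j_\<beta>)

section \<open>The laws for the family of inverses\<close>

context
  fixes b :: "'o \<Rightarrow> 'a"
  assumes b_iso: "\<And>c. c \<in> ob C \<Longrightarrow> iso_pair C (\<gamma> c) (b c) (c \<sqdot> g) (g \<sqdot> c)"
begin

lemma b_simps [simp]: "c \<in> ob C \<Longrightarrow> b c \<in> arr C" "c \<in> ob C \<Longrightarrow> src C (b c) = g \<sqdot> c"
    "c \<in> ob C \<Longrightarrow> trg C (b c) = c \<sqdot> g"
  using iso_pairD[OF b_iso] by simp_all

text \<open>Each law for \<gamma> is inverted as a whole. Applied in a dual category, where inverses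
  run in the direction of a half-braiding of the original category, this yields the laws for the
  coend.\<close>

lemma inverse_\<gamma>_nat: "f \<in> arr C \<Longrightarrow> b (trg C f) \<cdot> g \<triangleright> f = f \<triangleleft> g \<cdot> b (src C f)"
  by (rule iso_pair_square[OF b_iso b_iso]) (simp_all add: \<gamma>_nat)

lemma inverse_\<gamma>_unit: "b \<I> = \<l>' g \<cdot> \<r> g"
proof -
  have 1: "iso_pair C (\<gamma> \<I>) (\<l>' g \<cdot> \<r> g) (\<I> \<sqdot> g) (g \<sqdot> \<I>)"
    unfolding \<gamma>_unit by (rule iso_pair_comp[OF lun_iso iso_pair_sym[OF run_iso]]) simp_all
  show ?thesis using inv_arr_eq[OF b_iso[OF uob_ob]] inv_arr_eq[OF 1] by simp
qed

lemma inverse_\<gamma>_tensor: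
  assumes [simp]: "c \<in> ob C" "d \<in> ob C"
  shows "b (c \<sqdot> d) = \<b> c d g \<cdot> c \<triangleright> b d \<cdot> \<a> c g d \<cdot> b c \<triangleleft> d \<cdot> \<b> g c d"
proof -
  have 1: "iso_pair C (\<a> g c d \<cdot> \<gamma> c \<triangleleft> d \<cdot> \<b> c g d \<cdot> c \<triangleright> \<gamma> d \<cdot> \<a> c d g)
      ((((\<b> c d g \<cdot> c \<triangleright> b d) \<cdot> \<a> c g d) \<cdot> b c \<triangleleft> d) \<cdot> \<b> g c d) ((c \<sqdot> d) \<sqdot> g) (g \<sqdot> (c \<sqdot> d))"
    by (rule iso_pair_comp[OF iso_pair_comp[OF iso_pair_comp[OF iso_pair_comp[OF asc_iso
      lwh_iso[OF b_iso]] iso_pair_sym[OF asc_iso]] rwh_iso[OF b_iso]] asc_iso]) simp_all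
  show ?thesis
    using inv_arr_eq[OF b_iso[of "c \<sqdot> d"]] inv_arr_eq[OF 1] by (simp add: \<gamma>_tensor)
qed

end

end

section \<open>Arrows between ends induced by transformations\<close>

locale end_morphism =
  X: end_setting C N S T ev cv rd evr cvr \<theta> \<theta>' g j + Y: end_setting C N S T\<^sub>2 ev cv rd evr cvr \<theta> \<theta>' g\<^sub>2 j\<^sub>2
  for C :: "('o, 'a) mcat" (structure) and N :: "('m, 'n, 'o, 'a) mdcat"
    and S :: "('o, 'a) sdat" and T T\<^sub>2 :: "('m, 'n, 'o, 'a) tdat"
    and ev cv :: "'o \<Rightarrow> 'a" and rd :: "'o \<Rightarrow> 'o" and evr cvr \<theta> \<theta>' :: "'o \<Rightarrow> 'a"
    and g g\<^sub>2 :: 'o and j j\<^sub>2 :: "'m \<Rightarrow> 'a" +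
  fixes h :: "'m \<Rightarrow> 'm \<Rightarrow> 'a" and u :: 'a
  assumes h_arr [simp]: "m \<in> ob N \<Longrightarrow> n \<in> ob N \<Longrightarrow> h m n \<in> arr C"
    and h_src [simp]: "m \<in> ob N \<Longrightarrow> n \<in> ob N \<Longrightarrow> src C (h m n) = t0 T m n"
    and h_trg [simp]: "m \<in> ob N \<Longrightarrow> n \<in> ob N \<Longrightarrow> trg C (h m n) = t0 T\<^sub>2 m n"
    and h_nat: "m \<in> ob N \<Longrightarrow> f \<in> arr N \<Longrightarrow> h m (trg N f) \<cdot> t2 T m f = t2 T\<^sub>2 m f \<cdot> h m (src N f)"
    and h_lam: "c \<in> ob C \<Longrightarrow> m \<in> ob N \<Longrightarrow> n \<in> ob N \<Longrightarrow>
      lwh C c (h m n) \<cdot> lam T c m n = lam T\<^sub>2 c m n \<cdot> h m (aob N c n)"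
    and h_rho: "c \<in> ob C \<Longrightarrow> m \<in> ob N \<Longrightarrow> n \<in> ob N \<Longrightarrow>
      rwh C (h m n) c \<cdot> rho T c m n = rho T\<^sub>2 c m n \<cdot> h (aob N (st S c) m) n"
    and u_arr [simp]: "u \<in> arr C" and u_src [simp]: "src C u = g" and u_trg [simp]: "trg C u = g\<^sub>2"
    and j_u: "m \<in> ob N \<Longrightarrow> j\<^sub>2 m \<cdot> u = h m m \<cdot> j m"
begin

text \<open>Compared after the second wedge, \<open>u\<close> becomes \<open>h\<close>, which passes
  through the counit by naturality and through \<open>rho\<close> and \<open>lam\<close> by
  compatibility, until it meets the wedge at \<open>?m\<close> and becomes \<open>u\<close>
  again.\<close>

lemma \<gamma>_morphism:
  assumes [simp]: "c \<in> ob C"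
  shows "rwh C u c \<cdot> X.\<gamma> c = Y.\<gamma> c \<cdot> lwh C c u"
proof (rule Y.rwh_end_inject[of c])
  fix m assume [simp]: "m \<in> ob N"
  let ?m = "aob N (st S c) m"
  have 1: "rwh C (j\<^sub>2 m) c \<cdot> rwh C u c = rwh C (h m m) c \<cdot> rwh C (j m) c"
    by (simp add: j_u flip: X.rwh_comp)
  have 2: "rwh C (h m m) c \<cdot> rho T c m m = rho T\<^sub>2 c m m \<cdot> h ?m m" by (simp add: h_rho)
  have 3: "h ?m m \<cdot> t2 T ?m (X.\<epsilon> c m) = t2 T\<^sub>2 ?m (X.\<epsilon> c m) \<cdot> h ?m (aob N c ?m)"
    using h_nat[of ?m "X.\<epsilon> c m"] by simp
  have 4: "lam' T\<^sub>2 c ?m ?m \<cdot> lwh C c (h ?m ?m) = h ?m (aob N c ?m) \<cdot> lam' T c ?m ?m"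
    by (rule X.iso_pair_square[OF Y.lam_iso X.lam_iso]) (simp_all add: h_lam)
  have 5: "lwh C c (h ?m ?m) \<cdot> lwh C c (j ?m) = lwh C c (j\<^sub>2 ?m) \<cdot> lwh C c u"
    by (simp add: j_u flip: X.lwh_comp)
  have "rwh C (j\<^sub>2 m) c \<cdot> rwh C u c \<cdot> X.\<gamma> c = rwh C (h m m) c \<cdot> X.\<gamma>_comp c m"
    by (simp add: X.comp_tail[OF 1] X.j_\<gamma>)
  also have "\<dots> = Y.\<gamma>_comp c m \<cdot> lwh C c u"
    by (simp add: X.\<gamma>_comp_def Y.\<gamma>_comp_def X.comp_tail[OF 2] X.comp_tail[OF 3]
        X.comp_tail[OF 4[symmetric]] 5)
  finally show "rwh C (j\<^sub>2 m) c \<cdot> rwh C u c \<cdot> X.\<gamma> c = rwh C (j\<^sub>2 m) c \<cdot> Y.\<gamma> c \<cdot> lwh C c u"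
    by (simp add: X.comp_tail[OF Y.j_\<gamma>])
qed simp_all

lemma inverse_\<gamma>_morphism:
  assumes "c \<in> ob C" "iso_pair C (X.\<gamma> c) b (tob C c g) (tob C g c)" "iso_pair C (Y.\<gamma> c) b\<^sub>2 (tob C c g\<^sub>2) (tob C g\<^sub>2 c)"
  shows "lwh C c u \<cdot> b = b\<^sub>2 \<cdot> rwh C u c"
  using X.iso_pair_square[OF assms(3,2), of "lwh C c u" "rwh C u c"] \<gamma>_morphism[OF assms(1)] assms(1) by simp

end

section \<open>The monoidal category and the module underlying the given data\<close>

definition mc :: "('o, 'a, 'k) tcat \<Rightarrow> ('o, 'a) mcat" where
  "mc C = \<lparr>ob = ob C, arr = arr C, src = src C, trg = trg C, idt = idt C, comp = comp C,
     tob = bf_ob (tensor C), lwh = \<lambda>x f. idt C x \<otimes>\<^sub>a\<^bsub>C\<^esub> f, rwh = \<lambda>f x. f \<otimes>\<^sub>a\<^bsub>C\<^esub> idt C x, uob = \<one>\<^sub>o\<^bsub>C\<^esub>,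
     asc = assoc C, asc' = \<lambda>x y z. inv_arr C (assoc C x y z),
     lun = lunit C, lun' = \<lambda>x. inv_arr C (lunit C x), run = runit C, run' = \<lambda>x. inv_arr C (runit C x)\<rparr>"

lemma mc_simps [simp]:
  "ob (mc C) = ob C" "arr (mc C) = arr C" "src (mc C) = src C" "trg (mc C) = trg C"
  "idt (mc C) = idt C" "comp (mc C) = comp C" "tob (mc C) = bf_ob (tensor C)"
  "lwh (mc C) = (\<lambda>x f. idt C x \<otimes>\<^sub>a\<^bsub>C\<^esub> f)" "rwh (mc C) = (\<lambda>f x. f \<otimes>\<^sub>a\<^bsub>C\<^esub> idt C x)" "uob (mc C) = \<one>\<^sub>o\<^bsub>C\<^esub>"
  "asc (mc C) = assoc C" "asc' (mc C) = (\<lambda>x y z. inv_arr C (assoc C x y z))"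
  "lun (mc C) = lunit C" "lun' (mc C) = (\<lambda>x. inv_arr C (lunit C x))"
  "run (mc C) = runit C" "run' (mc C) = (\<lambda>x. inv_arr C (runit C x))"
  by (simp_all add: mc_def)

lemma iso_pair_mc [simp]: "iso_pair (mc C) f g x y \<longleftrightarrow> iso_pair C f g x y"
  by (auto simp: iso_pair_def Hom_iff)

definition mm :: "('o, 'a, 'k) tcat \<Rightarrow> ('m, 'n, 'k) lcat \<Rightarrow> ('o, 'a, 'm, 'n) lact \<Rightarrow>
    ('m, 'n, 'o, 'a) mdcat" where
  "mm C M L = \<lparr>ob = ob M, arr = arr M, src = src M, trg = trg M, idt = idt M, comp = comp M,
     aob = bf_ob (lact_fun L), lac = \<lambda>c g. idt C c \<rhd>\<^sub>a\<^bsub>L\<^esub> g, rac = \<lambda>f m. f \<rhd>\<^sub>a\<^bsub>L\<^esub> idt M m,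
     mas = lact_assoc L, mas' = \<lambda>c d m. inv_arr M (lact_assoc L c d m),
     mun = lact_unit L, mun' = \<lambda>m. inv_arr M (lact_unit L m)\<rparr>"

lemma mm_simps [simp]:
  "ob (mm C M L) = ob M" "arr (mm C M L) = arr M" "src (mm C M L) = src M" "trg (mm C M L) = trg M"
  "idt (mm C M L) = idt M" "comp (mm C M L) = comp M" "aob (mm C M L) = bf_ob (lact_fun L)"
  "lac (mm C M L) = (\<lambda>c g. idt C c \<rhd>\<^sub>a\<^bsub>L\<^esub> g)" "rac (mm C M L) = (\<lambda>f m. f \<rhd>\<^sub>a\<^bsub>L\<^esub> idt M m)"
  "mas (mm C M L) = lact_assoc L" "mas' (mm C M L) = (\<lambda>c d m. inv_arr M (lact_assoc L c d m))"
  "mun (mm C M L) = lact_unit L" "mun' (mm C M L) = (\<lambda>m. inv_arr M (lact_unit L m))"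
  by (simp_all add: mm_def)

lemma iso_pair_mm [simp]: "iso_pair (mm C M L) f g x y \<longleftrightarrow> iso_pair M f g x y"
  by (auto simp: iso_pair_def Hom_iff)

definition left_star :: "('o, 'a, 'k) tcat \<Rightarrow> ('o, 'a) sdat" where
  "left_star C = \<lparr>st = ldual C, sa = ldual_arr C, nu = ldual_tensor C,
     nu' = \<lambda>c d. inv_arr C (ldual_tensor C c d), uu = ldual_unit C, uu' = inv_arr C (ldual_unit C)\<rparr>"

definition right_star :: "('o, 'a, 'k) tcat \<Rightarrow> ('o, 'a) sdat" where
  "right_star C = \<lparr>st = rdual C, sa = rdual_arr C, nu = rdual_tensor C,
     nu' = \<lambda>c d. inv_arr C (rdual_tensor C c d), uu = rdual_unit C, uu' = inv_arr C (rdual_unit C)\<rparr>"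

lemma left_star_simps [simp]:
  "st (left_star C) = ldual C" "sa (left_star C) = ldual_arr C" "nu (left_star C) = ldual_tensor C"
  "nu' (left_star C) = (\<lambda>c d. inv_arr C (ldual_tensor C c d))"
  "uu (left_star C) = ldual_unit C" "uu' (left_star C) = inv_arr C (ldual_unit C)"
  by (simp_all add: left_star_def)

lemma right_star_simps [simp]:
  "st (right_star C) = rdual C" "sa (right_star C) = rdual_arr C" "nu (right_star C) = rdual_tensor C"
  "nu' (right_star C) = (\<lambda>c d. inv_arr C (rdual_tensor C c d))"
  "uu (right_star C) = rdual_unit C" "uu' (right_star C) = inv_arr C (rdual_unit C)"
  by (simp_all add: right_star_def)

context bifunctor
begin

lemma bf_ob' [simp]: "x \<in> ob A \<Longrightarrow> y \<in> ob B \<Longrightarrow> bf_ob T x y \<in> ob X"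
  by (rule ob)

lemma bf_arr' [simp]: "f \<in> arr A \<Longrightarrow> g \<in> arr B \<Longrightarrow> bf_arr T f g \<in> arr X"
  and bf_src' [simp]: "f \<in> arr A \<Longrightarrow> g \<in> arr B \<Longrightarrow> src X (bf_arr T f g) = bf_ob T (src A f) (src B g)"
  and bf_trg' [simp]: "f \<in> arr A \<Longrightarrow> g \<in> arr B \<Longrightarrow> trg X (bf_arr T f g) = bf_ob T (trg A f) (trg B g)"
  using hom[of f "src A f" "trg A f" g "src B g" "trg B g"] by (simp_all add: Hom_iff)

lemma bf_comp': "f \<in> arr A \<Longrightarrow> f' \<in> arr A \<Longrightarrow> g \<in> arr B \<Longrightarrow> g' \<in> arr B \<Longrightarrow> src A f' = trg A f \<Longrightarrow>
    src B g' = trg B g \<Longrightarrow> bf_arr T f' g' \<cdot>\<^bsub>X\<^esub> bf_arr T f g = bf_arr T (f' \<cdot>\<^bsub>A\<^esub> f) (g' \<cdot>\<^bsub>B\<^esub> g)"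
  by (rule comp[symmetric]) (simp_all add: Hom_iff)

end

lemma nat_iso3D:
  assumes "nat_iso3 A B E X S S' T T' \<tau>" "x \<in> ob A" "y \<in> ob B" "z \<in> ob E" "category X"
    "S x y z \<in> ob X" "T x y z \<in> ob X"
  shows "iso_pair X (\<tau> x y z) (inv_arr X (\<tau> x y z)) (S x y z) (T x y z)"
  using assms by (intro category.iso_pair_inv_arr) (auto simp: nat_iso3_def)

lemma nat_iso3_nat:
  assumes "nat_iso3 A B E X S S' T T' \<tau>" "f \<in> arr A" "g \<in> arr B" "h \<in> arr E"
  shows "\<tau> (trg A f) (trg B g) (trg E h) \<cdot>\<^bsub>X\<^esub> S' f g h = T' f g h \<cdot>\<^bsub>X\<^esub> \<tau> (src A f) (src B g) (src E h)"
  using assms by (simp add: nat_iso3_def)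

lemma nat_iso_nat:
  assumes "nat_iso A B F G \<tau>" "f \<in> arr A"
  shows "\<tau> (trg A f) \<cdot>\<^bsub>B\<^esub> f_arr F f = f_arr G f \<cdot>\<^bsub>B\<^esub> \<tau> (src A f)"
  using assms by (simp add: nat_iso_def nat_trans_def)

lemma nat_isoD:
  assumes "nat_iso A B F G \<tau>" "x \<in> ob A" "category B"
  shows "iso_pair B (\<tau> x) (inv_arr B (\<tau> x)) (f_ob F x) (f_ob G x)"
  using assms by (intro category.iso_pair_inv_arr) (auto simp: nat_iso_def nat_trans_def)

context
  fixes C :: "('o, 'a, 'k::field) tcat" (structure)
  assumes ftc: "finite_tensor_category C"
begin

interpretation C: finite_tensor_category C by (rule ftc)

lemma ftc_category: "category C" by unfold_locales

lemma assoc_iso: "x \<in> ob C \<Longrightarrow> y \<in> ob C \<Longrightarrow> z \<in> ob C \<Longrightarrow>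
    iso_pair C (assoc C x y z) (inv_arr C (assoc C x y z)) ((x \<otimes>\<^sub>o y) \<otimes>\<^sub>o z) (x \<otimes>\<^sub>o (y \<otimes>\<^sub>o z))"
  using nat_iso3D[OF C.assoc_nat, of x y z] by (simp add: ftc_category)

lemma lunit_iso: "x \<in> ob C \<Longrightarrow> iso_pair C (lunit C x) (inv_arr C (lunit C x)) (\<one>\<^sub>o \<otimes>\<^sub>o x) x"
  using nat_isoD[OF C.lunit_nat, of x] by (simp add: ftc_category fix_left_def id_ftr_def)

lemma runit_iso: "x \<in> ob C \<Longrightarrow> iso_pair C (runit C x) (inv_arr C (runit C x)) (x \<otimes>\<^sub>o \<one>\<^sub>o) x"
  using nat_isoD[OF C.runit_nat, of x] by (simp add: ftc_category fix_right_def id_ftr_def)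

lemma monoidal_mc: "monoidal (mc C)"
proof -
  note [simp] = C.unit_ob
  interpret m: category "mc C" by (rule category_arrI) auto
  show ?thesis
  proof unfold_locales
    fix f y z assume "f \<in> arr (mc C)" "y \<in> ob (mc C)" "z \<in> ob (mc C)"
    then have [simp]: "f \<in> arr C" "y \<in> ob C" "z \<in> ob C" by simp_all
    show "asc (mc C) (trg (mc C) f) y z \<cdot>\<^bsub>mc C\<^esub> rwh (mc C) (rwh (mc C) f y) z =
        rwh (mc C) f (tob (mc C) y z) \<cdot>\<^bsub>mc C\<^esub> asc (mc C) (src (mc C) f) y z"
      using nat_iso3_nat[OF C.assoc_nat, of f "idt C y" "idt C z"] by (simp add: C.idt)
    show "asc (mc C) y (trg (mc C) f) z \<cdot>\<^bsub>mc C\<^esub> rwh (mc C) (lwh (mc C) y f) z =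
        lwh (mc C) y (rwh (mc C) f z) \<cdot>\<^bsub>mc C\<^esub> asc (mc C) y (src (mc C) f) z"
      using nat_iso3_nat[OF C.assoc_nat, of "idt C y" f "idt C z"] by simp
    show "asc (mc C) y z (trg (mc C) f) \<cdot>\<^bsub>mc C\<^esub> lwh (mc C) (tob (mc C) y z) f =
        lwh (mc C) y (lwh (mc C) z f) \<cdot>\<^bsub>mc C\<^esub> asc (mc C) y z (src (mc C) f)"
      using nat_iso3_nat[OF C.assoc_nat, of "idt C y" "idt C z" f] by (simp add: C.idt)
  next
    fix f assume "f \<in> arr (mc C)"
    then have [simp]: "f \<in> arr C" by simp
    show "lun (mc C) (trg (mc C) f) \<cdot>\<^bsub>mc C\<^esub> lwh (mc C) (uob (mc C)) f = f \<cdot>\<^bsub>mc C\<^esub> lun (mc C) (src (mc C) f)"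
      using nat_iso_nat[OF C.lunit_nat, of f] by (simp add: fix_left_def id_ftr_def)
    show "run (mc C) (trg (mc C) f) \<cdot>\<^bsub>mc C\<^esub> rwh (mc C) f (uob (mc C)) = f \<cdot>\<^bsub>mc C\<^esub> run (mc C) (src (mc C) f)"
      using nat_iso_nat[OF C.runit_nat, of f] by (simp add: fix_right_def id_ftr_def)
  qed (simp_all add: C.bf_comp' C.idt assoc_iso lunit_iso runit_iso C.pentagon C.triangle)
qed

lemma duality_mc:
  assumes "dual_pair C x y ev cv"
  shows "duality (mc C) x y ev cv"
  using assms by (auto simp: duality_def dual_pair_def Hom_iff)

lemma left_module_mm:
  assumes "left_module_category C M L"
  shows "left_module (mc C) (mm C M L)"
proof -
  interpret M: left_module_category C M L by (rule assms)
  interpret c: monoidal "mc C" by (rule monoidal_mc)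
  interpret m: category "mm C M L" by (rule category_arrI) auto
  have Mc: "category M" by unfold_locales
  note [simp] = C.unit_ob
  show ?thesis
  proof unfold_locales
    fix f d m assume "f \<in> arr (mc C)" "d \<in> ob (mc C)" "m \<in> ob (mm C M L)"
    then have [simp]: "f \<in> arr C" "d \<in> ob C" "m \<in> ob M" by simp_all
    show "mas (mm C M L) (trg (mc C) f) d m \<cdot>\<^bsub>mm C M L\<^esub> rac (mm C M L) (rwh (mc C) f d) m =
        rac (mm C M L) f (aob (mm C M L) d m) \<cdot>\<^bsub>mm C M L\<^esub> mas (mm C M L) (src (mc C) f) d m"
      using nat_iso3_nat[OF M.assoc_nat, of f "idt C d" "idt M m"] by (simp add: M.idt)
    show "mas (mm C M L) d (trg (mc C) f) m \<cdot>\<^bsub>mm C M L\<^esub> rac (mm C M L) (lwh (mc C) d f) m =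
        lac (mm C M L) d (rac (mm C M L) f m) \<cdot>\<^bsub>mm C M L\<^esub> mas (mm C M L) d (src (mc C) f) m"
      using nat_iso3_nat[OF M.assoc_nat, of "idt C d" f "idt M m"] by simp
  next
    fix g c d assume "g \<in> arr (mm C M L)" "c \<in> ob (mc C)" "d \<in> ob (mc C)"
    then have [simp]: "g \<in> arr M" "c \<in> ob C" "d \<in> ob C" by simp_all
    show "mas (mm C M L) c d (trg (mm C M L) g) \<cdot>\<^bsub>mm C M L\<^esub> lac (mm C M L) (tob (mc C) c d) g =
        lac (mm C M L) c (lac (mm C M L) d g) \<cdot>\<^bsub>mm C M L\<^esub> mas (mm C M L) c d (src (mm C M L) g)"
      using nat_iso3_nat[OF M.assoc_nat, of "idt C c" "idt C d" g] by (simp add: C.idt)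
  next
    fix g assume "g \<in> arr (mm C M L)"
    then have [simp]: "g \<in> arr M" by simp
    show "mun (mm C M L) (trg (mm C M L) g) \<cdot>\<^bsub>mm C M L\<^esub> lac (mm C M L) (uob (mc C)) g =
        g \<cdot>\<^bsub>mm C M L\<^esub> mun (mm C M L) (src (mm C M L) g)"
      using nat_iso_nat[OF M.unit_nat, of g] by (simp add: fix_left_def id_ftr_def)
  next
    fix c d m assume "c \<in> ob (mc C)" "d \<in> ob (mc C)" "m \<in> ob (mm C M L)"
    then show "iso_pair (mm C M L) (mas (mm C M L) c d m) (mas' (mm C M L) c d m)
        (aob (mm C M L) (tob (mc C) c d) m) (aob (mm C M L) c (aob (mm C M L) d m))"
      using nat_iso3D[OF M.assoc_nat, of c d m] by (simp add: Mc)
  next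
    fix m assume "m \<in> ob (mm C M L)"
    then show "iso_pair (mm C M L) (mun (mm C M L) m) (mun' (mm C M L) m) (aob (mm C M L) (uob (mc C)) m) m"
      using nat_isoD[OF M.unit_nat, of m] by (simp add: Mc fix_left_def id_ftr_def)
  qed (simp_all add: M.bf_comp' M.idt M.pentagon M.triangle)
qed

interpretation c: monoidal "mc C" by (rule monoidal_mc)
interpretation v: monoidal "mrev (mc C)" by (rule c.monoidal_mrev)

lemma left_mate_eq: "left_mate C x y cv y' ev' f = c.mate x y cv y' (ev' \<cdot> (f \<otimes>\<^sub>a idt C y'))"
  by (simp add: left_mate_def c.mate_def)

text \<open>Mates for right duals are mates for left duals in the reversed tensor product, so a
  single calculus covers both.\<close>

lemma right_mate_eq: "right_mate C x y cv x' ev' f = v.mate y x cv x' (ev' \<cdot> (idt C x' \<otimes>\<^sub>a f))"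
  by (simp add: right_mate_def v.mate_def)

lemma duality_ldual: "c \<in> ob C \<Longrightarrow> duality (mc C) c (ldual C c) (ldual_ev C c) (ldual_coev C c)"
  by (intro duality_mc C.left_dual)

lemma duality_rdual: "c \<in> ob C \<Longrightarrow> duality (mc C) (rdual C c) c (rdual_ev C c) (rdual_coev C c)"
  by (intro duality_mc C.right_dual)

end

section \<open>Mates between different duals\<close>

context monoidal
begin

text \<open>Since the two unit constraints coincide at \<I>, the triangle law reduces each zigzag
  identity to the cancellation of a constraint with its inverse.\<close>

lemma duality_unit: "duality C \<I> \<I> (\<l> \<I>) (\<l>' \<I>)"
proof -
  have l': "\<l>' \<I> = \<r>' \<I>"
    using inv_arr_eq[OF lun_iso[OF uob_ob]] inv_arr_eq[OF run_iso[OF uob_ob]] by (simp add: lun_run_unit)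
  have 1: "\<I> \<triangleright> \<l> \<I> \<cdot> \<a> \<I> \<I> \<I> = \<r> \<I> \<triangleleft> \<I>" by (simp add: triangle)
  have 2: "\<b> \<I> \<I> \<I> \<cdot> \<I> \<triangleright> \<l>' \<I> = \<r>' \<I> \<triangleleft> \<I>" by (simp add: triangle')
  have 3: "\<r> \<I> \<triangleleft> \<I> \<cdot> \<l>' \<I> \<triangleleft> \<I> = idt C (\<I> \<sqdot> \<I>)" unfolding l' by simp
  have 4: "\<l> \<I> \<triangleleft> \<I> \<cdot> \<r>' \<I> \<triangleleft> \<I> = idt C (\<I> \<sqdot> \<I>)" unfolding l'[symmetric] by simp
  have "\<r> \<I> \<cdot> \<I> \<triangleright> \<l> \<I> \<cdot> \<a> \<I> \<I> \<I> \<cdot> \<l>' \<I> \<triangleleft> \<I> = \<l> \<I>"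
    by (simp add: comp_tail[OF 1] 3) (rule lun_run_unit[symmetric])
  moreover have "\<l> \<I> \<cdot> \<l> \<I> \<triangleleft> \<I> \<cdot> \<b> \<I> \<I> \<I> \<cdot> \<I> \<triangleright> \<l>' \<I> = \<r> \<I>"
    by (simp add: 2 4) (rule lun_run_unit)
  ultimately show ?thesis by (simp add: duality_def)
qed

text \<open>The comparison of two left duals of one object. All canonical isomorphisms between duals
  are instances, with \<open>ev'\<close> the chosen evaluation and the first pair one constructed by
  hand, or the other way round.\<close>

lemma mate_same:
  assumes d: "duality C x y ev cv" and d': "duality C x y' ev' cv'"
  defines "h \<equiv> mate x y cv y' ev'"
  shows "iso_pair C h (mate x y' cv' y ev) y' y" "ev \<cdot> x \<triangleright> h = ev'" "h \<triangleleft> x \<cdot> cv' = cv"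
proof -
  note [simp] = dualityD[OF d] dualityD[OF d']
  show 1: "ev \<cdot> x \<triangleright> h = ev'" unfolding h_def by (rule ev_mate[OF d]) simp_all
  show "iso_pair C h (mate x y' cv' y ev) y' y"
    by (rule mates_iso[OF d d' _ _ _ _ _ _ 1]) (simp_all add: h_def ev_mate[OF d'])
  show "h \<triangleleft> x \<cdot> cv' = cv"
    using mate_coev[OF d d', of h "idt C x"] 1 by (simp add: h_def)
qed

lemma mate_arr:
  assumes d: "duality C x y ev cv" and d': "duality C x' y' ev' cv'"
    and [simp]: "f \<in> arr C" "src C f = x" "trg C f = x'"
  defines "h \<equiv> mate x y cv y' (ev' \<cdot> f \<triangleleft> y')"
  shows "h \<in> arr C" "src C h = y'" "trg C h = y" "ev \<cdot> x \<triangleright> h = ev' \<cdot> f \<triangleleft> y'" "h \<triangleleft> x' \<cdot> cv' = y \<triangleright> f \<cdot> cv"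
proof -
  note [simp] = dualityD[OF d] dualityD[OF d']
  show 1: "h \<in> arr C" "src C h = y'" "trg C h = y" by (simp_all add: h_def)
  show 2: "ev \<cdot> x \<triangleright> h = ev' \<cdot> f \<triangleleft> y'" unfolding h_def by (rule ev_mate[OF d]) simp_all
  show "h \<triangleleft> x' \<cdot> cv' = y \<triangleright> f \<cdot> cv" by (rule mate_coev[OF d d' 1 _ _ _ 2]) simp_all
qed

end

lemma (in category) iso_pair_inv: "iso_pair C f f' x y \<Longrightarrow> iso_pair C f (inv_arr C f) x y"
  using inv_arr_eq by simp

section \<open>The canonical morphisms between duals as mates\<close>

context
  fixes C :: "('o, 'a, 'k::field) tcat" (structure)
  assumes ftc: "finite_tensor_category C"
begin

interpretation C: finite_tensor_category C by (rule ftc)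
interpretation c: monoidal "mc C" by (rule monoidal_mc[OF ftc])
interpretation v: monoidal "mrev (mc C)" by (rule c.monoidal_mrev)

lemmas dl = duality_ldual[OF ftc]
lemmas dr = duality_rdual[OF ftc]

lemma dr': "c \<in> ob C \<Longrightarrow> duality (mrev (mc C)) c (rdual C c) (rdual_ev C c) (rdual_coev C c)"
  using dr by simp

lemma unit_ob' [simp]: "\<one>\<^sub>o \<in> ob C" by (rule C.unit_ob)

lemma dual_ob [simp]: "c \<in> ob C \<Longrightarrow> ldual C c \<in> ob C" "c \<in> ob C \<Longrightarrow> rdual C c \<in> ob C"
  using dualityD(2)[OF dl] dualityD(1)[OF dr] by simp_all

text \<open>The canonical morphisms are mates of identities, and this removes the identity from
  their definitions.\<close>

lemma idt_tensor: "x \<in> ob C \<Longrightarrow> y \<in> ob C \<Longrightarrow> e \<in> arr C \<Longrightarrow> src C e = x \<otimes>\<^sub>o y \<Longrightarrow>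
    e \<cdot> (idt C x \<otimes>\<^sub>a idt C y) = e"
  by (simp add: C.idt)

lemma ldual_arr:
  assumes "f \<in> arr C"
  shows "ldual_arr C f \<in> arr C" "src C (ldual_arr C f) = ldual C (trg C f)" "trg C (ldual_arr C f) = ldual C (src C f)"
    "ldual_ev C (src C f) \<cdot> (idt C (src C f) \<otimes>\<^sub>a ldual_arr C f) =
     ldual_ev C (trg C f) \<cdot> (f \<otimes>\<^sub>a idt C (ldual C (trg C f)))"
  using c.mate_arr[OF dl dl, of "src C f" "trg C f" f] assms
  by (simp_all add: ldual_arr_def left_mate_eq[OF ftc])

lemma rdual_arr:
  assumes "f \<in> arr C"
  shows "rdual_arr C f \<in> arr C" "src C (rdual_arr C f) = rdual C (trg C f)" "trg C (rdual_arr C f) = rdual C (src C f)"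
    "(idt C (trg C f) \<otimes>\<^sub>a rdual_arr C f) \<cdot> rdual_coev C (trg C f) =
     (f \<otimes>\<^sub>a idt C (rdual C (src C f))) \<cdot> rdual_coev C (src C f)"
  using v.mate_arr[OF dr' dr', of "src C f" "trg C f" f] assms
  by (simp_all add: rdual_arr_def right_mate_eq[OF ftc])

text \<open>Both the chosen dual of the tensor product and the reversed product of the chosen duals
  are left duals of it, so \<open>mate_same\<close> gives invertibility and compatibility with
  evaluations at once.\<close>

lemma ldual_tensor:
  assumes [simp]: "c \<in> ob C" "d \<in> ob C"
  shows "iso_pair C (ldual_tensor C c d) (inv_arr C (ldual_tensor C c d)) (ldual C (c \<otimes>\<^sub>o d))
      (ldual C d \<otimes>\<^sub>o ldual C c)"
    "c.tensor_ev c (ldual C c) (ldual_ev C c) d (ldual C d) (ldual_ev C d) \<cdot>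
      (idt C (c \<otimes>\<^sub>o d) \<otimes>\<^sub>a ldual_tensor C c d) = ldual_ev C (c \<otimes>\<^sub>o d)"
proof -
  have e: "ldual_tensor C c d = c.mate (c \<otimes>\<^sub>o d) (ldual C d \<otimes>\<^sub>o ldual C c)
     (c.tensor_cv c (ldual C c) (ldual_coev C c) d (ldual C d) (ldual_coev C d)) (ldual C (c \<otimes>\<^sub>o d))
     (ldual_ev C (c \<otimes>\<^sub>o d))"
    using dualityD[OF dl[of "c \<otimes>\<^sub>o d"]]
    by (simp add: ldual_tensor_def left_mate_eq[OF ftc] idt_tensor coev_tensor_def c.tensor_cv_def)
  note m = c.mate_same[OF c.duality_tensor[OF dl[of c] dl[of d]], simplified, OF dl[of "c \<otimes>\<^sub>o d"], folded e]
  show "iso_pair C (ldual_tensor C c d) (inv_arr C (ldual_tensor C c d)) (ldual C (c \<otimes>\<^sub>o d))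
      (ldual C d \<otimes>\<^sub>o ldual C c)"
    by (rule C.iso_pair_inv) (use m(1) in simp)
  show "c.tensor_ev c (ldual C c) (ldual_ev C c) d (ldual C d) (ldual_ev C d) \<cdot>
      (idt C (c \<otimes>\<^sub>o d) \<otimes>\<^sub>a ldual_tensor C c d) = ldual_ev C (c \<otimes>\<^sub>o d)"
    using m(2) by simp
qed

text \<open>The same comparison for the reversed tensor product. It is recorded for coevaluations,
  because these are the evaluations of the dual category in which coends are treated.\<close>

lemma rdual_tensor:
  assumes [simp]: "c \<in> ob C" "d \<in> ob C"
  shows "iso_pair C (rdual_tensor C c d) (inv_arr C (rdual_tensor C c d)) (rdual C (c \<otimes>\<^sub>o d))
      (rdual C d \<otimes>\<^sub>o rdual C c)"
    "(idt C (c \<otimes>\<^sub>o d) \<otimes>\<^sub>a rdual_tensor C c d) \<cdot> rdual_coev C (c \<otimes>\<^sub>o d) =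
     c.tensor_cv (rdual C d) d (rdual_coev C d) (rdual C c) c (rdual_coev C c)"
proof -
  have d: "duality (mrev (mc C)) (c \<otimes>\<^sub>o d) (rdual C d \<otimes>\<^sub>o rdual C c)
     (c.tensor_ev (rdual C d) d (rdual_ev C d) (rdual C c) c (rdual_ev C c))
     (c.tensor_cv (rdual C d) d (rdual_coev C d) (rdual C c) c (rdual_coev C c))"
    using c.duality_tensor[OF dr[of d] dr[of c]] by simp
  have e: "rdual_tensor C c d = v.mate (c \<otimes>\<^sub>o d) (rdual C d \<otimes>\<^sub>o rdual C c)
     (c.tensor_cv (rdual C d) d (rdual_coev C d) (rdual C c) c (rdual_coev C c)) (rdual C (c \<otimes>\<^sub>o d))
     (rdual_ev C (c \<otimes>\<^sub>o d))"
    using dualityD[OF dr[of "c \<otimes>\<^sub>o d"]]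
    by (simp add: rdual_tensor_def right_mate_eq[OF ftc] idt_tensor coev_tensor_def c.tensor_cv_def)
  have d2: "duality (mrev (mc C)) (c \<otimes>\<^sub>o d) (rdual C (c \<otimes>\<^sub>o d)) (rdual_ev C (c \<otimes>\<^sub>o d)) (rdual_coev C (c \<otimes>\<^sub>o d))"
    by (rule dr') simp
  note m = v.mate_same[OF d d2, folded e]
  show "iso_pair C (rdual_tensor C c d) (inv_arr C (rdual_tensor C c d)) (rdual C (c \<otimes>\<^sub>o d))
      (rdual C d \<otimes>\<^sub>o rdual C c)"
    by (rule C.iso_pair_inv) (use m(1) in simp)
  show "(idt C (c \<otimes>\<^sub>o d) \<otimes>\<^sub>a rdual_tensor C c d) \<cdot> rdual_coev C (c \<otimes>\<^sub>o d) =
     c.tensor_cv (rdual C d) d (rdual_coev C d) (rdual C c) c (rdual_coev C c)"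
    using m(3) by simp
qed

lemma ldual_unit:
  shows "iso_pair C (ldual_unit C) (inv_arr C (ldual_unit C)) \<one>\<^sub>o (ldual C \<one>\<^sub>o)"
    "ldual_ev C \<one>\<^sub>o \<cdot> (idt C \<one>\<^sub>o \<otimes>\<^sub>a ldual_unit C) = lunit C \<one>\<^sub>o"
proof -
  have e: "ldual_unit C = c.mate \<one>\<^sub>o (ldual C \<one>\<^sub>o) (ldual_coev C \<one>\<^sub>o) \<one>\<^sub>o (lunit C \<one>\<^sub>o)"
    using dualityD[OF c.duality_unit] by (simp add: ldual_unit_def left_mate_eq[OF ftc] idt_tensor)
  note m = c.mate_same[OF dl[of "\<one>\<^sub>o"], of "\<one>\<^sub>o" "lunit C \<one>\<^sub>o" "inv_arr C (lunit C \<one>\<^sub>o)", folded e]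
  have d: "duality (mc C) \<one>\<^sub>o \<one>\<^sub>o (lunit C \<one>\<^sub>o) (inv_arr C (lunit C \<one>\<^sub>o))"
    using c.duality_unit by simp
  show "iso_pair C (ldual_unit C) (inv_arr C (ldual_unit C)) \<one>\<^sub>o (ldual C \<one>\<^sub>o)"
    by (rule C.iso_pair_inv) (use m(1) d in simp)
  show "ldual_ev C \<one>\<^sub>o \<cdot> (idt C \<one>\<^sub>o \<otimes>\<^sub>a ldual_unit C) = lunit C \<one>\<^sub>o"
    using m(2) d by simp
qed

lemma rdual_unit:
  shows "iso_pair C (rdual_unit C) (inv_arr C (rdual_unit C)) \<one>\<^sub>o (rdual C \<one>\<^sub>o)"
    "(idt C \<one>\<^sub>o \<otimes>\<^sub>a rdual_unit C) \<cdot> inv_arr C (lunit C \<one>\<^sub>o) = rdual_coev C \<one>\<^sub>o"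
proof -
  have e: "rdual_unit C = v.mate \<one>\<^sub>o (rdual C \<one>\<^sub>o) (rdual_coev C \<one>\<^sub>o) \<one>\<^sub>o (lunit C \<one>\<^sub>o)"
    using dualityD[OF c.duality_unit] by (simp add: rdual_unit_def right_mate_eq[OF ftc] idt_tensor)
  have d: "duality (mrev (mc C)) \<one>\<^sub>o \<one>\<^sub>o (lunit C \<one>\<^sub>o) (inv_arr C (lunit C \<one>\<^sub>o))"
    using c.duality_unit by simp
  note m = v.mate_same[OF dr'[of "\<one>\<^sub>o"] d, folded e]
  show "iso_pair C (rdual_unit C) (inv_arr C (rdual_unit C)) \<one>\<^sub>o (rdual C \<one>\<^sub>o)"
    by (rule C.iso_pair_inv) (use m(1) in simp)
  show "(idt C \<one>\<^sub>o \<otimes>\<^sub>a rdual_unit C) \<cdot> inv_arr C (lunit C \<one>\<^sub>o) = rdual_coev C \<one>\<^sub>o"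
    using m(3) by simp
qed

lemma ldual_rdual:
  assumes [simp]: "c \<in> ob C"
  shows "iso_pair C (ldual_rdual C c) (inv_arr C (ldual_rdual C c)) (ldual C (rdual C c)) c"
    "rdual_ev C c \<cdot> (idt C (rdual C c) \<otimes>\<^sub>a ldual_rdual C c) = ldual_ev C (rdual C c)"
proof -
  have e: "ldual_rdual C c = c.mate (rdual C c) c (rdual_coev C c) (ldual C (rdual C c)) (ldual_ev C (rdual C c))"
    using dualityD[OF dl[of "rdual C c"]] by (simp add: ldual_rdual_def left_mate_eq[OF ftc] idt_tensor)
  have d: "duality (mc C) (rdual C c) (ldual C (rdual C c)) (ldual_ev C (rdual C c)) (ldual_coev C (rdual C c))"
    by (rule dl) simp
  note m = c.mate_same[OF dr[OF assms] d, folded e]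
  show "iso_pair C (ldual_rdual C c) (inv_arr C (ldual_rdual C c)) (ldual C (rdual C c)) c"
    by (rule C.iso_pair_inv) (use m(1) in simp)
  show "rdual_ev C c \<cdot> (idt C (rdual C c) \<otimes>\<^sub>a ldual_rdual C c) = ldual_ev C (rdual C c)"
    using m(2) by simp
qed

lemma rdual_ldual:
  assumes [simp]: "c \<in> ob C"
  shows "iso_pair C (rdual_ldual C c) (inv_arr C (rdual_ldual C c)) (rdual C (ldual C c)) c"
    "(idt C (ldual C c) \<otimes>\<^sub>a rdual_ldual C c) \<cdot> rdual_coev C (ldual C c) = ldual_coev C c"
proof -
  have e: "rdual_ldual C c = v.mate (ldual C c) c (ldual_coev C c) (rdual C (ldual C c)) (rdual_ev C (ldual C c))"
    using dualityD[OF dr[of "ldual C c"]] by (simp add: rdual_ldual_def right_mate_eq[OF ftc] idt_tensor)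
  have d: "duality (mrev (mc C)) (ldual C c) c (ldual_ev C c) (ldual_coev C c)"
    using dl by simp
  have d2: "duality (mrev (mc C)) (ldual C c) (rdual C (ldual C c)) (rdual_ev C (ldual C c)) (rdual_coev C (ldual C c))"
    by (rule dr') simp
  note m = v.mate_same[OF d d2, folded e]
  show "iso_pair C (rdual_ldual C c) (inv_arr C (rdual_ldual C c)) (rdual C (ldual C c)) c"
    by (rule C.iso_pair_inv) (use m(1) in simp)
  show "(idt C (ldual C c) \<otimes>\<^sub>a rdual_ldual C c) \<cdot> rdual_coev C (ldual C c) = ldual_coev C c"
    using m(3) by simp
qed

end

section \<open>The equivariant functor underlying a bimodule functor\<close>

lemma regular_bimodule_simps [simp]:
  "ob (regular_bimodule C) = ob C" "arr (regular_bimodule C) = arr C" "src (regular_bimodule C) = src C"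
  "trg (regular_bimodule C) = trg C" "idt (regular_bimodule C) = idt C" "comp (regular_bimodule C) = comp C"
  "lact_fun (lft (regular_bimodule C)) = tensor C" "lact_assoc (lft (regular_bimodule C)) = assoc C"
  "lact_unit (lft (regular_bimodule C)) = lunit C"
  "ract_fun (rgt (regular_bimodule C)) = tensor C" "ract_assoc (rgt (regular_bimodule C)) = assoc C"
  "ract_unit (rgt (regular_bimodule C)) = runit C" "mid (regular_bimodule C) = assoc C"
  by (simp_all add: regular_bimodule_def)

lemma Hom_regular_bimodule [simp]: "Hom (regular_bimodule C) x y = Hom C x y"
  by (simp add: Hom_def)

lemma is_iso_regular_bimodule [simp]: "is_iso (regular_bimodule C) f = is_iso C f"
  by (simp add: is_iso_def inverse_arrows_def)

lemma opp_simps [simp]: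
  "ob (opp C) = ob C" "arr (opp C) = arr C" "src (opp C) = trg C" "trg (opp C) = src C"
  "idt (opp C) = idt C" "g \<cdot>\<^bsub>opp C\<^esub> f = f \<cdot>\<^bsub>C\<^esub> g" "zero_arr (opp C) x y = zero_arr C y x"
  "add_arr (opp C) = add_arr C" "scale_arr (opp C) = scale_arr C"
  by (simp_all add: opp_def)

text \<open>The restriction of \<open>G\<close> to products of two objects. Its constraints arise by
  composing the extension of the actions to the Deligne product with the bimodule constraints of
  \<open>G\<close>.\<close>

definition bim_tdat :: "('o, 'a, 'k) tcat \<Rightarrow> ('m, 'n, 'k) lcat \<Rightarrow> ('m, 'n, 'm, 'n, 'd, 'e, 'o) box \<Rightarrow>
    ('d, 'e, 'o, 'a, 'o) bimod_ftr \<Rightarrow> ('m, 'n, 'o, 'a) tdat" where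
  "bim_tdat C M bx G =
     \<lparr>t0 = \<lambda>m n. f_ob G (bf_ob bx m n),
      t1 = \<lambda>f n. f_arr G (bf_arr bx f (idt M n)),
      t2 = \<lambda>m g. f_arr G (bf_arr bx (idt M m) g),
      lam = \<lambda>c m n. lcon G c (bf_ob bx m n) \<cdot>\<^bsub>C\<^esub> f_arr G (box_l bx m c n),
      lam' = \<lambda>c m n. inv_arr C (lcon G c (bf_ob bx m n) \<cdot>\<^bsub>C\<^esub> f_arr G (box_l bx m c n)),
      rho = \<lambda>e m n. rcon G (bf_ob bx m n) e \<cdot>\<^bsub>C\<^esub> f_arr G (box_r bx m e n),
      rho' = \<lambda>e m n. inv_arr C (rcon G (bf_ob bx m n) e \<cdot>\<^bsub>C\<^esub> f_arr G (box_r bx m e n))\<rparr>"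

text \<open>The common form of the two right actions on \<open>opp M\<close>: they differ only in
  the choice of duals, here \<open>S\<close>. The right action is described on objects and arrows of
  \<open>M\<close>, because this is how far \<open>left_sharp\<close> and \<open>right_sharp\<close>
  have to be unfolded.\<close>

locale bimodule_data =
  fixes C :: "('o, 'a, 'k::field) tcat" (structure) and M :: "('m, 'n, 'k) lcat" and L :: "('o, 'a, 'm, 'n) lact"
    and S :: "('o, 'a) sdat" and R :: "('o, 'a, 'm, 'n) ract"
    and D :: "('d, 'e, 'k, 'o, 'a) bimod" and bx :: "('m, 'n, 'm, 'n, 'd, 'e, 'o) box"
  assumes ftc: "finite_tensor_category C" and modcat: "module_category C M L"
    and del: "deligne_bimodule C (opp M) R M L D bx"
    and R_ob: "m \<in> ob M \<Longrightarrow> c \<in> ob C \<Longrightarrow> m \<lhd>\<^sub>o\<^bsub>R\<^esub> c = st S c \<rhd>\<^sub>o\<^bsub>L\<^esub> m"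
    and R_arr: "g \<in> arr M \<Longrightarrow> f \<in> arr C \<Longrightarrow> g \<lhd>\<^sub>a\<^bsub>R\<^esub> f = sa S f \<rhd>\<^sub>a\<^bsub>L\<^esub> g"
    and R_assoc: "m \<in> ob M \<Longrightarrow> c \<in> ob C \<Longrightarrow> d \<in> ob C \<Longrightarrow>
      ract_assoc R m c d = lact_assoc L (st S d) (st S c) m \<cdot>\<^bsub>M\<^esub> (nu S c d \<rhd>\<^sub>a\<^bsub>L\<^esub> idt M m)"
    and R_unit: "m \<in> ob M \<Longrightarrow> ract_unit R m = (uu S \<rhd>\<^sub>a\<^bsub>L\<^esub> idt M m) \<cdot>\<^bsub>M\<^esub> inv_arr M (lact_unit L m)"
    and S_ob [simp]: "c \<in> ob C \<Longrightarrow> st S c \<in> ob C"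
    and S_arr [simp]: "f \<in> arr C \<Longrightarrow> sa S f \<in> arr C" "f \<in> arr C \<Longrightarrow> src C (sa S f) = st S (trg C f)"
      "f \<in> arr C \<Longrightarrow> trg C (sa S f) = st S (src C f)"
    and S_idt: "c \<in> ob C \<Longrightarrow> sa S (idt C c) = idt C (st S c)"
    and S_nu: "c \<in> ob C \<Longrightarrow> d \<in> ob C \<Longrightarrow>
      iso_pair C (nu S c d) (nu' S c d) (st S (c \<otimes>\<^sub>o d)) (st S d \<otimes>\<^sub>o st S c)"
    and S_uu: "iso_pair C (uu S) (uu' S) \<one>\<^sub>o (st S \<one>\<^sub>o)"
begin

interpretation C: finite_tensor_category C by (rule ftc)
interpretation M: module_category C M L by (rule modcat)
interpretation P: deligne_bimodule C "opp M" R M L D bx by (rule del)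
interpretation N: left_module "mc C" "mm C M L"
  by (rule left_module_mm[OF ftc]) (rule M.left_module_category_axioms)

declare C.unit_ob [simp]

lemma D_category: "category D" by unfold_locales

lemma bx_hom [simp]:
  "f \<in> arr M \<Longrightarrow> g \<in> arr M \<Longrightarrow> bf_arr bx f g \<in> arr D"
  "f \<in> arr M \<Longrightarrow> g \<in> arr M \<Longrightarrow> src D (bf_arr bx f g) = bf_ob bx (trg M f) (src M g)"
  "f \<in> arr M \<Longrightarrow> g \<in> arr M \<Longrightarrow> trg D (bf_arr bx f g) = bf_ob bx (src M f) (trg M g)"
  "m \<in> ob M \<Longrightarrow> n \<in> ob M \<Longrightarrow> bf_ob bx m n \<in> ob D"
  using P.bf_arr'[of f g] P.bf_src'[of f g] P.bf_trg'[of f g] P.bf_ob'[of m n] by simp_all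

lemma bx_comp: "f \<in> arr M \<Longrightarrow> f' \<in> arr M \<Longrightarrow> g \<in> arr M \<Longrightarrow> g' \<in> arr M \<Longrightarrow> src M f = trg M f' \<Longrightarrow>
    src M g' = trg M g \<Longrightarrow> bf_arr bx f' g' \<cdot>\<^bsub>D\<^esub> bf_arr bx f g = bf_arr bx (f \<cdot>\<^bsub>M\<^esub> f') (g' \<cdot>\<^bsub>M\<^esub> g)"
  using P.bf_comp'[of f f' g g'] by simp

lemma bx_idt [simp]: "m \<in> ob M \<Longrightarrow> n \<in> ob M \<Longrightarrow> bf_arr bx (idt M m) (idt M n) = idt D (bf_ob bx m n)"
  using P.idt[of m n] by simp

lemma box_l_iso: "m \<in> ob M \<Longrightarrow> c \<in> ob C \<Longrightarrow> n \<in> ob M \<Longrightarrow>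
    iso_pair D (box_l bx m c n) (inv_arr D (box_l bx m c n)) (bf_ob bx m (c \<rhd>\<^sub>o\<^bsub>L\<^esub> n)) (c \<rhd>\<^sub>o\<^bsub>lft D\<^esub> bf_ob bx m n)"
  using nat_iso3D[OF P.box_l_nat, of m c n] by (simp add: D_category)

lemma box_r_iso: "m \<in> ob M \<Longrightarrow> c \<in> ob C \<Longrightarrow> n \<in> ob M \<Longrightarrow>
    iso_pair D (box_r bx m c n) (inv_arr D (box_r bx m c n)) (bf_ob bx (st S c \<rhd>\<^sub>o\<^bsub>L\<^esub> m) n) (bf_ob bx m n \<lhd>\<^sub>o\<^bsub>rgt D\<^esub> c)"
  using nat_iso3D[OF P.box_r_nat, of m c n] by (simp add: D_category R_ob)

lemmas box_hom [simp] = P.iso_pairD(1-3)[OF box_l_iso] P.iso_pairD(1-3)[OF box_r_iso]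

lemma box_l_nat: "p \<in> arr M \<Longrightarrow> f \<in> arr C \<Longrightarrow> q \<in> arr M \<Longrightarrow>
    box_l bx (src M p) (trg C f) (trg M q) \<cdot>\<^bsub>D\<^esub> bf_arr bx p (f \<rhd>\<^sub>a\<^bsub>L\<^esub> q) =
    (f \<rhd>\<^sub>a\<^bsub>lft D\<^esub> bf_arr bx p q) \<cdot>\<^bsub>D\<^esub> box_l bx (trg M p) (src C f) (src M q)"
  using nat_iso3_nat[OF P.box_l_nat, of p f q] by simp

lemma box_r_nat: "p \<in> arr M \<Longrightarrow> f \<in> arr C \<Longrightarrow> q \<in> arr M \<Longrightarrow>
    box_r bx (src M p) (trg C f) (trg M q) \<cdot>\<^bsub>D\<^esub> bf_arr bx (sa S f \<rhd>\<^sub>a\<^bsub>L\<^esub> p) q =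
    (bf_arr bx p q \<lhd>\<^sub>a\<^bsub>rgt D\<^esub> f) \<cdot>\<^bsub>D\<^esub> box_r bx (trg M p) (src C f) (src M q)"
  using nat_iso3_nat[OF P.box_r_nat, of p f q] by (simp add: R_arr)

context
  fixes G :: "('d, 'e, 'o, 'a, 'o) bimod_ftr"
  assumes G: "bimodule_functor C D (regular_bimodule C) G"
begin

interpretation G: bimodule_functor C D "regular_bimodule C" G by (rule G)

lemma G_hom [simp]:
  "x \<in> ob D \<Longrightarrow> f_ob G x \<in> ob C"
  "k \<in> arr D \<Longrightarrow> f_arr G k \<in> arr C" "k \<in> arr D \<Longrightarrow> src C (f_arr G k) = f_ob G (src D k)"
  "k \<in> arr D \<Longrightarrow> trg C (f_arr G k) = f_ob G (trg D k)"
  "x \<in> ob D \<Longrightarrow> f_arr G (idt D x) = idt C (f_ob G x)"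
  "k \<in> arr D \<Longrightarrow> k' \<in> arr D \<Longrightarrow> src D k' = trg D k \<Longrightarrow> f_arr G (k' \<cdot>\<^bsub>D\<^esub> k) = f_arr G k' \<cdot> f_arr G k"
  using G.ob[of x] G.hom[of k "src D k" "trg D k"] G.idt[of x]
    G.comp[of k "src D k" "trg D k" k' "trg D k'"] by (simp_all add: Hom_iff)

lemma G_iso: "iso_pair D k k' x y \<Longrightarrow> iso_pair C (f_arr G k) (f_arr G k') (f_ob G x) (f_ob G y)"
  by (auto simp: iso_pair_def Hom_iff simp flip: G_hom(6))

lemma lcon_iso: "c \<in> ob C \<Longrightarrow> x \<in> ob D \<Longrightarrow>
    iso_pair C (lcon G c x) (inv_arr C (lcon G c x)) (f_ob G (c \<rhd>\<^sub>o\<^bsub>lft D\<^esub> x)) (c \<otimes>\<^sub>o f_ob G x)"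
  using G.lcon_nat by (intro C.iso_pair_inv_arr) (auto simp: nat_iso2_def nat_trans2_def comp_bftr_def)

lemma rcon_iso: "c \<in> ob C \<Longrightarrow> x \<in> ob D \<Longrightarrow>
    iso_pair C (rcon G x c) (inv_arr C (rcon G x c)) (f_ob G (x \<lhd>\<^sub>o\<^bsub>rgt D\<^esub> c)) (f_ob G x \<otimes>\<^sub>o c)"
  using G.rcon_nat by (intro C.iso_pair_inv_arr) (auto simp: nat_iso2_def nat_trans2_def comp_bftr_def)

lemmas con_hom [simp] = C.iso_pairD(1-3)[OF lcon_iso] C.iso_pairD(1-3)[OF rcon_iso]

lemma lcon_nat: "f \<in> arr C \<Longrightarrow> k \<in> arr D \<Longrightarrow>
    lcon G (trg C f) (trg D k) \<cdot> f_arr G (f \<rhd>\<^sub>a\<^bsub>lft D\<^esub> k) = (f \<otimes>\<^sub>a f_arr G k) \<cdot> lcon G (src C f) (src D k)"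
  using G.lcon_nat by (simp add: nat_iso2_def nat_trans2_def comp_bftr_def)

lemma rcon_nat: "f \<in> arr C \<Longrightarrow> k \<in> arr D \<Longrightarrow>
    rcon G (trg D k) (trg C f) \<cdot> f_arr G (k \<lhd>\<^sub>a\<^bsub>rgt D\<^esub> f) = (f_arr G k \<otimes>\<^sub>a f) \<cdot> rcon G (src D k) (src C f)"
  using G.rcon_nat by (simp add: nat_iso2_def nat_trans2_def comp_bftr_def)

abbreviation T where "T \<equiv> bim_tdat C M bx G"

lemma T_simps:
  "t0 T m n = f_ob G (bf_ob bx m n)" "t1 T f n = f_arr G (bf_arr bx f (idt M n))"
  "t2 T m g = f_arr G (bf_arr bx (idt M m) g)"
  "lam T c m n = lcon G c (bf_ob bx m n) \<cdot> f_arr G (box_l bx m c n)"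
  "lam' T c m n = inv_arr C (lcon G c (bf_ob bx m n) \<cdot> f_arr G (box_l bx m c n))"
  "rho T c m n = rcon G (bf_ob bx m n) c \<cdot> f_arr G (box_r bx m c n)"
  "rho' T c m n = inv_arr C (rcon G (bf_ob bx m n) c \<cdot> f_arr G (box_r bx m c n))"
  by (simp_all add: bim_tdat_def)

text \<open>Naturality in three variables at once; identities in two of them give the one-variable
  laws of \<open>equivariant\<close>. The lemma \<open>rho_gen\<close> serves the same purpose for
  the right action.\<close>

lemma lam_gen:
  assumes [simp]: "p \<in> arr M" "f \<in> arr C" "q \<in> arr M"
  shows "(f \<otimes>\<^sub>a f_arr G (bf_arr bx p q)) \<cdot> lam T (src C f) (trg M p) (src M q) =
    lam T (trg C f) (src M p) (trg M q) \<cdot> f_arr G (bf_arr bx p (f \<rhd>\<^sub>a\<^bsub>L\<^esub> q))"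
proof -
  have 1: "(f \<otimes>\<^sub>a f_arr G (bf_arr bx p q)) \<cdot> lcon G (src C f) (bf_ob bx (trg M p) (src M q)) =
      lcon G (trg C f) (bf_ob bx (src M p) (trg M q)) \<cdot> f_arr G (f \<rhd>\<^sub>a\<^bsub>lft D\<^esub> bf_arr bx p q)"
    using lcon_nat[of f "bf_arr bx p q"] by simp
  have 2: "f_arr G (f \<rhd>\<^sub>a\<^bsub>lft D\<^esub> bf_arr bx p q) \<cdot> f_arr G (box_l bx (trg M p) (src C f) (src M q)) =
      f_arr G (box_l bx (src M p) (trg C f) (trg M q)) \<cdot> f_arr G (bf_arr bx p (f \<rhd>\<^sub>a\<^bsub>L\<^esub> q))"
    using arg_cong[OF box_l_nat[OF assms], of "f_arr G"] by simp
  show ?thesis by (simp add: T_simps C.comp_tail[OF 1] 2)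
qed

lemma rho_gen:
  assumes [simp]: "p \<in> arr M" "f \<in> arr C" "q \<in> arr M"
  shows "(f_arr G (bf_arr bx p q) \<otimes>\<^sub>a f) \<cdot> rho T (src C f) (trg M p) (src M q) =
    rho T (trg C f) (src M p) (trg M q) \<cdot> f_arr G (bf_arr bx (sa S f \<rhd>\<^sub>a\<^bsub>L\<^esub> p) q)"
proof -
  have 1: "(f_arr G (bf_arr bx p q) \<otimes>\<^sub>a f) \<cdot> rcon G (bf_ob bx (trg M p) (src M q)) (src C f) =
      rcon G (bf_ob bx (src M p) (trg M q)) (trg C f) \<cdot> f_arr G (bf_arr bx p q \<lhd>\<^sub>a\<^bsub>rgt D\<^esub> f)"
    using rcon_nat[of f "bf_arr bx p q"] by simp
  have 2: "f_arr G (bf_arr bx p q \<lhd>\<^sub>a\<^bsub>rgt D\<^esub> f) \<cdot> f_arr G (box_r bx (trg M p) (src C f) (src M q)) =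
      f_arr G (box_r bx (src M p) (trg C f) (trg M q)) \<cdot> f_arr G (bf_arr bx (sa S f \<rhd>\<^sub>a\<^bsub>L\<^esub> p) q)"
    using arg_cong[OF box_r_nat[OF assms], of "f_arr G"] by simp
  show ?thesis by (simp add: T_simps C.comp_tail[OF 1] 2)
qed

lemma T_lam_iso: "c \<in> ob C \<Longrightarrow> m \<in> ob M \<Longrightarrow> n \<in> ob M \<Longrightarrow>
    iso_pair C (lam T c m n) (lam' T c m n) (t0 T m (c \<rhd>\<^sub>o\<^bsub>L\<^esub> n)) (c \<otimes>\<^sub>o t0 T m n)"
  unfolding T_simps by (rule C.iso_pair_inv, rule C.iso_pair_comp[OF G_iso[OF box_l_iso] lcon_iso]) simp_all

lemma T_rho_iso: "c \<in> ob C \<Longrightarrow> m \<in> ob M \<Longrightarrow> n \<in> ob M \<Longrightarrow>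
    iso_pair C (rho T c m n) (rho' T c m n) (t0 T (st S c \<rhd>\<^sub>o\<^bsub>L\<^esub> m) n) (t0 T m n \<otimes>\<^sub>o c)"
  unfolding T_simps by (rule C.iso_pair_inv, rule C.iso_pair_comp[OF G_iso[OF box_r_iso] rcon_iso]) simp_all

text \<open>Two coherence laws are pasted, that of the constraint of \<open>G\<close> and that of
  \<open>box_l\<close>; naturality of \<open>lcon\<close> at \<open>box_l\<close> exchanges the two
  arrows that separate them.\<close>

lemma T_lam_assoc:
  assumes [simp]: "c \<in> ob C" "d \<in> ob C" "m \<in> ob M" "n \<in> ob M"
  shows "assoc C c d (t0 T m n) \<cdot> lam T (c \<otimes>\<^sub>o d) m n =
    (idt C c \<otimes>\<^sub>a lam T d m n) \<cdot> lam T c m (d \<rhd>\<^sub>o\<^bsub>L\<^esub> n) \<cdot> t2 T m (lact_assoc L c d n)"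
proof -
  let ?x = "bf_ob bx m n"
  have a [simp]: "lact_assoc (lft D) c d ?x \<in> arr D" "src D (lact_assoc (lft D) c d ?x) = (c \<otimes>\<^sub>o d) \<rhd>\<^sub>o\<^bsub>lft D\<^esub> ?x"
    "trg D (lact_assoc (lft D) c d ?x) = c \<rhd>\<^sub>o\<^bsub>lft D\<^esub> (d \<rhd>\<^sub>o\<^bsub>lft D\<^esub> ?x)"
    using P.iso_pairD(1-3)[OF nat_iso3D[OF P.left.assoc_nat, of c d ?x]] by (simp_all add: D_category)
  have b [simp]: "lact_assoc L c d n \<in> arr M" "src M (lact_assoc L c d n) = (c \<otimes>\<^sub>o d) \<rhd>\<^sub>o\<^bsub>L\<^esub> n"
    "trg M (lact_assoc L c d n) = c \<rhd>\<^sub>o\<^bsub>L\<^esub> (d \<rhd>\<^sub>o\<^bsub>L\<^esub> n)"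
    using N.mas_simps(1-3)[of c d n] by simp_all
  have 1: "assoc C c d (f_ob G ?x) \<cdot> lcon G (c \<otimes>\<^sub>o d) ?x =
      (idt C c \<otimes>\<^sub>a lcon G d ?x) \<cdot> lcon G c (d \<rhd>\<^sub>o\<^bsub>lft D\<^esub> ?x) \<cdot> f_arr G (lact_assoc (lft D) c d ?x)"
    using G.lcon_assoc[of c d ?x] by simp
  have 2: "f_arr G (lact_assoc (lft D) c d ?x) \<cdot> f_arr G (box_l bx m (c \<otimes>\<^sub>o d) n) =
      f_arr G (idt C c \<rhd>\<^sub>a\<^bsub>lft D\<^esub> box_l bx m d n) \<cdot> f_arr G (box_l bx m c (d \<rhd>\<^sub>o\<^bsub>L\<^esub> n)) \<cdot>
        f_arr G (bf_arr bx (idt M m) (lact_assoc L c d n))"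
    using arg_cong[OF P.box_l_assoc[of m c d n], of "f_arr G"] by simp
  have 3: "lcon G c (d \<rhd>\<^sub>o\<^bsub>lft D\<^esub> ?x) \<cdot> f_arr G (idt C c \<rhd>\<^sub>a\<^bsub>lft D\<^esub> box_l bx m d n) =
      (idt C c \<otimes>\<^sub>a f_arr G (box_l bx m d n)) \<cdot> lcon G c (bf_ob bx m (d \<rhd>\<^sub>o\<^bsub>L\<^esub> n))"
    using lcon_nat[of "idt C c" "box_l bx m d n"] by simp
  have a2 [simp]: "assoc C c d (f_ob G ?x) \<in> arr C" "src C (assoc C c d (f_ob G ?x)) = (c \<otimes>\<^sub>o d) \<otimes>\<^sub>o f_ob G ?x"
    using C.iso_pairD(1,2)[OF assoc_iso[OF ftc, of c d "f_ob G ?x"]] by simp_all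
  have 4: "idt C c \<otimes>\<^sub>a (lcon G d ?x \<cdot> f_arr G (box_l bx m d n)) =
      (idt C c \<otimes>\<^sub>a lcon G d ?x) \<cdot> (idt C c \<otimes>\<^sub>a f_arr G (box_l bx m d n))"
    using C.bf_comp'[of "idt C c" "idt C c" "f_arr G (box_l bx m d n)" "lcon G d ?x"] by simp
  show ?thesis
    by (simp add: T_simps C.comp_tail[OF 1] 2 C.comp_tail[OF 3] 4)
qed

lemma T_lam_unit:
  assumes [simp]: "m \<in> ob M" "n \<in> ob M"
  shows "lunit C (t0 T m n) \<cdot> lam T \<one>\<^sub>o m n = t2 T m (lact_unit L n)"
proof -
  let ?x = "bf_ob bx m n"
  have a [simp]: "lact_unit (lft D) ?x \<in> arr D" "src D (lact_unit (lft D) ?x) = \<one>\<^sub>o \<rhd>\<^sub>o\<^bsub>lft D\<^esub> ?x"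
    using P.iso_pairD(1-3)[OF nat_isoD[OF P.left.unit_nat, of ?x]] by (simp_all add: D_category fix_left_def id_ftr_def)
  have b [simp]: "lunit C (f_ob G ?x) \<in> arr C" "src C (lunit C (f_ob G ?x)) = \<one>\<^sub>o \<otimes>\<^sub>o f_ob G ?x"
    using C.iso_pairD(1,2)[OF lunit_iso[OF ftc, of "f_ob G ?x"]] by simp_all
  have 1: "lunit C (f_ob G ?x) \<cdot> lcon G \<one>\<^sub>o ?x = f_arr G (lact_unit (lft D) ?x)"
    using G.lcon_unit[of ?x] by simp
  have 2: "f_arr G (lact_unit (lft D) ?x) \<cdot> f_arr G (box_l bx m \<one>\<^sub>o n) = f_arr G (bf_arr bx (idt M m) (lact_unit L n))"
    using arg_cong[OF P.box_l_unit[of m n], of "f_arr G"] by simp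
  show ?thesis by (simp add: T_simps C.comp_tail[OF 1] 2)
qed

lemma T_rho_assoc:
  assumes [simp]: "c \<in> ob C" "d \<in> ob C" "m \<in> ob M" "n \<in> ob M"
  shows "assoc C (t0 T m n) c d \<cdot> (rho T c m n \<otimes>\<^sub>a idt C d) \<cdot> rho T d (st S c \<rhd>\<^sub>o\<^bsub>L\<^esub> m) n =
    rho T (c \<otimes>\<^sub>o d) m n \<cdot> t1 T (lact_assoc L (st S d) (st S c) m \<cdot>\<^bsub>M\<^esub> (nu S c d \<rhd>\<^sub>a\<^bsub>L\<^esub> idt M m)) n"
proof -
  let ?x = "bf_ob bx m n" and ?m = "st S c \<rhd>\<^sub>o\<^bsub>L\<^esub> m"
  let ?a = "lact_assoc L (st S d) (st S c) m \<cdot>\<^bsub>M\<^esub> (nu S c d \<rhd>\<^sub>a\<^bsub>L\<^esub> idt M m)"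
  have a [simp]: "ract_assoc (rgt D) ?x c d \<in> arr D" "src D (ract_assoc (rgt D) ?x c d) = (?x \<lhd>\<^sub>o\<^bsub>rgt D\<^esub> c) \<lhd>\<^sub>o\<^bsub>rgt D\<^esub> d"
    "trg D (ract_assoc (rgt D) ?x c d) = ?x \<lhd>\<^sub>o\<^bsub>rgt D\<^esub> (c \<otimes>\<^sub>o d)"
    using P.iso_pairD(1-3)[OF nat_iso3D[OF P.right.assoc_nat, of ?x c d]] by (simp_all add: D_category)
  note nu [simp] = C.iso_pairD(1-3)[OF S_nu]
  have b [simp]: "?a \<in> arr M" "src M ?a = st S (c \<otimes>\<^sub>o d) \<rhd>\<^sub>o\<^bsub>L\<^esub> m"
    "trg M ?a = st S d \<rhd>\<^sub>o\<^bsub>L\<^esub> (st S c \<rhd>\<^sub>o\<^bsub>L\<^esub> m)"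
    using N.mas_simps(1-3)[of "st S d" "st S c" m] by simp_all
  have a2 [simp]: "assoc C (f_ob G ?x) c d \<in> arr C" "src C (assoc C (f_ob G ?x) c d) = (f_ob G ?x \<otimes>\<^sub>o c) \<otimes>\<^sub>o d"
    using C.iso_pairD(1,2)[OF assoc_iso[OF ftc, of "f_ob G ?x" c d]] by simp_all
  have 1: "assoc C (f_ob G ?x) c d \<cdot> (rcon G ?x c \<otimes>\<^sub>a idt C d) \<cdot> rcon G (?x \<lhd>\<^sub>o\<^bsub>rgt D\<^esub> c) d =
      rcon G ?x (c \<otimes>\<^sub>o d) \<cdot> f_arr G (ract_assoc (rgt D) ?x c d)"
    using G.rcon_assoc[of ?x c d] by simp
  have 2: "f_arr G (ract_assoc (rgt D) ?x c d) \<cdot> f_arr G (box_r bx m c n \<lhd>\<^sub>a\<^bsub>rgt D\<^esub> idt C d) \<cdot>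
      f_arr G (box_r bx ?m d n) = f_arr G (box_r bx m (c \<otimes>\<^sub>o d) n) \<cdot> f_arr G (bf_arr bx ?a (idt M n))"
    using arg_cong[OF P.box_r_assoc[of m c d n], of "f_arr G"] by (simp add: R_assoc R_ob del: N.mas_simps)
  have 3: "(f_arr G (box_r bx m c n) \<otimes>\<^sub>a idt C d) \<cdot> rcon G (bf_ob bx ?m n) d =
      rcon G (?x \<lhd>\<^sub>o\<^bsub>rgt D\<^esub> c) d \<cdot> f_arr G (box_r bx m c n \<lhd>\<^sub>a\<^bsub>rgt D\<^esub> idt C d)"
    using rcon_nat[of "idt C d" "box_r bx m c n"] by simp
  have 4: "(rcon G ?x c \<cdot> f_arr G (box_r bx m c n)) \<otimes>\<^sub>a idt C d =
      (rcon G ?x c \<otimes>\<^sub>a idt C d) \<cdot> (f_arr G (box_r bx m c n) \<otimes>\<^sub>a idt C d)"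
    using C.bf_comp'[of "f_arr G (box_r bx m c n)" "rcon G ?x c" "idt C d" "idt C d"] by simp
  show ?thesis
    unfolding T_simps 4 by (simp add: C.comp_tail[OF 3] C.comp_tail3[OF 1] 2)
qed

lemma T_rho_unit:
  assumes [simp]: "m \<in> ob M" "n \<in> ob M"
  shows "runit C (t0 T m n) \<cdot> rho T \<one>\<^sub>o m n =
    t1 T ((uu S \<rhd>\<^sub>a\<^bsub>L\<^esub> idt M m) \<cdot>\<^bsub>M\<^esub> inv_arr M (lact_unit L m)) n"
proof -
  let ?x = "bf_ob bx m n"
  have a [simp]: "ract_unit (rgt D) ?x \<in> arr D" "src D (ract_unit (rgt D) ?x) = ?x \<lhd>\<^sub>o\<^bsub>rgt D\<^esub> \<one>\<^sub>o"
    using P.iso_pairD(1-3)[OF nat_isoD[OF P.right.unit_nat, of ?x]] by (simp_all add: D_category fix_right_def id_ftr_def)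
  have b [simp]: "runit C (f_ob G ?x) \<in> arr C" "src C (runit C (f_ob G ?x)) = f_ob G ?x \<otimes>\<^sub>o \<one>\<^sub>o"
    using C.iso_pairD(1,2)[OF runit_iso[OF ftc, of "f_ob G ?x"]] by simp_all
  have 1: "runit C (f_ob G ?x) \<cdot> rcon G ?x \<one>\<^sub>o = f_arr G (ract_unit (rgt D) ?x)"
    using G.rcon_unit[of ?x] by simp
  have 2: "f_arr G (ract_unit (rgt D) ?x) \<cdot> f_arr G (box_r bx m \<one>\<^sub>o n) =
      f_arr G (bf_arr bx ((uu S \<rhd>\<^sub>a\<^bsub>L\<^esub> idt M m) \<cdot>\<^bsub>M\<^esub> inv_arr M (lact_unit L m)) (idt M n))"
    using arg_cong[OF P.box_r_unit[of m n], of "f_arr G"] by (simp add: R_unit)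
  show ?thesis by (simp add: T_simps C.comp_tail[OF 1] 2)
qed

text \<open>The laws \<open>con_mid\<close> for \<open>G\<close> and \<open>box_mid\<close> for the
  Deligne product share the arrow \<open>mid\<close>, along which they are pasted; the naturality of
  both constraints brings the boxes into position.\<close>

lemma T_lam_rho:
  assumes [simp]: "c \<in> ob C" "d \<in> ob C" "m \<in> ob M" "n \<in> ob M"
  shows "(idt C c \<otimes>\<^sub>a rho T d m n) \<cdot> lam T c (st S d \<rhd>\<^sub>o\<^bsub>L\<^esub> m) n =
    assoc C c (t0 T m n) d \<cdot> (lam T c m n \<otimes>\<^sub>a idt C d) \<cdot> rho T d m (c \<rhd>\<^sub>o\<^bsub>L\<^esub> n)"
proof -
  let ?x = "bf_ob bx m n" and ?m = "st S d \<rhd>\<^sub>o\<^bsub>L\<^esub> m" and ?n = "c \<rhd>\<^sub>o\<^bsub>L\<^esub> n"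
  have a [simp]: "mid D c ?x d \<in> arr D" "src D (mid D c ?x d) = (c \<rhd>\<^sub>o\<^bsub>lft D\<^esub> ?x) \<lhd>\<^sub>o\<^bsub>rgt D\<^esub> d"
    "trg D (mid D c ?x d) = c \<rhd>\<^sub>o\<^bsub>lft D\<^esub> (?x \<lhd>\<^sub>o\<^bsub>rgt D\<^esub> d)"
    using P.iso_pairD(1-3)[OF nat_iso3D[OF P.mid_nat, of c ?x d]] by (simp_all add: D_category)
  have a2 [simp]: "assoc C c (f_ob G ?x) d \<in> arr C" "src C (assoc C c (f_ob G ?x) d) = (c \<otimes>\<^sub>o f_ob G ?x) \<otimes>\<^sub>o d"
    using C.iso_pairD(1,2)[OF assoc_iso[OF ftc, of c "f_ob G ?x" d]] by simp_all
  have 1: "(idt C c \<otimes>\<^sub>a f_arr G (box_r bx m d n)) \<cdot> lcon G c (bf_ob bx ?m n) =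
      lcon G c (?x \<lhd>\<^sub>o\<^bsub>rgt D\<^esub> d) \<cdot> f_arr G (idt C c \<rhd>\<^sub>a\<^bsub>lft D\<^esub> box_r bx m d n)"
    using lcon_nat[of "idt C c" "box_r bx m d n"] by simp
  have 2: "f_arr G (idt C c \<rhd>\<^sub>a\<^bsub>lft D\<^esub> box_r bx m d n) \<cdot> f_arr G (box_l bx ?m c n) =
      f_arr G (mid D c ?x d) \<cdot> f_arr G (box_l bx m c n \<lhd>\<^sub>a\<^bsub>rgt D\<^esub> idt C d) \<cdot> f_arr G (box_r bx m d ?n)"
    using arg_cong[OF P.box_mid[of m c d n], of "f_arr G"] by (simp add: R_ob)
  have 3: "(idt C c \<otimes>\<^sub>a rcon G ?x d) \<cdot> lcon G c (?x \<lhd>\<^sub>o\<^bsub>rgt D\<^esub> d) \<cdot> f_arr G (mid D c ?x d) =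
      assoc C c (f_ob G ?x) d \<cdot> (lcon G c ?x \<otimes>\<^sub>a idt C d) \<cdot> rcon G (c \<rhd>\<^sub>o\<^bsub>lft D\<^esub> ?x) d"
    using G.con_mid[of c ?x d] by simp
  have 4: "(f_arr G (box_l bx m c n) \<otimes>\<^sub>a idt C d) \<cdot> rcon G (bf_ob bx m ?n) d =
      rcon G (c \<rhd>\<^sub>o\<^bsub>lft D\<^esub> ?x) d \<cdot> f_arr G (box_l bx m c n \<lhd>\<^sub>a\<^bsub>rgt D\<^esub> idt C d)"
    using rcon_nat[of "idt C d" "box_l bx m c n"] by simp
  have 5: "(lcon G c ?x \<cdot> f_arr G (box_l bx m c n)) \<otimes>\<^sub>a idt C d =
      (lcon G c ?x \<otimes>\<^sub>a idt C d) \<cdot> (f_arr G (box_l bx m c n) \<otimes>\<^sub>a idt C d)"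
    using C.bf_comp'[of "f_arr G (box_l bx m c n)" "lcon G c ?x" "idt C d" "idt C d"] by simp
  have 6: "idt C c \<otimes>\<^sub>a (rcon G ?x d \<cdot> f_arr G (box_r bx m d n)) =
      (idt C c \<otimes>\<^sub>a rcon G ?x d) \<cdot> (idt C c \<otimes>\<^sub>a f_arr G (box_r bx m d n))"
    using C.bf_comp'[of "idt C c" "idt C c" "f_arr G (box_r bx m d n)" "rcon G ?x d"] by simp
  show ?thesis
    unfolding T_simps 5 6 by (simp add: C.comp_tail[OF 1] 2 C.comp_tail3[OF 3] C.comp_tail[OF 4])
qed

lemma equivariant_T: "equivariant (mc C) (mm C M L) S T"
proof unfold_locales
  fix c d m n assume "c \<in> ob (mc C)" "d \<in> ob (mc C)" "m \<in> ob (mm C M L)" "n \<in> ob (mm C M L)"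
  then have o: "c \<in> ob C" "d \<in> ob C" "m \<in> ob M" "n \<in> ob M" by simp_all
  show "asc (mc C) c d (t0 T m n) \<cdot>\<^bsub>mc C\<^esub> lam T (tob (mc C) c d) m n =
      lwh (mc C) c (lam T d m n) \<cdot>\<^bsub>mc C\<^esub> lam T c m (aob (mm C M L) d n) \<cdot>\<^bsub>mc C\<^esub> t2 T m (mas (mm C M L) c d n)"
    using T_lam_assoc[OF o] by simp
  show "asc (mc C) (t0 T m n) c d \<cdot>\<^bsub>mc C\<^esub> rwh (mc C) (rho T c m n) d \<cdot>\<^bsub>mc C\<^esub> rho T d (aob (mm C M L) (st S c) m) n =
      rho T (tob (mc C) c d) m n \<cdot>\<^bsub>mc C\<^esub> t1 T (mas (mm C M L) (st S d) (st S c) m \<cdot>\<^bsub>mm C M L\<^esub> rac (mm C M L) (nu S c d) m) n"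
    using T_rho_assoc[OF o] by simp
  show "lwh (mc C) c (rho T d m n) \<cdot>\<^bsub>mc C\<^esub> lam T c (aob (mm C M L) (st S d) m) n =
      asc (mc C) c (t0 T m n) d \<cdot>\<^bsub>mc C\<^esub> rwh (mc C) (lam T c m n) d \<cdot>\<^bsub>mc C\<^esub> rho T d m (aob (mm C M L) c n)"
    using T_lam_rho[OF o] by simp
next
  fix m n assume "m \<in> ob (mm C M L)" "n \<in> ob (mm C M L)"
  then have o: "m \<in> ob M" "n \<in> ob M" by simp_all
  show "lun (mc C) (t0 T m n) \<cdot>\<^bsub>mc C\<^esub> lam T (uob (mc C)) m n = t2 T m (mun (mm C M L) n)"
    using T_lam_unit[OF o] by simp
  show "run (mc C) (t0 T m n) \<cdot>\<^bsub>mc C\<^esub> rho T (uob (mc C)) m n =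
      t1 T (rac (mm C M L) (uu S) m \<cdot>\<^bsub>mm C M L\<^esub> mun' (mm C M L) m) n"
    using T_rho_unit[OF o] by simp
next
  fix f m n assume "f \<in> arr (mc C)" "m \<in> ob (mm C M L)" "n \<in> ob (mm C M L)"
  then have [simp]: "f \<in> arr C" "m \<in> ob M" "n \<in> ob M" by simp_all
  show "rwh (mc C) f (t0 T m n) \<cdot>\<^bsub>mc C\<^esub> lam T (src (mc C) f) m n = lam T (trg (mc C) f) m n \<cdot>\<^bsub>mc C\<^esub> t2 T m (rac (mm C M L) f n)"
    using lam_gen[of "idt M m" f "idt M n"] by (simp add: T_simps(1-3))
  show "lwh (mc C) (t0 T m n) f \<cdot>\<^bsub>mc C\<^esub> rho T (src (mc C) f) m n = rho T (trg (mc C) f) m n \<cdot>\<^bsub>mc C\<^esub> t1 T (rac (mm C M L) (sa S f) m) n"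
    using rho_gen[of "idt M m" f "idt M n"] by (simp add: T_simps(1-3))
next
  fix c g n assume "c \<in> ob (mc C)" "g \<in> arr (mm C M L)" "n \<in> ob (mm C M L)"
  then have [simp]: "c \<in> ob C" "g \<in> arr M" "n \<in> ob M" by simp_all
  show "lwh (mc C) c (t1 T g n) \<cdot>\<^bsub>mc C\<^esub> lam T c (trg (mm C M L) g) n = lam T c (src (mm C M L) g) n \<cdot>\<^bsub>mc C\<^esub> t1 T g (aob (mm C M L) c n)"
    using lam_gen[of g "idt C c" "idt M n"] by (simp add: T_simps(1-3) M.idt)
  show "rwh (mc C) (t1 T g n) c \<cdot>\<^bsub>mc C\<^esub> rho T c (trg (mm C M L) g) n = rho T c (src (mm C M L) g) n \<cdot>\<^bsub>mc C\<^esub> t1 T (lac (mm C M L) (st S c) g) n"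
    using rho_gen[of g "idt C c" "idt M n"] by (simp add: T_simps(1-3) S_idt)
  show "lwh (mc C) c (t2 T n g) \<cdot>\<^bsub>mc C\<^esub> lam T c n (src (mm C M L) g) = lam T c n (trg (mm C M L) g) \<cdot>\<^bsub>mc C\<^esub> t2 T n (lac (mm C M L) c g)"
    using lam_gen[of "idt M n" "idt C c" g] by (simp add: T_simps(1-3))
  show "rwh (mc C) (t2 T n g) c \<cdot>\<^bsub>mc C\<^esub> rho T c n (src (mm C M L) g) = rho T c n (trg (mm C M L) g) \<cdot>\<^bsub>mc C\<^esub> t2 T (aob (mm C M L) (st S c) n) g"
    using rho_gen[of "idt M n" "idt C c" g] by (simp add: T_simps(1-3) S_idt M.idt)
qed (use T_lam_iso T_rho_iso S_nu S_uu in \<open>simp_all add: T_simps(1-3) bx_comp flip: G_hom(6)\<close>)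

text \<open>The definition applies \<open>G\<close> to all boxes first and its constraints
  afterwards; naturality of \<open>rcon\<close> at \<open>box_l\<close> regroups them into
  \<open>rho\<close> and \<open>lam\<close>.\<close>

lemma conj_iso_eq:
  assumes [simp]: "c \<in> ob C" "e \<in> ob C" "m \<in> ob M" "\<theta> \<in> arr C" "src C \<theta> = st S e" "trg C \<theta> = c"
  shows "conj_iso C M L D bx G e \<theta> c m = assoc C c (t0 T m m) e \<cdot> (lam T c m m \<otimes>\<^sub>a idt C e) \<cdot>
    rho T e m (c \<rhd>\<^sub>o\<^bsub>L\<^esub> m) \<cdot> t1 T (\<theta> \<rhd>\<^sub>a\<^bsub>L\<^esub> idt M m) (c \<rhd>\<^sub>o\<^bsub>L\<^esub> m)"
proof -
  let ?x = "bf_ob bx m m" and ?n = "c \<rhd>\<^sub>o\<^bsub>L\<^esub> m"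
  have a2 [simp]: "assoc C c (f_ob G ?x) e \<in> arr C" "src C (assoc C c (f_ob G ?x) e) = (c \<otimes>\<^sub>o f_ob G ?x) \<otimes>\<^sub>o e"
    using C.iso_pairD(1,2)[OF assoc_iso[OF ftc, of c "f_ob G ?x" e]] by simp_all
  have 4: "(f_arr G (box_l bx m c m) \<otimes>\<^sub>a idt C e) \<cdot> rcon G (bf_ob bx m ?n) e =
      rcon G (c \<rhd>\<^sub>o\<^bsub>lft D\<^esub> ?x) e \<cdot> f_arr G (box_l bx m c m \<lhd>\<^sub>a\<^bsub>rgt D\<^esub> idt C e)"
    using rcon_nat[of "idt C e" "box_l bx m c m"] by simp
  have 5: "(lcon G c ?x \<cdot> f_arr G (box_l bx m c m)) \<otimes>\<^sub>a idt C e =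
      (lcon G c ?x \<otimes>\<^sub>a idt C e) \<cdot> (f_arr G (box_l bx m c m) \<otimes>\<^sub>a idt C e)"
    using C.bf_comp'[of "f_arr G (box_l bx m c m)" "lcon G c ?x" "idt C e" "idt C e"] by simp
  show ?thesis
    unfolding T_simps 5 conj_iso_def by (simp add: C.comp_tail[OF 4])
qed

end

end

section \<open>Modules over a finite-dimensional algebra\<close>

lemma mult_entry:
  assumes "A \<in> carrier_mat a b" "B \<in> carrier_mat b c" "p < a" "q < c"
  shows "(A * B) $$ (p, q) = (\<Sum>r<b. A $$ (p, r) * B $$ (r, q))"
  using assms by (simp add: scalar_prod_def lessThan_atLeast0)

text \<open>The size is prescribed and not read off from the summands, so that an empty combination
  is the zero matrix of that size.\<close>

definition lin_comb :: "nat \<Rightarrow> nat \<Rightarrow> nat \<Rightarrow> (nat \<Rightarrow> 'k::field) \<Rightarrow> (nat \<Rightarrow> 'k mat) \<Rightarrow> 'k mat" where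
  "lin_comb a b n c \<rho> = mat a b (\<lambda>(p, q). \<Sum>l<n. c l * \<rho> l $$ (p, q))"

lemma lin_comb_carrier [simp]: "lin_comb a b n c \<rho> \<in> carrier_mat a b"
  by (simp add: lin_comb_def)

lemma lin_comb_cong: "(\<And>l. l < n \<Longrightarrow> \<rho> l = \<rho>' l) \<Longrightarrow> lin_comb a b n c \<rho> = lin_comb a b n c \<rho>'"
  by (simp add: lin_comb_def)

lemma mult_lin_comb:
  assumes A: "A \<in> carrier_mat r a" and \<rho>: "\<And>l. l < n \<Longrightarrow> \<rho> l \<in> carrier_mat a b"
  shows "A * lin_comb a b n c \<rho> = lin_comb r b n c (\<lambda>l. A * \<rho> l)"
proof (rule eq_matI)
  fix p q assume "p < dim_row (lin_comb r b n c (\<lambda>l. A * \<rho> l))" "q < dim_col (lin_comb r b n c (\<lambda>l. A * \<rho> l))"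
  then have pq: "p < r" "q < b" by (simp_all add: lin_comb_def)
  have "(A * lin_comb a b n c \<rho>) $$ (p, q) = (\<Sum>s<a. \<Sum>l<n. A $$ (p, s) * (c l * \<rho> l $$ (s, q)))"
    using mult_entry[OF A lin_comb_carrier pq] pq by (simp add: lin_comb_def sum_distrib_left)
  also have "\<dots> = (\<Sum>l<n. \<Sum>s<a. A $$ (p, s) * (c l * \<rho> l $$ (s, q)))" by (rule sum.swap)
  also have "\<dots> = (\<Sum>l<n. c l * (A * \<rho> l) $$ (p, q))"
  proof (rule sum.cong[OF refl])
    fix l assume "l \<in> {..<n}"
    then have "(A * \<rho> l) $$ (p, q) = (\<Sum>s<a. A $$ (p, s) * \<rho> l $$ (s, q))"
      using mult_entry[OF A \<rho> pq] by simp
    then show "(\<Sum>s<a. A $$ (p, s) * (c l * \<rho> l $$ (s, q))) = c l * (A * \<rho> l) $$ (p, q)"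
      by (simp add: sum_distrib_left mult.left_commute)
  qed
  finally show "(A * lin_comb a b n c \<rho>) $$ (p, q) = lin_comb r b n c (\<lambda>l. A * \<rho> l) $$ (p, q)"
    using pq by (simp add: lin_comb_def)
qed (use A in \<open>simp_all add: lin_comb_def\<close>)

lemma lin_comb_mult:
  assumes B: "B \<in> carrier_mat b r" and \<rho>: "\<And>l. l < n \<Longrightarrow> \<rho> l \<in> carrier_mat a b"
  shows "lin_comb a b n c \<rho> * B = lin_comb a r n c (\<lambda>l. \<rho> l * B)"
proof (rule eq_matI)
  fix p q assume "p < dim_row (lin_comb a r n c (\<lambda>l. \<rho> l * B))" "q < dim_col (lin_comb a r n c (\<lambda>l. \<rho> l * B))"
  then have pq: "p < a" "q < r" by (simp_all add: lin_comb_def)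
  have "(lin_comb a b n c \<rho> * B) $$ (p, q) = (\<Sum>s<b. \<Sum>l<n. c l * \<rho> l $$ (p, s) * B $$ (s, q))"
    using mult_entry[OF lin_comb_carrier B pq] pq by (simp add: lin_comb_def sum_distrib_right)
  also have "\<dots> = (\<Sum>l<n. \<Sum>s<b. c l * \<rho> l $$ (p, s) * B $$ (s, q))" by (rule sum.swap)
  also have "\<dots> = (\<Sum>l<n. c l * (\<rho> l * B) $$ (p, q))"
  proof (rule sum.cong[OF refl])
    fix l assume "l \<in> {..<n}"
    then have "(\<rho> l * B) $$ (p, q) = (\<Sum>s<b. \<rho> l $$ (p, s) * B $$ (s, q))"
      using mult_entry[OF \<rho> B pq] by simp
    then show "(\<Sum>s<b. c l * \<rho> l $$ (p, s) * B $$ (s, q)) = c l * (\<rho> l * B) $$ (p, q)"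
      by (simp add: sum_distrib_left mult.assoc)
  qed
  finally show "(lin_comb a b n c \<rho> * B) $$ (p, q) = lin_comb a r n c (\<lambda>l. \<rho> l * B) $$ (p, q)"
    using pq by (simp add: lin_comb_def)
qed (use B in \<open>simp_all add: lin_comb_def\<close>)

lemma fd_module_iff:
  "fd_module R X \<longleftrightarrow> (\<forall>i<alg_dim R. snd X i \<in> carrier_mat (fst X) (fst X)) \<and>
     (\<forall>i<alg_dim R. \<forall>j<alg_dim R. snd X i * snd X j = lin_comb (fst X) (fst X) (alg_dim R) (mul_const R i j) (snd X)) \<and>
     lin_comb (fst X) (fst X) (alg_dim R) (unit_const R) (snd X) = 1\<^sub>m (fst X)"
  by (simp add: fd_module_def lin_comb_def split: prod.split)

definition module_hom :: "'k::field fd_alg \<Rightarrow> 'k rep \<Rightarrow> 'k rep \<Rightarrow> 'k mat \<Rightarrow> bool" where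
  "module_hom R X Y f \<longleftrightarrow> f \<in> carrier_mat (fst Y) (fst X) \<and> (\<forall>i<alg_dim R. f * snd X i = snd Y i * f)"

subsection \<open>Free modules\<close>

lemma sum_div_mod: "(\<Sum>p<n * d. h (p div d) (p mod d)) = (\<Sum>j<n. \<Sum>s<d. h j s)" for h :: "nat \<Rightarrow> nat \<Rightarrow> 'b::comm_monoid_add"
proof (cases "d = 0")
  case False
  have "(\<Sum>j<n. \<Sum>s<d. h j s) = (\<Sum>(j, s)\<in>{..<n} \<times> {..<d}. h j s)" by (simp add: sum.cartesian_product)
  also have "\<dots> = (\<Sum>p<n * d. h (p div d) (p mod d))"
  proof (rule sum.reindex_bij_witness[of _ "\<lambda>p. (p div d, p mod d)" "\<lambda>(j, s). j * d + s"])
    fix b assume "b \<in> {..<n} \<times> {..<d}"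
    then obtain j s where b: "b = (j, s)" "j < n" "s < d" by auto
    have "j * d + s < Suc j * d" using b by simp
    also have "\<dots> \<le> n * d" using b by (intro mult_right_mono) auto
    finally show "(case b of (j, s) \<Rightarrow> j * d + s) \<in> {..<n * d}" by (simp add: b)
  qed (use False in \<open>auto simp: less_mult_imp_div_less\<close>)
  finally show ?thesis by simp
qed simp

text \<open>The regular module taken \<open>d\<close> times: the index \<open>p\<close> stands for
  the basis element \<open>p div d\<close> of the algebra in the copy \<open>p mod d\<close>. The
  columns of \<open>free_gens\<close> are the units of the copies, and \<open>free_hom\<close>
  extends a choice \<open>W\<close> of images for them.\<close>

definition free_module :: "'k::field fd_alg \<Rightarrow> nat \<Rightarrow> 'k rep" where
  "free_module R d = (alg_dim R * d, \<lambda>i. mat (alg_dim R * d) (alg_dim R * d)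
     (\<lambda>(p, q). if p mod d = q mod d then mul_const R i (q div d) (p div d) else 0))"

definition free_gens :: "'k::field fd_alg \<Rightarrow> nat \<Rightarrow> 'k mat" where
  "free_gens R d = mat (alg_dim R * d) d (\<lambda>(p, t). if p mod d = t then unit_const R (p div d) else 0)"

definition free_hom :: "'k::field fd_alg \<Rightarrow> nat \<Rightarrow> 'k rep \<Rightarrow> 'k mat \<Rightarrow> 'k mat" where
  "free_hom R d X W = mat (fst X) (alg_dim R * d) (\<lambda>(p, q). (snd X (q div d) * W) $$ (p, q mod d))"

lemma div_mod_less: "p < n * d \<Longrightarrow> p div d < n" "p < n * d \<Longrightarrow> p mod d < d" for p n d :: nat
  by (auto simp: less_mult_imp_div_less) (metis gr_zeroI mult_0_right not_less_zero mod_less_divisor)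

lemma free_module_dim [simp]: "fst (free_module R d) = alg_dim R * d"
  by (simp add: free_module_def)

lemma free_module_carrier [simp]: "snd (free_module R d) i \<in> carrier_mat (alg_dim R * d) (alg_dim R * d)"
  by (simp add: free_module_def)

lemma free_gens_carrier [simp]: "free_gens R d \<in> carrier_mat (alg_dim R * d) d"
  by (simp add: free_gens_def)

lemma fd_module_free_module:
  assumes R: "fd_algebra R"
  shows "fd_module R (free_module R d)"
proof -
  let ?n = "alg_dim R" and ?\<rho> = "snd (free_module R d)"
  have e: "?\<rho> i $$ (p, q) = (if p mod d = q mod d then mul_const R i (q div d) (p div d) else 0)"
    if "p < ?n * d" "q < ?n * d" for i p q using that by (simp add: free_module_def)
  have "?\<rho> i * ?\<rho> j = lin_comb (?n * d) (?n * d) ?n (mul_const R i j) ?\<rho>" if ij: "i < ?n" "j < ?n" for i j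
  proof (rule eq_matI)
    fix p q assume "p < dim_row (lin_comb (?n * d) (?n * d) ?n (mul_const R i j) ?\<rho>)"
      "q < dim_col (lin_comb (?n * d) (?n * d) ?n (mul_const R i j) ?\<rho>)"
    then have pq: "p < ?n * d" "q < ?n * d" by (simp_all add: lin_comb_def)
    have "(?\<rho> i * ?\<rho> j) $$ (p, q) = (\<Sum>r<?n * d. ?\<rho> i $$ (p, r) * ?\<rho> j $$ (r, q))"
      by (rule mult_entry[OF free_module_carrier free_module_carrier pq])
    also have "\<dots> = (\<Sum>r<?n * d. (\<lambda>u v. (if p mod d = v then mul_const R i u (p div d) else 0) *
        (if v = q mod d then mul_const R j (q div d) u else 0)) (r div d) (r mod d))"
      using pq by (intro sum.cong) (simp_all add: e)
    also have "\<dots> = (\<Sum>u<?n. \<Sum>v<d. (if p mod d = v then mul_const R i u (p div d) else 0) *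
        (if v = q mod d then mul_const R j (q div d) u else 0))" by (rule sum_div_mod)
    also have "\<dots> = (\<Sum>u<?n. \<Sum>v<d. if v = q mod d then (if p mod d = q mod d then
        mul_const R j (q div d) u * mul_const R i u (p div d) else 0) else 0)"
      by (intro sum.cong refl) auto
    also have "\<dots> = (\<Sum>u<?n. if p mod d = q mod d then
        mul_const R j (q div d) u * mul_const R i u (p div d) else 0)"
      using div_mod_less[OF pq(2)] by simp
    \<comment> \<open>Associativity of the structure constants, for the basis elements
      \<open>i\<close>, \<open>j\<close> and \<open>q div d\<close>.\<close>
    also have "\<dots> = (if p mod d = q mod d then
        \<Sum>u<?n. mul_const R i j u * mul_const R u (q div d) (p div d) else 0)"
      using R ij div_mod_less[OF pq(1)] div_mod_less[OF pq(2)] by (auto simp: fd_algebra_def)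
    also have "\<dots> = lin_comb (?n * d) (?n * d) ?n (mul_const R i j) ?\<rho> $$ (p, q)"
      using pq by (simp add: lin_comb_def e)
    finally show "(?\<rho> i * ?\<rho> j) $$ (p, q) = lin_comb (?n * d) (?n * d) ?n (mul_const R i j) ?\<rho> $$ (p, q)" .
  qed (simp_all add: lin_comb_def free_module_def)
  moreover have "lin_comb (?n * d) (?n * d) ?n (unit_const R) ?\<rho> = 1\<^sub>m (?n * d)"
  proof (rule eq_matI)
    fix p q assume "p < dim_row (1\<^sub>m (?n * d) :: 'a mat)" "q < dim_col (1\<^sub>m (?n * d) :: 'a mat)"
    then have pq: "p < ?n * d" "q < ?n * d" by simp_all
    have pq': "p = q \<longleftrightarrow> p div d = q div d \<and> p mod d = q mod d" by (metis div_mult_mod_eq)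
    have "(\<Sum>l<?n. unit_const R l * mul_const R l (q div d) (p div d)) = (if q div d = p div d then 1 else 0)"
      using R div_mod_less[OF pq(1)] div_mod_less[OF pq(2)] by (simp add: fd_algebra_def)
    then show "lin_comb (?n * d) (?n * d) ?n (unit_const R) ?\<rho> $$ (p, q) = 1\<^sub>m (?n * d) $$ (p, q)"
      using pq by (cases "p mod d = q mod d") (auto simp: lin_comb_def e pq')
  qed (simp_all add: lin_comb_def)
  ultimately show ?thesis by (simp add: fd_module_iff)
qed

text \<open>A basis element acting on the unit of a copy gives a standard basis vector. Hence the
  generators determine every homomorphism.\<close>

lemma free_module_gens:
  assumes R: "fd_algebra R" and i: "i < alg_dim R"
  shows "snd (free_module R d) i * free_gens R d =
    mat (alg_dim R * d) d (\<lambda>(p, t). if p = i * d + t then 1 else 0)" (is "?L = ?R")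
proof (rule eq_matI)
  let ?n = "alg_dim R"
  fix p t assume "p < dim_row ?R" "t < dim_col ?R"
  then have pt: "p < ?n * d" "t < d" by simp_all
  have "?L $$ (p, t) = (\<Sum>r<?n * d. snd (free_module R d) i $$ (p, r) * free_gens R d $$ (r, t))"
    by (rule mult_entry[OF free_module_carrier free_gens_carrier pt])
  also have "\<dots> = (\<Sum>r<?n * d. (\<lambda>u v. (if p mod d = v then mul_const R i u (p div d) else 0) *
      (if v = t then unit_const R u else 0)) (r div d) (r mod d))"
    using pt by (intro sum.cong) (simp_all add: free_module_def free_gens_def)
  also have "\<dots> = (\<Sum>u<?n. \<Sum>v<d. (if p mod d = v then mul_const R i u (p div d) else 0) *
      (if v = t then unit_const R u else 0))" by (rule sum_div_mod)
  also have "\<dots> = (\<Sum>u<?n. \<Sum>v<d. if v = t then (if p mod d = t then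
      unit_const R u * mul_const R i u (p div d) else 0) else 0)"
    by (intro sum.cong refl) auto
  also have "\<dots> = (if p mod d = t then \<Sum>u<?n. unit_const R u * mul_const R i u (p div d) else 0)"
    using pt by auto
  also have "\<dots> = (if p mod d = t \<and> i = p div d then 1 else 0)"
    using R i div_mod_less[OF pt(1)] by (simp add: fd_algebra_def)
  also have "\<dots> = ?R $$ (p, t)" using pt by auto
  finally show "?L $$ (p, t) = ?R $$ (p, t)" .
qed (simp_all add: free_module_def free_gens_def)

text \<open>Column \<open>q\<close> is the basis element \<open>q div d\<close> acting on column
  \<open>q mod d\<close> of \<open>W\<close>. Compatibility with the action is the multiplication
  law of \<open>X\<close>, and the value on the generators is its unit law.\<close>

lemma free_hom:
  assumes R: "fd_algebra R" and X: "fd_module R X" and W: "W \<in> carrier_mat (fst X) d"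
  shows "module_hom R (free_module R d) X (free_hom R d X W)" "free_hom R d X W * free_gens R d = W"
proof -
  let ?n = "alg_dim R" and ?g = "free_hom R d X W" and ?m = "fst X" and ?\<rho> = "snd X"
  have g: "?g \<in> carrier_mat ?m (?n * d)" by (simp add: free_hom_def)
  have \<rho>: "?\<rho> i \<in> carrier_mat ?m ?m" if "i < ?n" for i using X that by (simp add: fd_module_iff)
  have \<rho>W: "?\<rho> i * W \<in> carrier_mat ?m d" if "i < ?n" for i using \<rho>[OF that] W by simp
  have "?g * snd (free_module R d) i = ?\<rho> i * ?g" if i: "i < ?n" for i
  proof (rule eq_matI)
    fix p q assume "p < dim_row (?\<rho> i * ?g)" "q < dim_col (?\<rho> i * ?g)"
    then have pq: "p < ?m" "q < ?n * d" using \<rho>[OF i] g by auto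
    have q: "q div d < ?n" "q mod d < d" using div_mod_less[OF pq(2)] .
    have "(?g * snd (free_module R d) i) $$ (p, q) = (\<Sum>r<?n * d. ?g $$ (p, r) * snd (free_module R d) i $$ (r, q))"
      by (rule mult_entry[OF g free_module_carrier pq])
    also have "\<dots> = (\<Sum>r<?n * d. (\<lambda>u v. (?\<rho> u * W) $$ (p, v) * (if v = q mod d then mul_const R i (q div d) u else 0))
        (r div d) (r mod d))"
      using pq by (intro sum.cong) (simp_all add: free_module_def free_hom_def)
    also have "\<dots> = (\<Sum>u<?n. \<Sum>v<d. (?\<rho> u * W) $$ (p, v) * (if v = q mod d then mul_const R i (q div d) u else 0))"
      by (rule sum_div_mod)
    also have "\<dots> = (\<Sum>u<?n. mul_const R i (q div d) u * (?\<rho> u * W) $$ (p, q mod d))"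
      using q by (simp add: mult.commute if_distrib[of "\<lambda>x. _ * x"] cong: if_cong)
    also have "\<dots> = (lin_comb ?m d ?n (mul_const R i (q div d)) (\<lambda>u. ?\<rho> u * W)) $$ (p, q mod d)"
      using pq q by (simp add: lin_comb_def)
    also have "\<dots> = (?\<rho> i * ?\<rho> (q div d) * W) $$ (p, q mod d)"
      using X i q lin_comb_mult[OF W, of ?n ?\<rho> ?m "mul_const R i (q div d)"] \<rho> by (simp add: fd_module_iff)
    also have "\<dots> = (?\<rho> i * (?\<rho> (q div d) * W)) $$ (p, q mod d)"
      using assoc_mult_mat[OF \<rho>[OF i] \<rho>[OF q(1)] W] by simp
    also have "\<dots> = (\<Sum>r<?m. ?\<rho> i $$ (p, r) * ?g $$ (r, q))"
      unfolding mult_entry[OF \<rho>[OF i] \<rho>W[OF q(1)] pq(1) q(2)]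
      using pq by (intro sum.cong) (simp_all add: free_hom_def)
    also have "\<dots> = (?\<rho> i * ?g) $$ (p, q)" by (rule mult_entry[OF \<rho>[OF i] g pq, symmetric])
    finally show "(?g * snd (free_module R d) i) $$ (p, q) = (?\<rho> i * ?g) $$ (p, q)" .
  qed (use g \<rho>[OF i] in \<open>auto simp: free_module_def\<close>)
  then show "module_hom R (free_module R d) X ?g" using g by (simp add: module_hom_def)
  show "?g * free_gens R d = W"
  proof (rule eq_matI)
    fix p t assume "p < dim_row W" "t < dim_col W"
    then have pt: "p < ?m" "t < d" using W by auto
    have "(?g * free_gens R d) $$ (p, t) = (\<Sum>r<?n * d. ?g $$ (p, r) * free_gens R d $$ (r, t))"
      by (rule mult_entry[OF g free_gens_carrier pt])
    also have "\<dots> = (\<Sum>r<?n * d. (\<lambda>u v. (?\<rho> u * W) $$ (p, v) * (if v = t then unit_const R u else 0)) (r div d) (r mod d))"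
      using pt by (intro sum.cong) (simp_all add: free_gens_def free_hom_def)
    also have "\<dots> = (\<Sum>u<?n. \<Sum>v<d. (?\<rho> u * W) $$ (p, v) * (if v = t then unit_const R u else 0))" by (rule sum_div_mod)
    also have "\<dots> = (\<Sum>u<?n. \<Sum>v<d. if v = t then unit_const R u * (?\<rho> u * W) $$ (p, t) else 0)"
      by (intro sum.cong refl) simp
    also have "\<dots> = (\<Sum>u<?n. unit_const R u * (?\<rho> u * W) $$ (p, t))" using pt by simp
    also have "\<dots> = lin_comb ?m d ?n (unit_const R) (\<lambda>u. ?\<rho> u * W) $$ (p, t)" using pt by (simp add: lin_comb_def)
    also have "\<dots> = W $$ (p, t)"
      using X lin_comb_mult[OF W, of ?n ?\<rho> ?m "unit_const R"] \<rho> W by (simp add: fd_module_iff)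
    finally show "(?g * free_gens R d) $$ (p, t) = W $$ (p, t)" .
  qed (use g W in \<open>auto simp: free_gens_def\<close>)
qed

lemma free_hom_unique:
  assumes R: "fd_algebra R" and X: "fd_module R X" and g: "module_hom R (free_module R d) X g"
  shows "g = free_hom R d X (g * free_gens R d)"
proof (rule eq_matI)
  let ?n = "alg_dim R" and ?m = "fst X" and ?W = "g * free_gens R d"
  have gc: "g \<in> carrier_mat ?m (?n * d)" using g by (simp add: module_hom_def)
  fix p q assume "p < dim_row (free_hom R d X ?W)" "q < dim_col (free_hom R d X ?W)"
  then have pq: "p < ?m" "q < ?n * d" by (simp_all add: free_hom_def)
  have q: "q div d < ?n" "q mod d < d" using div_mod_less[OF pq(2)] .
  have \<rho>: "snd X (q div d) \<in> carrier_mat ?m ?m" using X q by (simp add: fd_module_iff)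
  let ?E = "mat (?n * d) d (\<lambda>(p, t). if p = (q div d) * d + t then 1 else 0 :: 'a)"
  have E: "?E \<in> carrier_mat (?n * d) d" by simp
  have "(snd X (q div d) * ?W) = (snd X (q div d) * g) * free_gens R d"
    using assoc_mult_mat[OF \<rho> gc free_gens_carrier] by simp
  also have "\<dots> = (g * snd (free_module R d) (q div d)) * free_gens R d" using g q by (simp add: module_hom_def)
  also have "\<dots> = g * ?E"
    using assoc_mult_mat[OF gc free_module_carrier free_gens_carrier] free_module_gens[OF R q(1)] by simp
  finally have "(snd X (q div d) * ?W) $$ (p, q mod d) = (\<Sum>r<?n * d. g $$ (p, r) * ?E $$ (r, q mod d))"
    using mult_entry[OF gc E pq(1) q(2)] by simp
  also have "\<dots> = (\<Sum>r<?n * d. if r = q then g $$ (p, r) else 0)"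
    using q by (intro sum.cong) auto
  also have "\<dots> = g $$ (p, q)" using pq by simp
  finally show "g $$ (p, q) = free_hom R d X ?W $$ (p, q)" using pq by (simp add: free_hom_def)
qed (use g in \<open>auto simp: module_hom_def free_hom_def\<close>)

subsection \<open>Kernels of families of matrices\<close>

text \<open>If \<open>p\<close> were larger, padding by zeros would give square matrices with
  \<open>l' * k' = 1\<close>. For square matrices this implies \<open>k' * l' = 1\<close>, although
  row \<open>n\<close> of \<open>k'\<close> vanishes.\<close>

lemma left_invertible_dim:
  fixes k :: "'k::field mat"
  assumes k: "k \<in> carrier_mat n p" and l: "l \<in> carrier_mat p n" and lk: "l * k = 1\<^sub>m p"
  shows "p \<le> n"
proof (rule ccontr)
  assume "\<not> p \<le> n"
  then have np: "n < p" by simp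
  define k' where "k' = mat p p (\<lambda>(i, j). if i < n then k $$ (i, j) else 0)"
  define l' where "l' = mat p p (\<lambda>(i, j). if j < n then l $$ (i, j) else 0)"
  have c: "k' \<in> carrier_mat p p" "l' \<in> carrier_mat p p" by (simp_all add: k'_def l'_def)
  have "l' * k' = 1\<^sub>m p"
  proof (rule eq_matI)
    fix i j assume "i < dim_row (1\<^sub>m p :: 'k mat)" "j < dim_col (1\<^sub>m p :: 'k mat)"
    then have ij: "i < p" "j < p" by simp_all
    have "(l' * k') $$ (i, j) = (\<Sum>r<p. if r < n then l $$ (i, r) * k $$ (r, j) else 0)"
      unfolding mult_entry[OF c(2,1) ij] using ij by (intro sum.cong) (simp_all add: k'_def l'_def)
    also have "\<dots> = (\<Sum>r<n. l $$ (i, r) * k $$ (r, j))"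
      by (rule sum.mono_neutral_cong_right) (use np in auto)
    also have "\<dots> = 1\<^sub>m p $$ (i, j)" using mult_entry[OF l k ij] lk by simp
    finally show "(l' * k') $$ (i, j) = 1\<^sub>m p $$ (i, j)" .
  qed (use c in auto)
  then have "k' * l' = 1\<^sub>m p" using mat_mult_left_right_inverse[OF c(2,1)] by simp
  moreover have "(k' * l') $$ (n, n) = (\<Sum>r<p. 0)"
    unfolding mult_entry[OF c np np] using np by (intro sum.cong) (simp_all add: k'_def)
  ultimately show False using np by simp
qed

text \<open>The joint kernel of an arbitrary, possibly infinite family, as a matrix \<open>k\<close>
  of its basis vectors with a left inverse \<open>l\<close>. The number \<open>p\<close> of columns
  is chosen maximal among those with a left inverse; it is bounded by \<open>n\<close>, and a vector
  of the kernel outside the span of \<open>k\<close> would enlarge it.\<close>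

lemma family_kernel:
  fixes F :: "'k::field mat set"
  assumes F: "\<And>f. f \<in> F \<Longrightarrow> dim_col f = n"
  obtains p k l where "k \<in> carrier_mat n p" "l \<in> carrier_mat p n" "l * k = 1\<^sub>m p"
    "\<forall>f\<in>F. f * k = 0\<^sub>m (dim_row f) p"
    "\<forall>h c. h \<in> carrier_mat n c \<longrightarrow> (\<forall>f\<in>F. f * h = 0\<^sub>m (dim_row f) c) \<longrightarrow> k * (l * h) = h"
proof -
  define Q where "Q p \<longleftrightarrow> (\<exists>k l. k \<in> carrier_mat n p \<and> l \<in> carrier_mat p n \<and> l * k = 1\<^sub>m p \<and>
      (\<forall>f\<in>F. f * k = 0\<^sub>m (dim_row f) p))" for p
  have fc: "f \<in> carrier_mat (dim_row f) n" if "f \<in> F" for f using F[OF that] by auto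
  have "Q 0"
    unfolding Q_def
    by (intro exI[of _ "0\<^sub>m n 0"] exI[of _ "0\<^sub>m 0 n"]) (use fc in \<open>auto intro!: eq_matI\<close>)
  moreover have "p \<le> n" if "Q p" for p using that left_invertible_dim unfolding Q_def by blast
  ultimately obtain p where p: "Q p" and max: "\<And>p'. Q p' \<Longrightarrow> p' \<le> p"
    using Nat.ex_has_greatest_nat[of Q 0 n] by blast
  obtain k l where k: "k \<in> carrier_mat n p" and l: "l \<in> carrier_mat p n" and lk: "l * k = 1\<^sub>m p"
    and fk: "\<And>f. f \<in> F \<Longrightarrow> f * k = 0\<^sub>m (dim_row f) p"
    using p unfolding Q_def by blast
  show thesis
  proof (rule that[OF k l lk], use fk in blast, intro allI impI)
    fix h c assume h: "h \<in> carrier_mat n c" and "\<forall>f\<in>F. f * h = 0\<^sub>m (dim_row f) c"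
    then have fh: "f * h = 0\<^sub>m (dim_row f) c" if "f \<in> F" for f using that by blast
    show "k * (l * h) = h"
    proof (rule ccontr)
      assume ne: "k * (l * h) \<noteq> h"
      \<comment> \<open>The part of \<open>h\<close> that is not captured by \<open>k\<close>; it
        lies in the kernel of \<open>l\<close> and of the whole family.\<close>
      define w where "w = h - k * (l * h)"
      have lh: "l * h \<in> carrier_mat p c" and klh: "k * (l * h) \<in> carrier_mat n c" using k l h by simp_all
      have w: "w \<in> carrier_mat n c" unfolding w_def by (rule minus_carrier_mat[OF klh])
      have "l * w = l * h - l * (k * (l * h))"
        unfolding w_def by (rule mult_minus_distrib_mat[OF l h klh])
      also have "l * (k * (l * h)) = l * h" using assoc_mult_mat[OF l k lh] left_mult_one_mat[OF lh] unfolding lk by simp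
      finally have lw: "l * w = 0\<^sub>m p c" using lh by simp
      have fw: "f * w = 0\<^sub>m (dim_row f) c" if f: "f \<in> F" for f
      proof -
        have "f * w = f * h - f * (k * (l * h))"
          unfolding w_def by (rule mult_minus_distrib_mat[OF fc[OF f] h klh])
        also have "f * (k * (l * h)) = 0\<^sub>m (dim_row f) c"
          using assoc_mult_mat[OF fc[OF f] k lh] left_mult_zero_mat[OF lh] unfolding fk[OF f] by simp
        finally show ?thesis using fh[OF f] by simp
      qed
      have "\<exists>a<n. \<exists>b<c. w $$ (a, b) \<noteq> 0"
      proof (rule ccontr)
        assume "\<not> (\<exists>a<n. \<exists>b<c. w $$ (a, b) \<noteq> 0)"
        then have z: "w $$ (a, b) = 0" if "a < n" "b < c" for a b using that by blast
        have "(k * (l * h)) $$ (a, b) = h $$ (a, b)" if ab: "a < n" "b < c" for a b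
          using z[OF ab] ab carrier_matD[OF klh] by (simp add: w_def del: index_mult_mat)
        then have "k * (l * h) = h"
          using carrier_matD[OF klh] carrier_matD[OF h] by (intro eq_matI) (simp_all del: index_mult_mat)
        then show False using ne by simp
      qed
      then obtain a b where ab: "a < n" "b < c" "w $$ (a, b) \<noteq> 0" by blast
      define z where "z = inverse (w $$ (a, b))"
      define kl where "kl = k * l"
      have kl: "kl \<in> carrier_mat n n" using k l by (simp add: kl_def)
      define k' where "k' = mat n (Suc p) (\<lambda>(i, j). if j < p then k $$ (i, j) else w $$ (i, b))"
      \<comment> \<open>The last row is row \<open>a\<close> of \<open>1 - k * l\<close>, scaled by
        \<open>z\<close>. It vanishes on the columns of \<open>k\<close>, because
        \<open>k * l * k = k\<close>, and takes the value 1 on column \<open>b\<close> of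
        \<open>w\<close>, because \<open>l * w = 0\<close>. The latter equation also makes the old
        rows vanish on the new column.\<close>
      define l' where "l' = mat (Suc p) n (\<lambda>(i, j). if i < p then l $$ (i, j) else z * ((if j = a then 1 else 0) - kl $$ (a, j)))"
      have c': "k' \<in> carrier_mat n (Suc p)" "l' \<in> carrier_mat (Suc p) n" by (simp_all add: k'_def l'_def)
      have lk_e: "(\<Sum>r<n. l $$ (i, r) * k $$ (r, j)) = (if i = j then 1 else 0)" if "i < p" "j < p" for i j
        using mult_entry[OF l k that] that lk by simp
      have lw_e: "(\<Sum>r<n. l $$ (i, r) * w $$ (r, b)) = 0" if "i < p" for i
        using mult_entry[OF l w that ab(2)] that lw ab by simp
      have "kl * k = k" using assoc_mult_mat[OF k l k] lk k by (simp add: kl_def)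
      then have klk_e: "(\<Sum>r<n. kl $$ (a, r) * k $$ (r, j)) = k $$ (a, j)" if "j < p" for j
        using mult_entry[OF kl k ab(1) that] by simp
      have "kl * w = 0\<^sub>m n c" using assoc_mult_mat[OF k l w] lw k by (simp add: kl_def)
      then have klw_e: "(\<Sum>r<n. kl $$ (a, r) * w $$ (r, b)) = 0"
        using mult_entry[OF kl w ab(1,2)] ab by simp
      have "l' * k' = 1\<^sub>m (Suc p)"
      proof (rule eq_matI)
        fix i j assume "i < dim_row (1\<^sub>m (Suc p) :: 'k mat)" "j < dim_col (1\<^sub>m (Suc p) :: 'k mat)"
        then have ij: "i < Suc p" "j < Suc p" by simp_all
        have s: "(\<Sum>r<n. z * ((if r = a then 1 else 0) - kl $$ (a, r)) * v r) = z * (v a - (\<Sum>r<n. kl $$ (a, r) * v r))" for v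
        proof -
          have "(\<Sum>r<n. z * ((if r = a then 1 else 0) - kl $$ (a, r)) * v r) =
              z * (\<Sum>r<n. (if r = a then v r else 0) - kl $$ (a, r) * v r)"
            unfolding sum_distrib_left by (intro sum.cong) (auto simp: algebra_simps)
          then show ?thesis using ab by (simp add: sum_subtractf)
        qed
        have "(l' * k') $$ (i, j) = (\<Sum>r<n. l' $$ (i, r) * k' $$ (r, j))" by (rule mult_entry[OF c'(2,1) ij])
        also have "\<dots> = (if i < p then (if j < p then \<Sum>r<n. l $$ (i, r) * k $$ (r, j) else \<Sum>r<n. l $$ (i, r) * w $$ (r, b))
            else (if j < p then z * (k $$ (a, j) - (\<Sum>r<n. kl $$ (a, r) * k $$ (r, j)))
              else z * (w $$ (a, b) - (\<Sum>r<n. kl $$ (a, r) * w $$ (r, b)))))"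
          using ij s[of "\<lambda>r. k $$ (r, j)"] s[of "\<lambda>r. w $$ (r, b)"] by (simp add: l'_def k'_def)
        also have "\<dots> = 1\<^sub>m (Suc p) $$ (i, j)"
          using ij ab by (auto simp: lk_e lw_e klk_e klw_e z_def)
        finally show "(l' * k') $$ (i, j) = 1\<^sub>m (Suc p) $$ (i, j)" .
      qed (use c' in auto)
      moreover have "f * k' = 0\<^sub>m (dim_row f) (Suc p)" if f: "f \<in> F" for f
      proof (rule eq_matI)
        fix i j assume "i < dim_row (0\<^sub>m (dim_row f) (Suc p) :: 'k mat)" "j < dim_col (0\<^sub>m (dim_row f) (Suc p) :: 'k mat)"
        then have ij: "i < dim_row f" "j < Suc p" by simp_all
        have 1: "(\<Sum>r<n. f $$ (i, r) * k $$ (r, j)) = 0" if "j < p"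
          using mult_entry[OF fc[OF f] k ij(1) that] fk[OF f] ij that by simp
        have 2: "(\<Sum>r<n. f $$ (i, r) * w $$ (r, b)) = 0"
          using mult_entry[OF fc[OF f] w ij(1) ab(2)] fw[OF f] ij ab by simp
        show "(f * k') $$ (i, j) = 0\<^sub>m (dim_row f) (Suc p) $$ (i, j)"
          unfolding mult_entry[OF fc[OF f] c'(1) ij] using ij 1 2 by (cases "j < p") (simp_all add: k'_def)
      qed (use c' in auto)
      ultimately have "Q (Suc p)" unfolding Q_def using c' by blast
      then show False using max[of "Suc p"] by simp
    qed
  qed
qed

section \<open>Finite linear categories as categories of matrices\<close>

context linear_category
begin

lemma zero_hom: "x \<in> ob C \<Longrightarrow> y \<in> ob C \<Longrightarrow> zero_arr C x y \<in> Hom C x y"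
  and add_hom: "f \<in> Hom C x y \<Longrightarrow> g \<in> Hom C x y \<Longrightarrow> add_arr C f g \<in> Hom C x y"
  and scale_zero: "f \<in> Hom C x y \<Longrightarrow> scale_arr C 0 f = zero_arr C x y"
  and add_zero: "f \<in> Hom C x y \<Longrightarrow> add_arr C f (zero_arr C x y) = f"
proof -
  have V: "vectorspace class_ring (hom_space C x y)" if "x \<in> ob C" "y \<in> ob C"
    by (rule hom_vectorspace[OF that])
  have m: "module class_ring (hom_space C x y)" if "x \<in> ob C" "y \<in> ob C"
    using V[OF that] by (rule vectorspace.axioms(1))
  have o: "x \<in> ob C" "y \<in> ob C" if "f \<in> Hom C x y" for f using that by (auto simp: Hom_iff)
  show "zero_arr C x y \<in> Hom C x y" if "x \<in> ob C" "y \<in> ob C"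
    using abelian_monoid.zero_closed[OF abelian_group.axioms(1)[OF module.axioms(2)[OF m[OF that]]]]
    by (simp add: hom_space_def)
  show "add_arr C f g \<in> Hom C x y" if "f \<in> Hom C x y" "g \<in> Hom C x y" for f g
    using abelian_monoid.a_closed[OF abelian_group.axioms(1)[OF module.axioms(2)[OF m[OF o[OF that(1)]]]], of f g] that
    by (simp add: hom_space_def)
  show "scale_arr C 0 f = zero_arr C x y" if "f \<in> Hom C x y" for f
    using module.smult_l_null[OF m[OF o[OF that]], of f] that by (simp add: hom_space_def class_ring_simps)
  show "add_arr C f (zero_arr C x y) = f" if "f \<in> Hom C x y" for f
    using abelian_monoid.r_zero[OF abelian_group.axioms(1)[OF module.axioms(2)[OF m[OF o[OF that]]]], of f] that
    by (simp add: hom_space_def)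
qed

lemma zero_simps [simp]:
  assumes "x \<in> ob C" "y \<in> ob C"
  shows "zero_arr C x y \<in> arr C" "src C (zero_arr C x y) = x" "trg C (zero_arr C x y) = y"
  using zero_hom[OF assms] by (simp_all add: Hom_iff)

text \<open>Zero arrows are multiples by the scalar 0, and composition commutes with
  scalars.\<close>

lemma comp_zero:
  assumes "f \<in> arr C" "z \<in> ob C"
  shows "f \<cdot> zero_arr C z (src C f) = zero_arr C z (trg C f)" "zero_arr C (trg C f) z \<cdot> f = zero_arr C (src C f) z"
proof -
  have "f \<cdot> zero_arr C z (src C f) = f \<cdot> scale_arr C 0 (zero_arr C z (src C f))"
    using scale_zero[OF zero_hom] assms by simp
  also have "\<dots> = scale_arr C 0 (f \<cdot> zero_arr C z (src C f))"
    by (rule comp_scale_right[OF zero_hom]) (use assms in \<open>auto simp: Hom_iff\<close>)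
  also have "\<dots> = zero_arr C z (trg C f)" by (rule scale_zero) (use assms in \<open>simp add: Hom_iff\<close>)
  finally show "f \<cdot> zero_arr C z (src C f) = zero_arr C z (trg C f)" .
  have "zero_arr C (trg C f) z \<cdot> f = scale_arr C 0 (zero_arr C (trg C f) z) \<cdot> f"
    using scale_zero[OF zero_hom] assms by simp
  also have "\<dots> = scale_arr C 0 (zero_arr C (trg C f) z \<cdot> f)"
    by (rule comp_scale_left[OF _ zero_hom]) (use assms in \<open>auto simp: Hom_iff\<close>)
  also have "\<dots> = zero_arr C (src C f) z" by (rule scale_zero) (use assms in \<open>simp add: Hom_iff\<close>)
  finally show "zero_arr C (trg C f) z \<cdot> f = zero_arr C (src C f) z" .
qed

lemma linear_category_opp: "linear_category (opp C)"
proof -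
  interpret d: category "opp C" by (rule category_arrI) auto
  have h: "Hom (opp C) x y = Hom C y x" for x y by (auto simp: Hom_iff)
  have s: "hom_space (opp C) x y = hom_space C y x" for x y by (simp add: hom_space_def h)
  show ?thesis
  proof (intro linear_category.intro[OF d.category_axioms] linear_category_axioms.intro)
    fix x y assume "x \<in> ob (opp C)" "y \<in> ob (opp C)"
    then show "vectorspace class_ring (hom_space (opp C) x y)" using hom_vectorspace[of y x] by (simp add: s)
  next
    fix f x y g z g' assume a: "f \<in> Hom (opp C) x y" "g \<in> Hom (opp C) y z" "g' \<in> Hom (opp C) y z"
    show "add_arr (opp C) g g' \<cdot>\<^bsub>opp C\<^esub> f = add_arr (opp C) (g \<cdot>\<^bsub>opp C\<^esub> f) (g' \<cdot>\<^bsub>opp C\<^esub> f)"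
      using comp_add_right[OF a(2,3,1)[unfolded h]] by simp
  next
    fix f x y f' g z assume a: "f \<in> Hom (opp C) x y" "f' \<in> Hom (opp C) x y" "g \<in> Hom (opp C) y z"
    show "g \<cdot>\<^bsub>opp C\<^esub> add_arr (opp C) f f' = add_arr (opp C) (g \<cdot>\<^bsub>opp C\<^esub> f) (g \<cdot>\<^bsub>opp C\<^esub> f')"
      using comp_add_left[OF a(3,1,2)[unfolded h]] by simp
  next
    fix f x y g z r assume a: "f \<in> Hom (opp C) x y" "g \<in> Hom (opp C) y z"
    show "scale_arr (opp C) r g \<cdot>\<^bsub>opp C\<^esub> f = scale_arr (opp C) r (g \<cdot>\<^bsub>opp C\<^esub> f)"
      using comp_scale_right[OF a(2,1)[unfolded h], of r] by simp
    show "g \<cdot>\<^bsub>opp C\<^esub> scale_arr (opp C) r f = scale_arr (opp C) r (g \<cdot>\<^bsub>opp C\<^esub> f)"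
      using comp_scale_left[OF a(2,1)[unfolded h], of r] by simp
  qed
qed

end

section \<open>Opposite algebras and transposed modules\<close>

lemma opp_opp [simp]: "opp (opp C) = C" for C :: "('o, 'a, 'k) lcat"
  by (simp add: opp_def)

text \<open>The dual vector space in the dual basis. Transposition reverses products, so it is a
  module over the opposite algebra, and it turns homomorphisms around; the opposite of a finite
  linear category is thereby again described by matrices.\<close>

definition transpose_rep :: "'k rep \<Rightarrow> 'k rep" where
  "transpose_rep X = (fst X, \<lambda>i. transpose_mat (snd X i))"

definition opp_alg :: "'k fd_alg \<Rightarrow> 'k fd_alg" where
  "opp_alg R = R\<lparr>mul_const := \<lambda>i j. mul_const R j i\<rparr>"

lemma transpose_rep_simps [simp]:
  "fst (transpose_rep X) = fst X" "snd (transpose_rep X) i = transpose_mat (snd X i)"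
  "transpose_rep (transpose_rep X) = X"
  by (simp_all add: transpose_rep_def)

lemma opp_alg_simps [simp]:
  "alg_dim (opp_alg R) = alg_dim R" "mul_const (opp_alg R) i j = mul_const R j i"
  "unit_const (opp_alg R) = unit_const R" "opp_alg (opp_alg R) = R"
  by (simp_all add: opp_alg_def)

lemma fd_algebra_opp: "fd_algebra R \<Longrightarrow> fd_algebra (opp_alg R)"
  by (auto simp: fd_algebra_def mult.commute)

lemma transpose_lin_comb:
  assumes "\<And>l. l < n \<Longrightarrow> \<rho> l \<in> carrier_mat a b"
  shows "transpose_mat (lin_comb a b n c \<rho>) = lin_comb b a n c (\<lambda>l. transpose_mat (\<rho> l))"
proof (rule eq_matI)
  fix i j assume "i < dim_row (lin_comb b a n c (\<lambda>l. transpose_mat (\<rho> l)))"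
    "j < dim_col (lin_comb b a n c (\<lambda>l. transpose_mat (\<rho> l)))"
  then have ij: "i < b" "j < a" by (simp_all add: lin_comb_def)
  have "\<rho> l $$ (j, i) = transpose_mat (\<rho> l) $$ (i, j)" if "l < n" for l using assms[OF that] ij by auto
  then show "transpose_mat (lin_comb a b n c \<rho>) $$ (i, j) = lin_comb b a n c (\<lambda>l. transpose_mat (\<rho> l)) $$ (i, j)"
    using ij by (simp add: lin_comb_def)
qed (simp_all add: lin_comb_def)

lemma fd_module_transpose:
  assumes "fd_module R X"
  shows "fd_module (opp_alg R) (transpose_rep X)"
proof -
  let ?n = "alg_dim R" and ?d = "fst X"
  have c: "snd X i \<in> carrier_mat ?d ?d" if "i < ?n" for i using assms that by (simp add: fd_module_iff)
  have m: "transpose_mat (snd X i) * transpose_mat (snd X j) =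
      lin_comb ?d ?d ?n (mul_const R j i) (\<lambda>l. transpose_mat (snd X l))" if ij: "i < ?n" "j < ?n" for i j
  proof -
    have "transpose_mat (snd X i) * transpose_mat (snd X j) = transpose_mat (snd X j * snd X i)"
      by (rule transpose_mult[OF c[OF ij(2)] c[OF ij(1)], symmetric])
    also have "snd X j * snd X i = lin_comb ?d ?d ?n (mul_const R j i) (snd X)"
      using assms ij by (simp add: fd_module_iff)
    finally show ?thesis using transpose_lin_comb[OF c] by simp
  qed
  have "lin_comb ?d ?d ?n (unit_const R) (\<lambda>l. transpose_mat (snd X l)) =
      transpose_mat (lin_comb ?d ?d ?n (unit_const R) (snd X))"
    using transpose_lin_comb[OF c] by simp
  also have "\<dots> = 1\<^sub>m ?d" using assms by (simp add: fd_module_iff)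
  finally have u: "lin_comb ?d ?d ?n (unit_const R) (\<lambda>l. transpose_mat (snd X l)) = 1\<^sub>m ?d" .
  have e: "snd (transpose_rep X) = (\<lambda>i. transpose_mat (snd X i))" by (simp add: transpose_rep_def)
  show ?thesis
    unfolding fd_module_iff e using c m u by (simp add: transpose_carrier_mat)
qed

lemma module_hom_transpose:
  assumes f: "module_hom R X Y f" and X: "fd_module R X" and Y: "fd_module R Y"
  shows "module_hom (opp_alg R) (transpose_rep Y) (transpose_rep X) (transpose_mat f)"
proof -
  have c: "f \<in> carrier_mat (fst Y) (fst X)" using f by (simp add: module_hom_def)
  have "transpose_mat f * transpose_mat (snd Y i) = transpose_mat (snd X i) * transpose_mat f"
    if i: "i < alg_dim R" for i
  proof -
    have "snd Y i \<in> carrier_mat (fst Y) (fst Y)" "snd X i \<in> carrier_mat (fst X) (fst X)"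
      using X Y i by (simp_all add: fd_module_iff)
    then have "transpose_mat f * transpose_mat (snd Y i) = transpose_mat (snd Y i * f)"
      "transpose_mat (snd X i) * transpose_mat f = transpose_mat (f * snd X i)"
      using transpose_mult[of "snd Y i" _ _ f] transpose_mult[of f _ _ "snd X i"] c by auto
    then show ?thesis using f i by (simp add: module_hom_def)
  qed
  then show ?thesis using c by (simp add: module_hom_def)
qed

text \<open>A linear equivalence with a category of modules, given by its matrices.\<close>

locale matrix_rep = linear_category A
  for A :: "('o, 'a, 'k::field, 'z) lcat_scheme" +
  fixes R :: "'k fd_alg" and Fo :: "'o \<Rightarrow> 'k rep" and Fa :: "'a \<Rightarrow> 'k mat"
  assumes alg: "fd_algebra R"
    and Fo_mod: "x \<in> ob A \<Longrightarrow> fd_module R (Fo x)"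
    and Fa_hom: "f \<in> arr A \<Longrightarrow> module_hom R (Fo (src A f)) (Fo (trg A f)) (Fa f)"
    and Fa_idt: "x \<in> ob A \<Longrightarrow> Fa (idt A x) = 1\<^sub>m (fst (Fo x))"
    and Fa_comp: "f \<in> arr A \<Longrightarrow> g \<in> arr A \<Longrightarrow> src A g = trg A f \<Longrightarrow> Fa (comp A g f) = Fa g * Fa f"
    and Fa_add: "f \<in> Hom A x y \<Longrightarrow> g \<in> Hom A x y \<Longrightarrow> Fa (add_arr A f g) = Fa f + Fa g"
    and full: "x \<in> ob A \<Longrightarrow> y \<in> ob A \<Longrightarrow> module_hom R (Fo x) (Fo y) h \<Longrightarrow> \<exists>f\<in>Hom A x y. Fa f = h"
    and faithful: "f \<in> Hom A x y \<Longrightarrow> g \<in> Hom A x y \<Longrightarrow> Fa f = Fa g \<Longrightarrow> f = g"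
    and ess_surj: "fd_module R X \<Longrightarrow> \<exists>x\<in>ob A. \<exists>p q. module_hom R (Fo x) X p \<and> module_hom R X (Fo x) q \<and>
      p * q = 1\<^sub>m (fst X) \<and> q * p = 1\<^sub>m (fst (Fo x))"

text \<open>An equivalence is fully faithful and essentially surjective. \<open>F\<close> is
  faithful because \<eta> is natural and invertible, \<open>G\<close> likewise because of
  \<epsilon>, and the fullness of \<open>F\<close> uses the faithfulness of
  \<open>G\<close>.\<close>

lemma finite_linear_category_matrix_rep:
  assumes "finite_linear_category (A :: ('o, 'a, 'k::field, 'z) lcat_scheme)"
  shows "\<exists>R Fo Fa. matrix_rep A R Fo Fa"
proof -
  interpret A: finite_linear_category A by (rule assms)
  obtain R where R: "fd_algebra R" and eq: "linearly_equivalent A (fd_modules R)" using A.finite by blast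
  obtain F :: "('o, 'a, 'k rep, 'k rep \<times> 'k mat \<times> 'k rep) ftr"
    and G :: "('k rep, 'k rep \<times> 'k mat \<times> 'k rep, 'o, 'a) ftr" and \<eta> \<epsilon>
    where F: "linear_functor A (fd_modules R) F" and G: "linear_functor (fd_modules R) A G"
      and \<eta>: "nat_iso A A (comp_ftr G F) id_ftr \<eta>" and \<epsilon>: "nat_iso (fd_modules R) (fd_modules R) (comp_ftr F G) id_ftr \<epsilon>"
    using eq unfolding linearly_equivalent_def by blast
  have B: "category (fd_modules R)" using F by (simp add: linear_functor_def cat_functor_def)
  interpret B: category "fd_modules R" by (rule B)
  interpret F: linear_functor A "fd_modules R" F by (rule F)
  interpret G: linear_functor "fd_modules R" A G by (rule G)
  have obB: "ob (fd_modules R) = {X. fd_module R X}" by (simp add: fd_modules_def)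
  have HomB: "(X, f, Y) \<in> Hom (fd_modules R) X' Y' \<longleftrightarrow> X' = X \<and> Y' = Y \<and> fd_module R X \<and> fd_module R Y \<and> module_hom R X Y f"
    for X Y X' Y' f by (auto simp: Hom_iff fd_modules_def module_hom_def)
  have idB: "idt (fd_modules R) X = (X, 1\<^sub>m (fst X), X)" for X by (simp add: fd_modules_def)
  have compB: "(Y', g, Z) \<cdot>\<^bsub>fd_modules R\<^esub> (X, f, Y) = (X, g * f, Z)" for X Y Y' Z f g by (simp add: fd_modules_def)
  define Fa where "Fa f = fst (snd (f_arr F f))" for f
  have Ff: "f_arr F f = (f_ob F (src A f), Fa f, f_ob F (trg A f))" if "f \<in> arr A" for f
  proof -
    have "f_arr F f \<in> Hom (fd_modules R) (f_ob F (src A f)) (f_ob F (trg A f))"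
      using F.hom[of f "src A f" "trg A f"] that by (simp add: Hom_iff)
    then show ?thesis unfolding Fa_def by (cases "f_arr F f") (auto simp: HomB)
  qed
  have Farr: "f_arr F f \<in> arr (fd_modules R)" "src (fd_modules R) (f_arr F f) = f_ob F (src A f)"
    "trg (fd_modules R) (f_arr F f) = f_ob F (trg A f)" if "f \<in> arr A" for f
    using F.hom[of f "src A f" "trg A f"] that by (simp_all add: Hom_iff)
  have Garr: "f_arr G f \<in> arr A" "src A (f_arr G f) = f_ob G (src (fd_modules R) f)"
    "trg A (f_arr G f) = f_ob G (trg (fd_modules R) f)" if "f \<in> arr (fd_modules R)" for f
    using G.hom[of f "src (fd_modules R) f" "trg (fd_modules R) f"] that by (simp_all add: Hom_iff)
  have \<eta>i: "iso_pair A (\<eta> x) (inv_arr A (\<eta> x)) (f_ob G (f_ob F x)) x" if "x \<in> ob A" for x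
    using nat_isoD[OF \<eta> that A.category_axioms] by (simp add: comp_ftr_def id_ftr_def)
  have \<epsilon>i: "iso_pair (fd_modules R) (\<epsilon> X) (inv_arr (fd_modules R) (\<epsilon> X)) (f_ob F (f_ob G X)) X" if "fd_module R X" for X
    using nat_isoD[OF \<epsilon> _ B, of X] that by (simp add: comp_ftr_def id_ftr_def obB)
  have faithfulF: "f = g" if f: "f \<in> arr A" and g: "g \<in> arr A" "src A f = src A g" "trg A f = trg A g"
    and e: "f_arr F f = f_arr F g" for f g
  proof -
    note [simp] = A.iso_pairD[OF \<eta>i] Farr Garr
    have "f \<cdot>\<^bsub>A\<^esub> \<eta> (src A f) = g \<cdot>\<^bsub>A\<^esub> \<eta> (src A f)"
      using nat_iso_nat[OF \<eta> f] nat_iso_nat[OF \<eta> g(1)] g e by (simp add: comp_ftr_def id_ftr_def)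
    then show ?thesis by (rule A.iso_epi[OF \<eta>i[OF A.src_ob'[OF f]]]) (use f g in simp_all)
  qed
  have faithfulG: "f = g" if f: "f \<in> arr (fd_modules R)" and g: "g \<in> arr (fd_modules R)"
    "src (fd_modules R) f = src (fd_modules R) g" "trg (fd_modules R) f = trg (fd_modules R) g"
    and e: "f_arr G f = f_arr G g" for f g
  proof -
    have o: "fd_module R (src (fd_modules R) f)" "fd_module R (trg (fd_modules R) f)"
      using B.src_ob'[OF f] B.trg_ob'[OF f] by (simp_all add: obB)
    note [simp] = B.iso_pairD[OF \<epsilon>i] Farr Garr
    have "f \<cdot>\<^bsub>fd_modules R\<^esub> \<epsilon> (src (fd_modules R) f) = g \<cdot>\<^bsub>fd_modules R\<^esub> \<epsilon> (src (fd_modules R) f)"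
      using nat_iso_nat[OF \<epsilon> f] nat_iso_nat[OF \<epsilon> g(1)] g e by (simp add: comp_ftr_def id_ftr_def)
    then show ?thesis by (rule B.iso_epi[OF \<epsilon>i[OF o(1)]]) (use f g o in simp_all)
  qed
  have fullF: "\<exists>f\<in>Hom A x y. f_arr F f = h"
    if x: "x \<in> ob A" and y: "y \<in> ob A" and h: "h \<in> Hom (fd_modules R) (f_ob F x) (f_ob F y)" for x y h
  proof -
    note [simp] = A.iso_pairD[OF \<eta>i] A.iso_pairD_tail[OF \<eta>i] Farr Garr
    \<comment> \<open>The only possible preimage of \<open>h\<close>: naturality of \<eta> shows
      that its image under \<open>F\<close> and the arrow \<open>h\<close> agree after applying
      \<open>G\<close>.\<close>
    define f where "f = \<eta> y \<cdot>\<^bsub>A\<^esub> f_arr G h \<cdot>\<^bsub>A\<^esub> inv_arr A (\<eta> x)"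
    have h': "h \<in> arr (fd_modules R)" "src (fd_modules R) h = f_ob F x" "trg (fd_modules R) h = f_ob F y"
      using h by (simp_all add: Hom_iff)
    have f: "f \<in> arr A" "src A f = x" "trg A f = y" using x y h' by (simp_all add: f_def)
    have "\<eta> y \<cdot>\<^bsub>A\<^esub> f_arr G (f_arr F f) = f \<cdot>\<^bsub>A\<^esub> \<eta> x"
      using nat_iso_nat[OF \<eta> f(1)] f by (simp add: comp_ftr_def id_ftr_def)
    also have "\<dots> = \<eta> y \<cdot>\<^bsub>A\<^esub> f_arr G h" using x y h' by (simp add: f_def)
    finally have "f_arr G (f_arr F f) = f_arr G h"
      by (rule A.iso_mono[OF \<eta>i[OF y]]) (use x y h' f in simp_all)
    then have "f_arr F f = h" by (intro faithfulG) (use h' f in simp_all)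
    then show ?thesis using f by (auto simp: Hom_iff)
  qed
  have Fmod: "fd_module R (f_ob F x)" if "x \<in> ob A" for x using F.ob[OF that] by (simp add: obB)
  have "matrix_rep A R (f_ob F) Fa"
  proof unfold_locales
    fix f assume f: "f \<in> arr A"
    show "module_hom R (f_ob F (src A f)) (f_ob F (trg A f)) (Fa f)"
      using F.hom[of f "src A f" "trg A f"] f unfolding Ff[OF f] HomB by (simp add: Hom_iff)
  next
    fix x assume x: "x \<in> ob A"
    show "Fa (idt A x) = 1\<^sub>m (fst (f_ob F x))" using F.idt[OF x] by (simp add: Fa_def idB)
  next
    fix f g assume fg: "f \<in> arr A" "g \<in> arr A" "src A g = trg A f"
    have "f_arr F (g \<cdot>\<^bsub>A\<^esub> f) = f_arr F g \<cdot>\<^bsub>fd_modules R\<^esub> f_arr F f"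
      by (rule F.comp) (use fg in \<open>auto simp: Hom_iff\<close>)
    also have "\<dots> = (f_ob F (src A f), Fa g * Fa f, f_ob F (trg A g))"
      unfolding Ff[OF fg(1)] Ff[OF fg(2)] compB ..
    finally show "Fa (g \<cdot>\<^bsub>A\<^esub> f) = Fa g * Fa f" by (simp add: Fa_def)
  next
    fix f x y g assume fg: "f \<in> Hom A x y" "g \<in> Hom A x y"
    then have a: "f \<in> arr A" "g \<in> arr A" by (simp_all add: Hom_iff)
    show "Fa (add_arr A f g) = Fa f + Fa g"
      using F.add[OF fg] unfolding Ff[OF a(1)] Ff[OF a(2)] by (simp add: Fa_def fd_modules_def)
  next
    fix x y h assume xy: "x \<in> ob A" "y \<in> ob A" and h: "module_hom R (f_ob F x) (f_ob F y) h"
    have "(f_ob F x, h, f_ob F y) \<in> Hom (fd_modules R) (f_ob F x) (f_ob F y)"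
      using h Fmod xy by (simp add: HomB)
    from fullF[OF xy this] obtain f where "f \<in> Hom A x y" "f_arr F f = (f_ob F x, h, f_ob F y)" by blast
    then show "\<exists>f\<in>Hom A x y. Fa f = h" by (intro bexI[of _ f]) (simp_all add: Fa_def)
  next
    fix f x y g assume fg: "f \<in> Hom A x y" "g \<in> Hom A x y" "Fa f = Fa g"
    then have a: "f \<in> arr A" "g \<in> arr A" "src A f = src A g" "trg A f = trg A g" by (simp_all add: Hom_iff)
    show "f = g" by (rule faithfulF[OF a]) (simp add: Ff a fg)
  next
    fix X assume X: "fd_module R X"
    have x: "f_ob G X \<in> ob A" using G.ob[of X] X by (simp add: obB)
    obtain a where "iso_pair (fd_modules R) (\<epsilon> X) a (f_ob F (f_ob G X)) X" using \<epsilon>i[OF X] by blast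
    moreover obtain X1 p Y1 where "\<epsilon> X = (X1, p, Y1)" by (cases "\<epsilon> X") auto
    moreover obtain X2 q Y2 where "a = (X2, q, Y2)" by (cases a) auto
    ultimately have i: "iso_pair (fd_modules R) (X1, p, Y1) (X2, q, Y2) (f_ob F (f_ob G X)) X" by simp
    have "X1 = f_ob F (f_ob G X) \<and> Y1 = X" "X2 = X \<and> Y2 = f_ob F (f_ob G X)"
      using i unfolding iso_pair_def HomB by auto
    then have XY: "X1 = f_ob F (f_ob G X)" "Y1 = X" "X2 = X" "Y2 = f_ob F (f_ob G X)" by simp_all
    have "module_hom R (f_ob F (f_ob G X)) X p" "module_hom R X (f_ob F (f_ob G X)) q"
      "p * q = 1\<^sub>m (fst X)" "q * p = 1\<^sub>m (fst (f_ob F (f_ob G X)))"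
      using i unfolding iso_pair_def XY HomB compB idB by auto
    then show "\<exists>x\<in>ob A. \<exists>p q. module_hom R (f_ob F x) X p \<and> module_hom R X (f_ob F x) q \<and>
        p * q = 1\<^sub>m (fst X) \<and> q * p = 1\<^sub>m (fst (f_ob F x))" using x by blast
  qed (use R Fmod in auto)
  then show ?thesis by blast
qed

context matrix_rep
begin

lemma Fa_carrier [simp]: "f \<in> arr A \<Longrightarrow> Fa f \<in> carrier_mat (fst (Fo (trg A f))) (fst (Fo (src A f)))"
  using Fa_hom by (simp add: module_hom_def)

lemma Fa_zero:
  assumes o [simp]: "x \<in> ob A" "y \<in> ob A"
  shows "Fa (zero_arr A x y) = 0\<^sub>m (fst (Fo y)) (fst (Fo x))"
proof -
  have z: "Fa (zero_arr A x y) \<in> carrier_mat (fst (Fo y)) (fst (Fo x))" using Fa_carrier[of "zero_arr A x y"] by simp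
  have "Fa (zero_arr A x y) = Fa (zero_arr A x y) + Fa (zero_arr A x y)"
    using Fa_add[OF zero_hom zero_hom, of x y] add_zero[OF zero_hom, of x y] by simp
  then have "Fa (zero_arr A x y) $$ (i, j) + Fa (zero_arr A x y) $$ (i, j) = Fa (zero_arr A x y) $$ (i, j)"
    if "i < fst (Fo y)" "j < fst (Fo x)" for i j using z that by (metis carrier_matD index_add_mat(1))
  then have "Fa (zero_arr A x y) $$ (i, j) = 0" if "i < fst (Fo y)" "j < fst (Fo x)" for i j
    using that unfolding add_cancel_left_right by blast
  then show ?thesis using z by (intro eq_matI) auto
qed

lemma matrix_rep_opp: "matrix_rep (opp A) (opp_alg R) (\<lambda>x. transpose_rep (Fo x)) (\<lambda>f. transpose_mat (Fa f))"
proof -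
  interpret d: linear_category "opp A" by (rule linear_category_opp)
  have h: "Hom (opp A) x y = Hom A y x" for x y by (auto simp: Hom_iff)
  show ?thesis
  proof unfold_locales
    show "fd_algebra (opp_alg R)" by (rule fd_algebra_opp[OF alg])
  next
    fix x assume "x \<in> ob (opp A)"
    then show "fd_module (opp_alg R) (transpose_rep (Fo x))" "transpose_mat (Fa (idt (opp A) x)) = 1\<^sub>m (fst (transpose_rep (Fo x)))"
      by (simp_all add: fd_module_transpose Fo_mod Fa_idt)
  next
    fix f assume "f \<in> arr (opp A)"
    then show "module_hom (opp_alg R) (transpose_rep (Fo (src (opp A) f))) (transpose_rep (Fo (trg (opp A) f))) (transpose_mat (Fa f))"
      using module_hom_transpose[OF Fa_hom, of f] by (simp add: Fo_mod)
  next
    fix f g assume "f \<in> arr (opp A)" "g \<in> arr (opp A)" "src (opp A) g = trg (opp A) f"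
    then have fg: "f \<in> arr A" "g \<in> arr A" "trg A g = src A f" by simp_all
    have "transpose_mat (Fa f * Fa g) = transpose_mat (Fa g) * transpose_mat (Fa f)"
      by (rule transpose_mult[OF Fa_carrier[OF fg(1)]]) (use Fa_carrier[OF fg(2)] fg in simp)
    then show "transpose_mat (Fa (g \<cdot>\<^bsub>opp A\<^esub> f)) = transpose_mat (Fa g) * transpose_mat (Fa f)"
      using fg by (simp add: Fa_comp)
  next
    fix f x y g assume "f \<in> Hom (opp A) x y" "g \<in> Hom (opp A) x y"
    then have fg: "f \<in> Hom A y x" "g \<in> Hom A y x" by (simp_all add: h)
    have "Fa f \<in> carrier_mat (fst (Fo x)) (fst (Fo y))" "Fa g \<in> carrier_mat (fst (Fo x)) (fst (Fo y))"
      using fg Fa_carrier[of f] Fa_carrier[of g] by (auto simp: Hom_iff)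
    then show "transpose_mat (Fa (add_arr (opp A) f g)) = transpose_mat (Fa f) + transpose_mat (Fa g)"
      using transpose_add by (simp add: Fa_add[OF fg])
  next
    fix x y h' assume "x \<in> ob (opp A)" "y \<in> ob (opp A)"
      and h': "module_hom (opp_alg R) (transpose_rep (Fo x)) (transpose_rep (Fo y)) h'"
    then have xy: "x \<in> ob A" "y \<in> ob A" by simp_all
    have "module_hom R (Fo y) (Fo x) (transpose_mat h')"
      using module_hom_transpose[OF h'] xy by (simp add: fd_module_transpose Fo_mod)
    from full[OF xy(2,1) this] obtain f where "f \<in> Hom A y x" "Fa f = transpose_mat h'" by blast
    then show "\<exists>f\<in>Hom (opp A) x y. transpose_mat (Fa f) = h'" by (intro bexI[of _ f]) (simp_all add: h)
  next
    fix f x y g assume fg: "f \<in> Hom (opp A) x y" "g \<in> Hom (opp A) x y" "transpose_mat (Fa f) = transpose_mat (Fa g)"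
    then have "Fa f = Fa g" by (metis transpose_transpose)
    then show "f = g" using fg(1,2) unfolding h by (intro faithful)
  next
    fix X assume X: "fd_module (opp_alg R) X"
    have X': "fd_module R (transpose_rep X)" using fd_module_transpose[OF X] by simp
    obtain x p q where x: "x \<in> ob A" and p: "module_hom R (Fo x) (transpose_rep X) p"
      and q: "module_hom R (transpose_rep X) (Fo x) q" and pq: "p * q = 1\<^sub>m (fst X)" "q * p = 1\<^sub>m (fst (Fo x))"
      using ess_surj[OF X'] by auto
    have c: "p \<in> carrier_mat (fst X) (fst (Fo x))" "q \<in> carrier_mat (fst (Fo x)) (fst X)"
      using p q by (simp_all add: module_hom_def)
    have "transpose_mat q * transpose_mat p = 1\<^sub>m (fst X)" "transpose_mat p * transpose_mat q = 1\<^sub>m (fst (Fo x))"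
      using transpose_mult[OF c(1,2)] transpose_mult[OF c(2,1)] pq by simp_all
    moreover have "module_hom (opp_alg R) (transpose_rep (Fo x)) X (transpose_mat q)"
      "module_hom (opp_alg R) X (transpose_rep (Fo x)) (transpose_mat p)"
      using module_hom_transpose[OF q X' Fo_mod[OF x]] module_hom_transpose[OF p Fo_mod[OF x] X'] by simp_all
    ultimately show "\<exists>x\<in>ob (opp A). \<exists>p q. module_hom (opp_alg R) (transpose_rep (Fo x)) X p \<and>
        module_hom (opp_alg R) X (transpose_rep (Fo x)) q \<and> p * q = 1\<^sub>m (fst X) \<and> q * p = 1\<^sub>m (fst (transpose_rep (Fo x)))"
      using x by auto
  qed
qed

subsection \<open>Joint equalisers\<close>

text \<open>In coordinates the equaliser is the joint kernel of the differences of matrices. It is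
  stable under the action, hence a module, and essential surjectivity provides an object that
  represents it.\<close>

lemma joint_equaliser:
  assumes x: "x \<in> ob A" and I: "\<And>i. i \<in> I \<Longrightarrow> f i \<in> arr A \<and> g i \<in> arr A \<and> src A (f i) = x \<and> src A (g i) = x \<and>
    trg A (g i) = trg A (f i)"
  shows "\<exists>e\<in>arr A. trg A e = x \<and> (\<forall>i\<in>I. f i \<cdot>\<^bsub>A\<^esub> e = g i \<cdot>\<^bsub>A\<^esub> e) \<and>
    (\<forall>h\<in>arr A. trg A h = x \<and> (\<forall>i\<in>I. f i \<cdot>\<^bsub>A\<^esub> h = g i \<cdot>\<^bsub>A\<^esub> h) \<longrightarrow> (\<exists>!u. u \<in> Hom A (src A h) (src A e) \<and> e \<cdot>\<^bsub>A\<^esub> u = h))"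
proof -
  let ?n = "fst (Fo x)" and ?\<rho> = "snd (Fo x)"
  have fc: "Fa (f i) \<in> carrier_mat (fst (Fo (trg A (f i)))) ?n" "Fa (g i) \<in> carrier_mat (fst (Fo (trg A (f i)))) ?n" if "i \<in> I" for i
    using Fa_carrier[of "f i"] Fa_carrier[of "g i"] I[OF that] by simp_all
  define D where "D = (\<lambda>i. Fa (f i) - Fa (g i)) ` I"
  have D: "dim_col d = ?n" if "d \<in> D" for d using that carrier_matD(2)[OF fc(2)] by (auto simp: D_def)
  have D0: "d * h = 0\<^sub>m (dim_row d) c" if d: "d \<in> D" and h: "h \<in> carrier_mat ?n c"
    and e: "\<And>i. i \<in> I \<Longrightarrow> Fa (f i) * h = Fa (g i) * h" for d h c
  proof -
    obtain i where i: "i \<in> I" "d = Fa (f i) - Fa (g i)" using d by (auto simp: D_def)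
    have "d * h = Fa (f i) * h - Fa (g i) * h" unfolding i by (rule minus_mult_distrib_mat[OF fc(1)[OF i(1)] fc(2)[OF i(1)] h])
    also have "\<dots> = 0\<^sub>m (fst (Fo (trg A (f i)))) c"
      unfolding e[OF i(1)] by (rule minus_r_inv_mat) (rule mult_carrier_mat[OF fc(2)[OF i(1)] h])
    finally show ?thesis using carrier_matD[OF fc(2)[OF i(1)]] by (simp add: i)
  qed
  obtain p k l where k: "k \<in> carrier_mat ?n p" and l: "l \<in> carrier_mat p ?n" and lk: "l * k = 1\<^sub>m p"
    and Dk: "\<forall>d\<in>D. d * k = 0\<^sub>m (dim_row d) p"
    and kl': "\<forall>h c. h \<in> carrier_mat ?n c \<longrightarrow> (\<forall>d\<in>D. d * h = 0\<^sub>m (dim_row d) c) \<longrightarrow> k * (l * h) = h"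
    by (rule family_kernel[of D ?n, OF D])
  have kl: "k * (l * h) = h" if "h \<in> carrier_mat ?n c" "\<And>d. d \<in> D \<Longrightarrow> d * h = 0\<^sub>m (dim_row d) c" for h c
    using kl'[rule_format, OF that(1)] that(2) by blast
  have fk: "Fa (f i) * k = Fa (g i) * k" if i: "i \<in> I" for i
  proof (rule eq_matI)
    have "(Fa (f i) - Fa (g i)) * k = 0\<^sub>m (fst (Fo (trg A (f i)))) p"
      using bspec[OF Dk, of "Fa (f i) - Fa (g i)"] i carrier_matD[OF fc(2)[OF i]] by (auto simp: D_def)
    then have z: "Fa (f i) * k - Fa (g i) * k = 0\<^sub>m (fst (Fo (trg A (f i)))) p"
      using minus_mult_distrib_mat[OF fc(1)[OF i] fc(2)[OF i] k] by simp
    fix a b assume "a < dim_row (Fa (g i) * k)" "b < dim_col (Fa (g i) * k)"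
    then have ab: "a < fst (Fo (trg A (f i)))" "b < p" using fc(2)[OF i] k by auto
    have "(Fa (f i) * k - Fa (g i) * k) $$ (a, b) = 0" unfolding z using ab by simp
    then show "(Fa (f i) * k) $$ (a, b) = (Fa (g i) * k) $$ (a, b)"
      using ab fc(2)[OF i] k by (simp del: index_mult_mat(1))
  qed (use fc[OF i] k in auto)
  have \<rho>c: "?\<rho> i \<in> carrier_mat ?n ?n" if "i < alg_dim R" for i using Fo_mod[OF x] that by (simp add: fd_module_iff)
  \<comment> \<open>The differences are module homomorphisms, so they annihilate
    \<open>?\<rho> i * k\<close> along with \<open>k\<close>; and \<open>k * l\<close> fixes
    whatever they annihilate.\<close>
  have \<rho>k: "k * (l * (?\<rho> i * k)) = ?\<rho> i * k" if i: "i < alg_dim R" for i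
  proof (rule kl[OF mult_carrier_mat[OF \<rho>c[OF i] k]], rule D0)
    fix j assume j: "j \<in> I"
    let ?y = "trg A (f j)"
    have "fd_module R (Fo ?y)" using I[OF j] Fo_mod by simp
    then have yc: "snd (Fo ?y) i \<in> carrier_mat (fst (Fo ?y)) (fst (Fo ?y))" using i by (simp add: fd_module_iff)
    have c: "Fa (f j) * ?\<rho> i = snd (Fo ?y) i * Fa (f j)" "Fa (g j) * ?\<rho> i = snd (Fo ?y) i * Fa (g j)"
      using Fa_hom[of "f j"] Fa_hom[of "g j"] I[OF j] i by (auto simp: module_hom_def)
    have "Fa (f j) * (?\<rho> i * k) = snd (Fo ?y) i * (Fa (f j) * k)"
      unfolding assoc_mult_mat[OF fc(1)[OF j] \<rho>c[OF i] k, symmetric] c(1) assoc_mult_mat[OF yc fc(1)[OF j] k] ..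
    also have "\<dots> = Fa (g j) * (?\<rho> i * k)"
      unfolding fk[OF j] assoc_mult_mat[OF fc(2)[OF j] \<rho>c[OF i] k, symmetric] c(2) assoc_mult_mat[OF yc fc(2)[OF j] k] ..
    finally show "Fa (f j) * (?\<rho> i * k) = Fa (g j) * (?\<rho> i * k)" .
  qed (use \<rho>c[OF i] k in auto)
  define K where "K = (p, \<lambda>i. l * (?\<rho> i * k))"
  have K [simp]: "fst K = p" "snd K i = l * (?\<rho> i * k)" for i by (simp_all add: K_def)
  have Kc: "l * (?\<rho> i * k) \<in> carrier_mat p p" if "i < alg_dim R" for i using l \<rho>c[OF that] k by simp
  \<comment> \<open>Identities in the kernel may be checked after applying \<open>k\<close>, that
    is, in the ambient module.\<close>
  have inj: "M = N" if "k * M = k * N" "M \<in> carrier_mat p c" "N \<in> carrier_mat p c" for M N c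
  proof -
    have "M = (l * k) * M" unfolding lk using that(2) by simp
    also have "\<dots> = l * (k * N)" unfolding assoc_mult_mat[OF l k that(2)] that(1) ..
    also have "\<dots> = N" unfolding assoc_mult_mat[OF l k that(3), symmetric] lk using that(3) by simp
    finally show ?thesis .
  qed
  have kK: "k * lin_comb p p (alg_dim R) c (snd K) = lin_comb ?n ?n (alg_dim R) c ?\<rho> * k" for c
  proof -
    have "k * lin_comb p p (alg_dim R) c (snd K) = lin_comb ?n p (alg_dim R) c (\<lambda>i. k * snd K i)"
      by (rule mult_lin_comb[OF k]) (simp add: Kc)
    also have "\<dots> = lin_comb ?n p (alg_dim R) c (\<lambda>i. ?\<rho> i * k)" by (rule lin_comb_cong) (simp add: \<rho>k)
    also have "\<dots> = lin_comb ?n ?n (alg_dim R) c ?\<rho> * k" by (rule lin_comb_mult[OF k, symmetric]) (rule \<rho>c)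
    finally show ?thesis .
  qed
  have "fd_module R K"
    unfolding fd_module_iff
  proof (intro conjI allI impI)
    fix i assume i: "i < alg_dim R"
    show "snd K i \<in> carrier_mat (fst K) (fst K)" using Kc[OF i] by simp
    fix j assume j: "j < alg_dim R"
    have "k * (snd K i * snd K j) = (k * snd K i) * snd K j"
      by (rule assoc_mult_mat[symmetric, OF k]) (use Kc i j in auto)
    also have "\<dots> = ?\<rho> i * (k * snd K j)"
      unfolding K \<rho>k[OF i] assoc_mult_mat[OF \<rho>c[OF i] k Kc[OF j]] ..
    also have "\<dots> = (?\<rho> i * ?\<rho> j) * k" unfolding K \<rho>k[OF j] assoc_mult_mat[OF \<rho>c[OF i] \<rho>c[OF j] k] ..
    also have "\<dots> = k * lin_comb p p (alg_dim R) (mul_const R i j) (snd K)"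
      unfolding kK using Fo_mod[OF x] i j by (simp add: fd_module_iff)
    finally have e: "k * (snd K i * snd K j) = k * lin_comb p p (alg_dim R) (mul_const R i j) (snd K)" .
    have "snd K i * snd K j \<in> carrier_mat p p" unfolding K by (rule mult_carrier_mat[OF Kc[OF i] Kc[OF j]])
    then show "snd K i * snd K j = lin_comb (fst K) (fst K) (alg_dim R) (mul_const R i j) (snd K)"
      unfolding K(1) by (rule inj[OF e]) simp
  next
    have "k * lin_comb p p (alg_dim R) (unit_const R) (snd K) = k * 1\<^sub>m p"
      unfolding kK using Fo_mod[OF x] k by (simp add: fd_module_iff)
    then show "lin_comb (fst K) (fst K) (alg_dim R) (unit_const R) (snd K) = 1\<^sub>m (fst K)"
      using inj[of "lin_comb p p (alg_dim R) (unit_const R) (snd K)" "1\<^sub>m p" p] by simp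
  qed
  from ess_surj[OF this] obtain y s t where y: "y \<in> ob A" and s: "module_hom R (Fo y) K s" and t: "module_hom R K (Fo y) t"
    and st: "s * t = 1\<^sub>m p" "t * s = 1\<^sub>m (fst (Fo y))" by auto
  let ?m = "fst (Fo y)"
  have sc: "s \<in> carrier_mat p ?m" and tc: "t \<in> carrier_mat ?m p" using s t by (simp_all add: module_hom_def)
  have \<rho>y: "snd (Fo y) i \<in> carrier_mat ?m ?m" if "i < alg_dim R" for i using Fo_mod[OF y] that by (simp add: fd_module_iff)
  have "module_hom R (Fo y) (Fo x) (k * s)"
    unfolding module_hom_def
  proof (intro conjI allI impI)
    show "k * s \<in> carrier_mat ?n ?m" using k sc by simp
    fix i assume i: "i < alg_dim R"
    have "(k * s) * snd (Fo y) i = k * (s * snd (Fo y) i)" by (rule assoc_mult_mat[OF k sc \<rho>y[OF i]])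
    also have "\<dots> = k * (snd K i * s)" using s i by (simp add: module_hom_def)
    also have "\<dots> = (k * snd K i) * s" unfolding K by (rule assoc_mult_mat[OF k Kc[OF i] sc, symmetric])
    also have "\<dots> = ?\<rho> i * (k * s)" unfolding K \<rho>k[OF i] assoc_mult_mat[OF \<rho>c[OF i] k sc] ..
    finally show "(k * s) * snd (Fo y) i = ?\<rho> i * (k * s)" .
  qed
  from full[OF y x this] obtain e where e: "e \<in> arr A" "src A e = y" "trg A e = x" "Fa e = k * s"
    by (auto simp: Hom_iff)
  have ek: "f i \<cdot>\<^bsub>A\<^esub> e = g i \<cdot>\<^bsub>A\<^esub> e" if i: "i \<in> I" for i
  proof (rule faithful[of _ y "trg A (f i)"])
    show "f i \<cdot>\<^bsub>A\<^esub> e \<in> Hom A y (trg A (f i))" "g i \<cdot>\<^bsub>A\<^esub> e \<in> Hom A y (trg A (f i))" using I[OF i] e by (simp_all add: Hom_iff)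
    have "Fa (f i \<cdot>\<^bsub>A\<^esub> e) = Fa (f i) * (k * s)" using I[OF i] e by (simp add: Fa_comp)
    also have "\<dots> = Fa (g i) * (k * s)"
      unfolding assoc_mult_mat[OF fc(1)[OF i] k sc, symmetric] fk[OF i] by (rule assoc_mult_mat[OF fc(2)[OF i] k sc])
    also have "\<dots> = Fa (g i \<cdot>\<^bsub>A\<^esub> e)" using I[OF i] e by (simp add: Fa_comp)
    finally show "Fa (f i \<cdot>\<^bsub>A\<^esub> e) = Fa (g i \<cdot>\<^bsub>A\<^esub> e)" .
  qed
  have eu: "\<exists>!u. u \<in> Hom A (src A h) y \<and> e \<cdot>\<^bsub>A\<^esub> u = h"
    if h: "h \<in> arr A" "trg A h = x" and he: "\<And>i. i \<in> I \<Longrightarrow> f i \<cdot>\<^bsub>A\<^esub> h = g i \<cdot>\<^bsub>A\<^esub> h" for h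
  proof -
    let ?z = "src A h" and ?H = "Fa h"
    let ?c = "fst (Fo ?z)"
    have hc: "?H \<in> carrier_mat ?n ?c" using Fa_carrier[OF h(1)] h by simp
    have klh: "k * (l * ?H) = ?H"
    proof (rule kl[OF hc], rule D0[OF _ hc])
      fix i assume i: "i \<in> I"
      show "Fa (f i) * ?H = Fa (g i) * ?H"
        using arg_cong[OF he[OF i], of Fa] I[OF i] h by (simp add: Fa_comp)
    qed
    have lhc: "l * ?H \<in> carrier_mat p ?c" using l hc by simp
    have zc: "snd (Fo ?z) i \<in> carrier_mat ?c ?c" if "i < alg_dim R" for i using Fo_mod[of ?z] h that by (simp add: fd_module_iff)
    \<comment> \<open>The coordinates of \<open>?H\<close> in the kernel are \<open>l * ?H\<close>,
      and \<open>t\<close> transports them to the object \<open>y\<close>.\<close>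
    have "module_hom R (Fo ?z) (Fo y) (t * (l * ?H))"
      unfolding module_hom_def
    proof (intro conjI allI impI)
      show "t * (l * ?H) \<in> carrier_mat ?m ?c" using tc lhc by simp
      fix i assume i: "i < alg_dim R"
      have "k * ((l * ?H) * snd (Fo ?z) i) = (k * (l * ?H)) * snd (Fo ?z) i"
        by (rule assoc_mult_mat[symmetric, OF k lhc zc[OF i]])
      also have "\<dots> = ?\<rho> i * ?H" unfolding klh using Fa_hom[OF h(1)] h i by (simp add: module_hom_def)
      also have "\<dots> = (?\<rho> i * k) * (l * ?H)" unfolding assoc_mult_mat[OF \<rho>c[OF i] k lhc] klh ..
      also have "\<dots> = k * (snd K i * (l * ?H))" unfolding K assoc_mult_mat[OF k Kc[OF i] lhc, symmetric] \<rho>k[OF i] ..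
      finally have a: "(l * ?H) * snd (Fo ?z) i = snd K i * (l * ?H)"
        by (rule inj) (rule mult_carrier_mat[OF lhc zc[OF i]], unfold K, rule mult_carrier_mat[OF Kc[OF i] lhc])
      have "(t * (l * ?H)) * snd (Fo ?z) i = t * ((l * ?H) * snd (Fo ?z) i)" by (rule assoc_mult_mat[OF tc lhc zc[OF i]])
      also have "\<dots> = (t * snd K i) * (l * ?H)" unfolding a K by (rule assoc_mult_mat[OF tc Kc[OF i] lhc, symmetric])
      also have "t * snd K i = snd (Fo y) i * t" using t i by (simp add: module_hom_def)
      also have "snd (Fo y) i * t * (l * ?H) = snd (Fo y) i * (t * (l * ?H))" by (rule assoc_mult_mat[OF \<rho>y[OF i] tc lhc])
      finally show "(t * (l * ?H)) * snd (Fo ?z) i = snd (Fo y) i * (t * (l * ?H))" .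
    qed
    from full[OF src_ob'[OF h(1)] y this] obtain u where u: "u \<in> Hom A ?z y" "Fa u = t * (l * ?H)" by blast
    show ?thesis
    proof (rule ex1I[of _ u], intro conjI u(1))
      have "Fa (e \<cdot>\<^bsub>A\<^esub> u) = (k * s) * (t * (l * ?H))" using u e by (simp add: Fa_comp Hom_iff)
      also have "\<dots> = k * (s * (t * (l * ?H)))" by (rule assoc_mult_mat[OF k sc mult_carrier_mat[OF tc lhc]])
      also have "s * (t * (l * ?H)) = l * ?H"
        unfolding assoc_mult_mat[OF sc tc lhc, symmetric] st(1) by (rule left_mult_one_mat[OF lhc])
      finally have "Fa (e \<cdot>\<^bsub>A\<^esub> u) = ?H" using klh by simp
      then show "e \<cdot>\<^bsub>A\<^esub> u = h" by (intro faithful[of _ ?z x]) (use u e h in \<open>auto simp: Hom_iff\<close>)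
      fix v assume v: "v \<in> Hom A ?z y \<and> e \<cdot>\<^bsub>A\<^esub> v = h"
      then have vc: "Fa v \<in> carrier_mat ?m ?c" using Fa_carrier[of v] by (auto simp: Hom_iff)
      have "?H = (k * s) * Fa v" using v e by (auto simp: Fa_comp Hom_iff)
      also have "\<dots> = k * (s * Fa v)" by (rule assoc_mult_mat[OF k sc vc])
      finally have "l * ?H = l * (k * (s * Fa v))" by (rule arg_cong)
      also have "\<dots> = s * Fa v"
        unfolding assoc_mult_mat[OF l k mult_carrier_mat[OF sc vc], symmetric] lk
        by (rule left_mult_one_mat[OF mult_carrier_mat[OF sc vc]])
      finally have "Fa u = (t * s) * Fa v" unfolding u(2) assoc_mult_mat[OF tc sc vc] by (rule arg_cong)
      also have "\<dots> = Fa v" unfolding st(2) by (rule left_mult_one_mat[OF vc])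
      finally have "Fa u = Fa v" .
      then show "v = u" by (intro faithful[of _ ?z y]) (use u v in auto)
    qed
  qed
  show ?thesis using e ek eu by (intro bexI[OF _ e(1)]) simp
qed

end

subsection \<open>Presentations by sums of a projective generator\<close>

text \<open>Finite sums of endomorphisms of \<open>Q\<close> that factor through \<open>P\<close>.
  Membership of the identity says that \<open>Q\<close> is a retract of a finite sum of copies of
  \<open>P\<close>, without mentioning the sum.\<close>

inductive_set factor_span :: "('o, 'a, 'k, 'z) lcat_scheme \<Rightarrow> 'o \<Rightarrow> 'o \<Rightarrow> 'a set"
  for C :: "('o, 'a, 'k, 'z) lcat_scheme" and P Q :: 'o where
  zero: "zero_arr C Q Q \<in> factor_span C P Q"
| add: "e \<in> factor_span C P Q \<Longrightarrow> p \<in> Hom C Q P \<Longrightarrow> i \<in> Hom C P Q \<Longrightarrow>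
    add_arr C e (i \<cdot>\<^bsub>C\<^esub> p) \<in> factor_span C P Q"

lemma (in linear_category) factor_span_Hom:
  assumes "e \<in> factor_span C P Q" "Q \<in> ob C"
  shows "e \<in> Hom C Q Q"
  using assms by induction (auto intro: zero_hom add_hom comp_hom)

lemma module_hom_comp:
  assumes f: "module_hom R X Y f" and g: "module_hom R Y Z g" and X: "fd_module R X" and Y: "fd_module R Y" and Z: "fd_module R Z"
  shows "module_hom R X Z (g * f)"
  unfolding module_hom_def
proof (intro conjI allI impI)
  have c: "f \<in> carrier_mat (fst Y) (fst X)" "g \<in> carrier_mat (fst Z) (fst Y)" using f g by (simp_all add: module_hom_def)
  then show "g * f \<in> carrier_mat (fst Z) (fst X)" by simp
  fix i assume i: "i < alg_dim R"
  have r: "snd X i \<in> carrier_mat (fst X) (fst X)" "snd Y i \<in> carrier_mat (fst Y) (fst Y)" "snd Z i \<in> carrier_mat (fst Z) (fst Z)"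
    using X Y Z i by (simp_all add: fd_module_iff)
  have "(g * f) * snd X i = g * (f * snd X i)" by (rule assoc_mult_mat[OF c(2,1) r(1)])
  also have "f * snd X i = snd Y i * f" using f i by (simp add: module_hom_def)
  also have "g * (snd Y i * f) = (g * snd Y i) * f" by (rule assoc_mult_mat[OF c(2) r(2) c(1), symmetric])
  also have "g * snd Y i = snd Z i * g" using g i by (simp add: module_hom_def)
  also have "snd Z i * g * f = snd Z i * (g * f)" by (rule assoc_mult_mat[OF r(3) c(2,1)])
  finally show "(g * f) * snd X i = snd Z i * (g * f)" .
qed

context matrix_rep
begin

text \<open>\<open>x\<close> is a free module on the columns of \<open>U\<close>.\<close>

definition free_on :: "'o \<Rightarrow> 'k mat \<Rightarrow> nat \<Rightarrow> bool" where
  "free_on x U d \<longleftrightarrow> x \<in> ob A \<and> U \<in> carrier_mat (fst (Fo x)) d \<and>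
     (\<forall>y\<in>ob A. \<forall>W\<in>carrier_mat (fst (Fo y)) d. \<exists>!f. f \<in> Hom A x y \<and> Fa f * U = W)"

lemma Fa_Hom: "f \<in> Hom A x y \<Longrightarrow> Fa f \<in> carrier_mat (fst (Fo y)) (fst (Fo x))"
  using Fa_carrier[of f] by (auto simp: Hom_iff)

lemma Fa_comp_Hom: "f \<in> Hom A x y \<Longrightarrow> g \<in> Hom A y z \<Longrightarrow> Fa (g \<cdot>\<^bsub>A\<^esub> f) = Fa g * Fa f"
  by (auto simp: Hom_iff Fa_comp)

text \<open>The free module in coordinates, transported to an object of the category along an
  isomorphism; \<open>q\<close> carries its generators there.\<close>

lemma free_on_ex: "\<exists>x U. free_on x U d"
proof -
  let ?X = "free_module R d" and ?G = "free_gens R d"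
  have X: "fd_module R ?X" by (rule fd_module_free_module[OF alg])
  obtain x p q where x: "x \<in> ob A" and p: "module_hom R (Fo x) ?X p" and q: "module_hom R ?X (Fo x) q"
    and pq: "p * q = 1\<^sub>m (alg_dim R * d)" "q * p = 1\<^sub>m (fst (Fo x))" using ess_surj[OF X] by auto
  have pc: "p \<in> carrier_mat (alg_dim R * d) (fst (Fo x))" and qc: "q \<in> carrier_mat (fst (Fo x)) (alg_dim R * d)"
    using p q by (simp_all add: module_hom_def)
  have "\<exists>!f. f \<in> Hom A x y \<and> Fa f * (q * ?G) = W" if y: "y \<in> ob A" and W: "W \<in> carrier_mat (fst (Fo y)) d" for y W
  proof -
    let ?h = "free_hom R d (Fo y) W"
    have h: "module_hom R ?X (Fo y) ?h" "?h * ?G = W" using free_hom[OF alg Fo_mod[OF y] W] .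
    have hc: "?h \<in> carrier_mat (fst (Fo y)) (alg_dim R * d)" using h(1) by (simp add: module_hom_def)
    obtain f where f: "f \<in> Hom A x y" "Fa f = ?h * p"
      using full[OF x y module_hom_comp[OF p h(1) Fo_mod[OF x] X Fo_mod[OF y]]] by blast
    have "(?h * p) * (q * ?G) = ?h * (p * (q * ?G))" by (rule assoc_mult_mat[OF hc pc mult_carrier_mat[OF qc free_gens_carrier]])
    also have "p * (q * ?G) = (p * q) * ?G" by (rule assoc_mult_mat[OF pc qc free_gens_carrier, symmetric])
    also have "\<dots> = ?G" unfolding pq(1) by (rule left_mult_one_mat[OF free_gens_carrier])
    finally have 1: "Fa f * (q * ?G) = W" using h(2) f(2) by simp
    have "f' = f" if f': "f' \<in> Hom A x y" "Fa f' * (q * ?G) = W" for f'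
    proof (rule faithful[OF f'(1) f(1)])
      have "module_hom R (Fo x) (Fo y) (Fa f')" using Fa_hom[of f'] f'(1) by (auto simp: Hom_iff)
      then have "module_hom R ?X (Fo y) (Fa f' * q)" by (rule module_hom_comp[OF q _ X Fo_mod[OF x] Fo_mod[OF y]])
      from free_hom_unique[OF alg Fo_mod[OF y] this]
      have e: "Fa f' * q = ?h" using f'(2) assoc_mult_mat[OF Fa_Hom[OF f'(1)] qc free_gens_carrier] by simp
      have "Fa f' = Fa f' * (q * p)" unfolding pq(2) using Fa_Hom[OF f'(1)] by simp
      also have "\<dots> = ?h * p" unfolding assoc_mult_mat[OF Fa_Hom[OF f'(1)] qc pc, symmetric] e ..
      finally show "Fa f' = Fa f" using f(2) by simp
    qed
    then show ?thesis using f(1) 1 by blast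
  qed
  moreover have "q * ?G \<in> carrier_mat (fst (Fo x)) d" using qc by simp
  ultimately show ?thesis using x unfolding free_on_def by blast
qed

lemma free_on_hom: "free_on x U d \<Longrightarrow> y \<in> ob A \<Longrightarrow> W \<in> carrier_mat (fst (Fo y)) d \<Longrightarrow> \<exists>f\<in>Hom A x y. Fa f * U = W"
  unfolding free_on_def by blast

lemma free_on_eq:
  assumes "free_on x U d" "f \<in> Hom A x y" "g \<in> Hom A x y" "Fa f * U = Fa g * U"
  shows "f = g"
proof -
  have "y \<in> ob A" using assms(2) by (auto simp: Hom_iff)
  moreover have "Fa g * U \<in> carrier_mat (fst (Fo y)) d"
    using Fa_Hom[OF assms(3)] assms(1) unfolding free_on_def by (meson mult_carrier_mat)
  ultimately have "\<exists>!f. f \<in> Hom A x y \<and> Fa f * U = Fa g * U" using assms(1) unfolding free_on_def by blast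
  then show ?thesis using assms(2-4) by blast
qed

text \<open>The identity is the sum of the projections to the single generators. Each projection is
  a product of a column and a row, and thus factors through the free module on one generator. The
  matrix \<open>D t\<close> projects to the first \<open>t\<close> generators.\<close>

lemma free_on_factor_span:
  assumes P: "free_on P V 1" and Q: "free_on Q U d"
  shows "idt A Q \<in> factor_span A P Q"
proof -
  have o: "P \<in> ob A" "Q \<in> ob A" and U: "U \<in> carrier_mat (fst (Fo Q)) d" and V: "V \<in> carrier_mat (fst (Fo P)) 1"
    using P Q by (simp_all add: free_on_def)
  define D where "D t = mat d d (\<lambda>(i, j). if i = j \<and> i < t then 1 else 0 :: 'k)" for t
  have Dc: "D t \<in> carrier_mat d d" for t by (simp add: D_def)
  have "t \<le> d \<Longrightarrow> \<exists>e\<in>factor_span A P Q. Fa e * U = U * D t" for t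
  proof (induction t)
    case 0
    have "D 0 = 0\<^sub>m d d" by (rule eq_matI) (simp_all add: D_def)
    then have "Fa (zero_arr A Q Q) * U = U * D 0" using U by (simp add: Fa_zero o)
    then show ?case by (rule bexI[OF _ factor_span.zero])
  next
    case (Suc t)
    then obtain e where e: "e \<in> factor_span A P Q" "Fa e * U = U * D t" by auto
    have eh: "e \<in> Hom A Q Q" by (rule factor_span_Hom[OF e(1) o(2)])
    define c where "c = mat d 1 (\<lambda>(i, j). if i = t then 1 else 0 :: 'k)"
    define r where "r = mat 1 d (\<lambda>(i, j). if j = t then 1 else 0 :: 'k)"
    have cc: "c \<in> carrier_mat d 1" and rc: "r \<in> carrier_mat 1 d" by (simp_all add: c_def r_def)
    have cr: "D t + c * r = D (Suc t)"
    proof (rule eq_matI)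
      fix i j assume "i < dim_row (D (Suc t))" "j < dim_col (D (Suc t))"
      then have ij: "i < d" "j < d" by (simp_all add: D_def)
      have "(c * r) $$ (i, j) = (if i = t \<and> j = t then 1 else 0)"
        using mult_entry[OF cc rc ij] ij by (simp add: c_def r_def)
      then show "(D t + c * r) $$ (i, j) = D (Suc t) $$ (i, j)"
        using ij cc rc by (auto simp: D_def simp del: index_mult_mat(1))
    qed (use cc rc in \<open>auto simp: D_def\<close>)
    obtain i where i: "i \<in> Hom A P Q" "Fa i * V = U * c"
      using free_on_hom[OF P o(2) mult_carrier_mat[OF U cc]] by blast
    obtain p where p: "p \<in> Hom A Q P" "Fa p * U = V * r"
      using free_on_hom[OF Q o(1) mult_carrier_mat[OF V rc]] by blast
    have ip: "i \<cdot>\<^bsub>A\<^esub> p \<in> Hom A Q Q" by (rule comp_hom[OF p(1) i(1)])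
    have "Fa (i \<cdot>\<^bsub>A\<^esub> p) * U = Fa i * (Fa p * U)"
      unfolding Fa_comp_Hom[OF p(1) i(1)] by (rule assoc_mult_mat[OF Fa_Hom[OF i(1)] Fa_Hom[OF p(1)] U])
    also have "\<dots> = U * (c * r)"
      unfolding p(2) assoc_mult_mat[OF Fa_Hom[OF i(1)] V rc, symmetric] i(2) by (rule assoc_mult_mat[OF U cc rc])
    finally have 1: "Fa (i \<cdot>\<^bsub>A\<^esub> p) * U = U * (c * r)" .
    have "Fa (add_arr A e (i \<cdot>\<^bsub>A\<^esub> p)) * U = Fa e * U + Fa (i \<cdot>\<^bsub>A\<^esub> p) * U"
      unfolding Fa_add[OF eh ip] by (rule add_mult_distrib_mat[OF Fa_Hom[OF eh] Fa_Hom[OF ip] U])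
    also have "\<dots> = U * D (Suc t)"
      unfolding e(2) 1 cr[symmetric] by (rule mult_add_distrib_mat[OF U Dc mult_carrier_mat[OF cc rc], symmetric])
    finally show ?case by (rule bexI[OF _ factor_span.add[OF e(1) p(1) i(1)]])
  qed
  then obtain e where e: "e \<in> factor_span A P Q" "Fa e * U = U * D d" by blast
  have "D d = 1\<^sub>m d" by (rule eq_matI) (auto simp: D_def)
  then have "Fa e * U = Fa (idt A Q) * U" using e(2) U o by (simp add: Fa_idt)
  then have "e = idt A Q" by (intro free_on_eq[OF Q factor_span_Hom[OF e(1) o(2)]]) (simp_all add: Hom_iff o)
  then show ?thesis using e(1) by simp
qed

text \<open>The presentation of \<open>m\<close> by free modules on a basis of \<open>m\<close> and on a basis of the first of them:
  \<open>q\<close> sends the generators to the basis and \<open>r\<close> sends the generator belonging to \<open>v\<close> to \<open>v - U (q v)\<close>.\<close>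

lemma presentation:
  assumes P: "free_on P V 1" and m: "m \<in> ob A"
  shows "\<exists>q r. is_cokernel A r q \<and> trg A q = m \<and> idt A (src A q) \<in> factor_span A P (src A q) \<and>
    idt A (src A r) \<in> factor_span A P (src A r) \<and> (\<forall>b\<in>Hom A P m. \<exists>b'\<in>Hom A P (src A q). q \<cdot>\<^bsub>A\<^esub> b' = b)"
proof -
  let ?d = "fst (Fo m)"
  have V: "V \<in> carrier_mat (fst (Fo P)) 1" using P by (simp add: free_on_def)
  obtain Q U where Q: "free_on Q U ?d" using free_on_ex by blast
  have Qo: "Q \<in> ob A" and U: "U \<in> carrier_mat (fst (Fo Q)) ?d" using Q by (simp_all add: free_on_def)
  let ?n = "fst (Fo Q)"
  obtain Q' U' where Q': "free_on Q' U' ?n" using free_on_ex by blast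
  have Qo': "Q' \<in> ob A" and U': "U' \<in> carrier_mat (fst (Fo Q')) ?n" using Q' by (simp_all add: free_on_def)
  obtain q where q: "q \<in> Hom A Q m" "Fa q * U = 1\<^sub>m ?d" using free_on_hom[OF Q m one_carrier_mat] by blast
  have qc: "Fa q \<in> carrier_mat ?d ?n" by (rule Fa_Hom[OF q(1)])
  have Uq: "U * Fa q \<in> carrier_mat ?n ?n" by (rule mult_carrier_mat[OF U qc])
  obtain r where r: "r \<in> Hom A Q' Q" "Fa r * U' = 1\<^sub>m ?n - U * Fa q"
    using free_on_hom[OF Q' Qo minus_carrier_mat[OF Uq]] by blast
  \<comment> \<open>On generators \<open>r\<close> is \<open>1 - U * Fa q\<close>, so composition
    with \<open>r\<close> measures how far \<open>Fa h\<close> is from factoring through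
    \<open>Fa q\<close> by way of \<open>Fa h * U\<close>.\<close>
  have key: "Fa (h \<cdot>\<^bsub>A\<^esub> r) * U' = Fa h - (Fa h * U) * Fa q" if h: "h \<in> Hom A Q y" for h y
  proof -
    have hc: "Fa h \<in> carrier_mat (fst (Fo y)) ?n" by (rule Fa_Hom[OF h])
    have "Fa (h \<cdot>\<^bsub>A\<^esub> r) * U' = Fa h * (Fa r * U')"
      unfolding Fa_comp_Hom[OF r(1) h] by (rule assoc_mult_mat[OF hc Fa_Hom[OF r(1)] U'])
    also have "\<dots> = Fa h * 1\<^sub>m ?n - Fa h * (U * Fa q)"
      unfolding r(2) by (rule mult_minus_distrib_mat[OF hc one_carrier_mat Uq])
    also have "\<dots> = Fa h - (Fa h * U) * Fa q"
      unfolding assoc_mult_mat[OF hc U qc] using hc by simp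
    finally show ?thesis .
  qed
  have h0: "h \<cdot>\<^bsub>A\<^esub> r = zero_arr A Q' y \<longleftrightarrow> Fa h = (Fa h * U) * Fa q" if h: "h \<in> Hom A Q y" for h y
  proof -
    have y: "y \<in> ob A" using h by (auto simp: Hom_iff)
    have hc: "Fa h \<in> carrier_mat (fst (Fo y)) ?n" by (rule Fa_Hom[OF h])
    have hUq: "(Fa h * U) * Fa q \<in> carrier_mat (fst (Fo y)) ?n" by (rule mult_carrier_mat[OF mult_carrier_mat[OF hc U] qc])
    have z: "Fa (zero_arr A Q' y) * U' = 0\<^sub>m (fst (Fo y)) ?n" using U' by (simp add: Fa_zero Qo' y)
    show ?thesis
    proof
      assume "h \<cdot>\<^bsub>A\<^esub> r = zero_arr A Q' y"
      then have e: "Fa h - (Fa h * U) * Fa q = 0\<^sub>m (fst (Fo y)) ?n" using key[OF h] z by simp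
      have "Fa h $$ (a, b) = ((Fa h * U) * Fa q) $$ (a, b)" if "a < fst (Fo y)" "b < ?n" for a b
      proof -
        have "(Fa h - (Fa h * U) * Fa q) $$ (a, b) = 0" unfolding e using that by simp
        then show ?thesis using that carrier_matD[OF hUq] by (simp del: index_mult_mat(1))
      qed
      then show "Fa h = (Fa h * U) * Fa q"
        using carrier_matD[OF hc] carrier_matD[OF hUq] by (intro eq_matI) (simp_all del: index_mult_mat)
    next
      assume "Fa h = (Fa h * U) * Fa q"
      then have "Fa h - (Fa h * U) * Fa q = Fa h - Fa h" by (rule arg_cong[symmetric])
      also have "\<dots> = 0\<^sub>m (fst (Fo y)) ?n" by (rule minus_r_inv_mat[OF hc])
      finally have "Fa (h \<cdot>\<^bsub>A\<^esub> r) * U' = Fa (zero_arr A Q' y) * U'" unfolding key[OF h] z .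
      then show "h \<cdot>\<^bsub>A\<^esub> r = zero_arr A Q' y"
        by (rule free_on_eq[OF Q' comp_hom[OF r(1) h] zero_hom[OF Qo' y]])
    qed
  qed
  have qr: "q \<cdot>\<^bsub>A\<^esub> r = zero_arr A Q' m" unfolding h0[OF q(1)] q(2) using qc by simp
  have uni: "\<exists>!u. u \<in> Hom A m y \<and> u \<cdot>\<^bsub>A\<^esub> q = h" if h: "h \<in> Hom A Q y" and hr: "h \<cdot>\<^bsub>A\<^esub> r = zero_arr A Q' y" for h y
  proof -
    have y: "y \<in> ob A" using h by (auto simp: Hom_iff)
    have hc: "Fa h \<in> carrier_mat (fst (Fo y)) ?n" by (rule Fa_Hom[OF h])
    have hU: "Fa h * U \<in> carrier_mat (fst (Fo y)) ?d" by (rule mult_carrier_mat[OF hc U])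
    have e: "(Fa h * U) * Fa q = Fa h" using hr h0[OF h] by simp
    \<comment> \<open>The matrix \<open>U\<close> is a linear section of \<open>q\<close> that need
      not respect the action. The product \<open>Fa h * U\<close> does: insert
      \<open>Fa q * U = 1\<close>, move the action through \<open>q\<close>, and use
      \<open>e\<close>, which expresses that \<open>h\<close> kills \<open>r\<close>.\<close>
    have "module_hom R (Fo m) (Fo y) (Fa h * U)"
      unfolding module_hom_def
    proof (intro conjI allI impI hU)
      fix i assume i: "i < alg_dim R"
      have mc: "snd (Fo m) i \<in> carrier_mat ?d ?d" and Qc: "snd (Fo Q) i \<in> carrier_mat ?n ?n"
        and yc: "snd (Fo y) i \<in> carrier_mat (fst (Fo y)) (fst (Fo y))"
        using Fo_mod[OF m] Fo_mod[OF Qo] Fo_mod[OF y] i by (simp_all add: fd_module_iff)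
      have qi: "Fa q * snd (Fo Q) i = snd (Fo m) i * Fa q" using Fa_hom[of q] q(1) i by (auto simp: module_hom_def Hom_iff)
      have hi: "Fa h * snd (Fo Q) i = snd (Fo y) i * Fa h" using Fa_hom[of h] h i by (auto simp: module_hom_def Hom_iff)
      have "(Fa h * U) * snd (Fo m) i = (Fa h * U) * (snd (Fo m) i * (Fa q * U))" unfolding q(2) using mc by simp
      also have "snd (Fo m) i * (Fa q * U) = (snd (Fo m) i * Fa q) * U" by (rule assoc_mult_mat[OF mc qc U, symmetric])
      also have "\<dots> = Fa q * (snd (Fo Q) i * U)" unfolding qi[symmetric] by (rule assoc_mult_mat[OF qc Qc U])
      also have "(Fa h * U) * (Fa q * (snd (Fo Q) i * U)) = Fa h * (snd (Fo Q) i * U)"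
        unfolding assoc_mult_mat[OF hU qc mult_carrier_mat[OF Qc U], symmetric] e ..
      also have "\<dots> = snd (Fo y) i * (Fa h * U)"
        unfolding assoc_mult_mat[OF hc Qc U, symmetric] hi by (rule assoc_mult_mat[OF yc hc U])
      finally show "(Fa h * U) * snd (Fo m) i = snd (Fo y) i * (Fa h * U)" .
    qed
    from full[OF m y this] obtain u where u: "u \<in> Hom A m y" "Fa u = Fa h * U" by blast
    have 1: "u \<cdot>\<^bsub>A\<^esub> q = h"
      by (rule faithful[OF comp_hom[OF q(1) u(1)] h]) (simp only: Fa_comp_Hom[OF q(1) u(1)] u(2) e)
    have "v = u" if v: "v \<in> Hom A m y" "v \<cdot>\<^bsub>A\<^esub> q = h" for v
    proof (rule faithful[OF v(1) u(1)])
      have vc: "Fa v \<in> carrier_mat (fst (Fo y)) ?d" by (rule Fa_Hom[OF v(1)])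
      have "Fa u = (Fa v * Fa q) * U" unfolding u(2) v(2)[symmetric] Fa_comp_Hom[OF q(1) v(1)] ..
      also have "\<dots> = Fa v" unfolding assoc_mult_mat[OF vc qc U] q(2) using vc by simp
      finally show "Fa v = Fa u" by simp
    qed
    then show ?thesis using u(1) 1 by blast
  qed
  have st: "q \<in> arr A" "src A q = Q" "trg A q = m" "r \<in> arr A" "src A r = Q'" "trg A r = Q"
    using q(1) r(1) by (simp_all add: Hom_iff)
  have "is_cokernel A r q"
    unfolding is_cokernel_def using st qr uni by (auto simp: Hom_iff)
  \<comment> \<open>\<open>P\<close> is projective because it is free: its generator may be sent to
    any preimage, here the one provided by the section \<open>U\<close>.\<close>
  moreover have "\<exists>b'\<in>Hom A P Q. q \<cdot>\<^bsub>A\<^esub> b' = b" if b: "b \<in> Hom A P m" for b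
  proof -
    have bV: "Fa b * V \<in> carrier_mat ?d 1" by (rule mult_carrier_mat[OF Fa_Hom[OF b] V])
    obtain b' where b': "b' \<in> Hom A P Q" "Fa b' * V = U * (Fa b * V)"
      using free_on_hom[OF P Qo mult_carrier_mat[OF U bV]] by blast
    have "Fa (q \<cdot>\<^bsub>A\<^esub> b') * V = Fa q * (Fa b' * V)"
      unfolding Fa_comp_Hom[OF b'(1) q(1)] by (rule assoc_mult_mat[OF qc Fa_Hom[OF b'(1)] V])
    also have "\<dots> = Fa b * V"
      unfolding b'(2) assoc_mult_mat[OF qc U bV, symmetric] q(2) by (rule left_mult_one_mat[OF bV])
    finally have "q \<cdot>\<^bsub>A\<^esub> b' = b" by (rule free_on_eq[OF P comp_hom[OF b'(1) q(1)] b])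
    then show ?thesis using b'(1) by blast
  qed
  ultimately show ?thesis using st free_on_factor_span[OF P Q] free_on_factor_span[OF P Q'] by auto
qed

end

section \<open>Existence of ends\<close>

lemma is_kernel_opp: "is_kernel (opp A) f k \<longleftrightarrow> is_cokernel A f k"
  unfolding is_kernel_def is_cokernel_def by (simp add: Hom_def conj_ac)

text \<open>Since \<open>P\<close> is a projective generator, a wedge \<open>j\<close> is determined by \<open>j P\<close>, which equalises \<open>T P i\<close> and
  \<open>T i P\<close> for all endomorphisms \<open>i\<close> of \<open>P\<close>. Conversely, an arrow equalising these extends to a wedge: it extends to
  the objects whose identity is a sum of arrows factoring through \<open>P\<close>, and then, by left exactness in
  the contravariant variable, to the objects presented by them.\<close>

lemma end_exists:
  fixes M :: "('m, 'n, 'k::field) lcat" and C :: "('o, 'a, 'k, 'z) lcat_scheme"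
    and T :: "('m, 'n, 'm, 'n, 'o, 'a, 't) bftr_scheme"
  assumes T: "bilinear_bifunctor (opp M) M C T"
    and M: "matrix_rep M R Fo Fa" and C: "matrix_rep C R' Fo' Fa'"
    and left: "\<And>y. y \<in> ob M \<Longrightarrow> left_exact (opp M) C (fix_right M T y)"
  shows "\<exists>g j. is_end M C T g j"
proof -
  interpret M: matrix_rep M R Fo Fa by (rule M)
  interpret C: matrix_rep C R' Fo' Fa' by (rule C)
  interpret T: bilinear_bifunctor "opp M" M C T by (rule T)
  obtain P V where P: "M.free_on P V 1" using M.free_on_ex by blast
  have Po [simp]: "P \<in> ob M" using P by (simp add: M.free_on_def)
  have T_hom [simp]: "bf_arr T f k \<in> arr C" "src C (bf_arr T f k) = bf_ob T (trg M f) (src M k)"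
    "trg C (bf_arr T f k) = bf_ob T (src M f) (trg M k)" if "f \<in> arr M" "k \<in> arr M" for f k
    using T.bf_arr'[of f k] T.bf_src'[of f k] T.bf_trg'[of f k] that by simp_all
  have T_ob [simp]: "bf_ob T m n \<in> ob C" if "m \<in> ob M" "n \<in> ob M" for m n using T.bf_ob'[of m n] that by simp
  have T_comp [simp]: "bf_arr T f' k' \<cdot>\<^bsub>C\<^esub> bf_arr T f k = bf_arr T (f \<cdot>\<^bsub>M\<^esub> f') (k' \<cdot>\<^bsub>M\<^esub> k)"
    if "f \<in> arr M" "f' \<in> arr M" "k \<in> arr M" "k' \<in> arr M" "src M f = trg M f'" "src M k' = trg M k" for f f' k k'
    using T.bf_comp'[of f f' k k'] that by simp
  have T_tail: "bf_arr T f' k' \<cdot>\<^bsub>C\<^esub> (bf_arr T f k \<cdot>\<^bsub>C\<^esub> z) = bf_arr T (f \<cdot>\<^bsub>M\<^esub> f') (k' \<cdot>\<^bsub>M\<^esub> k) \<cdot>\<^bsub>C\<^esub> z"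
    if "f \<in> arr M" "f' \<in> arr M" "k \<in> arr M" "k' \<in> arr M" "src M f = trg M f'" "src M k' = trg M k"
      "z \<in> arr C" "trg C z = bf_ob T (trg M f) (src M k)" for f f' k k' z
    using C.comp_tail[OF T_comp[of f f' k k'], of z] that by simp
  have T_zero1: "bf_arr T (zero_arr M m n) k = zero_arr C (bf_ob T n (src M k)) (bf_ob T m (trg M k))"
    if [simp]: "m \<in> ob M" "n \<in> ob M" "k \<in> arr M" for m n k
  proof -
    have z: "zero_arr M m n \<in> Hom (opp M) n m" using M.zero_hom[of m n] by (simp add: Hom_iff)
    have "bf_arr T (zero_arr M m n) k = bf_arr T (scale_arr (opp M) 0 (zero_arr M m n)) k"
      using M.scale_zero[OF M.zero_hom[of m n]] by simp
    also have "\<dots> = scale_arr C 0 (bf_arr T (zero_arr M m n) k)"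
      by (rule T.scale_left[OF z, of k "src M k" "trg M k"]) (simp add: Hom_iff)
    also have "\<dots> = zero_arr C (bf_ob T n (src M k)) (bf_ob T m (trg M k))"
      by (rule C.scale_zero) (simp add: Hom_iff)
    finally show ?thesis .
  qed
  have T_zero2: "bf_arr T f (zero_arr M m n) = zero_arr C (bf_ob T (trg M f) m) (bf_ob T (src M f) n)"
    if [simp]: "m \<in> ob M" "n \<in> ob M" "f \<in> arr M" for m n f
  proof -
    have "bf_arr T f (zero_arr M m n) = bf_arr T f (scale_arr M 0 (zero_arr M m n))"
      using M.scale_zero[OF M.zero_hom[of m n]] by simp
    also have "\<dots> = scale_arr C 0 (bf_arr T f (zero_arr M m n))"
      by (rule T.scale_right[OF _ M.zero_hom, of f "trg M f" "src M f"]) (simp_all add: Hom_iff)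
    also have "\<dots> = zero_arr C (bf_ob T (trg M f) m) (bf_ob T (src M f) n)"
      by (rule C.scale_zero) (simp add: Hom_iff)
    finally show ?thesis .
  qed
  \<comment> \<open>The arrow \<open>x\<close> is to be the component of the end at
    \<open>P\<close>; the pairs that it equalises are the wedge conditions for the endomorphisms of
    \<open>P\<close>.\<close>
  have "\<exists>e\<in>arr C. trg C e = bf_ob T P P \<and>
      (\<forall>i\<in>Hom M P P. bf_arr T (idt M P) i \<cdot>\<^bsub>C\<^esub> e = bf_arr T i (idt M P) \<cdot>\<^bsub>C\<^esub> e) \<and>
      (\<forall>h\<in>arr C. trg C h = bf_ob T P P \<and> (\<forall>i\<in>Hom M P P. bf_arr T (idt M P) i \<cdot>\<^bsub>C\<^esub> h = bf_arr T i (idt M P) \<cdot>\<^bsub>C\<^esub> h) \<longrightarrow>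
        (\<exists>!u. u \<in> Hom C (src C h) (src C e) \<and> e \<cdot>\<^bsub>C\<^esub> u = h))"
    by (rule C.joint_equaliser) (auto simp: Hom_iff)
  then obtain x where x [simp]: "x \<in> arr C" "trg C x = bf_ob T P P"
    and x_eq: "\<And>i. i \<in> Hom M P P \<Longrightarrow> bf_arr T (idt M P) i \<cdot>\<^bsub>C\<^esub> x = bf_arr T i (idt M P) \<cdot>\<^bsub>C\<^esub> x"
    and x_uni: "\<And>h. h \<in> arr C \<Longrightarrow> trg C h = bf_ob T P P \<Longrightarrow>
      (\<forall>i\<in>Hom M P P. bf_arr T (idt M P) i \<cdot>\<^bsub>C\<^esub> h = bf_arr T i (idt M P) \<cdot>\<^bsub>C\<^esub> h) \<Longrightarrow>
      \<exists>!u. u \<in> Hom C (src C h) (src C x) \<and> x \<cdot>\<^bsub>C\<^esub> u = h" by blast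
  define g where "g = src C x"
  \<comment> \<open>\<open>good m j\<close> is the wedge condition for all arrows from
    \<open>P\<close> to \<open>m\<close>, with \<open>x\<close> as component at \<open>P\<close>.
    The property \<open>mono m\<close> defined next says that arrows into \<open>T m n\<close> are
    detected by restriction along these arrows, so that there is at most one such
    \<open>j\<close>.\<close>
  define good where "good m j \<longleftrightarrow> j \<in> arr C \<and> src C j = g \<and> trg C j = bf_ob T m m \<and>
    (\<forall>b\<in>Hom M P m. bf_arr T b (idt M m) \<cdot>\<^bsub>C\<^esub> j = bf_arr T (idt M P) b \<cdot>\<^bsub>C\<^esub> x)" for m j
  define mono where "mono m \<longleftrightarrow> (\<forall>n\<in>ob M. \<forall>y\<in>arr C. \<forall>y'\<in>arr C. trg C y = bf_ob T m n \<longrightarrow> trg C y' = bf_ob T m n \<longrightarrow>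
    src C y = src C y' \<longrightarrow> (\<forall>b\<in>Hom M P m. bf_arr T b (idt M n) \<cdot>\<^bsub>C\<^esub> y = bf_arr T b (idt M n) \<cdot>\<^bsub>C\<^esub> y') \<longrightarrow> y = y')" for m
  have mono_eq: "y = y'" if "mono m" "n \<in> ob M" "y \<in> arr C" "y' \<in> arr C" "trg C y = bf_ob T m n" "trg C y' = bf_ob T m n"
    "src C y = src C y'" "\<And>b. b \<in> Hom M P m \<Longrightarrow> bf_arr T b (idt M n) \<cdot>\<^bsub>C\<^esub> y = bf_arr T b (idt M n) \<cdot>\<^bsub>C\<^esub> y'" for m n y y'
    using that unfolding mono_def by blast
  \<comment> \<open>By additivity it suffices to treat one summand, \<open>p\<close> followed by
    \<open>i\<close>: restriction along it is restriction along the arrow \<open>i\<close> from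
    \<open>P\<close>, followed by restriction along \<open>p\<close>.\<close>
  have span_mono: "mono Q" if Q: "Q \<in> ob M" "idt M Q \<in> factor_span M P Q" for Q
    unfolding mono_def
  proof (intro ballI impI)
    fix n y y' assume n [simp]: "n \<in> ob M" and y [simp]: "y \<in> arr C" "trg C y = bf_ob T Q n" "y' \<in> arr C" "trg C y' = bf_ob T Q n"
      and s: "src C y = src C y'"
      and e: "\<forall>b\<in>Hom M P Q. bf_arr T b (idt M n) \<cdot>\<^bsub>C\<^esub> y = bf_arr T b (idt M n) \<cdot>\<^bsub>C\<^esub> y'"
    have "bf_arr T a (idt M n) \<cdot>\<^bsub>C\<^esub> y = bf_arr T a (idt M n) \<cdot>\<^bsub>C\<^esub> y'" if "a \<in> factor_span M P Q" for a
      using that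
    proof induction
      case zero
      have "bf_arr T (zero_arr M Q Q) (idt M n) \<cdot>\<^bsub>C\<^esub> w = zero_arr C (src C w) (bf_ob T Q n)"
        if "w \<in> arr C" "trg C w = bf_ob T Q n" for w
        using C.comp_zero(2)[of w "bf_ob T Q n"] that Q by (simp add: T_zero1)
      then show ?case by (simp add: s)
    next
      case (add a p i)
      have a: "a \<in> Hom M Q Q" by (rule M.factor_span_Hom[OF add(1) Q(1)])
      have pi: "p \<in> arr M" "src M p = Q" "trg M p = P" "i \<in> arr M" "src M i = P" "trg M i = Q"
        using add by (simp_all add: Hom_iff)
      have d: "bf_arr T (add_arr M a (i \<cdot>\<^bsub>M\<^esub> p)) (idt M n) \<cdot>\<^bsub>C\<^esub> w =
          add_arr C (bf_arr T a (idt M n) \<cdot>\<^bsub>C\<^esub> w) (bf_arr T p (idt M n) \<cdot>\<^bsub>C\<^esub> bf_arr T i (idt M n) \<cdot>\<^bsub>C\<^esub> w)"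
        if w: "w \<in> arr C" "trg C w = bf_ob T Q n" for w
      proof -
        have "bf_arr T (add_arr M a (i \<cdot>\<^bsub>M\<^esub> p)) (idt M n) = add_arr C (bf_arr T a (idt M n)) (bf_arr T (i \<cdot>\<^bsub>M\<^esub> p) (idt M n))"
          using T.add_left[of a Q Q "i \<cdot>\<^bsub>M\<^esub> p" "idt M n" n n] a pi by (simp add: Hom_iff)
        moreover have "add_arr C (bf_arr T a (idt M n)) (bf_arr T (i \<cdot>\<^bsub>M\<^esub> p) (idt M n)) \<cdot>\<^bsub>C\<^esub> w =
            add_arr C (bf_arr T a (idt M n) \<cdot>\<^bsub>C\<^esub> w) (bf_arr T (i \<cdot>\<^bsub>M\<^esub> p) (idt M n) \<cdot>\<^bsub>C\<^esub> w)"
          by (rule C.comp_add_left[of w "src C w" "bf_ob T Q n" _ "bf_ob T Q n"])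
            (use a pi w in \<open>simp_all add: Hom_iff\<close>)
        ultimately show ?thesis using pi w by (simp add: T_tail)
      qed
      show ?case using add.IH bspec[OF e add(3)] by (simp only: d y)
    qed
    from this[OF Q(2)] show "y = y'"
      using T.idt[of Q n] Q by simp
  qed
  have span_good: "\<exists>z. good Q z" if Q: "Q \<in> ob M" "idt M Q \<in> factor_span M P Q" for Q
  proof -
    have "\<exists>z\<in>Hom C g (bf_ob T Q Q). \<forall>b\<in>Hom M P Q. bf_arr T b (idt M Q) \<cdot>\<^bsub>C\<^esub> z = bf_arr T (idt M P) (a \<cdot>\<^bsub>M\<^esub> b) \<cdot>\<^bsub>C\<^esub> x"
      if "a \<in> factor_span M P Q" for a
      using that
    proof induction
      case zero
      have go: "g \<in> ob C" by (simp add: g_def)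
      have "bf_arr T b (idt M Q) \<cdot>\<^bsub>C\<^esub> zero_arr C g (bf_ob T Q Q) = bf_arr T (idt M P) (zero_arr M Q Q \<cdot>\<^bsub>M\<^esub> b) \<cdot>\<^bsub>C\<^esub> x"
        if b: "b \<in> Hom M P Q" for b
      proof -
        have b': "b \<in> arr M" "src M b = P" "trg M b = Q" using b by (simp_all add: Hom_iff)
        have "bf_arr T b (idt M Q) \<cdot>\<^bsub>C\<^esub> zero_arr C g (bf_ob T Q Q) = zero_arr C g (bf_ob T P Q)"
          using C.comp_zero(1)[of "bf_arr T b (idt M Q)" g] b' Q go by simp
        moreover have "zero_arr M Q Q \<cdot>\<^bsub>M\<^esub> b = zero_arr M P Q" using M.comp_zero(2)[of b Q] b' Q by simp
        moreover have "zero_arr C (bf_ob T P P) (bf_ob T P Q) \<cdot>\<^bsub>C\<^esub> x = zero_arr C g (bf_ob T P Q)"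
          using C.comp_zero(2)[of x "bf_ob T P Q"] Q by (simp add: g_def)
        ultimately show ?thesis using Q by (simp add: T_zero2)
      qed
      then show ?case using C.zero_hom[OF go, of "bf_ob T Q Q"] Q by (intro bexI[of _ "zero_arr C g (bf_ob T Q Q)"]) simp_all
    next
      case (add a p i)
      then obtain z where z: "z \<in> Hom C g (bf_ob T Q Q)"
        and ze: "\<And>b. b \<in> Hom M P Q \<Longrightarrow> bf_arr T b (idt M Q) \<cdot>\<^bsub>C\<^esub> z = bf_arr T (idt M P) (a \<cdot>\<^bsub>M\<^esub> b) \<cdot>\<^bsub>C\<^esub> x" by blast
      have a: "a \<in> Hom M Q Q" by (rule M.factor_span_Hom[OF add(1) Q(1)])
      have pi: "p \<in> arr M" "src M p = Q" "trg M p = P" "i \<in> arr M" "src M i = P" "trg M i = Q"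
        using add by (simp_all add: Hom_iff)
      \<comment> \<open>The contribution of the summand \<open>p\<close> followed by
        \<open>i\<close>. Restricted along \<open>b\<close>, it contains the endomorphism of
        \<open>P\<close> given by \<open>b\<close> and then \<open>p\<close>, which
        \<open>x_eq\<close> moves from the contravariant to the covariant variable.\<close>
      let ?w = "bf_arr T p i \<cdot>\<^bsub>C\<^esub> x"
      have w: "?w \<in> Hom C g (bf_ob T Q Q)" using pi by (simp add: Hom_iff g_def)
      have "bf_arr T b (idt M Q) \<cdot>\<^bsub>C\<^esub> add_arr C z ?w = bf_arr T (idt M P) (add_arr M a (i \<cdot>\<^bsub>M\<^esub> p) \<cdot>\<^bsub>M\<^esub> b) \<cdot>\<^bsub>C\<^esub> x"
        if b: "b \<in> Hom M P Q" for b
      proof -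
        have b': "b \<in> arr M" "src M b = P" "trg M b = Q" using b by (simp_all add: Hom_iff)
        have pb: "p \<cdot>\<^bsub>M\<^esub> b \<in> Hom M P P" using pi b' by (simp add: Hom_iff)
        have "bf_arr T b (idt M Q) \<cdot>\<^bsub>C\<^esub> ?w = bf_arr T (idt M P) i \<cdot>\<^bsub>C\<^esub> bf_arr T (p \<cdot>\<^bsub>M\<^esub> b) (idt M P) \<cdot>\<^bsub>C\<^esub> x"
          using pi b' Q by (simp add: T_tail)
        also have "\<dots> = bf_arr T (idt M P) ((i \<cdot>\<^bsub>M\<^esub> p) \<cdot>\<^bsub>M\<^esub> b) \<cdot>\<^bsub>C\<^esub> x"
          unfolding x_eq[OF pb, symmetric] using pi b' by (simp add: T_tail)
        finally have 1: "bf_arr T b (idt M Q) \<cdot>\<^bsub>C\<^esub> ?w = bf_arr T (idt M P) ((i \<cdot>\<^bsub>M\<^esub> p) \<cdot>\<^bsub>M\<^esub> b) \<cdot>\<^bsub>C\<^esub> x" .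
        have ip: "i \<cdot>\<^bsub>M\<^esub> p \<in> Hom M Q Q" using pi by (simp add: Hom_iff)
        have "bf_arr T b (idt M Q) \<cdot>\<^bsub>C\<^esub> add_arr C z ?w =
            add_arr C (bf_arr T b (idt M Q) \<cdot>\<^bsub>C\<^esub> z) (bf_arr T b (idt M Q) \<cdot>\<^bsub>C\<^esub> ?w)"
          by (rule C.comp_add_right[OF z w, of _ "bf_ob T P Q"]) (use b' Q in \<open>simp add: Hom_iff\<close>)
        also have "\<dots> = add_arr C (bf_arr T (idt M P) (a \<cdot>\<^bsub>M\<^esub> b) \<cdot>\<^bsub>C\<^esub> x) (bf_arr T (idt M P) ((i \<cdot>\<^bsub>M\<^esub> p) \<cdot>\<^bsub>M\<^esub> b) \<cdot>\<^bsub>C\<^esub> x)"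
          unfolding ze[OF b] 1 ..
        also have "\<dots> = add_arr C (bf_arr T (idt M P) (a \<cdot>\<^bsub>M\<^esub> b)) (bf_arr T (idt M P) ((i \<cdot>\<^bsub>M\<^esub> p) \<cdot>\<^bsub>M\<^esub> b)) \<cdot>\<^bsub>C\<^esub> x"
          by (rule C.comp_add_left[of x g "bf_ob T P P" _ "bf_ob T P Q", symmetric])
            (use a pi b' in \<open>simp_all add: Hom_iff g_def\<close>)
        also have "add_arr C (bf_arr T (idt M P) (a \<cdot>\<^bsub>M\<^esub> b)) (bf_arr T (idt M P) ((i \<cdot>\<^bsub>M\<^esub> p) \<cdot>\<^bsub>M\<^esub> b)) =
            bf_arr T (idt M P) (add_arr M (a \<cdot>\<^bsub>M\<^esub> b) ((i \<cdot>\<^bsub>M\<^esub> p) \<cdot>\<^bsub>M\<^esub> b))"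
          by (rule T.add_right[of "idt M P" P P _ P Q, symmetric]) (use a pi b' in \<open>simp_all add: Hom_iff\<close>)
        also have "add_arr M (a \<cdot>\<^bsub>M\<^esub> b) ((i \<cdot>\<^bsub>M\<^esub> p) \<cdot>\<^bsub>M\<^esub> b) = add_arr M a (i \<cdot>\<^bsub>M\<^esub> p) \<cdot>\<^bsub>M\<^esub> b"
          by (rule M.comp_add_left[OF b a ip, symmetric])
        finally show ?thesis .
      qed
      then show ?case using C.add_hom[OF z w] by (intro bexI[of _ "add_arr C z ?w"]) simp_all
    qed
    from this[OF Q(2)] obtain z where z: "z \<in> Hom C g (bf_ob T Q Q)"
      "\<forall>b\<in>Hom M P Q. bf_arr T b (idt M Q) \<cdot>\<^bsub>C\<^esub> z = bf_arr T (idt M P) (idt M Q \<cdot>\<^bsub>M\<^esub> b) \<cdot>\<^bsub>C\<^esub> x" by blast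
    have "good Q z" unfolding good_def using z by (auto simp: Hom_iff)
    then show ?thesis by blast
  qed
  \<comment> \<open>Left exactness turns the cokernel \<open>q\<close> of \<open>r\<close> into a
    kernel of an arrow between values of \<open>T\<close>, so both properties descend from the free
    objects \<open>Q\<close> and \<open>Q'\<close> to \<open>m\<close>.\<close>
  have main: "mono m \<and> (\<exists>j. good m j)" if m [simp]: "m \<in> ob M" for m
  proof -
    obtain q r where ck: "is_cokernel M r q" and qm: "trg M q = m"
      and sp: "idt M (src M q) \<in> factor_span M P (src M q)" "idt M (src M r) \<in> factor_span M P (src M r)"
      and lift: "\<And>b. b \<in> Hom M P m \<Longrightarrow> \<exists>b'\<in>Hom M P (src M q). q \<cdot>\<^bsub>M\<^esub> b' = b"
      using M.presentation[OF P m] by blast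
    define Q Q' where "Q = src M q" and "Q' = src M r"
    have q [simp]: "q \<in> arr M" "src M q = Q" "trg M q = m" and r [simp]: "r \<in> arr M" "src M r = Q'" "trg M r = Q"
      and qr: "q \<cdot>\<^bsub>M\<^esub> r = zero_arr M Q' m"
      using ck qm by (auto simp: is_cokernel_def Q_def Q'_def)
    have Qo [simp]: "Q \<in> ob M" "Q' \<in> ob M" using M.src_ob'[OF q(1)] M.src_ob'[OF r(1)] by simp_all
    have "is_kernel (opp M) r q" using ck unfolding is_kernel_opp .
    then have k: "is_kernel C (bf_arr T r (idt M m)) (bf_arr T q (idt M m))"
      using left[OF m] by (simp add: left_exact_def fix_right_def)
    have k_uni: "\<exists>!u. u \<in> Hom C (src C h) (bf_ob T m m) \<and> bf_arr T q (idt M m) \<cdot>\<^bsub>C\<^esub> u = h"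
      if "h \<in> arr C" "trg C h = bf_ob T Q m" "bf_arr T r (idt M m) \<cdot>\<^bsub>C\<^esub> h = zero_arr C (src C h) (bf_ob T Q' m)" for h
      using k that by (simp add: is_kernel_def)
    have mQ: "mono Q" "mono Q'" using span_mono[of Q] span_mono[of Q'] sp by (simp_all add: Q_def[symmetric] Q'_def[symmetric])
    have "mono m"
      unfolding mono_def
    proof (intro ballI impI)
      fix n y y' assume n [simp]: "n \<in> ob M" and y [simp]: "y \<in> arr C" "trg C y = bf_ob T m n" "y' \<in> arr C" "trg C y' = bf_ob T m n"
        and s: "src C y = src C y'"
        and e: "\<forall>b\<in>Hom M P m. bf_arr T b (idt M n) \<cdot>\<^bsub>C\<^esub> y = bf_arr T b (idt M n) \<cdot>\<^bsub>C\<^esub> y'"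
      have kn: "is_kernel C (bf_arr T r (idt M n)) (bf_arr T q (idt M n))"
        using left[OF n] \<open>is_kernel (opp M) r q\<close> by (simp add: left_exact_def fix_right_def)
      have qe: "bf_arr T b' (idt M n) \<cdot>\<^bsub>C\<^esub> (bf_arr T q (idt M n) \<cdot>\<^bsub>C\<^esub> y) = bf_arr T b' (idt M n) \<cdot>\<^bsub>C\<^esub> (bf_arr T q (idt M n) \<cdot>\<^bsub>C\<^esub> y')"
        if b': "b' \<in> Hom M P Q" for b'
      proof -
        have "q \<cdot>\<^bsub>M\<^esub> b' \<in> Hom M P m" using b' by (auto simp: Hom_iff)
        from bspec[OF e this] show ?thesis using b' by (simp add: T_tail Hom_iff)
      qed
      have qy: "bf_arr T q (idt M n) \<cdot>\<^bsub>C\<^esub> y = bf_arr T q (idt M n) \<cdot>\<^bsub>C\<^esub> y'"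
        by (rule mono_eq[OF mQ(1) n _ _ _ _ _ qe]) (simp_all add: s)
      have qry: "bf_arr T r (idt M n) \<cdot>\<^bsub>C\<^esub> (bf_arr T q (idt M n) \<cdot>\<^bsub>C\<^esub> y) = zero_arr C (src C y) (bf_ob T Q' n)"
        using C.comp_zero(2)[of y "bf_ob T Q' n"] by (simp add: T_tail qr T_zero1)
      have "\<exists>!u. u \<in> Hom C (src C (bf_arr T q (idt M n) \<cdot>\<^bsub>C\<^esub> y)) (src C (bf_arr T q (idt M n))) \<and>
          bf_arr T q (idt M n) \<cdot>\<^bsub>C\<^esub> u = bf_arr T q (idt M n) \<cdot>\<^bsub>C\<^esub> y"
        by (rule kn[unfolded is_kernel_def, THEN conjunct2, THEN conjunct2, THEN conjunct2, THEN conjunct2, rule_format])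
          (simp_all add: qry)
      then have "\<exists>!u. u \<in> Hom C (src C y) (bf_ob T m n) \<and> bf_arr T q (idt M n) \<cdot>\<^bsub>C\<^esub> u = bf_arr T q (idt M n) \<cdot>\<^bsub>C\<^esub> y"
        by simp
      moreover have "y \<in> Hom C (src C y) (bf_ob T m n)" "y' \<in> Hom C (src C y) (bf_ob T m n)" by (simp_all add: Hom_iff s)
      ultimately show "y = y'" using qy[symmetric] by blast
    qed
    moreover have "\<exists>j. good m j"
    proof -
      obtain z where "good Q z" using span_good[of Q] sp by (auto simp: Q_def[symmetric])
      then have z [simp]: "z \<in> arr C" "src C z = g" "trg C z = bf_ob T Q Q"
        and ze: "\<And>b. b \<in> Hom M P Q \<Longrightarrow> bf_arr T b (idt M Q) \<cdot>\<^bsub>C\<^esub> z = bf_arr T (idt M P) b \<cdot>\<^bsub>C\<^esub> x"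
        by (auto simp: good_def)
      have go [simp]: "g \<in> ob C" by (simp add: g_def)
      have split: "bf_arr T b q \<cdot>\<^bsub>C\<^esub> z = bf_arr T (idt M P) (q \<cdot>\<^bsub>M\<^esub> b) \<cdot>\<^bsub>C\<^esub> x" if b: "b \<in> Hom M P Q" for b
      proof -
        have b': "b \<in> arr M" "src M b = P" "trg M b = Q" using b by (simp_all add: Hom_iff)
        have "bf_arr T b q \<cdot>\<^bsub>C\<^esub> z = bf_arr T (idt M P) q \<cdot>\<^bsub>C\<^esub> bf_arr T b (idt M Q) \<cdot>\<^bsub>C\<^esub> z"
          using b' by (simp add: T_tail)
        also have "\<dots> = bf_arr T (idt M P) (q \<cdot>\<^bsub>M\<^esub> b) \<cdot>\<^bsub>C\<^esub> x" unfolding ze[OF b] using b' by (simp add: T_tail)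
        finally show ?thesis .
      qed
      let ?h = "bf_arr T (idt M Q) q \<cdot>\<^bsub>C\<^esub> z"
      \<comment> \<open>By \<open>mono Q'\<close> this is tested on arrows \<open>b\<close> from
        \<open>P\<close> to \<open>Q'\<close>. There the arrow becomes \<open>x\<close> followed by
        the covariant action of \<open>b\<close>, \<open>r\<close> and \<open>q\<close> in
        succession, which is zero.\<close>
      have "bf_arr T r (idt M m) \<cdot>\<^bsub>C\<^esub> ?h = zero_arr C g (bf_ob T Q' m)"
      proof -
        have rh: "bf_arr T b (idt M m) \<cdot>\<^bsub>C\<^esub> (bf_arr T r (idt M m) \<cdot>\<^bsub>C\<^esub> ?h) = bf_arr T b (idt M m) \<cdot>\<^bsub>C\<^esub> zero_arr C g (bf_ob T Q' m)"
          if b: "b \<in> Hom M P Q'" for b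
        proof -
          have b': "b \<in> arr M" "src M b = P" "trg M b = Q'" using b by (simp_all add: Hom_iff)
          have rb: "r \<cdot>\<^bsub>M\<^esub> b \<in> Hom M P Q" using b' by (simp add: Hom_iff)
          have "bf_arr T b (idt M m) \<cdot>\<^bsub>C\<^esub> (bf_arr T r (idt M m) \<cdot>\<^bsub>C\<^esub> ?h) = bf_arr T (r \<cdot>\<^bsub>M\<^esub> b) q \<cdot>\<^bsub>C\<^esub> z"
            using b' by (simp add: T_tail)
          also have "\<dots> = bf_arr T (idt M P) (q \<cdot>\<^bsub>M\<^esub> r \<cdot>\<^bsub>M\<^esub> b) \<cdot>\<^bsub>C\<^esub> x" using split[OF rb] .
          also have "q \<cdot>\<^bsub>M\<^esub> r \<cdot>\<^bsub>M\<^esub> b = zero_arr M P m"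
            using M.comp_tail[OF qr, of b] M.comp_zero(2)[of b m] b' by simp
          also have "bf_arr T (idt M P) (zero_arr M P m) \<cdot>\<^bsub>C\<^esub> x = zero_arr C g (bf_ob T P m)"
            using C.comp_zero(2)[of x "bf_ob T P m"] by (simp add: T_zero2 g_def)
          also have "\<dots> = bf_arr T b (idt M m) \<cdot>\<^bsub>C\<^esub> zero_arr C g (bf_ob T Q' m)"
            using C.comp_zero(1)[of "bf_arr T b (idt M m)" g] b' by simp
          finally show ?thesis .
        qed
        show ?thesis by (rule mono_eq[OF mQ(2) m _ _ _ _ _ rh]) simp_all
      qed
      then have hz: "bf_arr T r (idt M m) \<cdot>\<^bsub>C\<^esub> ?h = zero_arr C (src C ?h) (bf_ob T Q' m)" by simp
      have "\<exists>!u. u \<in> Hom C (src C ?h) (bf_ob T m m) \<and> bf_arr T q (idt M m) \<cdot>\<^bsub>C\<^esub> u = ?h"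
        by (rule k_uni[OF _ _ hz]) simp_all
      then obtain j where j0: "j \<in> Hom C (src C ?h) (bf_ob T m m)" and j1: "bf_arr T q (idt M m) \<cdot>\<^bsub>C\<^esub> j = ?h"
        unfolding Ex1_def by (elim exE conjE) (rule that)
      have j: "j \<in> arr C" "src C j = g" "trg C j = bf_ob T m m" using j0 by (simp_all add: Hom_iff)
      \<comment> \<open>As \<open>P\<close> is projective, \<open>b\<close> lifts along
        \<open>q\<close> to \<open>Q\<close>, where the restriction is known.\<close>
      have "bf_arr T b (idt M m) \<cdot>\<^bsub>C\<^esub> j = bf_arr T (idt M P) b \<cdot>\<^bsub>C\<^esub> x" if b: "b \<in> Hom M P m" for b
      proof -
        obtain b' where b': "b' \<in> Hom M P Q" "q \<cdot>\<^bsub>M\<^esub> b' = b" by (rule bexE[OF lift[OF b, unfolded q(2)]]) (rule that)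
        have b'': "b' \<in> arr M" "src M b' = P" "trg M b' = Q" using b'(1) by (simp_all add: Hom_iff)
        have "bf_arr T b (idt M m) \<cdot>\<^bsub>C\<^esub> j = bf_arr T b' (idt M m) \<cdot>\<^bsub>C\<^esub> bf_arr T q (idt M m) \<cdot>\<^bsub>C\<^esub> j"
          unfolding b'(2)[symmetric] using b'' j by (simp add: T_tail)
        also have "\<dots> = bf_arr T b' q \<cdot>\<^bsub>C\<^esub> z" unfolding j1 using b'' by (simp add: T_tail)
        also have "\<dots> = bf_arr T (idt M P) b \<cdot>\<^bsub>C\<^esub> x" using split[OF b'(1)] b'(2) by simp
        finally show ?thesis .
      qed
      then have "good m j" using j by (simp add: good_def)
      then show ?thesis by blast
    qed
    ultimately show ?thesis by blast
  qed
  define j where "j m = (SOME j. good m j)" for m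
  have "good m (j m)" if "m \<in> ob M" for m unfolding j_def using main[OF that] by (auto intro: someI_ex)
  then have j [simp]: "j m \<in> arr C" "src C (j m) = g" "trg C (j m) = bf_ob T m m"
    and j_eq: "\<And>b. b \<in> Hom M P m \<Longrightarrow> bf_arr T b (idt M m) \<cdot>\<^bsub>C\<^esub> j m = bf_arr T (idt M P) b \<cdot>\<^bsub>C\<^esub> x" if "m \<in> ob M" for m
    using that by (auto simp: good_def)
  have w: "wedge M C T g j"
    unfolding wedge_def
  proof (intro conjI ballI)
    show "g \<in> ob C" by (simp add: g_def)
    show "j m \<in> Hom C g (bf_ob T m m)" if "m \<in> ob M" for m using that by (simp add: Hom_iff)
    fix f assume f [simp]: "f \<in> arr M"
    show "bf_arr T (idt M (src M f)) f \<cdot>\<^bsub>C\<^esub> j (src M f) = bf_arr T f (idt M (trg M f)) \<cdot>\<^bsub>C\<^esub> j (trg M f)"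
    \<comment> \<open>Both sides are compared by restriction along arrows \<open>b\<close> from
      \<open>P\<close> to the source of \<open>f\<close>; each of them becomes \<open>x\<close>
      followed by the covariant action of \<open>b\<close> and then \<open>f\<close>.\<close>
    proof (rule mono_eq[OF main[OF M.src_ob'[OF f], THEN conjunct1] M.trg_ob'[OF f]])
      fix b assume b: "b \<in> Hom M P (src M f)"
      then have b' [simp]: "b \<in> arr M" "src M b = P" "trg M b = src M f" by (simp_all add: Hom_iff)
      have fb: "f \<cdot>\<^bsub>M\<^esub> b \<in> Hom M P (trg M f)" by (simp add: Hom_iff)
      have "bf_arr T b (idt M (trg M f)) \<cdot>\<^bsub>C\<^esub> (bf_arr T (idt M (src M f)) f \<cdot>\<^bsub>C\<^esub> j (src M f)) =
          bf_arr T (idt M P) f \<cdot>\<^bsub>C\<^esub> bf_arr T b (idt M (src M f)) \<cdot>\<^bsub>C\<^esub> j (src M f)"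
        by (simp add: T_tail)
      also have "\<dots> = bf_arr T (idt M P) (f \<cdot>\<^bsub>M\<^esub> b) \<cdot>\<^bsub>C\<^esub> x" unfolding j_eq[OF M.src_ob'[OF f] b] by (simp add: T_tail)
      also have "\<dots> = bf_arr T (f \<cdot>\<^bsub>M\<^esub> b) (idt M (trg M f)) \<cdot>\<^bsub>C\<^esub> j (trg M f)" by (rule j_eq[OF M.trg_ob'[OF f] fb, symmetric])
      also have "\<dots> = bf_arr T b (idt M (trg M f)) \<cdot>\<^bsub>C\<^esub> (bf_arr T f (idt M (trg M f)) \<cdot>\<^bsub>C\<^esub> j (trg M f))"
        by (simp add: T_tail)
      finally show "bf_arr T b (idt M (trg M f)) \<cdot>\<^bsub>C\<^esub> (bf_arr T (idt M (src M f)) f \<cdot>\<^bsub>C\<^esub> j (src M f)) =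
          bf_arr T b (idt M (trg M f)) \<cdot>\<^bsub>C\<^esub> (bf_arr T f (idt M (trg M f)) \<cdot>\<^bsub>C\<^esub> j (trg M f))" .
    qed simp_all
  qed
  have jP: "j P = x"
    using j_eq[OF Po, of "idt M P"] T.idt[of P P] by (simp add: Hom_iff)
  have uni: "\<exists>!u. u \<in> Hom C w g \<and> (\<forall>m\<in>ob M. j m \<cdot>\<^bsub>C\<^esub> u = k m)" if k: "wedge M C T w k" for w k
  proof -
    have kh [simp]: "k m \<in> arr C" "src C (k m) = w" "trg C (k m) = bf_ob T m m" if "m \<in> ob M" for m
      using k that unfolding wedge_def Hom_iff by blast+
    have kd: "bf_arr T (idt M (src M f)) f \<cdot>\<^bsub>C\<^esub> k (src M f) = bf_arr T f (idt M (trg M f)) \<cdot>\<^bsub>C\<^esub> k (trg M f)" if "f \<in> arr M" for f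
      using k that unfolding wedge_def by blast
    \<comment> \<open>A competing wedge satisfies the conditions for the endomorphisms of
      \<open>P\<close>, so its component at \<open>P\<close> factors through \<open>x\<close>. The
      other components follow by detection on \<open>P\<close>.\<close>
    have "\<exists>!u. u \<in> Hom C (src C (k P)) (src C x) \<and> x \<cdot>\<^bsub>C\<^esub> u = k P"
    proof (rule x_uni)
      show "\<forall>i\<in>Hom M P P. bf_arr T (idt M P) i \<cdot>\<^bsub>C\<^esub> k P = bf_arr T i (idt M P) \<cdot>\<^bsub>C\<^esub> k P"
      proof
        fix i assume "i \<in> Hom M P P"
        then show "bf_arr T (idt M P) i \<cdot>\<^bsub>C\<^esub> k P = bf_arr T i (idt M P) \<cdot>\<^bsub>C\<^esub> k P" using kd[of i] unfolding Hom_iff by metis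
      qed
    qed simp_all
    then have ex: "\<exists>!u. u \<in> Hom C w g \<and> x \<cdot>\<^bsub>C\<^esub> u = k P" by (simp add: g_def)
    then obtain u where u0: "u \<in> Hom C w g" and xu: "x \<cdot>\<^bsub>C\<^esub> u = k P" unfolding Ex1_def by (elim exE conjE) (rule that)
    have u: "u \<in> arr C" "src C u = w" "trg C u = g" using u0 by (simp_all add: Hom_iff)
    have xs: "src C x = g" by (simp add: g_def)
    have "j m \<cdot>\<^bsub>C\<^esub> u = k m" if m [simp]: "m \<in> ob M" for m
    proof (rule mono_eq[OF main[OF m, THEN conjunct1] m])
      fix b assume b: "b \<in> Hom M P m"
      then have b' [simp]: "b \<in> arr M" "src M b = P" "trg M b = m" by (simp_all add: Hom_iff)
      have "bf_arr T b (idt M m) \<cdot>\<^bsub>C\<^esub> (j m \<cdot>\<^bsub>C\<^esub> u) = bf_arr T (idt M P) b \<cdot>\<^bsub>C\<^esub> (x \<cdot>\<^bsub>C\<^esub> u)"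
        using C.comp_tail[OF j_eq[OF m b], of u] u xs by simp
      also have "\<dots> = bf_arr T b (idt M m) \<cdot>\<^bsub>C\<^esub> k m" unfolding xu using kd[of b] by simp
      finally show "bf_arr T b (idt M m) \<cdot>\<^bsub>C\<^esub> (j m \<cdot>\<^bsub>C\<^esub> u) = bf_arr T b (idt M m) \<cdot>\<^bsub>C\<^esub> k m" .
    qed (use u in simp_all)
    moreover have "v = u" if v: "v \<in> Hom C w g" "\<forall>m\<in>ob M. j m \<cdot>\<^bsub>C\<^esub> v = k m" for v
      using bspec[OF v(2) Po] v(1) u0 xu ex unfolding jP by blast
    ultimately show ?thesis using u0 by (intro ex1I[of _ u]) blast+
  qed
  show ?thesis using w uni unfolding is_end_def by blast
qed

section \<open>Ends and coends as limits\<close>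

lemma ldual_arr_idt:
  fixes C :: "('o, 'a, 'k::field) tcat" (structure)
  assumes ftc: "finite_tensor_category C" and c [simp]: "c \<in> ob C"
  shows "ldual_arr C (idt C c) = idt C (ldual C c)"
proof -
  interpret C: finite_tensor_category C by (rule ftc)
  interpret c: monoidal "mc C" by (rule monoidal_mc[OF ftc])
  note d = duality_ldual[OF ftc c]
  note [simp] = dual_ob[OF ftc] dualityD[OF d] ldual_arr(1-3)[OF ftc]
  show ?thesis by (rule c.ev_inject[OF d]) (simp_all add: ldual_arr(4)[OF ftc, of "idt C c", simplified])
qed

text \<open>In the dual category the coevaluation of the right dual is an evaluation, so the arrow
  is determined by its effect on it.\<close>

lemma rdual_arr_idt:
  fixes C :: "('o, 'a, 'k::field) tcat" (structure)
  assumes ftc: "finite_tensor_category C" and c [simp]: "c \<in> ob C"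
  shows "rdual_arr C (idt C c) = idt C (rdual C c)"
proof -
  interpret C: finite_tensor_category C by (rule ftc)
  interpret c: monoidal "mc C" by (rule monoidal_mc[OF ftc])
  interpret d: monoidal "mdual (mc C)" by (rule c.monoidal_mdual)
  note d = duality_rdual[OF ftc c]
  note [simp] = dual_ob[OF ftc] dualityD[OF d] rdual_arr(1-3)[OF ftc]
  show ?thesis
    by (rule d.ev_inject[OF c.duality_mdual[OF d]]) (simp_all add: rdual_arr(4)[OF ftc, of "idt C c", simplified])
qed

lemma bimodule_data_left:
  fixes C :: "('o, 'a, 'k::field) tcat" (structure)
  assumes ftc: "finite_tensor_category C" and M: "module_category C M L"
    and D: "deligne_bimodule C (opp M) (left_sharp C M L) M L D bx"
  shows "bimodule_data C M L (left_star C) (left_sharp C M L) D bx"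
  using ftc M D
  by (intro bimodule_data.intro)
    (simp_all add: left_sharp_def ldual_arr[OF ftc] ldual_arr_idt[OF ftc] ldual_tensor[OF ftc]
      ldual_unit[OF ftc] dual_ob[OF ftc])

lemma bimodule_data_right:
  fixes C :: "('o, 'a, 'k::field) tcat" (structure)
  assumes ftc: "finite_tensor_category C" and M: "module_category C M L"
    and D: "deligne_bimodule C (opp M) (right_sharp C M L) M L D bx"
  shows "bimodule_data C M L (right_star C) (right_sharp C M L) D bx"
  using ftc M D
  by (intro bimodule_data.intro)
    (simp_all add: right_sharp_def rdual_arr[OF ftc] rdual_arr_idt[OF ftc] rdual_tensor[OF ftc]
      rdual_unit[OF ftc] dual_ob[OF ftc])

lemma is_end_limit_fan:
  "is_end M C (comp_bftr G bx) g j \<longleftrightarrow>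
   limit_fan (mc C) (mm C M L) (\<lambda>m. t0 (bim_tdat C M bx G) m m)
     (\<lambda>f. t2 (bim_tdat C M bx G) (src (mm C M L) f) f)
     (\<lambda>f. t1 (bim_tdat C M bx G) f (trg (mm C M L) f)) g j"
proof -
  have "wedge M C (comp_bftr G bx) w k \<longleftrightarrow>
      fan (mc C) (mm C M L) (\<lambda>m. t0 (bim_tdat C M bx G) m m) (\<lambda>f. t2 (bim_tdat C M bx G) (src (mm C M L) f) f)
        (\<lambda>f. t1 (bim_tdat C M bx G) f (trg (mm C M L) f)) w k" for w k
    by (simp add: wedge_def fan_def bim_tdat_def comp_bftr_def Hom_def)
  then show ?thesis by (simp add: is_end_def limit_fan_def Hom_def)
qed

lemma is_coend_limit_fan:
  "is_coend M C (comp_bftr G bx) g j \<longleftrightarrow>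
   limit_fan (mdual (mc C)) (mddual (mm C M L)) (\<lambda>m. t0 (tdual (bim_tdat C M bx G)) m m)
     (\<lambda>f. t2 (tdual (bim_tdat C M bx G)) (src (mddual (mm C M L)) f) f)
     (\<lambda>f. t1 (tdual (bim_tdat C M bx G)) f (trg (mddual (mm C M L)) f)) g j"
proof -
  have H: "Hom (mdual (mc C)) x y = Hom C y x" for x y by (auto simp: Hom_def)
  have "cowedge M C (comp_bftr G bx) w k \<longleftrightarrow>
      fan (mdual (mc C)) (mddual (mm C M L)) (\<lambda>m. t0 (tdual (bim_tdat C M bx G)) m m)
        (\<lambda>f. t2 (tdual (bim_tdat C M bx G)) (src (mddual (mm C M L)) f) f)
        (\<lambda>f. t1 (tdual (bim_tdat C M bx G)) f (trg (mddual (mm C M L)) f)) w k" for w k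
    unfolding cowedge_def fan_def H by (simp add: bim_tdat_def comp_bftr_def) (metis (no_types, lifting))
  then show ?thesis unfolding is_coend_def limit_fan_def H by simp
qed

section \<open>Functors to the Drinfeld center\<close>

lemma category_full_subcategory: "category C \<Longrightarrow> category (full_subcategory C S)"
proof -
  assume "category C"
  then interpret category C .
  show ?thesis by (rule category_arrI) (auto simp: full_subcategory_def)
qed

lemma category_drinfeld_center:
  fixes C :: "('o, 'a, 'k::field) tcat" (structure)
  assumes ftc: "finite_tensor_category C"
  shows "category (drinfeld_center C)"
proof -
  interpret C: finite_tensor_category C by (rule ftc)
  interpret c: monoidal "mc C" by (rule monoidal_mc[OF ftc])
  have z: "z \<in> ob C" if "(z, \<sigma>) \<in> center_objects C" for z \<sigma> using that by (simp add: center_objects_def)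
  have s: "\<sigma> a \<in> arr C \<and> src C (\<sigma> a) = a \<otimes>\<^sub>o z \<and> trg C (\<sigma> a) = z \<otimes>\<^sub>o a"
    if "(z, \<sigma>) \<in> center_objects C" "a \<in> ob C" for z \<sigma> a
    using that by (auto simp: center_objects_def half_braiding_def Hom_iff)
  have cp: "((g \<cdot> f) \<otimes>\<^sub>a idt C a) \<cdot> s1 = s3 \<cdot> (idt C a \<otimes>\<^sub>a (g \<cdot> f))"
    if a: "a \<in> ob C" "f \<in> arr C" "g \<in> arr C" "src C g = trg C f"
      and s1: "s1 \<in> arr C" "src C s1 = a \<otimes>\<^sub>o src C f" "trg C s1 = src C f \<otimes>\<^sub>o a"
      and s2: "s2 \<in> arr C" "src C s2 = a \<otimes>\<^sub>o trg C f" "trg C s2 = trg C f \<otimes>\<^sub>o a"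
      and s3: "s3 \<in> arr C" "src C s3 = a \<otimes>\<^sub>o trg C g" "trg C s3 = trg C g \<otimes>\<^sub>o a"
      and f: "(f \<otimes>\<^sub>a idt C a) \<cdot> s1 = s2 \<cdot> (idt C a \<otimes>\<^sub>a f)"
      and g: "(g \<otimes>\<^sub>a idt C a) \<cdot> s2 = s3 \<cdot> (idt C a \<otimes>\<^sub>a g)" for f g a s1 s2 s3
  proof -
    have "((g \<cdot> f) \<otimes>\<^sub>a idt C a) \<cdot> s1 = (g \<otimes>\<^sub>a idt C a) \<cdot> ((f \<otimes>\<^sub>a idt C a) \<cdot> s1)"
      using c.rwh_comp[of a f g] a s1 by simp
    also have "\<dots> = ((g \<otimes>\<^sub>a idt C a) \<cdot> s2) \<cdot> (idt C a \<otimes>\<^sub>a f)" unfolding f using a s2 by simp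
    also have "\<dots> = s3 \<cdot> (idt C a \<otimes>\<^sub>a (g \<cdot> f))" unfolding g using c.lwh_comp[of a f g] a s3 by simp
    finally show ?thesis .
  qed
  show ?thesis
  proof (rule category_arrI)
    fix x assume "x \<in> ob (drinfeld_center C)"
    then have x: "x \<in> center_objects C" by (simp add: drinfeld_center_def)
    obtain z \<sigma> where xe: "x = (z, \<sigma>)" by (cases x)
    have "(idt C z \<otimes>\<^sub>a idt C a) \<cdot> \<sigma> a = \<sigma> a \<cdot> (idt C a \<otimes>\<^sub>a idt C z)" if "a \<in> ob C" for a
      using s[of z \<sigma> a] z[of z \<sigma>] x xe that by (simp add: C.idt)
    then show "idt (drinfeld_center C) x \<in> arr (drinfeld_center C) \<and>
        src (drinfeld_center C) (idt (drinfeld_center C) x) = x \<and> trg (drinfeld_center C) (idt (drinfeld_center C) x) = x"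
      using x z[of z \<sigma>] by (simp add: drinfeld_center_def xe Hom_iff)
  next
    fix f g assume f: "f \<in> arr (drinfeld_center C)" and g: "g \<in> arr (drinfeld_center C)"
      and fg: "src (drinfeld_center C) g = trg (drinfeld_center C) f"
    obtain X f' Y Z g' where fe: "f = (X, f', Y)" and ge: "g = (Y, g', Z)"
      using fg by (cases f, cases g) (simp add: drinfeld_center_def)
    obtain x sx y sy z sz where o: "X = (x, sx)" "Y = (y, sy)" "Z = (z, sz)" by (cases X, cases Y, cases Z)
    have co: "(x, sx) \<in> center_objects C" "(y, sy) \<in> center_objects C" "(z, sz) \<in> center_objects C"
      and h: "f' \<in> arr C" "src C f' = x" "trg C f' = y" "g' \<in> arr C" "src C g' = y" "trg C g' = z"
      and e: "\<And>a. a \<in> ob C \<Longrightarrow> (f' \<otimes>\<^sub>a idt C a) \<cdot> sx a = sy a \<cdot> (idt C a \<otimes>\<^sub>a f')"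
        "\<And>a. a \<in> ob C \<Longrightarrow> (g' \<otimes>\<^sub>a idt C a) \<cdot> sy a = sz a \<cdot> (idt C a \<otimes>\<^sub>a g')"
      using f g by (simp_all add: drinfeld_center_def fe ge o Hom_iff)
    have "((g' \<cdot> f') \<otimes>\<^sub>a idt C a) \<cdot> sx a = sz a \<cdot> (idt C a \<otimes>\<^sub>a (g' \<cdot> f'))" if a: "a \<in> ob C" for a
      by (rule cp[OF a, where ?s2.0 = "sy a"]) (use h e[OF a] s[OF co(1) a] s[OF co(2) a] s[OF co(3) a] in simp_all)
    then show "g \<cdot>\<^bsub>drinfeld_center C\<^esub> f \<in> arr (drinfeld_center C) \<and>
        src (drinfeld_center C) (g \<cdot>\<^bsub>drinfeld_center C\<^esub> f) = src (drinfeld_center C) f \<and>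
        trg (drinfeld_center C) (g \<cdot>\<^bsub>drinfeld_center C\<^esub> f) = trg (drinfeld_center C) g"
      using co h by (simp add: drinfeld_center_def fe ge o Hom_iff)
  qed (auto simp: drinfeld_center_def Hom_iff)
qed

text \<open>The relation \<open>R\<close> stands for the description of the induced arrow on ends or
  coends. Since it determines the arrow, identities and composites are preserved as soon as they
  satisfy it. Arrows of \<open>A\<close> are triples carrying their source and target.\<close>

lemma center_functorI:
  fixes C :: "('o, 'a, 'k::field) tcat" (structure) and A :: "('x, 'x \<times> 'y \<times> 'x) cat"
  assumes ftc: "finite_tensor_category C" and A: "category A"
    and A_src: "\<And>G \<eta> G'. src A (G, \<eta>, G') = G" and A_trg: "\<And>G \<eta> G'. trg A (G, \<eta>, G') = G'"
    and P: "\<And>G. G \<in> ob A \<Longrightarrow> P G \<in> center_objects C"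
    and ex: "\<And>G \<eta> G'. (G, \<eta>, G') \<in> arr A \<Longrightarrow> \<exists>!u. R G \<eta> G' u"
    and R: "\<And>G \<eta> G' u. (G, \<eta>, G') \<in> arr A \<Longrightarrow> R G \<eta> G' u \<Longrightarrow> u \<in> Hom C (fst (P G)) (fst (P G')) \<and>
      (\<forall>c\<in>ob C. (u \<otimes>\<^sub>a idt C c) \<cdot> snd (P G) c = snd (P G') c \<cdot> (idt C c \<otimes>\<^sub>a u))"
    and R_idt: "\<And>G. G \<in> ob A \<Longrightarrow> R G (fst (snd (idt A G))) G (idt C (fst (P G)))"
    and R_comp: "\<And>G \<eta> G' \<theta> G'' u v. (G, \<eta>, G') \<in> arr A \<Longrightarrow> (G', \<theta>, G'') \<in> arr A \<Longrightarrow> R G \<eta> G' u \<Longrightarrow> R G' \<theta> G'' v \<Longrightarrow>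
      R G (fst (snd ((G', \<theta>, G'') \<cdot>\<^bsub>A\<^esub> (G, \<eta>, G')))) G'' (v \<cdot> u)"
  shows "cat_functor A (drinfeld_center C)
    \<lparr>f_ob = P, f_arr = \<lambda>(G, \<eta>, G'). (P G, THE u. R G \<eta> G' u, P G')\<rparr>"
proof -
  interpret A: category A by (rule A)
  interpret Z: category "drinfeld_center C" by (rule category_drinfeld_center[OF ftc])
  have the: "R G \<eta> G' (THE u. R G \<eta> G' u)" if "(G, \<eta>, G') \<in> arr A" for G \<eta> G'
    by (rule theI'[OF ex[OF that]])
  have eq: "(THE u. R G \<eta> G' u) = v" if "(G, \<eta>, G') \<in> arr A" "R G \<eta> G' v" for G \<eta> G' v
    by (rule the1_equality[OF ex[OF that(1)] that(2)])
  show ?thesis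
  proof (unfold_locales, goal_cases)
    case (1 x)
    then show ?case using P by (simp add: drinfeld_center_def)
  next
    case (2 f x y)
    obtain \<eta> where f: "f = (x, \<eta>, y)" using 2 by (cases f) (auto simp: Hom_iff A_src A_trg)
    have fa: "(x, \<eta>, y) \<in> arr A" using 2 f by (simp add: Hom_iff)
    have o: "x \<in> ob A" "y \<in> ob A" using A.src_ob[OF fa] A.trg_ob[OF fa] by (simp_all add: A_src A_trg)
    show ?case using R[OF fa the[OF fa]] P[OF o(1)] P[OF o(2)]
      by (simp add: f drinfeld_center_def Hom_iff)
  next
    case (3 x)
    obtain X \<eta> Y where e: "idt A x = (X, \<eta>, Y)" by (cases "idt A x")
    have e': "idt A x = (x, \<eta>, x)" using e 3 A.idt_hom[OF 3] by (simp add: Hom_iff A_src A_trg)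
    have fa: "(x, \<eta>, x) \<in> arr A" using A.idt_hom[OF 3] by (simp add: Hom_iff e')
    show ?case using eq[OF fa R_idt[OF 3, unfolded e' fst_conv snd_conv]] by (simp add: e' drinfeld_center_def)
  next
    case (4 f x y g z)
    obtain \<eta> where f: "f = (x, \<eta>, y)" using 4 by (cases f) (auto simp: Hom_iff A_src A_trg)
    obtain \<theta> where g: "g = (y, \<theta>, z)" using 4 by (cases g) (auto simp: Hom_iff A_src A_trg)
    have fa: "(x, \<eta>, y) \<in> arr A" and ga: "(y, \<theta>, z) \<in> arr A" using 4 f g by (auto simp: Hom_iff)
    have gf: "g \<cdot>\<^bsub>A\<^esub> f \<in> Hom A x z" by (rule A.comp_hom[OF 4])
    obtain X \<kappa> Y where e: "g \<cdot>\<^bsub>A\<^esub> f = (X, \<kappa>, Y)" by (cases "g \<cdot>\<^bsub>A\<^esub> f")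
    have e': "(y, \<theta>, z) \<cdot>\<^bsub>A\<^esub> (x, \<eta>, y) = (x, \<kappa>, z)" using e gf by (simp add: Hom_iff A_src A_trg f g)
    have ka: "(x, \<kappa>, z) \<in> arr A" using gf by (simp add: Hom_iff f g e')
    show ?case
      using eq[OF ka R_comp[OF fa ga the[OF fa] the[OF ga], unfolded e' fst_conv snd_conv]]
      by (simp add: f g e' drinfeld_center_def)
  qed
qed

lemma (in equivariant) conj_iso_pair:
  assumes [simp]: "c \<in> ob C" "e \<in> ob C" "m \<in> ob N" and \<theta>: "iso_pair C \<theta> \<theta>' (st S e) c"
  shows "iso_pair C (\<a> c (t0 T m m) e \<cdot> lam T c m m \<triangleleft> e \<cdot> rho T e m (c \<bullet> m) \<cdot> t1 T (\<theta> \<diamondop> m) (c \<bullet> m))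
    (((t1 T (\<theta>' \<diamondop> m) (c \<bullet> m) \<cdot> rho' T e m (c \<bullet> m)) \<cdot> lam' T c m m \<triangleleft> e) \<cdot> \<b> c (t0 T m m) e)
    (t0 T (c \<bullet> m) (c \<bullet> m)) (c \<sqdot> (t0 T m m \<sqdot> e))"
proof -
  have t: "iso_pair C (t1 T (\<theta> \<diamondop> m) (c \<bullet> m)) (t1 T (\<theta>' \<diamondop> m) (c \<bullet> m))
      (t0 T (c \<bullet> m) (c \<bullet> m)) (t0 T (st S e \<bullet> m) (c \<bullet> m))"
    by (rule t1_iso[OF rac_iso[OF \<theta>]]) simp_all
  show ?thesis
    by (rule iso_pair_comp[OF iso_pair_comp[OF iso_pair_comp[OF t rho_iso] rwh_iso[OF lam_iso]] asc_iso]) simp_all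
qed

context end_setting
begin

lemma \<delta>_comp_eq: "c \<in> ob C \<Longrightarrow> m \<in> ob N \<Longrightarrow> \<delta>_comp c m =
    (\<a> c (t0 T m m) (rd c) \<cdot> lam T c m m \<triangleleft> rd c \<cdot> rho T (rd c) m (c \<bullet> m) \<cdot> t1 T (\<theta> c \<diamondop> m) (c \<bullet> m)) \<cdot> j (c \<bullet> m)"
  by (simp add: \<delta>_comp_def)

text \<open>Two bracketings of the same arrow. The first has the form of the inverse half-braiding
  on an end; the second, once composition is reversed, has that of the half-braiding on a coend. The
  pentagon leads from one to the other.\<close>

lemma
  assumes [simp]: "c \<in> ob C" "\<delta> \<in> arr C" "src C \<delta> = g" "trg C \<delta> = c \<sqdot> (g \<sqdot> rd c)"
  shows \<beta>_eq: "\<beta> c \<delta> = c \<triangleright> (\<r> g \<cdot> g \<triangleright> evr c \<cdot> \<a> g (rd c) c) \<cdot> \<a> c (g \<sqdot> rd c) c \<cdot> \<delta> \<triangleleft> c"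
    and \<beta>_eq': "\<beta> c \<delta> =
      (((\<r> (c \<sqdot> g) \<cdot> (c \<sqdot> g) \<triangleright> evr c) \<cdot> \<a> (c \<sqdot> g) (rd c) c) \<cdot> \<b> c g (rd c) \<triangleleft> c) \<cdot> \<delta> \<triangleleft> c"
proof -
  show "\<beta> c \<delta> = c \<triangleright> (\<r> g \<cdot> g \<triangleright> evr c \<cdot> \<a> g (rd c) c) \<cdot> \<a> c (g \<sqdot> rd c) c \<cdot> \<delta> \<triangleleft> c"
    by (simp add: \<beta>_def)
  have 1: "c \<triangleright> \<a> g (rd c) c \<cdot> \<a> c (g \<sqdot> rd c) c = \<a> c g (rd c \<sqdot> c) \<cdot> \<a> (c \<sqdot> g) (rd c) c \<cdot> \<b> c g (rd c) \<triangleleft> c"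
    using arg_cong[OF pentagon[of c g "rd c" c], of "\<lambda>f. f \<cdot> \<b> c g (rd c) \<triangleleft> c"] by simp
  have 2: "c \<triangleright> (g \<triangleright> evr c) \<cdot> \<a> c g (rd c \<sqdot> c) = \<a> c g \<I> \<cdot> (c \<sqdot> g) \<triangleright> evr c" using asc_nat3[of "evr c" c g] by simp
  have 3: "c \<triangleright> \<r> g \<cdot> \<a> c g \<I> = \<r> (c \<sqdot> g)" by (simp add: run_tensor')
  show "\<beta> c \<delta> =
      (((\<r> (c \<sqdot> g) \<cdot> (c \<sqdot> g) \<triangleright> evr c) \<cdot> \<a> (c \<sqdot> g) (rd c) c) \<cdot> \<b> c g (rd c) \<triangleleft> c) \<cdot> \<delta> \<triangleleft> c"
    by (simp add: \<beta>_def comp_tail[OF 1] comp_tail[OF 2] comp_tail[OF 3])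
qed

end

text \<open>The family \<sigma> is one for which the laws are known, and \<tau> is the family as it
  is written in the definition of the object.\<close>

lemma center_objectI:
  fixes C :: "('o, 'a, 'k::field) tcat" (structure)
  assumes ftc: "finite_tensor_category C" and g: "g \<in> ob C"
    and \<sigma>: "\<And>c. c \<in> ob C \<Longrightarrow> iso_pair C (\<sigma> c) (\<sigma>' c) (c \<otimes>\<^sub>o g) (g \<otimes>\<^sub>o c)"
    and nat: "\<And>f. f \<in> arr C \<Longrightarrow> \<sigma> (trg C f) \<cdot> (f \<otimes>\<^sub>a idt C g) = (idt C g \<otimes>\<^sub>a f) \<cdot> \<sigma> (src C f)"
    and tensor: "\<And>a b. a \<in> ob C \<Longrightarrow> b \<in> ob C \<Longrightarrow> \<sigma> (a \<otimes>\<^sub>o b) =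
        assoc C g a b \<cdot> (\<sigma> a \<otimes>\<^sub>a idt C b) \<cdot> inv_arr C (assoc C a g b) \<cdot>
        (idt C a \<otimes>\<^sub>a \<sigma> b) \<cdot> assoc C a b g"
    and unit: "\<sigma> \<one>\<^sub>o = inv_arr C (runit C g) \<cdot> lunit C g"
    and \<tau>: "\<And>c. c \<in> ob C \<Longrightarrow> \<tau> c = \<sigma> c"
  shows "(g, \<lambda>c\<in>ob C. \<tau> c) \<in> center_objects C"
proof -
  interpret C: finite_tensor_category C by (rule ftc)
  have "(\<lambda>c\<in>ob C. \<tau> c) = (\<lambda>c\<in>ob C. \<sigma> c)" using \<tau> by (intro restrict_ext) simp
  moreover have "half_braiding C g (\<lambda>c\<in>ob C. \<sigma> c)"
    unfolding half_braiding_def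
  proof (intro conjI ballI)
    fix a assume a: "a \<in> ob C"
    show "(\<lambda>c\<in>ob C. \<sigma> c) a \<in> Hom C (a \<otimes>\<^sub>o g) (g \<otimes>\<^sub>o a)" "is_iso C ((\<lambda>c\<in>ob C. \<sigma> c) a)"
      using C.iso_pairD[OF \<sigma>[OF a]] C.iso_pair_is_iso[OF \<sigma>[OF a]] a by (simp_all add: Hom_iff)
    fix b assume b: "b \<in> ob C"
    show "(\<lambda>c\<in>ob C. \<sigma> c) (a \<otimes>\<^sub>o b) =
        assoc C g a b \<cdot> ((\<lambda>c\<in>ob C. \<sigma> c) a \<otimes>\<^sub>a idt C b) \<cdot> inv_arr C (assoc C a g b) \<cdot>
        (idt C a \<otimes>\<^sub>a (\<lambda>c\<in>ob C. \<sigma> c) b) \<cdot> assoc C a b g"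
      using tensor[OF a b] a b by simp
  next
    fix f assume f: "f \<in> arr C"
    show "(\<lambda>c\<in>ob C. \<sigma> c) (trg C f) \<cdot> (f \<otimes>\<^sub>a idt C g) = (idt C g \<otimes>\<^sub>a f) \<cdot> (\<lambda>c\<in>ob C. \<sigma> c) (src C f)"
      using nat[OF f] f by simp
  qed (use unit C.unit_ob in simp)
  ultimately show ?thesis using g by (simp add: center_objects_def)
qed

section \<open>Bimodule natural transformations\<close>

context bimodule_data
begin

interpretation C: finite_tensor_category C by (rule ftc)
interpretation M: module_category C M L by (rule modcat)
interpretation P: deligne_bimodule C "opp M" R M L D bx by (rule del)

lemma M_category: "category M" by unfold_locales

context
  fixes G G' :: "('d, 'e, 'o, 'a, 'o) bimod_ftr" and \<eta> :: "'d \<Rightarrow> 'a"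
  assumes G: "bimodule_functor C D (regular_bimodule C) G" and G': "bimodule_functor C D (regular_bimodule C) G'"
    and \<eta>: "bimodule_nat_trans C D (regular_bimodule C) G G' \<eta>"
begin

lemma trans_hom [simp]: "x \<in> ob D \<Longrightarrow> \<eta> x \<in> arr C" "x \<in> ob D \<Longrightarrow> src C (\<eta> x) = f_ob G x"
    "x \<in> ob D \<Longrightarrow> trg C (\<eta> x) = f_ob G' x"
  using \<eta> by (auto simp: bimodule_nat_trans_def nat_trans_def Hom_iff)

lemma trans_nat: "k \<in> arr D \<Longrightarrow> \<eta> (trg D k) \<cdot> f_arr G k = f_arr G' k \<cdot> \<eta> (src D k)"
  using \<eta> by (simp add: bimodule_nat_trans_def nat_trans_def)

lemma trans_lcon: "c \<in> ob C \<Longrightarrow> x \<in> ob D \<Longrightarrow>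
    (idt C c \<otimes>\<^sub>a \<eta> x) \<cdot> lcon G c x = lcon G' c x \<cdot> \<eta> (c \<rhd>\<^sub>o\<^bsub>lft D\<^esub> x)"
  using \<eta> by (simp add: bimodule_nat_trans_def)

lemma trans_rcon: "c \<in> ob C \<Longrightarrow> x \<in> ob D \<Longrightarrow>
    (\<eta> x \<otimes>\<^sub>a idt C c) \<cdot> rcon G x c = rcon G' x c \<cdot> \<eta> (x \<lhd>\<^sub>o\<^bsub>rgt D\<^esub> c)"
  using \<eta> by (simp add: bimodule_nat_trans_def)

lemmas hom_simps = G_hom[OF G] G_hom[OF G'] con_hom[OF G] con_hom[OF G']

lemma trans_lam:
  assumes [simp]: "c \<in> ob C" "m \<in> ob M" "n \<in> ob M"
  shows "(idt C c \<otimes>\<^sub>a \<eta> (bf_ob bx m n)) \<cdot> lam (bim_tdat C M bx G) c m n =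
    lam (bim_tdat C M bx G') c m n \<cdot> \<eta> (bf_ob bx m (c \<rhd>\<^sub>o\<^bsub>L\<^esub> n))"
proof -
  note [simp] = hom_simps
  have "\<eta> (c \<rhd>\<^sub>o\<^bsub>lft D\<^esub> bf_ob bx m n) \<cdot> f_arr G (box_l bx m c n) =
      f_arr G' (box_l bx m c n) \<cdot> \<eta> (bf_ob bx m (c \<rhd>\<^sub>o\<^bsub>L\<^esub> n))"
    using trans_nat[of "box_l bx m c n"] by simp
  then show ?thesis
    unfolding T_simps[OF G] T_simps[OF G'] by (simp add: C.comp_tail[OF trans_lcon])
qed

lemma trans_rho:
  assumes [simp]: "c \<in> ob C" "m \<in> ob M" "n \<in> ob M"
  shows "(\<eta> (bf_ob bx m n) \<otimes>\<^sub>a idt C c) \<cdot> rho (bim_tdat C M bx G) c m n =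
    rho (bim_tdat C M bx G') c m n \<cdot> \<eta> (bf_ob bx (st S c \<rhd>\<^sub>o\<^bsub>L\<^esub> m) n)"
proof -
  note [simp] = hom_simps
  have "\<eta> (bf_ob bx m n \<lhd>\<^sub>o\<^bsub>rgt D\<^esub> c) \<cdot> f_arr G (box_r bx m c n) =
      f_arr G' (box_r bx m c n) \<cdot> \<eta> (bf_ob bx (st S c \<rhd>\<^sub>o\<^bsub>L\<^esub> m) n)"
    using trans_nat[of "box_r bx m c n"] by simp
  then show ?thesis
    unfolding T_simps[OF G] T_simps[OF G'] by (simp add: C.comp_tail[OF trans_rcon])
qed

lemma trans_t2:
  assumes [simp]: "f \<in> arr M" "m \<in> ob M"
  shows "\<eta> (bf_ob bx m (trg M f)) \<cdot> t2 (bim_tdat C M bx G) m f =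
    t2 (bim_tdat C M bx G') m f \<cdot> \<eta> (bf_ob bx m (src M f))"
  using trans_nat[of "bf_arr bx (idt M m) f"] by (simp add: T_simps[OF G] T_simps[OF G'])

text \<open>Composing the first wedge with \<eta> gives a wedge over the second functor, by
  naturality of \<eta> in each variable. For coends the second cowedge is precomposed with \<eta>
  instead.\<close>

lemma end_map_ex:
  assumes e: "is_end M C (comp_bftr G bx) g j" and e': "is_end M C (comp_bftr G' bx) g' j'"
  shows "\<exists>!u. is_end_map C M bx (g, j) \<eta> (g', j') u"
proof -
  note [simp] = hom_simps
  have j: "g \<in> ob C" "j m \<in> arr C" "src C (j m) = g" "trg C (j m) = f_ob G (bf_ob bx m m)" if "m \<in> ob M" for m
    using e that by (auto simp: is_end_def wedge_def Hom_iff comp_bftr_def)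
  have "wedge M C (comp_bftr G' bx) g (\<lambda>m. \<eta> (bf_ob bx m m) \<cdot> j m)"
    unfolding wedge_def
  proof (intro conjI ballI)
    show "g \<in> ob C" using e by (simp add: is_end_def wedge_def)
    show "\<eta> (bf_ob bx m m) \<cdot> j m \<in> Hom C g (bf_ob (comp_bftr G' bx) m m)" if "m \<in> ob M" for m
      using j[OF that] that by (simp add: Hom_iff comp_bftr_def)
    fix f assume f [simp]: "f \<in> arr M"
    let ?m = "src M f" and ?n = "trg M f"
    note [simp] = j[OF category.src_ob'[OF M_category f]] j[OF category.trg_ob'[OF M_category f]]
    have 1: "f_arr G' (bf_arr bx (idt M ?m) f) \<cdot> \<eta> (bf_ob bx ?m ?m) = \<eta> (bf_ob bx ?m ?n) \<cdot> f_arr G (bf_arr bx (idt M ?m) f)"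
      using trans_nat[of "bf_arr bx (idt M ?m) f"] by simp
    have 2: "\<eta> (bf_ob bx ?m ?n) \<cdot> f_arr G (bf_arr bx f (idt M ?n)) = f_arr G' (bf_arr bx f (idt M ?n)) \<cdot> \<eta> (bf_ob bx ?n ?n)"
      using trans_nat[of "bf_arr bx f (idt M ?n)"] by simp
    have 3: "f_arr G (bf_arr bx (idt M ?m) f) \<cdot> j ?m = f_arr G (bf_arr bx f (idt M ?n)) \<cdot> j ?n"
      using e f by (simp add: is_end_def wedge_def comp_bftr_def)
    show "bf_arr (comp_bftr G' bx) (idt M ?m) f \<cdot> \<eta> (bf_ob bx ?m ?m) \<cdot> j ?m =
        bf_arr (comp_bftr G' bx) f (idt M ?n) \<cdot> \<eta> (bf_ob bx ?n ?n) \<cdot> j ?n"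
      by (simp add: comp_bftr_def C.comp_tail[OF 1] 3 C.comp_tail[OF 2])
  qed
  then show ?thesis using e' unfolding is_end_def is_end_map_def by simp
qed

lemma coend_map_ex:
  assumes e: "is_coend M C (comp_bftr G bx) g j" and e': "is_coend M C (comp_bftr G' bx) g' j'"
  shows "\<exists>!u. is_coend_map C M bx (g, j) \<eta> (g', j') u"
proof -
  note [simp] = hom_simps
  have j: "g' \<in> ob C" "j' m \<in> arr C" "trg C (j' m) = g'" "src C (j' m) = f_ob G' (bf_ob bx m m)" if "m \<in> ob M" for m
    using e' that by (auto simp: is_coend_def cowedge_def Hom_iff comp_bftr_def)
  have "cowedge M C (comp_bftr G bx) g' (\<lambda>m. j' m \<cdot> \<eta> (bf_ob bx m m))"
    unfolding cowedge_def
  proof (intro conjI ballI)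
    show "g' \<in> ob C" using e' by (simp add: is_coend_def cowedge_def)
    show "j' m \<cdot> \<eta> (bf_ob bx m m) \<in> Hom C (bf_ob (comp_bftr G bx) m m) g'" if "m \<in> ob M" for m
      using j[OF that] that by (simp add: Hom_iff comp_bftr_def)
    fix f assume f [simp]: "f \<in> arr M"
    let ?m = "src M f" and ?n = "trg M f"
    note [simp] = j[OF category.src_ob'[OF M_category f]] j[OF category.trg_ob'[OF M_category f]]
    have 1: "\<eta> (bf_ob bx ?m ?m) \<cdot> f_arr G (bf_arr bx f (idt M ?m)) = f_arr G' (bf_arr bx f (idt M ?m)) \<cdot> \<eta> (bf_ob bx ?n ?m)"
      using trans_nat[of "bf_arr bx f (idt M ?m)"] by simp
    have 2: "\<eta> (bf_ob bx ?n ?n) \<cdot> f_arr G (bf_arr bx (idt M ?n) f) = f_arr G' (bf_arr bx (idt M ?n) f) \<cdot> \<eta> (bf_ob bx ?n ?m)"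
      using trans_nat[of "bf_arr bx (idt M ?n) f"] by simp
    have 3: "j' ?m \<cdot> f_arr G' (bf_arr bx f (idt M ?m)) = j' ?n \<cdot> f_arr G' (bf_arr bx (idt M ?n) f)"
      using e' f by (simp add: is_coend_def cowedge_def comp_bftr_def)
    show "(j' ?m \<cdot> \<eta> (bf_ob bx ?m ?m)) \<cdot> bf_arr (comp_bftr G bx) f (idt M ?m) =
        (j' ?n \<cdot> \<eta> (bf_ob bx ?n ?n)) \<cdot> bf_arr (comp_bftr G bx) (idt M ?n) f"
      by (simp add: comp_bftr_def 1 2 C.comp_tail[OF 3])
  qed
  then show ?thesis using e unfolding is_coend_def is_coend_map_def by simp
qed

end

lemma bimodule_nat_trans_idt:
  assumes G: "bimodule_functor C D (regular_bimodule C) G"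
  shows "bimodule_nat_trans C D (regular_bimodule C) G G (\<lambda>x\<in>ob D. idt C (f_ob G x))"
proof -
  note [simp] = G_hom[OF G] con_hom[OF G] P.left.bf_ob' P.right.bf_ob'
  show ?thesis by (auto simp: bimodule_nat_trans_def nat_trans_def Hom_iff C.idt)
qed

lemma bimodule_nat_trans_comp:
  assumes G: "bimodule_functor C D (regular_bimodule C) G" and G': "bimodule_functor C D (regular_bimodule C) G'"
    and G'': "bimodule_functor C D (regular_bimodule C) G''"
    and \<eta>: "bimodule_nat_trans C D (regular_bimodule C) G G' \<eta>" and \<theta>: "bimodule_nat_trans C D (regular_bimodule C) G' G'' \<theta>"
  shows "bimodule_nat_trans C D (regular_bimodule C) G G'' (\<lambda>x\<in>ob D. \<theta> x \<cdot> \<eta> x)"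
proof -
  note [simp] = G_hom[OF G] con_hom[OF G] G_hom[OF G'] con_hom[OF G'] G_hom[OF G''] con_hom[OF G'']
    trans_hom[OF G G' \<eta>] trans_hom[OF G' G'' \<theta>]
  have b [simp]: "c \<rhd>\<^sub>o\<^bsub>lft D\<^esub> x \<in> ob D" "x \<lhd>\<^sub>o\<^bsub>rgt D\<^esub> c \<in> ob D" if "c \<in> ob C" "x \<in> ob D" for c x
    using P.left.bf_ob'[of c x] P.right.bf_ob'[of x c] that by simp_all
  have n: "(\<theta> (trg D k) \<cdot> \<eta> (trg D k)) \<cdot> f_arr G k = f_arr G'' k \<cdot> \<theta> (src D k) \<cdot> \<eta> (src D k)" if "k \<in> arr D" for k
    using that by (simp add: trans_nat[OF G G' \<eta>] C.comp_tail[OF trans_nat[OF G' G'' \<theta>]])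
  have l: "lcon G'' c x \<cdot> \<theta> (c \<rhd>\<^sub>o\<^bsub>lft D\<^esub> x) \<cdot> \<eta> (c \<rhd>\<^sub>o\<^bsub>lft D\<^esub> x) = (idt C c \<otimes>\<^sub>a (\<theta> x \<cdot> \<eta> x)) \<cdot> lcon G c x"
    if [simp]: "c \<in> ob C" "x \<in> ob D" for c x
  proof -
    have "idt C c \<otimes>\<^sub>a (\<theta> x \<cdot> \<eta> x) = (idt C c \<otimes>\<^sub>a \<theta> x) \<cdot> (idt C c \<otimes>\<^sub>a \<eta> x)"
      using C.bf_comp'[of "idt C c" "idt C c" "\<eta> x" "\<theta> x"] by simp
    then show ?thesis by (simp add: trans_lcon[OF G G' \<eta>] C.comp_tail[OF trans_lcon[OF G' G'' \<theta>]])
  qed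
  have r: "rcon G'' x c \<cdot> \<theta> (x \<lhd>\<^sub>o\<^bsub>rgt D\<^esub> c) \<cdot> \<eta> (x \<lhd>\<^sub>o\<^bsub>rgt D\<^esub> c) = ((\<theta> x \<cdot> \<eta> x) \<otimes>\<^sub>a idt C c) \<cdot> rcon G x c"
    if [simp]: "c \<in> ob C" "x \<in> ob D" for c x
  proof -
    have "(\<theta> x \<cdot> \<eta> x) \<otimes>\<^sub>a idt C c = (\<theta> x \<otimes>\<^sub>a idt C c) \<cdot> (\<eta> x \<otimes>\<^sub>a idt C c)"
      using C.bf_comp'[of "\<eta> x" "\<theta> x" "idt C c" "idt C c"] by simp
    then show ?thesis by (simp add: trans_rcon[OF G G' \<eta>] C.comp_tail[OF trans_rcon[OF G' G'' \<theta>]])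
  qed
  show ?thesis
    unfolding bimodule_nat_trans_def nat_trans_def by (auto simp: Hom_iff n l r simp del: C.comp_assoc')
qed

lemma category_bimodule_functors: "category (bimodule_functors C D (regular_bimodule C))"
proof (rule category_arrI, goal_cases)
  case (3 G)
  then show ?case using bimodule_nat_trans_idt[of G] by (simp add: bimodule_functors_def)
next
  case (4 f g)
  obtain G \<eta> G' \<theta> G'' where "f = (G, \<eta>, G')" "g = (G', \<theta>, G'')"
    using 4 by (cases f, cases g) (simp add: bimodule_functors_def)
  then show ?case using 4 bimodule_nat_trans_comp[of G G' G'' \<eta> \<theta>] by (simp add: bimodule_functors_def)
next
  case (5 f g h)
  obtain G \<eta> G' \<theta> G'' \<zeta> G3 where f: "f = (G, \<eta>, G')" "g = (G', \<theta>, G'')" "h = (G'', \<zeta>, G3)"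
    using 5 by (cases f, cases g, cases h) (simp add: bimodule_functors_def)
  have a: "bimodule_functor C D (regular_bimodule C) G" "bimodule_functor C D (regular_bimodule C) G'"
    "bimodule_functor C D (regular_bimodule C) G''" "bimodule_functor C D (regular_bimodule C) G3"
    "bimodule_nat_trans C D (regular_bimodule C) G G' \<eta>" "bimodule_nat_trans C D (regular_bimodule C) G' G'' \<theta>"
    "bimodule_nat_trans C D (regular_bimodule C) G'' G3 \<zeta>"
    using 5 f by (simp_all add: bimodule_functors_def)
  note [simp] = trans_hom[OF a(1,2,5)] trans_hom[OF a(2,3,6)] trans_hom[OF a(3,4,7)]
  show ?case unfolding f by (auto simp: bimodule_functors_def intro!: restrict_ext)
next
  case (6 f)
  obtain G \<eta> G' where f: "f = (G, \<eta>, G')" by (cases f)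
  have a: "bimodule_functor C D (regular_bimodule C) G" "bimodule_functor C D (regular_bimodule C) G'"
    "bimodule_nat_trans C D (regular_bimodule C) G G' \<eta>" and x: "\<eta> \<in> extensional (ob D)"
    using 6 f by (simp_all add: bimodule_functors_def)
  note [simp] = trans_hom[OF a]
  have "(\<lambda>x\<in>ob D. \<eta> x \<cdot> (\<lambda>x\<in>ob D. idt C (f_ob G x)) x) = \<eta>" "(\<lambda>x\<in>ob D. (\<lambda>x\<in>ob D. idt C (f_ob G' x)) x \<cdot> \<eta> x) = \<eta>"
    using x by (auto simp: fun_eq_iff restrict_def extensional_def)
  then show ?case by (simp add: bimodule_functors_def f)
qed (auto simp: bimodule_functors_def)

lemma comp_bftr_bilinear:
  assumes G: "bimodule_functor C D (regular_bimodule C) G"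
  shows "bilinear_bifunctor (opp M) M C (comp_bftr G bx)"
proof -
  interpret G: bimodule_functor C D "regular_bimodule C" G by (rule G)
  interpret OM: linear_category "opp M" by unfold_locales
  note [simp] = G_hom[OF G]
  have s: "add_arr (regular_bimodule C) = add_arr C" "scale_arr (regular_bimodule C) = scale_arr C"
    by (simp_all add: regular_bimodule_def)
  have H: "bf_arr bx f k \<in> Hom D (bf_ob bx x y) (bf_ob bx x' y')" if "f \<in> Hom (opp M) x x'" "k \<in> Hom M y y'" for f k x x' y y'
    by (rule P.hom[OF that])
  have Hc: "bf_arr (comp_bftr G bx) f k = f_arr G (bf_arr bx f k)" "bf_ob (comp_bftr G bx) x y = f_ob G (bf_ob bx x y)" for f k x y
    by (simp_all add: comp_bftr_def)
  show ?thesis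
  proof (unfold_locales, unfold Hc, goal_cases)
    case (1 x y)
    then show ?case by simp
  next
    case (2 f x x' k y y')
    show ?case using G.hom[OF H[OF 2]] by simp
  next
    case (3 x y)
    then show ?case by simp
  next
    case (4 f x x' f' x'' k y y' k' y'')
    show ?case unfolding P.comp[OF 4] using G.comp[OF H[OF 4(1,3)] H[OF 4(2,4)]] by simp
  next
    case (5 f x x' f' k y y')
    show ?case unfolding P.add_left[OF 5] using G.add[OF H[OF 5(1,3)] H[OF 5(2,3)]] unfolding s .
  next
    case (6 f x x' k y y' k')
    show ?case unfolding P.add_right[OF 6] using G.add[OF H[OF 6(1,2)] H[OF 6(1,3)]] unfolding s .
  next
    case (7 f x x' k y y' r)
    show ?case unfolding P.scale_left[OF 7] using G.scale[OF H[OF 7]] unfolding s .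
  next
    case (8 f x x' k y y' r)
    show ?case unfolding P.scale_right[OF 8] using G.scale[OF H[OF 8]] unfolding s .
  qed
qed

end

section \<open>The end as an object of the Drinfeld center\<close>

locale end_data = bimodule_data C M L "left_star C" "left_sharp C M L" D bx
  for C :: "('o, 'a, 'k::field) tcat" (structure) and M :: "('m, 'n, 'k) lcat" and L :: "('o, 'a, 'm, 'n) lact"
    and D :: "('d, 'e, 'k, 'o, 'a) bimod" and bx :: "('m, 'n, 'm, 'n, 'd, 'e, 'o) box"
begin

interpretation C: finite_tensor_category C by (rule ftc)

lemma end_setting_end:
  assumes G: "bimodule_functor C D (regular_bimodule C) G" and e: "is_end M C (comp_bftr G bx) g j"
  shows "end_setting (mc C) (mm C M L) (left_star C) (bim_tdat C M bx G) (ldual_ev C) (ldual_coev C) (rdual C)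
    (rdual_ev C) (rdual_coev C) (ldual_rdual C) (\<lambda>c. inv_arr C (ldual_rdual C c)) g j"
proof (intro end_setting.intro[OF equivariant_T[OF G]] end_setting_axioms.intro, goal_cases)
  case 8
  show ?case using e by (rule is_end_limit_fan[THEN iffD1])
qed (simp_all add: duality_ldual[OF ftc] duality_rdual[OF ftc] ldual_arr(4)[OF ftc] ldual_tensor(2)[OF ftc]
    ldual_unit(2)[OF ftc] ldual_rdual[OF ftc])

context
  fixes G :: "('d, 'e, 'o, 'a, 'o) bimod_ftr" and g :: 'o and j :: "'m \<Rightarrow> 'a"
  assumes G: "bimodule_functor C D (regular_bimodule C) G" and e: "is_end M C (comp_bftr G bx) g j"
begin

interpretation E: end_setting "mc C" "mm C M L" "left_star C" "bim_tdat C M bx G" "ldual_ev C" "ldual_coev C"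
  "rdual C" "rdual_ev C" "rdual_coev C" "ldual_rdual C" "\<lambda>c. inv_arr C (ldual_rdual C c)" g j
  by (rule end_setting_end[OF G e])

lemma is_end_delta_iff:
  assumes c: "c \<in> ob C"
  shows "is_end_delta C M L D bx G g j c \<delta> \<longleftrightarrow> \<delta> \<in> Hom (mc C) g (tob (mc C) c (tob (mc C) g (rdual C c))) \<and>
    (\<forall>m\<in>ob (mm C M L). lwh (mc C) c (rwh (mc C) (j m) (rdual C c)) \<cdot>\<^bsub>mc C\<^esub> \<delta> = E.\<delta>_comp c m)"
proof -
  have "end_conj C M L D bx G c m \<cdot> j (c \<rhd>\<^sub>o\<^bsub>L\<^esub> m) = E.\<delta>_comp c m" if "m \<in> ob M" for m
    unfolding end_conj_def
    using that c dual_ob[OF ftc] C.iso_pairD(1-3)[OF ldual_rdual(1)[OF ftc c]]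
    by (subst conj_iso_eq[OF G]) (simp_all add: E.\<delta>_comp_eq)
  moreover have "Hom (mc C) x y = Hom C x y" for x y by (simp add: Hom_def)
  ultimately show ?thesis by (simp add: is_end_delta_def)
qed

lemma end_delta_ex1: "c \<in> ob C \<Longrightarrow> \<exists>!\<delta>. is_end_delta C M L D bx G g j c \<delta>"
  unfolding is_end_delta_iff by (rule E.\<delta>_ex) simp

lemma end_half_braiding_inv_iso:
  assumes c: "c \<in> ob C"
  shows "iso_pair C (E.\<gamma> c) (end_half_braiding_inv C M L D bx G g j c) (c \<otimes>\<^sub>o g) (g \<otimes>\<^sub>o c)"
proof -
  have "is_end_delta C M L D bx G g j c (end_delta C M L D bx G g j c)"
    unfolding end_delta_def by (rule theI'[OF end_delta_ex1[OF c]])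
  note d = this[unfolded is_end_delta_iff[OF c]]
  have c': "c \<in> ob (mc C)" using c by simp
  note i = E.\<beta>_iso[OF c' d[THEN conjunct1] d[THEN conjunct2]]
  have "end_half_braiding_inv C M L D bx G g j c = E.\<beta> c (end_delta C M L D bx G g j c)"
    using d[THEN conjunct1] c unfolding Hom_iff
    by (subst E.\<beta>_eq[OF c']) (simp_all add: end_half_braiding_inv_def)
  then show ?thesis using i by simp
qed

text \<open>The half-braiding is defined as the inverse of an arrow that is inverse to \<gamma>,
  hence equals \<gamma>, for which the laws were proved.\<close>

lemma end_object_eq: "c \<in> ob C \<Longrightarrow> snd (end_object C M L D bx G (g, j)) c = E.\<gamma> c"
  using C.inv_arr_eq[OF C.iso_pair_sym[OF end_half_braiding_inv_iso]] by (simp add: end_object_def)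

lemma end_object_center: "end_object C M L D bx G (g, j) \<in> center_objects C"
  unfolding end_object_def prod.case
proof (rule center_objectI[OF ftc, where \<sigma> = E.\<gamma>])
  show "g \<in> ob C" using E.end_ob by simp
  show "E.\<gamma> (trg C f) \<cdot> (f \<otimes>\<^sub>a idt C g) = (idt C g \<otimes>\<^sub>a f) \<cdot> E.\<gamma> (src C f)" if "f \<in> arr C" for f
    using E.\<gamma>_nat[of f] that by simp
  show "E.\<gamma> (a \<otimes>\<^sub>o b) =
        assoc C g a b \<cdot> (E.\<gamma> a \<otimes>\<^sub>a idt C b) \<cdot> inv_arr C (assoc C a g b) \<cdot>
        (idt C a \<otimes>\<^sub>a E.\<gamma> b) \<cdot> assoc C a b g" if "a \<in> ob C" "b \<in> ob C" for a b
    using E.\<gamma>_tensor[of a b] that by simp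
  show "E.\<gamma> \<one>\<^sub>o = inv_arr C (runit C g) \<cdot> lunit C g" using E.\<gamma>_unit by simp
  show "inv_arr C (end_half_braiding_inv C M L D bx G g j c) = E.\<gamma> c" if "c \<in> ob C" for c
    using end_object_eq[OF that] that by (simp add: end_object_def)
qed (rule end_half_braiding_inv_iso)

end

lemma end_map_center:
  assumes G: "bimodule_functor C D (regular_bimodule C) G" and G': "bimodule_functor C D (regular_bimodule C) G'"
    and \<eta>: "bimodule_nat_trans C D (regular_bimodule C) G G' \<eta>"
    and e: "is_end M C (comp_bftr G bx) g j" and e': "is_end M C (comp_bftr G' bx) g' j'"
    and u: "is_end_map C M bx (g, j) \<eta> (g', j') u" and c: "c \<in> ob C"
  shows "(u \<otimes>\<^sub>a idt C c) \<cdot> snd (end_object C M L D bx G (g, j)) c =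
    snd (end_object C M L D bx G' (g', j')) c \<cdot> (idt C c \<otimes>\<^sub>a u)"
proof -
  note [simp] = trans_hom[OF G G' \<eta>] trans_lam[OF G G' \<eta>] trans_rho[OF G G' \<eta>] trans_t2[OF G G' \<eta>]
  interpret E: end_morphism "mc C" "mm C M L" "left_star C" "bim_tdat C M bx G" "bim_tdat C M bx G'"
    "ldual_ev C" "ldual_coev C" "rdual C" "rdual_ev C" "rdual_coev C" "ldual_rdual C"
    "\<lambda>c. inv_arr C (ldual_rdual C c)" g g' j j' "\<lambda>m n. \<eta> (bf_ob bx m n)" u
  proof (intro end_morphism.intro end_setting_end[OF G e] end_setting_end[OF G' e'] end_morphism_axioms.intro)
  qed (use u in \<open>simp_all add: T_simps(1)[OF G] T_simps(1)[OF G'] is_end_map_def Hom_iff\<close>)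
  show ?thesis
    using E.\<gamma>_morphism[of c] c by (simp add: end_object_eq[OF G e] end_object_eq[OF G' e'])
qed

end

section \<open>The coend as an object of the Drinfeld center\<close>

text \<open>A coend is an end in the dual category, where the evaluations and coevaluations are interchanged.\<close>

locale coend_data = bimodule_data C M L "right_star C" "right_sharp C M L" D bx
  for C :: "('o, 'a, 'k::field) tcat" (structure) and M :: "('m, 'n, 'k) lcat" and L :: "('o, 'a, 'm, 'n) lact"
    and D :: "('d, 'e, 'k, 'o, 'a) bimod" and bx :: "('m, 'n, 'm, 'n, 'd, 'e, 'o) box"
begin

interpretation C: finite_tensor_category C by (rule ftc)
interpretation c: monoidal "mc C" by (rule monoidal_mc[OF ftc])
interpretation d: monoidal "mdual (mc C)" by (rule c.monoidal_mdual)

text \<open>Reversal of arrows makes the coevaluation of a right dual an evaluation, so right duals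
  take the place of left duals and conversely. The comparison of a double dual with the object
  itself is inverted for the same reason.\<close>

lemma end_setting_coend:
  assumes H: "bimodule_functor C D (regular_bimodule C) H" and e: "is_coend M C (comp_bftr H bx) h i"
  shows "end_setting (mdual (mc C)) (mddual (mm C M L)) (sdual (right_star C)) (tdual (bim_tdat C M bx H))
    (rdual_coev C) (rdual_ev C) (ldual C) (ldual_coev C) (ldual_ev C)
    (\<lambda>c. inv_arr C (rdual_ldual C c)) (rdual_ldual C) h i"
proof (intro end_setting.intro[OF equivariant.equivariant_dual[OF equivariant_T[OF H]]] end_setting_axioms.intro, goal_cases)
  case (1 c)
  then show ?case using c.duality_mdual[OF duality_rdual[OF ftc, of c]] by simp
next
  case (2 f)
  then show ?case using rdual_arr(4)[OF ftc, of f] by simp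
next
  case (3 c d)
  then have cd [simp]: "c \<in> ob C" "d \<in> ob C" by simp_all
  note i = rdual_tensor[OF ftc cd]
  have o: "c \<otimes>\<^sub>o d \<in> ob C" by simp
  note [simp] = C.iso_pairD[OF i(1)] dualityD[OF duality_rdual[OF ftc o], simplified]
  \<comment> \<open>The nested evaluation of the dual category is the nested coevaluation of
    \<open>C\<close>, for which \<open>rdual_tensor\<close> was characterised. Its inverse is
    required here, since \<open>nu\<close> and \<open>nu'\<close> are exchanged.\<close>
  have "d.tensor_ev c (rdual C c) (rdual_coev C c) d (rdual C d) (rdual_coev C d) =
      c.tensor_cv (rdual C d) d (rdual_coev C d) (rdual C c) c (rdual_coev C c)"
    by (rule c.tensor_ev_mdual[OF duality_rdual[OF ftc cd(2)] duality_rdual[OF ftc cd(1)]])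
  then have "d.tensor_ev c (rdual C c) (rdual_coev C c) d (rdual C d) (rdual_coev C d) =
      (idt C (c \<otimes>\<^sub>o d) \<otimes>\<^sub>a rdual_tensor C c d) \<cdot> rdual_coev C (c \<otimes>\<^sub>o d)"
    using i(2) by simp
  moreover have "(idt C (c \<otimes>\<^sub>o d) \<otimes>\<^sub>a inv_arr C (rdual_tensor C c d)) \<cdot>
      ((idt C (c \<otimes>\<^sub>o d) \<otimes>\<^sub>a rdual_tensor C c d) \<cdot> rdual_coev C (c \<otimes>\<^sub>o d)) = rdual_coev C (c \<otimes>\<^sub>o d)"
    using C.iso_pairD_tail(1)[OF c.lwh_iso[of "rdual_tensor C c d", simplified, OF i(1) o], of "rdual_coev C (c \<otimes>\<^sub>o d)"]
    by simp
  ultimately show ?case by simp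
next
  case 4
  note i = rdual_unit[OF ftc]
  note [simp] = C.iso_pairD[OF i(1)] C.unit_ob C.iso_pairD[OF lunit_iso[OF ftc C.unit_ob]]
  show ?case
    using C.iso_pairD_tail(1)[OF c.lwh_iso[of "rdual_unit C", simplified, OF i(1) C.unit_ob], of "inv_arr C (lunit C \<one>\<^sub>o)"]
    by (simp add: i(2))
next
  case (5 c)
  then show ?case using c.duality_mdual[OF duality_ldual[OF ftc, of c]] by simp
next
  case (6 c)
  then show ?case using rdual_ldual(1)[OF ftc, of c] by simp
next
  case (7 c)
  then have c [simp]: "c \<in> ob C" by simp
  have o: "ldual C c \<in> ob C" by (rule dual_ob(1)[OF ftc c])
  note i = rdual_ldual[OF ftc c]
  note [simp] = o C.iso_pairD[OF i(1)] dualityD[OF duality_rdual[OF ftc o], simplified]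
  show ?case
    using C.iso_pairD_tail(1)[OF c.lwh_iso[of "rdual_ldual C c", simplified, OF i(1) o], of "rdual_coev C (ldual C c)"]
    by (simp add: i(2))
next
  case 8
  show ?case using e by (rule is_coend_limit_fan[THEN iffD1])
qed

context
  fixes H :: "('d, 'e, 'o, 'a, 'o) bimod_ftr" and h :: 'o and i :: "'m \<Rightarrow> 'a"
  assumes H: "bimodule_functor C D (regular_bimodule C) H" and e: "is_coend M C (comp_bftr H bx) h i"
begin

interpretation T: equivariant "mc C" "mm C M L" "right_star C" "bim_tdat C M bx H"
  by (rule equivariant_T[OF H])
interpretation E: end_setting "mdual (mc C)" "mddual (mm C M L)" "sdual (right_star C)" "tdual (bim_tdat C M bx H)"
  "rdual_coev C" "rdual_ev C" "ldual C" "ldual_coev C" "ldual_ev C"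
  "\<lambda>c. inv_arr C (rdual_ldual C c)" "rdual_ldual C" h i
  by (rule end_setting_coend[OF H e])

text \<open>The inverse of \<open>coend_conj\<close> is given explicitly by
  \<open>conj_iso_pair\<close> as a composite of inverse constraints, and these are the constraints
  of the dual category.\<close>

lemma is_coend_rho_iff:
  assumes c: "c \<in> ob C"
  shows "is_coend_rho C M L D bx H h i c \<rho> \<longleftrightarrow>
    \<rho> \<in> Hom (mdual (mc C)) h (tob (mdual (mc C)) c (tob (mdual (mc C)) h (ldual C c))) \<and>
    (\<forall>m\<in>ob (mddual (mm C M L)).
      lwh (mdual (mc C)) c (rwh (mdual (mc C)) (i m) (ldual C c)) \<cdot>\<^bsub>mdual (mc C)\<^esub> \<rho> = E.\<delta>_comp c m)"
proof -
  note r = rdual_ldual(1)[OF ftc c] and o = dual_ob(1)[OF ftc c]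
  have s: "src C (rdual_ldual C c) = st (right_star C) (ldual C c)" using C.iso_pairD(2)[OF r] by simp
  have "i (c \<rhd>\<^sub>o\<^bsub>L\<^esub> m) \<cdot> inv_arr C (coend_conj C M L D bx H c m) = E.\<delta>_comp c m" if m: "m \<in> ob M" for m
  proof -
    have "inv_arr C (coend_conj C M L D bx H c m) =
        ((t1 (bim_tdat C M bx H) (inv_arr C (rdual_ldual C c) \<rhd>\<^sub>a\<^bsub>L\<^esub> idt M m) (c \<rhd>\<^sub>o\<^bsub>L\<^esub> m) \<cdot>
          rho' (bim_tdat C M bx H) (ldual C c) m (c \<rhd>\<^sub>o\<^bsub>L\<^esub> m)) \<cdot>
          (lam' (bim_tdat C M bx H) c m m \<otimes>\<^sub>a idt C (ldual C c))) \<cdot>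
          inv_arr C (assoc C c (t0 (bim_tdat C M bx H) m m) (ldual C c))"
      unfolding coend_conj_def conj_iso_eq[OF H c o m C.iso_pairD(1)[OF r] s C.iso_pairD(3)[OF r]]
      by (rule C.inv_arr_eq[OF T.conj_iso_pair[of c "ldual C c" m "rdual_ldual C c" "inv_arr C (rdual_ldual C c)",
          unfolded mc_simps mm_simps right_star_simps iso_pair_mc, OF c o m r]])
    then show ?thesis using m c by (simp add: E.\<delta>_comp_eq)
  qed
  moreover have "Hom (mdual (mc C)) x y = Hom C y x" for x y by (auto simp: Hom_def)
  ultimately show ?thesis by (simp add: is_coend_rho_def)
qed

lemma coend_rho_ex1: "c \<in> ob C \<Longrightarrow> \<exists>!\<rho>. is_coend_rho C M L D bx H h i c \<rho>"
  unfolding is_coend_rho_iff by (rule E.\<delta>_ex) simp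

lemma coend_half_braiding_iso:
  assumes c: "c \<in> ob C"
  shows "iso_pair (mdual (mc C)) (E.\<gamma> c) (coend_half_braiding C M L D bx H h i c) (c \<otimes>\<^sub>o h) (h \<otimes>\<^sub>o c)"
proof -
  have "is_coend_rho C M L D bx H h i c (coend_rho C M L D bx H h i c)"
    unfolding coend_rho_def by (rule theI'[OF coend_rho_ex1[OF c]])
  note d = this[unfolded is_coend_rho_iff[OF c]]
  have c': "c \<in> ob (mdual (mc C))" using c by simp
  note \<beta> = E.\<beta>_iso[OF c' d[THEN conjunct1] d[THEN conjunct2]]
  have "coend_half_braiding C M L D bx H h i c = E.\<beta> c (coend_rho C M L D bx H h i c)"
    using d[THEN conjunct1] c unfolding Hom_iff
    by (subst E.\<beta>_eq'[OF c']) (simp_all add: coend_half_braiding_def)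
  then show ?thesis using \<beta> by simp
qed

lemma coend_object_center: "coend_object C M L D bx H (h, i) \<in> center_objects C"
  unfolding coend_object_def prod.case
proof (rule center_objectI[OF ftc, where \<sigma> = "coend_half_braiding C M L D bx H h i" and \<sigma>' = E.\<gamma>])
  let ?\<sigma> = "coend_half_braiding C M L D bx H h i"
  have b: "iso_pair (mdual (mc C)) (E.\<gamma> c) (?\<sigma> c) (tob (mdual (mc C)) c h) (tob (mdual (mc C)) h c)"
    if "c \<in> ob (mdual (mc C))" for c
    using coend_half_braiding_iso[of c] that by simp
  show "h \<in> ob C" using E.end_ob by simp
  show "iso_pair C (?\<sigma> c) (E.\<gamma> c) (c \<otimes>\<^sub>o h) (h \<otimes>\<^sub>o c)" if "c \<in> ob C" for c
    using coend_half_braiding_iso[OF that] by simp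
  show "?\<sigma> (trg C f) \<cdot> (f \<otimes>\<^sub>a idt C h) = (idt C h \<otimes>\<^sub>a f) \<cdot> ?\<sigma> (src C f)" if "f \<in> arr C" for f
    using E.inverse_\<gamma>_nat[OF b, of f] that by simp
  show "?\<sigma> (a \<otimes>\<^sub>o d) =
        assoc C h a d \<cdot> (?\<sigma> a \<otimes>\<^sub>a idt C d) \<cdot> inv_arr C (assoc C a h d) \<cdot>
        (idt C a \<otimes>\<^sub>a ?\<sigma> d) \<cdot> assoc C a d h" if ad [simp]: "a \<in> ob C" "d \<in> ob C" for a d
  proof -
    have hs [simp]: "h \<in> ob C" using E.end_ob by simp
    note [simp] = C.iso_pairD(1-6)[OF assoc_iso[OF ftc]]
      C.iso_pairD(1-3)[OF coend_half_braiding_iso[unfolded iso_pair_mdual iso_pair_mc]]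
    show ?thesis using E.inverse_\<gamma>_tensor[OF b, of a d] by simp
  qed
  show "?\<sigma> \<one>\<^sub>o = inv_arr C (runit C h) \<cdot> lunit C h" using E.inverse_\<gamma>_unit[OF b] by simp
qed simp

end

lemma coend_map_center:
  assumes H: "bimodule_functor C D (regular_bimodule C) H" and H': "bimodule_functor C D (regular_bimodule C) H'"
    and \<eta>: "bimodule_nat_trans C D (regular_bimodule C) H H' \<eta>"
    and e: "is_coend M C (comp_bftr H bx) h i" and e': "is_coend M C (comp_bftr H' bx) h' i'"
    and u: "is_coend_map C M bx (h, i) \<eta> (h', i') u" and c: "c \<in> ob C"
  shows "(u \<otimes>\<^sub>a idt C c) \<cdot> snd (coend_object C M L D bx H (h, i)) c =
    snd (coend_object C M L D bx H' (h', i')) c \<cdot> (idt C c \<otimes>\<^sub>a u)"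
proof -
  interpret T: equivariant "mc C" "mm C M L" "right_star C" "bim_tdat C M bx H"
    by (rule equivariant_T[OF H])
  interpret T': equivariant "mc C" "mm C M L" "right_star C" "bim_tdat C M bx H'"
    by (rule equivariant_T[OF H'])
  note t [simp] = trans_hom[OF H H' \<eta>]
  have l: "(idt C d \<otimes>\<^sub>a \<eta> (bf_ob bx m n)) \<cdot> lam (bim_tdat C M bx H) d m n =
      lam (bim_tdat C M bx H') d m n \<cdot> \<eta> (bf_ob bx m (d \<rhd>\<^sub>o\<^bsub>L\<^esub> n))" if "d \<in> ob C" "m \<in> ob M" "n \<in> ob M" for d m n
    by (rule trans_lam[OF H H' \<eta> that])
  \<comment> \<open>The constraints of the dual category are the inverse ones, so the compatibility
    of \<eta> has to be solved for them.\<close>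
  have l': "lam' (bim_tdat C M bx H') d m n \<cdot> (idt C d \<otimes>\<^sub>a \<eta> (bf_ob bx m n)) =
      \<eta> (bf_ob bx m (d \<rhd>\<^sub>o\<^bsub>L\<^esub> n)) \<cdot> lam' (bim_tdat C M bx H) d m n" if [simp]: "d \<in> ob C" "m \<in> ob M" "n \<in> ob M" for d m n
    using C.iso_pair_square[OF T'.lam_iso[of d m n, simplified] T.lam_iso[of d m n, simplified],
        of "\<eta> (bf_ob bx m (d \<rhd>\<^sub>o\<^bsub>L\<^esub> n))" "idt C d \<otimes>\<^sub>a \<eta> (bf_ob bx m n)"] l[of d m n]
      T.aob_ob[of d n]
    by (simp add: T_simps(1)[OF H] T_simps(1)[OF H'])
  have r': "rho' (bim_tdat C M bx H') d m n \<cdot> (\<eta> (bf_ob bx m n) \<otimes>\<^sub>a idt C d) =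
      \<eta> (bf_ob bx (rdual C d \<rhd>\<^sub>o\<^bsub>L\<^esub> m) n) \<cdot> rho' (bim_tdat C M bx H) d m n" if [simp]: "d \<in> ob C" "m \<in> ob M" "n \<in> ob M" for d m n
    using C.iso_pair_square[OF T'.rho_iso[of d m n, simplified] T.rho_iso[of d m n, simplified],
        of "\<eta> (bf_ob bx (rdual C d \<rhd>\<^sub>o\<^bsub>L\<^esub> m) n)" "\<eta> (bf_ob bx m n) \<otimes>\<^sub>a idt C d"] trans_rho[OF H H' \<eta> that]
      T.aob_ob[of "rdual C d" m] dual_ob[OF ftc, of d]
    by (simp add: T_simps(1)[OF H] T_simps(1)[OF H'])
  \<comment> \<open>As a transformation in the dual category, \<eta> runs from \<open>H'\<close> to
    \<open>H\<close>, so the two functors change places.\<close>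
  interpret E: end_morphism "mdual (mc C)" "mddual (mm C M L)" "sdual (right_star C)" "tdual (bim_tdat C M bx H')"
    "tdual (bim_tdat C M bx H)" "rdual_coev C" "rdual_ev C" "ldual C" "ldual_coev C" "ldual_ev C"
    "\<lambda>c. inv_arr C (rdual_ldual C c)" "rdual_ldual C" h' h i' i "\<lambda>m n. \<eta> (bf_ob bx m n)" u
  proof (intro end_morphism.intro end_setting_coend[OF H e] end_setting_coend[OF H' e'] end_morphism_axioms.intro)
  qed (use u in \<open>simp_all add: T_simps(1)[OF H] T_simps(1)[OF H'] is_coend_map_def Hom_iff l' r' trans_t2[OF H H' \<eta>]\<close>)
  have "iso_pair (mdual (mc C)) (E.X.\<gamma> c) (coend_half_braiding C M L D bx H' h' i' c)
      (tob (mdual (mc C)) c h') (tob (mdual (mc C)) h' c)"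
    using coend_half_braiding_iso[OF H' e' c] by simp
  moreover have "iso_pair (mdual (mc C)) (E.Y.\<gamma> c) (coend_half_braiding C M L D bx H h i c)
      (tob (mdual (mc C)) c h) (tob (mdual (mc C)) h c)"
    using coend_half_braiding_iso[OF H e c] by simp
  ultimately show ?thesis
    using E.inverse_\<gamma>_morphism[of c] c by (simp add: coend_object_def)
qed

end

section \<open>The functors given by the ends and the coends\<close>

lemma Hom_opp: "Hom (opp C) x y = Hom C y x"
  by (auto simp: Hom_def)

lemma is_end_opp: "is_end (opp M) (opp C) T h i \<longleftrightarrow> is_coend M C T h i"
proof -
  have "wedge (opp M) (opp C) T w k \<longleftrightarrow> cowedge M C T w k" for w k
    unfolding wedge_def cowedge_def Hom_opp by (simp add: eq_commute)
  then show ?thesis unfolding is_end_def is_coend_def Hom_opp by simp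
qed

lemma bilinear_bifunctor_opp:
  assumes "bilinear_bifunctor A B X T"
  shows "bilinear_bifunctor (opp A) (opp B) (opp X) T"
proof -
  interpret bilinear_bifunctor A B X T by (rule assms)
  interpret OA: linear_category "opp A" by (rule A.linear_category_opp)
  interpret OB: linear_category "opp B" by (rule B.linear_category_opp)
  interpret OX: linear_category "opp X" by (rule X.linear_category_opp)
  show ?thesis
  proof (unfold_locales, unfold Hom_opp opp_simps)
    show "bf_arr T (f \<cdot>\<^bsub>A\<^esub> f') (g \<cdot>\<^bsub>B\<^esub> g') = bf_arr T f g \<cdot>\<^bsub>X\<^esub> bf_arr T f' g'"
      if "f \<in> Hom A x' x" "f' \<in> Hom A x'' x'" "g \<in> Hom B y' y" "g' \<in> Hom B y'' y'" for f x x' f' x'' g y y' g' y''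
      by (rule comp[OF that(2,1,4,3)])
  qed (rule ob hom idt add_left add_right scale_left scale_right; assumption)+
qed

text \<open>A coend is an end in the opposite categories, which are again described by matrices;
  right exactness in the contravariant variable becomes left exactness.\<close>

lemma coend_exists:
  fixes M :: "('m, 'n, 'k::field) lcat"
  assumes T: "bilinear_bifunctor (opp M) M C T" and M: "matrix_rep M R Fo Fa" and C: "matrix_rep C R' Fo' Fa'"
    and right: "\<And>y. y \<in> ob M \<Longrightarrow> right_exact (opp M) C (fix_right M T y)"
  shows "\<exists>h i. is_coend M C T h i"
proof -
  have "left_exact (opp (opp M)) (opp C) (fix_right (opp M) T y)" if "y \<in> ob (opp M)" for y
    using right[of y] that
    unfolding left_exact_def right_exact_def is_kernel_opp by (simp add: fix_right_def)
  from end_exists[OF bilinear_bifunctor_opp[OF T] matrix_rep.matrix_rep_opp[OF M] matrix_rep.matrix_rep_opp[OF C] this]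
  show ?thesis unfolding is_end_opp .
qed

context bimodule_data
begin

lemma matrix_reps:
  obtains R1 Fo Fa R2 Fo' Fa' where "matrix_rep M R1 Fo Fa" "matrix_rep C R2 Fo' Fa'"
  using finite_linear_category_matrix_rep[OF module_category.axioms(2)[OF modcat]]
    finite_linear_category_matrix_rep[OF finite_tensor_category.axioms(1)[OF ftc]] by blast

lemma ob_bimodule_functors: "G \<in> ob (bimodule_functors C D (regular_bimodule C)) \<longleftrightarrow> bimodule_functor C D (regular_bimodule C) G"
  by (simp add: bimodule_functors_def)

lemma arr_bimodule_functors: "(G, \<eta>, G') \<in> arr (full_subcategory (bimodule_functors C D (regular_bimodule C)) K) \<longleftrightarrow>
    G \<in> K \<and> G' \<in> K \<and> bimodule_functor C D (regular_bimodule C) G \<and> bimodule_functor C D (regular_bimodule C) G' \<and>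
    \<eta> \<in> extensional (ob D) \<and> bimodule_nat_trans C D (regular_bimodule C) G G' \<eta>"
  by (auto simp: bimodule_functors_def full_subcategory_def)

end

lemma (in end_data) end_functor_center:
  "let Fun = bimodule_functors C D (regular_bimodule C); Dom = ob Fun \<inter> has_end C M bx in
    (\<forall>G\<in>ob Fun. left_exact_in_each (opp M) M C (comp_bftr G bx) \<longrightarrow> G \<in> Dom) \<and>
    (\<forall>\<E>. (\<forall>G\<in>Dom. is_end M C (comp_bftr G bx) (fst (\<E> G)) (snd (\<E> G))) \<longrightarrow>
       (\<forall>G\<in>Dom. \<forall>c\<in>ob C. \<exists>!\<delta>. is_end_delta C M L D bx G (fst (\<E> G)) (snd (\<E> G)) c \<delta>) \<and>
       (\<forall>(G, \<eta>, G')\<in>arr (full_subcategory Fun Dom). \<exists>!u. is_end_map C M bx (\<E> G) \<eta> (\<E> G') u) \<and>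
       cat_functor (full_subcategory Fun Dom) (drinfeld_center C) (end_functor C M L D bx \<E>))"
proof -
  interpret C: finite_tensor_category C by (rule ftc)
  define Fun where "Fun = bimodule_functors C D (regular_bimodule C)"
  define Dom where "Dom = ob Fun \<inter> has_end C M bx"
  have ex: "G \<in> Dom" if G: "G \<in> ob Fun" and l: "left_exact_in_each (opp M) M C (comp_bftr G bx)" for G
  proof -
    have G': "bimodule_functor C D (regular_bimodule C) G" using G by (simp add: Fun_def ob_bimodule_functors)
    obtain R1 Fo Fa R2 Fo' Fa' where r: "matrix_rep M R1 Fo Fa" "matrix_rep C R2 Fo' Fa'" by (rule matrix_reps)
    have "\<exists>g j. is_end M C (comp_bftr G bx) g j"
      by (rule end_exists[OF comp_bftr_bilinear[OF G'] r]) (use l in \<open>simp add: left_exact_in_each_def\<close>)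
    then show ?thesis using G by (simp add: Dom_def has_end_def)
  qed
  {
    fix \<E> assume \<E>: "\<forall>G\<in>Dom. is_end M C (comp_bftr G bx) (fst (\<E> G)) (snd (\<E> G))"
    have DomD: "bimodule_functor C D (regular_bimodule C) G" "is_end M C (comp_bftr G bx) (fst (\<E> G)) (snd (\<E> G))"
      if "G \<in> Dom" for G using that \<E> by (simp_all add: Dom_def Fun_def ob_bimodule_functors)
    have delta: "\<exists>!\<delta>. is_end_delta C M L D bx G (fst (\<E> G)) (snd (\<E> G)) c \<delta>" if "G \<in> Dom" "c \<in> ob C" for G c
      by (rule end_delta_ex1[OF DomD[OF that(1)] that(2)])
    have arrD: "G \<in> Dom" "G' \<in> Dom" "bimodule_nat_trans C D (regular_bimodule C) G G' \<eta>"
      if "(G, \<eta>, G') \<in> arr (full_subcategory Fun Dom)" for G \<eta> G'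
      using that by (simp_all add: Fun_def arr_bimodule_functors)
    have map: "\<exists>!u. is_end_map C M bx (\<E> G) \<eta> (\<E> G') u" if "(G, \<eta>, G') \<in> arr (full_subcategory Fun Dom)" for G \<eta> G'
      using end_map_ex[OF DomD(1)[OF arrD(1)[OF that]] DomD(1)[OF arrD(2)[OF that]] arrD(3)[OF that]
          DomD(2)[OF arrD(1)[OF that]] DomD(2)[OF arrD(2)[OF that]]] by simp
    have mapD: "u \<in> arr C" "src C u = fst (\<E> G)" "trg C u = fst (\<E> G')"
      "\<And>m. m \<in> ob M \<Longrightarrow> snd (\<E> G') m \<cdot> u = \<eta> (bf_ob bx m m) \<cdot> snd (\<E> G) m"
      if "is_end_map C M bx (\<E> G) \<eta> (\<E> G') u" for G \<eta> G' u
      using that by (simp_all add: is_end_map_def Hom_iff split_beta)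
    have j: "fst (\<E> G) \<in> ob C" "\<And>m. m \<in> ob M \<Longrightarrow> snd (\<E> G) m \<in> arr C"
      "\<And>m. m \<in> ob M \<Longrightarrow> src C (snd (\<E> G) m) = fst (\<E> G)"
      "\<And>m. m \<in> ob M \<Longrightarrow> trg C (snd (\<E> G) m) = f_ob G (bf_ob bx m m)" if "G \<in> Dom" for G
      using DomD(2)[OF that] by (simp_all add: is_end_def wedge_def Hom_iff comp_bftr_def)
    have fst_P: "fst (end_object C M L D bx G (\<E> G)) = fst (\<E> G)" for G by (simp add: end_object_def split_beta)
    have "cat_functor (full_subcategory Fun Dom) (drinfeld_center C)
        \<lparr>f_ob = \<lambda>G. end_object C M L D bx G (\<E> G), f_arr = \<lambda>(G, \<eta>, G').
          (end_object C M L D bx G (\<E> G), THE u. is_end_map C M bx (\<E> G) \<eta> (\<E> G') u, end_object C M L D bx G' (\<E> G'))\<rparr>"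
    proof (rule center_functorI[OF ftc])
      show "category (full_subcategory Fun Dom)"
        unfolding Fun_def by (rule category_full_subcategory[OF category_bimodule_functors])
      show "src (full_subcategory Fun Dom) (G, \<eta>, G') = G" "trg (full_subcategory Fun Dom) (G, \<eta>, G') = G'" for G \<eta> G'
        by (simp_all add: full_subcategory_def Fun_def bimodule_functors_def)
      show "end_object C M L D bx G (\<E> G) \<in> center_objects C" if "G \<in> ob (full_subcategory Fun Dom)" for G
        using end_object_center[OF DomD] that by (simp add: full_subcategory_def)
      show "\<exists>!u. is_end_map C M bx (\<E> G) \<eta> (\<E> G') u" if "(G, \<eta>, G') \<in> arr (full_subcategory Fun Dom)" for G \<eta> G'
        by (rule map[OF that])
    next
      fix G \<eta> G' u assume a: "(G, \<eta>, G') \<in> arr (full_subcategory Fun Dom)" and u: "is_end_map C M bx (\<E> G) \<eta> (\<E> G') u"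
      note d = arrD[OF a]
      have "(u \<otimes>\<^sub>a idt C c) \<cdot> snd (end_object C M L D bx G (\<E> G)) c =
          snd (end_object C M L D bx G' (\<E> G')) c \<cdot> (idt C c \<otimes>\<^sub>a u)" if "c \<in> ob C" for c
        using end_map_center[OF DomD(1)[OF d(1)] DomD(1)[OF d(2)] d(3) DomD(2)[OF d(1)] DomD(2)[OF d(2)] _ that, of u] u
        by simp
      then show "u \<in> Hom C (fst (end_object C M L D bx G (\<E> G))) (fst (end_object C M L D bx G' (\<E> G'))) \<and>
          (\<forall>c\<in>ob C. (u \<otimes>\<^sub>a idt C c) \<cdot> snd (end_object C M L D bx G (\<E> G)) c =
            snd (end_object C M L D bx G' (\<E> G')) c \<cdot> (idt C c \<otimes>\<^sub>a u))"
        using mapD[OF u] by (simp add: fst_P Hom_iff)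
    next
      fix G assume "G \<in> ob (full_subcategory Fun Dom)"
      then have G: "G \<in> Dom" by (simp add: full_subcategory_def)
      note [simp] = j[OF G] G_hom[OF DomD(1)[OF G]]
      have "is_end_map C M bx (\<E> G) (\<lambda>x\<in>ob D. idt C (f_ob G x)) (\<E> G) (idt C (fst (\<E> G)))"
        by (simp add: is_end_map_def split_beta Hom_iff)
      then show "is_end_map C M bx (\<E> G) (fst (snd (idt (full_subcategory Fun Dom) G))) (\<E> G)
          (idt C (fst (end_object C M L D bx G (\<E> G))))"
        unfolding fst_P by (simp add: full_subcategory_def Fun_def bimodule_functors_def)
    next
      fix G \<eta> G' \<theta> G'' u v
      assume a: "(G, \<eta>, G') \<in> arr (full_subcategory Fun Dom)" "(G', \<theta>, G'') \<in> arr (full_subcategory Fun Dom)"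
        and uv: "is_end_map C M bx (\<E> G) \<eta> (\<E> G') u" "is_end_map C M bx (\<E> G') \<theta> (\<E> G'') v"
      note d = arrD[OF a(1)] arrD[OF a(2)]
      note [simp] = j[OF d(1)] j[OF d(2)] j[OF d(5)] mapD(1-3)[OF uv(1)] mapD(1-3)[OF uv(2)]
        trans_hom[OF DomD(1)[OF d(1)] DomD(1)[OF d(2)] d(3)] trans_hom[OF DomD(1)[OF d(4)] DomD(1)[OF d(5)] d(6)]
      have "snd (\<E> G'') m \<cdot> (v \<cdot> u) = (\<theta> (bf_ob bx m m) \<cdot> \<eta> (bf_ob bx m m)) \<cdot> snd (\<E> G) m" if [simp]: "m \<in> ob M" for m
        using mapD(4)[OF uv(1), of m] by (simp add: C.comp_tail[OF mapD(4)[OF uv(2)]])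
      then have "is_end_map C M bx (\<E> G) (\<lambda>x\<in>ob D. \<theta> x \<cdot> \<eta> x) (\<E> G'') (v \<cdot> u)"
        by (simp add: is_end_map_def split_beta Hom_iff)
      then show "is_end_map C M bx (\<E> G) (fst (snd ((G', \<theta>, G'') \<cdot>\<^bsub>full_subcategory Fun Dom\<^esub> (G, \<eta>, G')))) (\<E> G'') (v \<cdot> u)"
        by (simp add: full_subcategory_def Fun_def bimodule_functors_def)
    qed
    then have "cat_functor (full_subcategory Fun Dom) (drinfeld_center C) (end_functor C M L D bx \<E>)"
      by (simp add: end_functor_def)
    note delta map this
  }
  then show ?thesis unfolding Let_def Fun_def[symmetric] Dom_def[symmetric] using ex by blast
qed

lemma (in coend_data) coend_functor_center:
  "let Fun = bimodule_functors C D (regular_bimodule C); Dom = ob Fun \<inter> has_coend C M bx in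
    (\<forall>H\<in>ob Fun. right_exact_in_each (opp M) M C (comp_bftr H bx) \<longrightarrow> H \<in> Dom) \<and>
    (\<forall>\<E>. (\<forall>H\<in>Dom. is_coend M C (comp_bftr H bx) (fst (\<E> H)) (snd (\<E> H))) \<longrightarrow>
       (\<forall>H\<in>Dom. \<forall>c\<in>ob C. \<exists>!\<rho>. is_coend_rho C M L D bx H (fst (\<E> H)) (snd (\<E> H)) c \<rho>) \<and>
       (\<forall>(H, \<eta>, H')\<in>arr (full_subcategory Fun Dom). \<exists>!u. is_coend_map C M bx (\<E> H) \<eta> (\<E> H') u) \<and>
       cat_functor (full_subcategory Fun Dom) (drinfeld_center C) (coend_functor C M L D bx \<E>))"
proof -
  interpret C: finite_tensor_category C by (rule ftc)
  define Fun where "Fun = bimodule_functors C D (regular_bimodule C)"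
  define Dom where "Dom = ob Fun \<inter> has_coend C M bx"
  have ex: "G \<in> Dom" if G: "G \<in> ob Fun" and l: "right_exact_in_each (opp M) M C (comp_bftr G bx)" for G
  proof -
    have G': "bimodule_functor C D (regular_bimodule C) G" using G by (simp add: Fun_def ob_bimodule_functors)
    obtain R1 Fo Fa R2 Fo' Fa' where r: "matrix_rep M R1 Fo Fa" "matrix_rep C R2 Fo' Fa'" by (rule matrix_reps)
    have "\<exists>h i. is_coend M C (comp_bftr G bx) h i"
      by (rule coend_exists[OF comp_bftr_bilinear[OF G'] r]) (use l in \<open>simp add: right_exact_in_each_def\<close>)
    then show ?thesis using G by (simp add: Dom_def has_coend_def)
  qed
  {
    fix \<E> assume \<E>: "\<forall>G\<in>Dom. is_coend M C (comp_bftr G bx) (fst (\<E> G)) (snd (\<E> G))"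
    have DomD: "bimodule_functor C D (regular_bimodule C) G" "is_coend M C (comp_bftr G bx) (fst (\<E> G)) (snd (\<E> G))"
      if "G \<in> Dom" for G using that \<E> by (simp_all add: Dom_def Fun_def ob_bimodule_functors)
    have rho: "\<exists>!\<delta>. is_coend_rho C M L D bx G (fst (\<E> G)) (snd (\<E> G)) c \<delta>" if "G \<in> Dom" "c \<in> ob C" for G c
      by (rule coend_rho_ex1[OF DomD[OF that(1)] that(2)])
    have arrD: "G \<in> Dom" "G' \<in> Dom" "bimodule_nat_trans C D (regular_bimodule C) G G' \<eta>"
      if "(G, \<eta>, G') \<in> arr (full_subcategory Fun Dom)" for G \<eta> G'
      using that by (simp_all add: Fun_def arr_bimodule_functors)
    have map: "\<exists>!u. is_coend_map C M bx (\<E> G) \<eta> (\<E> G') u" if "(G, \<eta>, G') \<in> arr (full_subcategory Fun Dom)" for G \<eta> G'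
      using coend_map_ex[OF DomD(1)[OF arrD(1)[OF that]] DomD(1)[OF arrD(2)[OF that]] arrD(3)[OF that]
          DomD(2)[OF arrD(1)[OF that]] DomD(2)[OF arrD(2)[OF that]]] by simp
    have mapD: "u \<in> arr C" "src C u = fst (\<E> G)" "trg C u = fst (\<E> G')"
      "\<And>m. m \<in> ob M \<Longrightarrow> u \<cdot> snd (\<E> G) m = snd (\<E> G') m \<cdot> \<eta> (bf_ob bx m m)"
      if "is_coend_map C M bx (\<E> G) \<eta> (\<E> G') u" for G \<eta> G' u
      using that by (simp_all add: is_coend_map_def Hom_iff split_beta)
    have j: "fst (\<E> G) \<in> ob C" "\<And>m. m \<in> ob M \<Longrightarrow> snd (\<E> G) m \<in> arr C"
      "\<And>m. m \<in> ob M \<Longrightarrow> trg C (snd (\<E> G) m) = fst (\<E> G)"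
      "\<And>m. m \<in> ob M \<Longrightarrow> src C (snd (\<E> G) m) = f_ob G (bf_ob bx m m)" if "G \<in> Dom" for G
      using DomD(2)[OF that] by (simp_all add: is_coend_def cowedge_def Hom_iff comp_bftr_def)
    have fst_P: "fst (coend_object C M L D bx G (\<E> G)) = fst (\<E> G)" for G by (simp add: coend_object_def split_beta)
    have "cat_functor (full_subcategory Fun Dom) (drinfeld_center C)
        \<lparr>f_ob = \<lambda>G. coend_object C M L D bx G (\<E> G), f_arr = \<lambda>(G, \<eta>, G').
          (coend_object C M L D bx G (\<E> G), THE u. is_coend_map C M bx (\<E> G) \<eta> (\<E> G') u, coend_object C M L D bx G' (\<E> G'))\<rparr>"
    proof (rule center_functorI[OF ftc])
      show "category (full_subcategory Fun Dom)"
        unfolding Fun_def by (rule category_full_subcategory[OF category_bimodule_functors])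
      show "src (full_subcategory Fun Dom) (G, \<eta>, G') = G" "trg (full_subcategory Fun Dom) (G, \<eta>, G') = G'" for G \<eta> G'
        by (simp_all add: full_subcategory_def Fun_def bimodule_functors_def)
      show "coend_object C M L D bx G (\<E> G) \<in> center_objects C" if "G \<in> ob (full_subcategory Fun Dom)" for G
        using coend_object_center[OF DomD] that by (simp add: full_subcategory_def)
      show "\<exists>!u. is_coend_map C M bx (\<E> G) \<eta> (\<E> G') u" if "(G, \<eta>, G') \<in> arr (full_subcategory Fun Dom)" for G \<eta> G'
        by (rule map[OF that])
    next
      fix G \<eta> G' u assume a: "(G, \<eta>, G') \<in> arr (full_subcategory Fun Dom)" and u: "is_coend_map C M bx (\<E> G) \<eta> (\<E> G') u"
      note d = arrD[OF a]
      have "(u \<otimes>\<^sub>a idt C c) \<cdot> snd (coend_object C M L D bx G (\<E> G)) c =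
          snd (coend_object C M L D bx G' (\<E> G')) c \<cdot> (idt C c \<otimes>\<^sub>a u)" if "c \<in> ob C" for c
        using coend_map_center[OF DomD(1)[OF d(1)] DomD(1)[OF d(2)] d(3) DomD(2)[OF d(1)] DomD(2)[OF d(2)] _ that, of u] u
        by simp
      then show "u \<in> Hom C (fst (coend_object C M L D bx G (\<E> G))) (fst (coend_object C M L D bx G' (\<E> G'))) \<and>
          (\<forall>c\<in>ob C. (u \<otimes>\<^sub>a idt C c) \<cdot> snd (coend_object C M L D bx G (\<E> G)) c =
            snd (coend_object C M L D bx G' (\<E> G')) c \<cdot> (idt C c \<otimes>\<^sub>a u))"
        using mapD[OF u] by (simp add: fst_P Hom_iff)
    next
      fix G assume "G \<in> ob (full_subcategory Fun Dom)"
      then have G: "G \<in> Dom" by (simp add: full_subcategory_def)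
      note [simp] = j[OF G] G_hom[OF DomD(1)[OF G]]
      have "is_coend_map C M bx (\<E> G) (\<lambda>x\<in>ob D. idt C (f_ob G x)) (\<E> G) (idt C (fst (\<E> G)))"
        by (simp add: is_coend_map_def split_beta Hom_iff)
      then show "is_coend_map C M bx (\<E> G) (fst (snd (idt (full_subcategory Fun Dom) G))) (\<E> G)
          (idt C (fst (coend_object C M L D bx G (\<E> G))))"
        unfolding fst_P by (simp add: full_subcategory_def Fun_def bimodule_functors_def)
    next
      fix G \<eta> G' \<theta> G'' u v
      assume a: "(G, \<eta>, G') \<in> arr (full_subcategory Fun Dom)" "(G', \<theta>, G'') \<in> arr (full_subcategory Fun Dom)"
        and uv: "is_coend_map C M bx (\<E> G) \<eta> (\<E> G') u" "is_coend_map C M bx (\<E> G') \<theta> (\<E> G'') v"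
      note d = arrD[OF a(1)] arrD[OF a(2)]
      note [simp] = j[OF d(1)] j[OF d(2)] j[OF d(5)] mapD(1-3)[OF uv(1)] mapD(1-3)[OF uv(2)]
        trans_hom[OF DomD(1)[OF d(1)] DomD(1)[OF d(2)] d(3)] trans_hom[OF DomD(1)[OF d(4)] DomD(1)[OF d(5)] d(6)]
      have "(v \<cdot> u) \<cdot> snd (\<E> G) m = snd (\<E> G'') m \<cdot> (\<theta> (bf_ob bx m m) \<cdot> \<eta> (bf_ob bx m m))" if [simp]: "m \<in> ob M" for m
        using mapD(4)[OF uv(1), of m] by (simp add: C.comp_tail[OF mapD(4)[OF uv(2)]])
      then have "is_coend_map C M bx (\<E> G) (\<lambda>x\<in>ob D. \<theta> x \<cdot> \<eta> x) (\<E> G'') (v \<cdot> u)"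
        by (simp add: is_coend_map_def split_beta Hom_iff)
      then show "is_coend_map C M bx (\<E> G) (fst (snd ((G', \<theta>, G'') \<cdot>\<^bsub>full_subcategory Fun Dom\<^esub> (G, \<eta>, G')))) (\<E> G'') (v \<cdot> u)"
        by (simp add: full_subcategory_def Fun_def bimodule_functors_def)
    qed
    then have "cat_functor (full_subcategory Fun Dom) (drinfeld_center C) (coend_functor C M L D bx \<E>)"
      by (simp add: coend_functor_def)
    note rho map this
  }
  then show ?thesis unfolding Let_def Fun_def[symmetric] Dom_def[symmetric] using ex by blast
qed

theorem theorem15:
  fixes C :: "('o, 'a, 'k::alg_closed_field) tcat"
    and M :: "('m, 'n, 'k) lcat" and L :: "('o, 'a, 'm, 'n) lact"
    and D :: "('d, 'e, 'k, 'o, 'a) bimod" and bx :: "('m, 'n, 'm, 'n, 'd, 'e, 'o) box"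
    and D' :: "('d2, 'e2, 'k, 'o, 'a) bimod" and bx' :: "('m, 'n, 'm, 'n, 'd2, 'e2, 'o) box"
  assumes "finite_tensor_category C"
    and "module_category C M L"
    and "deligne_bimodule C (opp M) (left_sharp C M L) M L D bx"
    and "deligne_bimodule C (opp M) (right_sharp C M L) M L D' bx'"
  shows
    "(let Fun = bimodule_functors C D (regular_bimodule C); Dom = ob Fun \<inter> has_end C M bx in
        (\<forall>G\<in>ob Fun. left_exact_in_each (opp M) M C (comp_bftr G bx) \<longrightarrow> G \<in> Dom) \<and>
        (\<forall>\<E>. (\<forall>G\<in>Dom. is_end M C (comp_bftr G bx) (fst (\<E> G)) (snd (\<E> G))) \<longrightarrow>
           (\<forall>G\<in>Dom. \<forall>c\<in>ob C. \<exists>!\<delta>. is_end_delta C M L D bx G (fst (\<E> G)) (snd (\<E> G)) c \<delta>) \<and>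
           (\<forall>(G, \<eta>, G')\<in>arr (full_subcategory Fun Dom). \<exists>!u. is_end_map C M bx (\<E> G) \<eta> (\<E> G') u) \<and>
           cat_functor (full_subcategory Fun Dom) (drinfeld_center C) (end_functor C M L D bx \<E>))) \<and>
     (let Fun = bimodule_functors C D' (regular_bimodule C); Dom = ob Fun \<inter> has_coend C M bx' in
        (\<forall>H\<in>ob Fun. right_exact_in_each (opp M) M C (comp_bftr H bx') \<longrightarrow> H \<in> Dom) \<and>
        (\<forall>\<E>. (\<forall>H\<in>Dom. is_coend M C (comp_bftr H bx') (fst (\<E> H)) (snd (\<E> H))) \<longrightarrow>
           (\<forall>H\<in>Dom. \<forall>c\<in>ob C. \<exists>!\<rho>. is_coend_rho C M L D' bx' H (fst (\<E> H)) (snd (\<E> H)) c \<rho>) \<and>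
           (\<forall>(H, \<eta>, H')\<in>arr (full_subcategory Fun Dom). \<exists>!u. is_coend_map C M bx' (\<E> H) \<eta> (\<E> H') u) \<and>
           cat_functor (full_subcategory Fun Dom) (drinfeld_center C) (coend_functor C M L D' bx' \<E>)))"
  using end_data.end_functor_center[OF end_data.intro[OF bimodule_data_left[OF assms(1-3)]]]
    coend_data.coend_functor_center[OF coend_data.intro[OF bimodule_data_right[OF assms(1,2,4)]]]
  by (rule conjI)

end
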